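(* Let $\mathbb H$ be a homogeneous group. Let $N>0$, $\gamma/N<p, q<\infty$ and $w \in A_{pN/\gamma}$. Let $\varphi^{(\ell)} \in \mathscr S$, $\int \varphi^{(\ell)}\, dx=0$, $1\leq \ell\leq M$. Suppose that, for some $b\in(0,1)$ and some $\eta^{(\ell)}\in \mathscr {S}$, $1\leq \ell \leq M$, $$\sum_{j=-\infty}^\infty \sum_{\ell=1}^M \varphi^{(\ell)}_{b^{j}}*\eta^{(\ell)}_{b^{j}}= \lim_{k\to \infty,\; m\to \infty}\ \sum_{j=-k}^m \sum_{\ell=1}^M \varphi^{(\ell)}_{b^{j}}*\eta^{(\ell)}_{b^{j}}=\delta \quad \text{in } \mathscr S'.$$ Assume also that $(\eta^{(m)}, X_k\varphi^{(\ell)})\in \mathscr C_{N+\epsilon, N}^{(1)}$ for some $\epsilon>0$, for $1\leq k \leq n$ and $1\leq \ell, m \leq M$. Let $\psi\in \mathscr S$ and $\int \psi \, dx=0$. If $(\eta^{(\ell)}, \psi) \in \mathscr C_{N+\epsilon, N}^{(1)}$ for $1\leq \ell\leq M$ with some $\epsilon>0$, then $$\left\|\left(\sum_{j=-\infty}^\infty \left((f*\psi_{b^{j}})_{N,b^{-j}}^{**}\right)^q\right)^{1/q}\right\|_{L^p_w} \leq C\sum_{\ell=1}^M \left\|\Delta^{(q)}_{\varphi^{(\ell)}, b}(f)\right\|_{L^p_w}$$ for all $f\in \mathscr S$ with a positive constant $C$ independent of $f$, where $\Delta^{(q)}_{\varphi, b}(f)(x)=\left(\sum_{j=-\infty}^\infty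 |f*\varphi_{b^{j}}(x)|^q\right)^{1/q}$.
   Context: Homogeneous group: $n\ge 2$ and $\mathbb H$ is $\mathbb R^n$ equipped with dilations $A_tx=(t^{a_1}x_1,\dots,t^{a_n}x_n)$, $t>0$, where $1=a_1\le a_2\le\dots\le a_n$ are real numbers, and with a nilpotent Lie group multiplication such that: Lebesgue measure $dx$ is a bi-invariant Haar measure; the identity is $0$ and $x^{-1}=-x$; $(\alpha x)(\beta x)=\alpha x+\beta x$ for $\alpha,\beta\in\mathbb R$; $A_t(xy)=(A_tx)(A_ty)$; and if $z=xy$ then $z_1=x_1+y_1$ and, for $k\ge2$, $z_k=x_k+y_k+R_k(x,y)$ with $R_k$ a polynomial in $x_1,\dots,x_{k-1},y_1,\dots,y_{k-1}$ of the form $\sum_{|I|\ne0,|J|\ne0,\,a(I)+a(J)=a_k}c^{(k)}_{I,J}x^Iy^J$, where for $I\in\mathbb N_0^n$, $|I|=i_1+\dots+i_n$, $a(I)=a_1i_1+\dots+a_ni_n$, $x^I=x_1^{i_1}\cdots x_n^{i_n}$. Put $\gamma=a_1+\dots+a_n$. $\rho$ is a fixed norm function on $\mathbb H$: $\rho$ is continuous on $\mathbb R^n$, smooth off $0$, $\rho(A_tx)=t\rho(x)$, $\rho(x+y)\le\rho(x)+\rho(y)$, $\rho(xy)\le c_0(\rho(x)+\rho(y))$ with a constant $c_0\ge1$, $\rho(x^{-1})=\rho(x)$; $\rho(x)\le1$ iff $|x|\le1$ and $\rho(x)=1$ iff $|x|=1$; and $\rho$ is bounded above and below by constant multiples of positive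 powers of $|x|$, both on $\{\rho\ge1\}$ and on $\{\rho\le1\}$. $\mathscr S$, $\mathscr S'$: usual Schwartz space and tempered distributions on $\mathbb R^n$; $\delta$: Dirac delta at $0$. Convolution: $F*G(x)=\int F(xy^{-1})G(y)\,dy$. $\varphi_t(x)=t^{-\gamma}\varphi(A_t^{-1}x)$. Left-invariant derivatives: $X_jf(x)=\left[\frac{d}{dt}f(x(te_j))\right]_{t=0}$, $e_j$ the standard basis vectors. Peetre maximal function: $F^{**}_{N,R}(x)=\sup_{y\in\mathbb H}\dfrac{|F(xy^{-1})|}{(1+R\rho(y))^N}$. For $\eta,\psi\in\mathscr S$, $t>0$, $L\ge0$: $C(\eta,\psi,t,L)=\int_{\mathbb H}(1+\rho(x))^L|\eta*\psi_t(x)|\,dx$. For $a,L\ge0$: $\mathscr C^{(1)}_{a,L}=\{(\eta,\psi)\in\mathscr S\times\mathscr S:\sup_{t\ge1}t^aC(\eta,\psi,t,L)<\infty\}$. Weights: balls are $B(x,t)=\{y\in\mathbb H:\rho(y^{-1}x)<t\}$. For $1<s<\infty$ a weight $w$ is in the Muckenhoupt class $A_s$ if $\sup_B\left(|B|^{-1}\int_Bw\,dx\right)\left(|B|^{-1}\int_Bw^{-1/(s-1)}dx\right)^{s-1}<\infty$, the supremum being over all balls $B$. $\|f\|_{L^p_w}=\left(\int_{\mathbb H}|f|^pw\,dx\right)^{1/p}$. *)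

theory Defs
  imports "HOL-Analysis.Analysis" "HOL-Algebra.Generated_Groups"
begin

text \<open>
  Coordinates of \<open>\<real>\<^sup>n\<close> are indexed by a type \<open>'n\<close> of classes \<open>finite\<close> and
  \<open>linorder\<close>, which is order isomorphic to \<open>{1, \<dots>, n}\<close> with \<open>n = CARD('n)\<close>;
  the first index is \<open>Min UNIV\<close>. Functions on the group are complex valued.
\<close>

section \<open>Homogeneous groups\<close>

primrec lower_central :: "('a, 'b) monoid_scheme \<Rightarrow> nat \<Rightarrow> 'a set" where
  "lower_central G 0 = carrier G"
| "lower_central G (Suc k) = generate G
     {x \<otimes>\<^bsub>G\<^esub> y \<otimes>\<^bsub>G\<^esub> inv\<^bsub>G\<^esub> x \<otimes>\<^bsub>G\<^esub> inv\<^bsub>G\<^esub> y | x y. x \<in> lower_central G k \<and> y \<in> carrier G}"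

definition nilpotent_group :: "('a, 'b) monoid_scheme \<Rightarrow> bool" where
  "nilpotent_group G \<longleftrightarrow> group G \<and> (\<exists>k. lower_central G k = {\<one>\<^bsub>G\<^esub>})"

definition group_of :: "('v::zero \<Rightarrow> 'v \<Rightarrow> 'v) \<Rightarrow> 'v monoid" where
  "group_of mul = \<lparr>carrier = UNIV, monoid.mult = mul, one = 0\<rparr>"

definition dil :: "('n \<Rightarrow> real) \<Rightarrow> real \<Rightarrow> real ^ 'n \<Rightarrow> real ^ 'n" where
  "dil a t x = (\<chi> i. t powr a i * x $ i)"

definition hom_dim :: "('n::finite \<Rightarrow> real) \<Rightarrow> real" where
  "hom_dim a = (\<Sum>i\<in>UNIV. a i)"

definition monomial :: "('n \<Rightarrow> nat) \<Rightarrow> real ^ 'n \<Rightarrow> real" where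
  "monomial I x = (\<Prod>i\<in>UNIV. (x $ i) ^ I i)"

text \<open>
  The pairs of multi-indices allowed in \<open>R\<^sub>k\<close>: both are nonzero, involve only the
  variables before the \<open>k\<close>-th, and have weighted lengths adding up to \<open>a\<^sub>k\<close>.
  If all \<open>a\<^sub>i \<ge> 1\<close>, there are only finitely many such pairs.
\<close>

definition admissible :: "('n::{finite, linorder} \<Rightarrow> real) \<Rightarrow> 'n \<Rightarrow> (('n \<Rightarrow> nat) \<times> ('n \<Rightarrow> nat)) set" where
  "admissible a k = {(I, J).
     (\<forall>i\<ge>k. I i = 0 \<and> J i = 0) \<and> (\<Sum>i\<in>UNIV. I i) \<noteq> 0 \<and> (\<Sum>i\<in>UNIV. J i) \<noteq> 0 \<and>
     (\<Sum>i\<in>UNIV. a i * real (I i)) + (\<Sum>i\<in>UNIV. a i * real (J i)) = a k}"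

text \<open>
  Smoothness of the multiplication and of the inversion, i.e. the Lie group property,
  is contained in \<open>mul_first\<close>, \<open>mul_poly\<close> and \<open>inv_eq\<close>.
\<close>

locale homogeneous_group =
  fixes a :: "'n::{finite, linorder} \<Rightarrow> real"
    and mul :: "real ^ ('n::{finite, linorder}) \<Rightarrow> real ^ ('n::{finite, linorder}) \<Rightarrow> real ^ ('n::{finite, linorder})"
  assumes card_ge: "CARD('n) \<ge> 2"
    and a_first: "a (Min UNIV) = 1"
    and a_mono: "mono a"
    and nilpotent: "nilpotent_group (group_of mul)"
    and inv_eq: "inv\<^bsub>group_of mul\<^esub> x = - x"
    and haar_left: "distr lborel lborel (\<lambda>y. mul x y) = lborel"
    and haar_right: "distr lborel lborel (\<lambda>y. mul y x) = lborel"
    and mul_line: "mul (\<alpha> *\<^sub>R x) (\<beta> *\<^sub>R x) = \<alpha> *\<^sub>R x + \<beta> *\<^sub>R x"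
    and dil_mul: "t > 0 \<Longrightarrow> dil a t (mul x y) = mul (dil a t x) (dil a t y)"
    and mul_first: "mul x y $ Min UNIV = x $ Min UNIV + y $ Min UNIV"
    and mul_poly: "\<exists>c. \<forall>k. k \<noteq> Min UNIV \<longrightarrow> (\<forall>x y. mul x y $ k =
      x $ k + y $ k + (\<Sum>(I, J)\<in>admissible a k. c k I J * monomial I x * monomial J y))"

section \<open>Smooth functions, Schwartz space, distributions\<close>

definition partial_deriv :: "'n::finite \<Rightarrow> (real ^ 'n \<Rightarrow> 'b::real_normed_vector) \<Rightarrow> real ^ 'n \<Rightarrow> 'b" where
  "partial_deriv i f x = vector_derivative (\<lambda>t. f (x + t *\<^sub>R axis i 1)) (at 0)"

abbreviation iter_partial :: "'n::finite list \<Rightarrow> (real ^ 'n \<Rightarrow> 'b::real_normed_vector) \<Rightarrow> real ^ 'n \<Rightarrow> 'b" where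
  "iter_partial l f \<equiv> foldr partial_deriv l f"

text \<open>For open \<open>S\<close>, this says that \<open>f\<close> is \<open>C\<^sup>\<infinity>\<close> on \<open>S\<close>.\<close>

definition smooth_on :: "(real ^ 'n) set \<Rightarrow> (real ^ 'n \<Rightarrow> 'b::real_normed_vector) \<Rightarrow> bool" where
  "smooth_on S f \<longleftrightarrow> (\<forall>l. \<forall>x\<in>S. iter_partial l f differentiable (at x))"

definition schwartz :: "(real ^ 'n \<Rightarrow> complex) set" where
  "schwartz = {f. smooth_on UNIV f \<and>
     (\<forall>l m. bounded (range (\<lambda>x. (1 + norm x) ^ m *\<^sub>R iter_partial l f x)))}"

definition fun_distribution :: "(real ^ 'n \<Rightarrow> complex) \<Rightarrow> (real ^ 'n \<Rightarrow> complex) \<Rightarrow> complex" where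
  "fun_distribution F g = (LINT x|lebesgue. F x * g x)"

definition dirac :: "(real ^ 'n \<Rightarrow> complex) \<Rightarrow> complex" where
  "dirac g = g 0"

text \<open>Convergence in \<open>\<S>'\<close> (weak-* topology) along a filter.\<close>

definition tendsto_tempered ::
  "('i \<Rightarrow> (real ^ 'n \<Rightarrow> complex) \<Rightarrow> complex) \<Rightarrow> ((real ^ 'n \<Rightarrow> complex) \<Rightarrow> complex) \<Rightarrow> 'i filter \<Rightarrow> bool" where
  "tendsto_tempered T T\<^sub>0 F \<longleftrightarrow> (\<forall>g\<in>schwartz. ((\<lambda>i. T i g) \<longlongrightarrow> T\<^sub>0 g) F)"

section \<open>Norm functions\<close>

locale homogeneous_group_norm = homogeneous_group a mul
  for a :: "'n::{finite, linorder} \<Rightarrow> real" and mul +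
  fixes \<rho> :: "real ^ ('n::{finite, linorder}) \<Rightarrow> real"
  assumes rho_cont: "continuous_on UNIV \<rho>"
    and rho_smooth: "smooth_on (- {0}) \<rho>"
    and rho_dil: "t > 0 \<Longrightarrow> \<rho> (dil a t x) = t * \<rho> x"
    and rho_add: "\<rho> (x + y) \<le> \<rho> x + \<rho> y"
    and rho_mul: "\<exists>c\<^sub>0\<ge>1. \<forall>x y. \<rho> (mul x y) \<le> c\<^sub>0 * (\<rho> x + \<rho> y)"
    and rho_inv: "\<rho> (inv\<^bsub>group_of mul\<^esub> x) = \<rho> x"
    and rho_le_1_iff: "\<rho> x \<le> 1 \<longleftrightarrow> norm x \<le> 1"
    and rho_eq_1_iff: "\<rho> x = 1 \<longleftrightarrow> norm x = 1"
    and rho_bounds_large: "\<exists>c\<^sub>1>0. \<exists>c\<^sub>2>0. \<exists>\<alpha>\<^sub>1>0. \<exists>\<alpha>\<^sub>2>0. \<forall>x. \<rho> x \<ge> 1 \<longrightarrow>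
      c\<^sub>1 * norm x powr \<alpha>\<^sub>1 \<le> \<rho> x \<and> \<rho> x \<le> c\<^sub>2 * norm x powr \<alpha>\<^sub>2"
    and rho_bounds_small: "\<exists>c\<^sub>1>0. \<exists>c\<^sub>2>0. \<exists>\<beta>\<^sub>1>0. \<exists>\<beta>\<^sub>2>0. \<forall>x. \<rho> x \<le> 1 \<longrightarrow>
      c\<^sub>1 * norm x powr \<beta>\<^sub>1 \<le> \<rho> x \<and> \<rho> x \<le> c\<^sub>2 * norm x powr \<beta>\<^sub>2"

section \<open>Analysis on the group\<close>

text \<open>In the following definitions, \<open>- y\<close> is the group inverse of \<open>y\<close> (see \<open>inv_eq\<close>).\<close>

definition conv :: "(real ^ 'n \<Rightarrow> real ^ 'n \<Rightarrow> real ^ 'n) \<Rightarrow>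
    (real ^ 'n \<Rightarrow> complex) \<Rightarrow> (real ^ 'n \<Rightarrow> complex) \<Rightarrow> real ^ 'n \<Rightarrow> complex" where
  "conv mul F G x = (LINT y|lebesgue. F (mul x (- y)) * G y)"

text \<open>\<open>\<phi>\<^sub>t\<close>; note that the inverse of \<open>A\<^sub>t\<close> is \<open>A\<^bsub>1/t\<^esub>\<close>.\<close>

definition dilate :: "('n::finite \<Rightarrow> real) \<Rightarrow> real \<Rightarrow> (real ^ 'n \<Rightarrow> complex) \<Rightarrow> real ^ 'n \<Rightarrow> complex" where
  "dilate a t \<phi> x = t powr (- hom_dim a) *\<^sub>R \<phi> (dil a (inverse t) x)"

definition left_deriv :: "(real ^ 'n \<Rightarrow> real ^ 'n \<Rightarrow> real ^ 'n) \<Rightarrow> 'n::finite \<Rightarrow>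
    (real ^ 'n \<Rightarrow> complex) \<Rightarrow> real ^ 'n \<Rightarrow> complex" where
  "left_deriv mul j f x = vector_derivative (\<lambda>t. f (mul x (t *\<^sub>R axis j 1))) (at 0)"

definition peetre :: "(real ^ 'n \<Rightarrow> real ^ 'n \<Rightarrow> real ^ 'n) \<Rightarrow> (real ^ 'n \<Rightarrow> real) \<Rightarrow> real \<Rightarrow> real \<Rightarrow>
    (real ^ 'n \<Rightarrow> complex) \<Rightarrow> real ^ 'n \<Rightarrow> ennreal" where
  "peetre mul \<rho> N R F x = (SUP y. ennreal (cmod (F (mul x (- y))) / (1 + R * \<rho> y) powr N))"

definition C_int :: "('n::finite \<Rightarrow> real) \<Rightarrow> (real ^ 'n \<Rightarrow> real ^ 'n \<Rightarrow> real ^ 'n) \<Rightarrow> (real ^ 'n \<Rightarrow> real) \<Rightarrow>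
    (real ^ 'n \<Rightarrow> complex) \<Rightarrow> (real ^ 'n \<Rightarrow> complex) \<Rightarrow> real \<Rightarrow> real \<Rightarrow> ennreal" where
  "C_int a mul \<rho> \<eta> \<psi> t L =
     (\<integral>\<^sup>+x. ennreal ((1 + \<rho> x) powr L * cmod (conv mul \<eta> (dilate a t \<psi>) x)) \<partial>lebesgue)"

definition C1_class :: "('n::finite \<Rightarrow> real) \<Rightarrow> (real ^ 'n \<Rightarrow> real ^ 'n \<Rightarrow> real ^ 'n) \<Rightarrow> (real ^ 'n \<Rightarrow> real) \<Rightarrow>
    real \<Rightarrow> real \<Rightarrow> ((real ^ 'n \<Rightarrow> complex) \<times> (real ^ 'n \<Rightarrow> complex)) set" where
  "C1_class a mul \<rho> \<alpha> L = {(\<eta>, \<psi>) \<in> schwartz \<times> schwartz.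
     (SUP t\<in>{1..}. ennreal (t powr \<alpha>) * C_int a mul \<rho> \<eta> \<psi> t L) < \<infinity>}"

section \<open>Weights and weighted norms\<close>

text \<open>Powers of \<open>[0, \<infinity>]\<close>-valued quantities with a positive real exponent.\<close>

definition epowr :: "ennreal \<Rightarrow> real \<Rightarrow> ennreal" where
  "epowr x r = (if x = \<infinity> then \<infinity> else ennreal (enn2real x powr r))"

definition gball :: "(real ^ 'n \<Rightarrow> real ^ 'n \<Rightarrow> real ^ 'n) \<Rightarrow> (real ^ 'n \<Rightarrow> real) \<Rightarrow>
    real ^ 'n \<Rightarrow> real \<Rightarrow> (real ^ 'n) set" where
  "gball mul \<rho> x t = {y. \<rho> (mul (- y) x) < t}"

definition weight :: "(real ^ 'n \<Rightarrow> real) \<Rightarrow> bool" where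
  "weight w \<longleftrightarrow> (\<forall>x. w x \<ge> 0) \<and> (AE x in lebesgue. w x > 0) \<and>
     (\<forall>K. compact K \<longrightarrow> set_integrable lebesgue K w) \<and> w \<in> borel_measurable lebesgue"

definition average :: "(real ^ 'n) set \<Rightarrow> (real ^ 'n \<Rightarrow> real) \<Rightarrow> ennreal" where
  "average B u = (\<integral>\<^sup>+x\<in>B. ennreal (u x) \<partial>lebesgue) / emeasure lebesgue B"

text \<open>
  Since a weight is positive almost everywhere, the convention \<open>0 powr r = 0\<close> has no effect.
\<close>

definition muckenhoupt :: "(real ^ 'n \<Rightarrow> real ^ 'n \<Rightarrow> real ^ 'n) \<Rightarrow> (real ^ 'n \<Rightarrow> real) \<Rightarrow> real \<Rightarrow>
    (real ^ 'n \<Rightarrow> real) set" where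
  "muckenhoupt mul \<rho> s = {w. weight w \<and>
     (SUP (x, t)\<in>UNIV \<times> {0<..}.
        average (gball mul \<rho> x t) w *
        epowr (average (gball mul \<rho> x t) (\<lambda>y. w y powr (- 1 / (s - 1)))) (s - 1)) < \<infinity>}"

definition Lp_norm :: "real \<Rightarrow> (real ^ 'n \<Rightarrow> real) \<Rightarrow> (real ^ 'n \<Rightarrow> ennreal) \<Rightarrow> ennreal" where
  "Lp_norm p w F = epowr (\<integral>\<^sup>+x. epowr (F x) p * ennreal (w x) \<partial>lebesgue) (1 / p)"

text \<open>The \<open>\<ell>\<^sup>q\<close> norm over \<open>\<int>\<close>; infinite sums in \<^typ>\<open>ennreal\<close> always converge.\<close>

definition lq_norm :: "real \<Rightarrow> (int \<Rightarrow> ennreal) \<Rightarrow> ennreal" where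
  "lq_norm q u = epowr (\<Sum>\<^sub>\<infinity>j. epowr (u j) q) (1 / q)"

definition square_fun :: "('n::finite \<Rightarrow> real) \<Rightarrow> (real ^ 'n \<Rightarrow> real ^ 'n \<Rightarrow> real ^ 'n) \<Rightarrow> real \<Rightarrow>
    (real ^ 'n \<Rightarrow> complex) \<Rightarrow> real \<Rightarrow> (real ^ 'n \<Rightarrow> complex) \<Rightarrow> real ^ 'n \<Rightarrow> ennreal" where
  "square_fun a mul q \<phi> b f x =
     lq_norm q (\<lambda>j. ennreal (cmod (conv mul f (dilate a (b powi j) \<phi>) x)))"

end

theory Submission
  imports Defs "HOL-Library.Nat_Bijection"
begin

text \<open>
  Write \<open>\<gamma>\<close> for the homogeneous dimension, \<open>r = \<gamma> / N\<close>, \<open>F\<^sub>k\<close> for the dilate of \<open>F\<close> by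
  \<open>b\<^sup>k\<close>, and \<open>P\<^sub>k\<close> for the Peetre maximal function with parameters \<open>N\<close> and \<open>R = b\<^sup>-\<^sup>k\<close>.
  The proof has two pointwise parts and one part about weights.

  The first pointwise part compares \<open>\<psi>\<close> with the \<open>\<phi>\<^sup>l\<close>. By the reproducing formula
  \<open>f * \<psi>\<^sub>j\<close> is the sum over \<open>k\<close> and \<open>l\<close> of \<open>(f * \<phi>\<^sup>l\<^sub>k) * (\<eta>\<^sup>l\<^sub>k * \<psi>\<^sub>j)\<close>
  (\<open>reproducing_bound\<close>). The weighted \<open>L\<^sup>1\<close> norm of \<open>\<eta>\<^sup>l\<^sub>k * \<psi>\<^sub>j\<close> decays geometrically in
  \<open>\<bar>j - k\<bar>\<close>: if \<open>b\<^sup>j \<ge> b\<^sup>k\<close> this is the hypothesis on the pair \<open>(\<eta>\<^sup>l, \<psi>)\<close>, and if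
  \<open>b\<^sup>j \<le> b\<^sup>k\<close> it follows from the vanishing integral of \<open>\<psi>\<close> (\<open>C_int_decay\<close>). Hence
  \<open>P\<^sub>j (f * \<psi>\<^sub>j)\<close> is at most a constant times the convolution of a geometric sequence with
  \<open>\<Sum>\<^sub>l P\<^sub>k (f * \<phi>\<^sup>l\<^sub>k)\<close> (\<open>peetre_comparison\<close>), and such a convolution is bounded on
  \<open>\<ell>\<^sup>q\<close> (\<open>discrete_convolution_lq\<close>).

  The second pointwise part controls \<open>P\<^sub>k (f * \<phi>\<^sup>l\<^sub>k)\<close> itself. Averaging over a ball of radius
  \<open>\<delta> b\<^sup>k\<close> bounds its \<open>r\<close>-th power by \<open>\<delta>\<^sup>-\<^sup>\<gamma>\<close> times the Hardy--Littlewood maximal function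
  of \<open>\<bar>f * \<phi>\<^sup>l\<^sub>k\<bar>\<^sup>r\<close> plus \<open>\<delta>\<^sup>r\<close> times the same quantity for the left-invariant
  derivatives \<open>X\<^sub>i \<phi>\<^sup>l\<close> (\<open>peetre_local\<close>). These have vanishing integral, so the first part
  applies to them and returns to the \<open>\<phi>\<^sup>l\<close>. If \<open>\<delta>\<close> is small, the last term can be absorbed
  at every point, because the \<open>\<ell>\<^sup>q\<close> norm in question is finite
  (\<open>conv_uniform_decay\<close>, \<open>peetre_lq_le_maximal\<close>).

  What remains is the vector-valued maximal inequality for the exponents \<open>p / r\<close> and
  \<open>q / r\<close>, both above 1, and a weight in the Muckenhoupt class of exponent \<open>p / r\<close>. It is proved for every doubling
  measure on a quasi-metric space. Covering gives the maximal inequality for doubling measures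
  (\<open>maxfun_strong_type\<close>). Applied to the measures given by a weight and by its dual weight, it
  yields the weighted scalar inequality (\<open>Muckenhoupt\<close>), with a constant that depends only on
  the \<open>A\<^sub>p\<close> constant. If both exponents agree, summation gives the vector-valued inequality; the
  other cases follow by extrapolation (\<open>vector_maximal_inequality\<close>).
\<close>

hide_const (open) Order.top Order.bottom

section \<open>Powers and sums in the extended nonnegative reals\<close>

lemma epowr_0 [simp]: "epowr 0 r = 0"
  by (simp add: epowr_def)

lemma epowr_top [simp]: "epowr top r = top"
  by (simp add: epowr_def)

lemma epowr_ennreal: "x \<ge> 0 \<Longrightarrow> epowr (ennreal x) r = ennreal (x powr r)"
  by (simp add: epowr_def)

lemma epowr_1 [simp]: "epowr x 1 = x"
  by (cases x) (auto simp: epowr_ennreal)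

lemma epowr_mono: "x \<le> y \<Longrightarrow> r \<ge> 0 \<Longrightarrow> epowr x r \<le> epowr y r"
  by (cases x; cases y) (auto simp: epowr_ennreal top_unique intro!: ennreal_leI powr_mono2)

lemma epowr_mult: "epowr (x * y) r = epowr x r * epowr y r"
proof (cases x; cases y)
  fix a b assume "0 \<le> a" "x = ennreal a" "0 \<le> b" "y = ennreal b"
  then show ?thesis
    by (simp add: epowr_ennreal powr_mult ennreal_mult flip: ennreal_mult)
next
  fix a assume "0 \<le> a" "x = ennreal a" "y = top"
  then show ?thesis
    by (cases "a = 0") (auto simp: epowr_ennreal ennreal_mult_top)
next
  fix b assume "x = top" "0 \<le> b" "y = ennreal b"
  then show ?thesis
    by (cases "b = 0") (auto simp: epowr_ennreal ennreal_top_mult)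
qed simp

lemma epowr_epowr: "epowr (epowr x r) s = epowr x (r * s)"
  by (cases x) (auto simp: epowr_ennreal powr_powr)

lemma epowr_add: "epowr x (r + s) = epowr x r * epowr x s"
  by (cases x) (auto simp: epowr_ennreal powr_add ennreal_mult)

lemma epowr_eq_0_iff [simp]: "epowr x r = 0 \<longleftrightarrow> x = 0"
  by (cases x) (auto simp: epowr_ennreal)

lemma epowr_eq_top_iff [simp]: "epowr x r = top \<longleftrightarrow> x = top"
  by (cases x) (auto simp: epowr_ennreal)

lemma epowr_pos_iff: "0 < epowr x r \<longleftrightarrow> 0 < x"
  by (simp add: zero_less_iff_neq_zero)

lemma epowr_le_iff:
  assumes "r > 0" shows "epowr x r \<le> y \<longleftrightarrow> x \<le> epowr y (1 / r)"
proof
  assume "epowr x r \<le> y"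
  from epowr_mono[OF this, of "1/r"] show "x \<le> epowr y (1 / r)"
    using assms by (simp add: epowr_epowr)
next
  assume "x \<le> epowr y (1 / r)"
  from epowr_mono[OF this, of r] show "epowr x r \<le> y"
    using assms by (simp add: epowr_epowr)
qed

lemma epowr_SUP:
  assumes "r > 0" shows "epowr (SUP i\<in>I. f i) r = (SUP i\<in>I. epowr (f i) r)"
proof (rule antisym)
  have "(SUP i\<in>I. f i) \<le> epowr (SUP i\<in>I. epowr (f i) r) (1 / r)"
    by (intro SUP_least, subst epowr_le_iff[symmetric]) (use assms in \<open>auto intro: SUP_upper\<close>)
  then show "epowr (SUP i\<in>I. f i) r \<le> (SUP i\<in>I. epowr (f i) r)"
    using assms by (simp add: epowr_le_iff)
  show "(SUP i\<in>I. epowr (f i) r) \<le> epowr (SUP i\<in>I. f i) r"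
    by (intro SUP_least epowr_mono SUP_upper) (use assms in auto)
qed

lemma borel_measurable_epowr [measurable (raw)]:
  "f \<in> borel_measurable M \<Longrightarrow> (\<lambda>x. epowr (f x) r) \<in> borel_measurable M"
  unfolding epowr_def by (intro measurable_If) auto

lemma epowr_sum_le:
  assumes "finite I" "r > 0"
  shows "epowr (\<Sum>i\<in>I. f i) r \<le> ennreal (real (card I) powr r) * (\<Sum>i\<in>I. epowr (f i) r)"
proof (cases "I = {}")
  case False
  define m where "m = Max (f ` I)"
  have m: "f i \<le> m" if "i \<in> I" for i using that assms by (simp add: m_def)
  have "m \<in> f ` I" unfolding m_def using assms False by (intro Max_in) auto
  then obtain k where k: "k \<in> I" "m = f k" by auto
  have "(\<Sum>i\<in>I. f i) \<le> of_nat (card I) * m" using m by (intro sum_bounded_above) auto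
  then have "epowr (\<Sum>i\<in>I. f i) r \<le> epowr (of_nat (card I) * m) r"
    using assms by (intro epowr_mono) auto
  also have "\<dots> = ennreal (real (card I) powr r) * epowr (f k) r"
    by (simp add: epowr_mult k epowr_ennreal flip: ennreal_of_nat_eq_real_of_nat)
       (simp add: epowr_ennreal ennreal_of_nat_eq_real_of_nat)
  also have "\<dots> \<le> ennreal (real (card I) powr r) * (\<Sum>i\<in>I. epowr (f i) r)"
    using assms k by (intro mult_left_mono member_le_sum) auto
  finally show ?thesis .
qed auto

lemma epowr_add_le:
  assumes "r > 0"
  shows "epowr (x + y) r \<le> ennreal (2 powr r) * (epowr x r + epowr y r)"
proof -
  have "epowr (\<Sum>i\<in>{True, False}. if i then x else y) r
      \<le> ennreal (real (card {True, False}) powr r) * (\<Sum>i\<in>{True, False}. epowr (if i then x else y) r)"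
    by (rule epowr_sum_le) (use assms in auto)
  then show ?thesis by simp
qed

lemma term_le_suminf: "f k \<le> (\<Sum>i. f i :: ennreal)"
  using sum_le_suminf[of f "{k}"] by auto

lemma power_powr_swap: "e > 0 \<Longrightarrow> (e ^ m) powr q = (e powr q) ^ m" for e :: real
proof -
  assume e: "e > 0"
  have "(e ^ m) powr q = (e powr real m) powr q" using e by (subst powr_realpow) auto
  also have "\<dots> = (e powr q) powr real m" by (simp only: powr_powr mult.commute)
  also have "\<dots> = (e powr q) ^ m" using e by (intro powr_realpow) simp
  finally show ?thesis .
qed

text \<open>Bounding the sum by the supremum of half of the weighted terms treats all exponents
  \<open>r > 0\<close> in the same way, since the supremum commutes with powers.\<close>

lemma epowr_weighted_count_space:
  fixes \<beta> v :: "'i \<Rightarrow> ennreal"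
  assumes "r > 0"
  shows "epowr (\<integral>\<^sup>+i. \<beta> i * (\<beta> i * v i) \<partial>count_space UNIV) r
    \<le> epowr (\<integral>\<^sup>+i. \<beta> i \<partial>count_space UNIV) r * (\<integral>\<^sup>+i. epowr (\<beta> i * v i) r \<partial>count_space UNIV)"
proof -
  have "(\<integral>\<^sup>+i. \<beta> i * (\<beta> i * v i) \<partial>count_space UNIV) \<le> (\<integral>\<^sup>+i. \<beta> i * (SUP k. \<beta> k * v k) \<partial>count_space UNIV)"
    by (intro nn_integral_mono mult_left_mono SUP_upper) auto
  then have "epowr (\<integral>\<^sup>+i. \<beta> i * (\<beta> i * v i) \<partial>count_space UNIV) r
      \<le> epowr ((\<integral>\<^sup>+i. \<beta> i \<partial>count_space UNIV) * (SUP k. \<beta> k * v k)) r"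
    using assms by (intro epowr_mono) (auto simp: nn_integral_multc)
  also have "\<dots> = epowr (\<integral>\<^sup>+i. \<beta> i \<partial>count_space UNIV) r * (SUP k. epowr (\<beta> k * v k) r)"
    using assms by (simp add: epowr_mult epowr_SUP)
  also have "\<dots> \<le> epowr (\<integral>\<^sup>+i. \<beta> i \<partial>count_space UNIV) r * (\<integral>\<^sup>+i. epowr (\<beta> i * v i) r \<partial>count_space UNIV)"
    by (intro mult_left_mono SUP_least nn_integral_ge_point) auto
  finally show ?thesis .
qed

lemma epowr_weighted_suminf_le:
  fixes \<beta> v :: "nat \<Rightarrow> ennreal"
  assumes "r > 0"
  shows "epowr (\<Sum>i. \<beta> i * (\<beta> i * v i)) r \<le> epowr (\<Sum>i. \<beta> i) r * (\<Sum>i. epowr (\<beta> i * v i) r)"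
  using epowr_weighted_count_space[OF assms, of \<beta> v] by (simp add: nn_integral_count_space_nat)

text \<open>Stated with the exponents \<open>\<theta>\<close> and \<open>1 - \<theta>\<close>, the form in which products of powers of
  weights are integrated below.\<close>

lemma nn_integral_Hoelder:
  assumes [measurable]: "f \<in> borel_measurable M" "g \<in> borel_measurable M" and \<theta>: "0 < \<theta>" "\<theta> < 1"
  shows "(\<integral>\<^sup>+x. epowr (f x) \<theta> * epowr (g x) (1 - \<theta>) \<partial>M)
     \<le> epowr (\<integral>\<^sup>+x. f x \<partial>M) \<theta> * epowr (\<integral>\<^sup>+x. g x \<partial>M) (1 - \<theta>)"
proof -
  consider (z) "(\<integral>\<^sup>+x. f x \<partial>M) = 0 \<or> (\<integral>\<^sup>+x. g x \<partial>M) = 0"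
    | (t) "(\<integral>\<^sup>+x. f x \<partial>M) \<noteq> 0" "(\<integral>\<^sup>+x. g x \<partial>M) \<noteq> 0" "(\<integral>\<^sup>+x. f x \<partial>M) = top \<or> (\<integral>\<^sup>+x. g x \<partial>M) = top"
    | (f) "(\<integral>\<^sup>+x. f x \<partial>M) \<noteq> 0" "(\<integral>\<^sup>+x. g x \<partial>M) \<noteq> 0" "(\<integral>\<^sup>+x. f x \<partial>M) \<noteq> top" "(\<integral>\<^sup>+x. g x \<partial>M) \<noteq> top"
    by auto
  then show ?thesis
  proof cases
    case z
    then have "(AE x in M. f x = 0) \<or> (AE x in M. g x = 0)"
      by (simp add: nn_integral_0_iff_AE)
    then have "AE x in M. epowr (f x) \<theta> * epowr (g x) (1 - \<theta>) = 0" by auto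
    then have "(\<integral>\<^sup>+x. epowr (f x) \<theta> * epowr (g x) (1 - \<theta>) \<partial>M) = 0"
      by (subst nn_integral_0_iff_AE) auto
    then show ?thesis by simp
  next
    case t
    then have "epowr (\<integral>\<^sup>+x. f x \<partial>M) \<theta> * epowr (\<integral>\<^sup>+x. g x \<partial>M) (1 - \<theta>) = top"
      by (auto simp: ennreal_mult_eq_top_iff)
    then show ?thesis by simp
  next
    case f
    obtain F where F: "(\<integral>\<^sup>+x. f x \<partial>M) = ennreal F" "F > 0"
      using f by (cases "\<integral>\<^sup>+x. f x \<partial>M") (auto simp: less_le)
    obtain G where G: "(\<integral>\<^sup>+x. g x \<partial>M) = ennreal G" "G > 0"
      using f by (cases "\<integral>\<^sup>+x. g x \<partial>M") (auto simp: less_le)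
    have pt: "epowr u \<theta> * epowr v (1 - \<theta>)
        \<le> ennreal (F powr \<theta> * G powr (1 - \<theta>)) * (ennreal (\<theta> / F) * u + ennreal ((1 - \<theta>) / G) * v)" for u v
    proof (cases u; cases v)
      fix x y :: real assume xy: "0 \<le> x" "u = ennreal x" "0 \<le> y" "v = ennreal y"
      have "x powr \<theta> * y powr (1 - \<theta>)
         = F powr \<theta> * G powr (1 - \<theta>) * ((x / F) powr \<theta> * (y / G) powr (1 - \<theta>))"
        using F G xy by (simp add: powr_divide)
      also have "\<dots> \<le> F powr \<theta> * G powr (1 - \<theta>) * (\<theta> * (x / F) + (1 - \<theta>) * (y / G))"
      proof (intro mult_left_mono)
        show "(x / F) powr \<theta> * (y / G) powr (1 - \<theta>) \<le> \<theta> * (x / F) + (1 - \<theta>) * (y / G)"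
        proof (cases "x = 0 \<or> y = 0")
          case True then show ?thesis using F G xy \<theta> by auto
        next
          case False
          then show ?thesis using F G xy \<theta> by (intro Youngs_inequality_0) auto
        qed
      qed simp
      finally show ?thesis using xy F G \<theta>
        by (simp add: epowr_ennreal flip: ennreal_mult ennreal_plus)
    qed (use F G \<theta> in \<open>auto simp: ennreal_mult_top ennreal_mult_eq_top_iff\<close>)
    have "(\<integral>\<^sup>+x. epowr (f x) \<theta> * epowr (g x) (1 - \<theta>) \<partial>M)
       \<le> (\<integral>\<^sup>+x. ennreal (F powr \<theta> * G powr (1 - \<theta>)) * (ennreal (\<theta> / F) * f x + ennreal ((1 - \<theta>) / G) * g x) \<partial>M)"
      by (intro nn_integral_mono pt)
    also have "\<dots> = ennreal (F powr \<theta> * G powr (1 - \<theta>)) * (ennreal (\<theta> / F) * ennreal F + ennreal ((1 - \<theta>) / G) * ennreal G)"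
      using F G by (simp add: nn_integral_cmult nn_integral_add)
    also have "ennreal (\<theta> / F) * ennreal F + ennreal ((1 - \<theta>) / G) * ennreal G = 1"
      using F G \<theta> by (simp flip: ennreal_mult ennreal_plus)
    finally show ?thesis using F G by (simp add: epowr_ennreal ennreal_mult)
  qed
qed

text \<open>Sums over the integers are treated as integrals over the counting measure, where they can be
  interchanged with each other.\<close>

lemma infsum_int_eq_nn_integral_count_space:
  fixes f :: "int \<Rightarrow> ennreal"
  shows "(\<Sum>\<^sub>\<infinity>j. f j) = (\<integral>\<^sup>+j. f j \<partial>count_space UNIV)"
proof -
  have b: "bij int_decode" by (simp add: bij_int_decode)
  have "(\<Sum>\<^sub>\<infinity>j. f j) = (\<Sum>\<^sub>\<infinity>n. f (int_decode n))"
    by (rule infsum_reindex_bij_betw[symmetric, OF b])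
  also have "\<dots> = (\<Sum>n. f (int_decode n))"
    using has_sum_imp_sums[OF has_sum_infsum[OF nonneg_summable_on_complete[of UNIV "\<lambda>n. f (int_decode n)"]]]
    by (simp add: sums_iff)
  also have "\<dots> = (\<integral>\<^sup>+n. f (int_decode n) \<partial>count_space UNIV)"
    by (simp add: nn_integral_count_space_nat)
  also have "\<dots> = (\<integral>\<^sup>+j. f j \<partial>count_space UNIV)"
    by (rule nn_integral_bij_count_space[OF b])
  finally show ?thesis .
qed

section \<open>The Hardy--Littlewood maximal function of a doubling measure\<close>

locale quasi_metric =
  fixes d :: "'a::second_countable_topology \<Rightarrow> 'a \<Rightarrow> real" and \<kappa> :: real
  assumes kappa_ge_1: "\<kappa> \<ge> 1"
    and d_refl: "d x x = 0"
    and d_sym: "d x y = d y x"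
    and d_quasi: "d x z \<le> \<kappa> * (d x y + d y z)"
    and open_qball: "open {y. d x y < t}"
begin

definition qball :: "'a \<Rightarrow> real \<Rightarrow> 'a set" where
  "qball x t = {y. d x y < t}"

text \<open>If two balls meet, then the larger one, enlarged by this factor, contains the smaller one.\<close>

definition enl :: real where "enl = \<kappa> * (1 + 2 * \<kappa>)"

text \<open>The enlargement factor is the one that the covering lemma produces.\<close>

definition doubling :: "'a measure \<Rightarrow> real \<Rightarrow> bool" where
  "doubling \<nu> D \<longleftrightarrow> sets \<nu> = sets borel \<and> D > 0 \<and> (\<forall>x. \<forall>t>0.
     0 < emeasure \<nu> (qball x t) \<and> emeasure \<nu> (qball x t) < top \<and>
     emeasure \<nu> (qball x (enl * t)) \<le> ennreal D * emeasure \<nu> (qball x t))"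

text \<open>The supremum is over all balls that contain the point, not only over those centred at it, so
  that superlevel sets are unions of balls.\<close>

definition maxfun :: "'a measure \<Rightarrow> ('a \<Rightarrow> ennreal) \<Rightarrow> 'a \<Rightarrow> ennreal" where
  "maxfun \<nu> g x = (SUP (c, t)\<in>{(c, t). t > 0 \<and> x \<in> qball c t}.
     (\<integral>\<^sup>+y\<in>qball c t. g y \<partial>\<nu>) / emeasure \<nu> (qball c t))"

lemma open_qball' [simp, intro]: "open (qball x t)"
  using open_qball by (simp add: qball_def)

lemma qball_sets [measurable, simp]: "qball x t \<in> sets borel"
  by (simp add: borel_open)

lemma center_in_qball: "t > 0 \<Longrightarrow> x \<in> qball x t"
  by (simp add: qball_def d_refl)

lemma qball_mono: "s \<le> t \<Longrightarrow> qball x s \<subseteq> qball x t"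
  by (auto simp: qball_def)

lemma enl_ge_1: "enl \<ge> 1"
proof -
  have "1 * 1 \<le> \<kappa> * (1 + 2 * \<kappa>)" using kappa_ge_1 by (intro mult_mono) auto
  then show ?thesis by (simp add: enl_def)
qed

lemma qball_meet_subset:
  assumes "qball x s \<inter> qball y t \<noteq> {}" "s \<le> t"
  shows "qball x s \<subseteq> qball y (enl * t)"
proof
  fix z assume "z \<in> qball x s"
  then have z: "d x z < s" by (simp add: qball_def)
  obtain u where u: "d x u < s" "d y u < t" using assms(1) by (auto simp: qball_def)
  have "d y z \<le> \<kappa> * (d y x + d x z)" by (rule d_quasi)
  also have "\<dots> \<le> \<kappa> * (\<kappa> * (d y u + d u x) + d x z)"
    using d_quasi[of y x u] kappa_ge_1 by (intro mult_left_mono add_right_mono) auto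
  also have "\<dots> < \<kappa> * (\<kappa> * (t + t) + t)"
  proof -
    have "\<kappa> * (d y u + d u x) \<le> \<kappa> * (t + t)"
      using u assms(2) kappa_ge_1 by (intro mult_left_mono) (auto simp: d_sym[of u x])
    then have "\<kappa> * (d y u + d u x) + d x z < \<kappa> * (t + t) + t" using z assms(2) by linarith
    then show ?thesis using kappa_ge_1 by (intro mult_strict_left_mono) auto
  qed
  also have "\<dots> = enl * t" by (simp add: enl_def algebra_simps)
  finally show "z \<in> qball y (enl * t)" by (simp add: qball_def)
qed

text \<open>Choose a ball of largest radius, discard the balls that meet it and repeat: each discarded ball
  lies in the enlargement of a chosen one.\<close>

lemma finite_Vitali:
  assumes "finite I"
  shows "\<exists>J\<subseteq>I. pairwise (\<lambda>p q. disjnt (qball (fst p) (snd p)) (qball (fst q) (snd q))) J \<and>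
     (\<Union>p\<in>I. qball (fst p) (snd p)) \<subseteq> (\<Union>p\<in>J. qball (fst p) (enl * snd p))"
  using assms
proof (induction I rule: finite_psubset_induct)
  case (psubset I)
  show ?case
  proof (cases "I = {}")
    case False
    define m where "m = Max (snd ` I)"
    have "m \<in> snd ` I" unfolding m_def using psubset.hyps False by (intro Max_in) auto
    then obtain p where p: "p \<in> I" "snd p = m" by auto
    have m: "snd q \<le> snd p" if "q \<in> I" for q using that psubset.hyps by (simp add: m_def p)
    define I' where "I' = {q\<in>I. disjnt (qball (fst q) (snd q)) (qball (fst p) (snd p))} - {p}"
    have "I' \<subset> I" using p by (auto simp: I'_def)
    from psubset.IH[OF this] obtain J where J: "J \<subseteq> I'"
        "pairwise (\<lambda>p q. disjnt (qball (fst p) (snd p)) (qball (fst q) (snd q))) J"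
        "(\<Union>p\<in>I'. qball (fst p) (snd p)) \<subseteq> (\<Union>p\<in>J. qball (fst p) (enl * snd p))" by auto
    show ?thesis
    proof (intro exI[of _ "insert p J"] conjI)
      show "insert p J \<subseteq> I" using J p by (auto simp: I'_def)
      show "pairwise (\<lambda>p q. disjnt (qball (fst p) (snd p)) (qball (fst q) (snd q))) (insert p J)"
        using J(1,2) by (auto simp: pairwise_insert I'_def disjnt_sym)
      have "qball (fst q) (snd q) \<subseteq> (\<Union>p\<in>insert p J. qball (fst p) (enl * snd p))" if "q \<in> I" for q
      proof (cases "q \<in> I'")
        case True then show ?thesis using J(3) by auto
      next
        case F: False
        show ?thesis
        proof (cases "qball (fst q) (snd q) = {}")
          case False
          then have "qball (fst q) (snd q) \<inter> qball (fst p) (snd p) \<noteq> {}"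
            using F that by (auto simp: I'_def disjnt_def)
          from qball_meet_subset[OF this m[OF that]] show ?thesis by auto
        qed auto
      qed
      then show "(\<Union>p\<in>I. qball (fst p) (snd p)) \<subseteq> (\<Union>p\<in>insert p J. qball (fst p) (enl * snd p))"
        by auto
    qed
  qed auto
qed

lemma doublingD:
  assumes "doubling \<nu> D"
  shows "sets \<nu> = sets borel" "D > 0"
    and "t > 0 \<Longrightarrow> 0 < emeasure \<nu> (qball x t)" "t > 0 \<Longrightarrow> emeasure \<nu> (qball x t) < top"
    and "t > 0 \<Longrightarrow> emeasure \<nu> (qball x (enl * t)) \<le> ennreal D * emeasure \<nu> (qball x t)"
  using assms by (auto simp: doubling_def)

lemma UN_qball: "(\<Union>n. qball x (real (Suc n))) = UNIV"
proof -
  have "\<exists>n. y \<in> qball x (real (Suc n))" for y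
    using reals_Archimedean2[of "d x y"] by (auto simp: qball_def) (meson less_add_same_cancel2 less_trans zero_less_one)
  then show ?thesis by auto
qed

lemma doubling_sigma_finite:
  assumes "doubling \<nu> D" shows "sigma_finite_measure \<nu>"
proof
  note D = doublingD[OF assms]
  have "space \<nu> = UNIV" using sets_eq_imp_space_eq[OF D(1)] by simp
  then show "\<exists>A. countable A \<and> A \<subseteq> sets \<nu> \<and> \<Union> A = space \<nu> \<and> (\<forall>a\<in>A. emeasure \<nu> a \<noteq> \<infinity>)"
    using D UN_qball[of undefined]
    by (intro exI[of _ "range (\<lambda>n. qball undefined (real (Suc n)))"])
       (auto simp: less_top[symmetric] simp del: of_nat_Suc)
qed

lemma average_le_maxfun:
  assumes "t > 0" "x \<in> qball c t"
  shows "(\<integral>\<^sup>+y\<in>qball c t. g y \<partial>\<nu>) / emeasure \<nu> (qball c t) \<le> maxfun \<nu> g x"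
  unfolding maxfun_def by (rule SUP_upper2[of "(c, t)"]) (use assms in auto)

lemma maxfun_superlevel:
  "{x. \<alpha> < maxfun \<nu> g x} = (\<Union>(c, t)\<in>{(c, t). t > 0 \<and>
     \<alpha> < (\<integral>\<^sup>+y\<in>qball c t. g y \<partial>\<nu>) / emeasure \<nu> (qball c t)}. qball c t)"
  unfolding maxfun_def less_SUP_iff by auto

lemma borel_measurable_maxfun [measurable]: "maxfun \<nu> g \<in> borel_measurable borel"
proof (rule borel_measurableI_greater)
  fix \<alpha> have "open {x. \<alpha> < maxfun \<nu> g x}" unfolding maxfun_superlevel by auto
  then show "{x \<in> space borel. \<alpha> < maxfun \<nu> g x} \<in> sets borel" by simp
qed

lemma maxfun_mono_AE:
  assumes "AE y in \<nu>. g y \<le> h y" shows "maxfun \<nu> g x \<le> maxfun \<nu> h x"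
  unfolding maxfun_def using assms
  by (intro SUP_mono) (force intro!: divide_right_mono_ennreal nn_integral_mono_AE split: split_indicator)

lemma maxfun_suminf_le:
  assumes \<nu>: "sets \<nu> = sets borel" and [measurable]: "\<And>i. g i \<in> borel_measurable borel"
  shows "maxfun \<nu> (\<lambda>y. \<Sum>i. g i y) x \<le> (\<Sum>i. maxfun \<nu> (g i) x)"
  unfolding maxfun_def[of _ "\<lambda>y. \<Sum>i. g i y"]
proof (rule SUP_least, clarify)
  fix c t assume ct: "0 < t" "x \<in> qball c t"
  note [measurable_cong] = \<nu>
  have "(\<integral>\<^sup>+y\<in>qball c t. (\<Sum>i. g i y) \<partial>\<nu>) / emeasure \<nu> (qball c t)
     = (\<Sum>i. (\<integral>\<^sup>+y\<in>qball c t. g i y \<partial>\<nu>)) / emeasure \<nu> (qball c t)"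
    by (subst nn_integral_suminf[symmetric]) (auto simp: mult.commute[of _ "indicator _ _"])
  also have "\<dots> = (\<Sum>i. (\<integral>\<^sup>+y\<in>qball c t. g i y \<partial>\<nu>) / emeasure \<nu> (qball c t))"
    by (simp add: divide_ennreal_def)
  also have "\<dots> \<le> (\<Sum>i. maxfun \<nu> (g i) x)"
    by (intro suminf_le average_le_maxfun ct) auto
  finally show "(\<integral>\<^sup>+y\<in>qball c t. (\<Sum>i. g i y) \<partial>\<nu>) / emeasure \<nu> (qball c t) \<le> (\<Sum>i. maxfun \<nu> (g i) x)" .
qed

lemma maxfun_cmult:
  assumes \<nu>: "sets \<nu> = sets borel" and [measurable]: "g \<in> borel_measurable borel"
  shows "maxfun \<nu> (\<lambda>y. c * g y) x \<le> c * maxfun \<nu> g x"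
  unfolding maxfun_def[of _ "\<lambda>y. c * g y"]
proof (rule SUP_least, clarify)
  fix b t assume bt: "0 < t" "x \<in> qball b t"
  note [measurable_cong] = \<nu>
  have "(\<integral>\<^sup>+y\<in>qball b t. c * g y \<partial>\<nu>) / emeasure \<nu> (qball b t)
     = c * ((\<integral>\<^sup>+y\<in>qball b t. g y \<partial>\<nu>) / emeasure \<nu> (qball b t))"
    by (simp add: mult.assoc nn_integral_cmult ennreal_times_divide)
  also have "\<dots> \<le> c * maxfun \<nu> g x"
    by (intro mult_left_mono average_le_maxfun bt) auto
  finally show "(\<integral>\<^sup>+y\<in>qball b t. c * g y \<partial>\<nu>) / emeasure \<nu> (qball b t) \<le> c * maxfun \<nu> g x" .
qed

text \<open>The superlevel set is a union of balls on which the average of \<open>g\<close> exceeds \<open>\<alpha>\<close>. Countably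
  many of them cover it, by Lindeloef, and finitely many suffice up to a limit; the covering lemma
  then reduces to disjoint balls.\<close>

lemma maxfun_weak_type:
  assumes \<nu>: "doubling \<nu> D" and [measurable]: "g \<in> borel_measurable borel"
  shows "\<alpha> * emeasure \<nu> {x. \<alpha> < maxfun \<nu> g x} \<le> ennreal D * (\<integral>\<^sup>+x. g x \<partial>\<nu>)"
proof -
  note D = doublingD[OF \<nu>]
  note [measurable_cong] = D(1)
  have [simp]: "qball c t \<in> sets \<nu>" for c t by (simp add: D(1))
  define P where "P = {(c, t). t > 0 \<and> \<alpha> < (\<integral>\<^sup>+y\<in>qball c t. g y \<partial>\<nu>) / emeasure \<nu> (qball c t)}"
  define \<B> where "\<B> p = qball (fst p) (snd p)" for p :: "'a \<times> real"
  have Pdef: "{x. \<alpha> < maxfun \<nu> g x} = \<Union> (\<B> ` P)"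
    unfolding maxfun_superlevel P_def \<B>_def by force
  have P: "\<alpha> * emeasure \<nu> (\<B> p) \<le> (\<integral>\<^sup>+y\<in>\<B> p. g y \<partial>\<nu>)" "snd p > 0" if "p \<in> P" for p
  proof -
    obtain c t where p: "p = (c, t)" by (cases p)
    show "snd p > 0" using that by (simp add: P_def p)
    have t: "t > 0" and "\<alpha> \<le> (\<integral>\<^sup>+y\<in>qball c t. g y \<partial>\<nu>) / emeasure \<nu> (qball c t)"
      using that by (auto simp: P_def p)
    then have "\<alpha> * emeasure \<nu> (qball c t)
        \<le> (\<integral>\<^sup>+y\<in>qball c t. g y \<partial>\<nu>) / emeasure \<nu> (qball c t) * emeasure \<nu> (qball c t)"
      by (intro mult_right_mono) auto
    also have "\<dots> = (\<integral>\<^sup>+y\<in>qball c t. g y \<partial>\<nu>)"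
      using D(3,4)[OF t, of c] by (subst ennreal_divide_times) (auto simp: ennreal_divide_self)
    finally show "\<alpha> * emeasure \<nu> (\<B> p) \<le> (\<integral>\<^sup>+y\<in>\<B> p. g y \<partial>\<nu>)" by (simp add: p \<B>_def)
  qed
  have fin: "\<alpha> * emeasure \<nu> (\<Union> (\<B> ` I)) \<le> ennreal D * (\<integral>\<^sup>+x. g x \<partial>\<nu>)" if I: "finite I" "I \<subseteq> P" for I
  proof -
    obtain J where J: "J \<subseteq> I" "pairwise (\<lambda>p q. disjnt (\<B> p) (\<B> q)) J"
       "\<Union> (\<B> ` I) \<subseteq> (\<Union>p\<in>J. qball (fst p) (enl * snd p))"
      using finite_Vitali[OF I(1)] unfolding \<B>_def by auto
    have "finite J" "J \<subseteq> P" using J(1) I finite_subset by auto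
    have "emeasure \<nu> (\<Union> (\<B> ` I)) \<le> emeasure \<nu> (\<Union>p\<in>J. qball (fst p) (enl * snd p))"
      by (intro emeasure_mono J(3)) (use \<open>finite J\<close> in auto)
    also have "\<dots> \<le> (\<Sum>p\<in>J. emeasure \<nu> (qball (fst p) (enl * snd p)))"
      by (intro emeasure_subadditive_finite) (use \<open>finite J\<close> in auto)
    also have "\<dots> \<le> (\<Sum>p\<in>J. ennreal D * emeasure \<nu> (\<B> p))"
      unfolding \<B>_def using P(2) \<open>J \<subseteq> P\<close> by (intro sum_mono D(5)) auto
    finally have "\<alpha> * emeasure \<nu> (\<Union> (\<B> ` I)) \<le> \<alpha> * (\<Sum>p\<in>J. ennreal D * emeasure \<nu> (\<B> p))"
      by (intro mult_left_mono) auto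
    also have "\<dots> = ennreal D * (\<Sum>p\<in>J. \<alpha> * emeasure \<nu> (\<B> p))"
      by (simp add: sum_distrib_left mult_ac)
    also have "\<dots> \<le> ennreal D * (\<Sum>p\<in>J. \<integral>\<^sup>+y\<in>\<B> p. g y \<partial>\<nu>)"
      using P \<open>J \<subseteq> P\<close> by (intro mult_left_mono sum_mono) auto
    also have "(\<Sum>p\<in>J. \<integral>\<^sup>+y\<in>\<B> p. g y \<partial>\<nu>) = (\<integral>\<^sup>+y. (\<Sum>p\<in>J. g y * indicator (\<B> p) y) \<partial>\<nu>)"
      by (subst nn_integral_sum) (auto simp: \<B>_def)
    also have "\<dots> \<le> (\<integral>\<^sup>+y. g y \<partial>\<nu>)"
    proof (intro nn_integral_mono)
      fix y
      have "card {p\<in>J. y \<in> \<B> p} \<le> 1"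
      proof (rule ccontr)
        assume c: "\<not> card {p\<in>J. y \<in> \<B> p} \<le> 1"
        then have "\<not> is_singleton {p\<in>J. y \<in> \<B> p}" by (simp add: is_singleton_altdef)
        moreover have "{p\<in>J. y \<in> \<B> p} \<noteq> {}" using c by (metis card.empty zero_le)
        ultimately
        obtain p q where "p \<in> J" "q \<in> J" "p \<noteq> q" "y \<in> \<B> p" "y \<in> \<B> q"
          unfolding is_singleton_def by blast
        then show False using J(2) by (auto simp: pairwise_def disjnt_def)
      qed
      then have "(\<Sum>p\<in>J. indicator (\<B> p) y :: ennreal) \<le> 1"
        using \<open>finite J\<close> by (simp add: indicator_def sum.If_cases Int_def of_nat_le_1_iff)
      then show "(\<Sum>p\<in>J. g y * indicator (\<B> p) y) \<le> g y"
        using mult_left_mono[of "\<Sum>p\<in>J. indicator (\<B> p) y :: ennreal" 1 "g y"]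
        by (simp add: sum_distrib_left)
    qed
    finally show ?thesis by (simp add: mult_left_mono)
  qed
  obtain \<F> where F: "\<F> \<subseteq> \<B> ` P" "countable \<F>" "\<Union> \<F> = \<Union> (\<B> ` P)"
    by (rule Lindelof[of "\<B> ` P"]) (auto simp: \<B>_def)
  show ?thesis
  proof (cases "\<F> = {}")
    case True then show ?thesis using F(3) Pdef by simp
  next
    case False
    define S where "S n = (\<Union>i<n. from_nat_into \<F> i)" for n :: nat
    have "range (from_nat_into \<F>) = \<F>" using False F(2) by simp
    then have FP: "from_nat_into \<F> i \<in> \<B> ` P" for i using F(1) by auto
    have US: "(\<Union>n. S n) = {x. \<alpha> < maxfun \<nu> g x}"
    proof -
      have "(\<Union>n. S n) = \<Union> (range (from_nat_into \<F>))" unfolding S_def by blast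
      then show ?thesis using \<open>range (from_nat_into \<F>) = \<F>\<close> F(3) Pdef by simp
    qed
    have Ss: "S n \<in> sets \<nu>" for n
    proof -
      have "from_nat_into \<F> i \<in> sets \<nu>" for i using FP[of i] by (auto simp: \<B>_def)
      then show ?thesis unfolding S_def by auto
    qed
    have "incseq S" unfolding S_def by (intro monoI UN_mono) auto
    then have "emeasure \<nu> {x. \<alpha> < maxfun \<nu> g x} = (SUP n. emeasure \<nu> (S n))"
      using Ss by (subst US[symmetric], intro SUP_emeasure_incseq[symmetric]) auto
    then have "\<alpha> * emeasure \<nu> {x. \<alpha> < maxfun \<nu> g x} = (SUP n. \<alpha> * emeasure \<nu> (S n))"
      by (simp add: SUP_mult_left_ennreal)
    also have "\<dots> \<le> ennreal D * (\<integral>\<^sup>+x. g x \<partial>\<nu>)"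
    proof (rule SUP_least)
      fix n
      have "\<forall>i. \<exists>p. p \<in> P \<and> from_nat_into \<F> i = \<B> p" using FP by blast
      then obtain pp where pp: "\<And>i. pp i \<in> P" "\<And>i. from_nat_into \<F> i = \<B> (pp i)" by metis
      have "S n = \<Union> (\<B> ` (pp ` {..<n}))" by (auto simp: S_def pp(2))
      then show "\<alpha> * emeasure \<nu> (S n) \<le> ennreal D * (\<integral>\<^sup>+x. g x \<partial>\<nu>)"
        using fin[of "pp ` {..<n}"] pp(1) by auto
    qed
    finally show ?thesis .
  qed
qed

end

text \<open>The level is parametrized as \<open>exp (- s)\<close>, so that the integral is over a half-line and
  converges for every positive exponent.\<close>

lemma epowr_layer_cake:
  assumes "\<alpha> > 0"
  shows "(\<integral>\<^sup>+s. ennreal (\<alpha> * exp (- \<alpha> * s)) * indicator {s. ennreal (exp (- s)) \<le> h} s \<partial>lborel) = epowr h \<alpha>"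
proof -
  have pos: "(\<integral>\<^sup>+s. ennreal (\<alpha> * exp (- \<alpha> * s)) * indicator {s. ennreal (exp (- s)) \<le> ennreal r} s \<partial>lborel)
      = ennreal (r powr \<alpha>)" if "r > 0" for r
  proof -
    have eq: "{s. ennreal (exp (- s)) \<le> ennreal r} = {- ln r..}"
    proof -
      have "exp (- s) \<le> r \<longleftrightarrow> - ln r \<le> s" for s
        using that by (metis exp_le_cancel_iff exp_ln minus_le_iff)
      then show ?thesis using that by (auto simp: ennreal_le_iff)
    qed
    have lim: "((\<lambda>s. - exp (- \<alpha> * s)) \<longlongrightarrow> - 0) at_top"
      by (intro tendsto_minus filterlim_compose[OF exp_at_bot])
         (use assms in \<open>simp add: filterlim_uminus_at_bot filterlim_tendsto_pos_mult_at_top[OF tendsto_const] filterlim_ident\<close>)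
    have "(\<integral>\<^sup>+s\<in>{- ln r..}. ennreal (\<alpha> * exp (- \<alpha> * s)) \<partial>lborel) = ennreal (- 0 - - exp (- \<alpha> * (- ln r)))"
      by (intro nn_integral_FTC_atLeast lim) (use assms in \<open>auto intro!: derivative_eq_intros\<close>)
    also have "\<dots> = ennreal (r powr \<alpha>)" using that by (simp add: powr_def mult.commute)
    finally show ?thesis by (simp add: eq)
  qed
  show ?thesis
  proof (cases h)
    case (real r)
    show ?thesis
    proof (cases "r = 0")
      case True then show ?thesis by (simp add: real)
    next
      case False then show ?thesis using real pos[of r] by (simp add: epowr_ennreal)
    qed
  next
    case top
    define I where "I = (\<integral>\<^sup>+s. ennreal (\<alpha> * exp (- \<alpha> * s)) * indicator {s. ennreal (exp (- s)) \<le> h} s \<partial>lborel)"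
    have "ennreal x \<le> (\<integral>\<^sup>+s. ennreal (\<alpha> * exp (- \<alpha> * s)) * indicator {s. ennreal (exp (- s)) \<le> h} s \<partial>lborel)"
      if "x > 0" for x
    proof -
      have "ennreal x = ennreal ((x powr (1 / \<alpha>)) powr \<alpha>)"
        using that assms by (simp add: powr_powr)
      also have "\<dots> = (\<integral>\<^sup>+s. ennreal (\<alpha> * exp (- \<alpha> * s)) * indicator {s. ennreal (exp (- s)) \<le> ennreal (x powr (1 / \<alpha>))} s \<partial>lborel)"
        by (rule pos[symmetric]) (use that in simp)
      also have "\<dots> \<le> (\<integral>\<^sup>+s. ennreal (\<alpha> * exp (- \<alpha> * s)) * indicator {s. ennreal (exp (- s)) \<le> h} s \<partial>lborel)"
        by (intro nn_integral_mono) (auto simp: top split: split_indicator)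
      finally show ?thesis .
    qed
    then have ge: "ennreal x \<le> I" if "x > 0" for x using that unfolding I_def by auto
    have "I = top"
    proof (cases I)
      case (real r)
      then show ?thesis using ge[of "r + 1"] by (simp add: ennreal_le_iff)
    qed
    then show ?thesis by (simp add: top I_def)
  qed
qed

context quasi_metric begin

lemma maxfun_le_truncated:
  assumes \<nu>: "doubling \<nu> D" and [measurable]: "g \<in> borel_measurable borel"
  shows "maxfun \<nu> g x \<le> maxfun \<nu> (\<lambda>y. g y * indicator {y. \<alpha> \<le> g y} y) x + \<alpha>"
  unfolding maxfun_def[of _ g]
proof (rule SUP_least, clarify)
  fix c t assume ct: "0 < t" "x \<in> qball c t"
  note D = doublingD[OF \<nu>]
  note [measurable_cong] = D(1)
  have [simp]: "qball c t \<in> sets \<nu>" for c t by (simp add: D(1))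
  have [measurable]: "{y. \<alpha> \<le> g y} \<in> sets borel" by measurable
  have "(\<integral>\<^sup>+y\<in>qball c t. g y \<partial>\<nu>) \<le> (\<integral>\<^sup>+y. (g y * indicator {y. \<alpha> \<le> g y} y) * indicator (qball c t) y
      + \<alpha> * indicator (qball c t) y \<partial>\<nu>)"
    by (intro nn_integral_mono) (auto split: split_indicator)
  also have "\<dots> = (\<integral>\<^sup>+y\<in>qball c t. (g y * indicator {y. \<alpha> \<le> g y} y) \<partial>\<nu>) + \<alpha> * emeasure \<nu> (qball c t)"
    by (subst nn_integral_add) (auto simp: nn_integral_cmult_indicator)
  finally have "(\<integral>\<^sup>+y\<in>qball c t. g y \<partial>\<nu>) / emeasure \<nu> (qball c t)
     \<le> (\<integral>\<^sup>+y\<in>qball c t. (g y * indicator {y. \<alpha> \<le> g y} y) \<partial>\<nu>) / emeasure \<nu> (qball c t)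
       + \<alpha> * emeasure \<nu> (qball c t) / emeasure \<nu> (qball c t)"
    by (simp add: add_divide_distrib_ennreal[symmetric] divide_right_mono_ennreal)
  also have "\<alpha> * emeasure \<nu> (qball c t) / emeasure \<nu> (qball c t) = \<alpha>"
    using D(3,4)[OF ct(1), of c] by (simp add: ennreal_times_divide[symmetric] ennreal_divide_self)
  finally show "(\<integral>\<^sup>+y\<in>qball c t. g y \<partial>\<nu>) / emeasure \<nu> (qball c t)
     \<le> maxfun \<nu> (\<lambda>y. g y * indicator {y. \<alpha> \<le> g y} y) x + \<alpha>"
    by (rule order_trans) (intro add_right_mono average_le_maxfun ct)
qed

text \<open>Marcinkiewicz interpolation: the part of \<open>g\<close> below a quarter of the level contributes at most
  that quarter to the maximal function, and the weak-type bound is applied to the rest.\<close>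

lemma maxfun_strong_type:
  assumes \<nu>: "doubling \<nu> D" and [measurable]: "g \<in> borel_measurable borel" and p: "p > 1"
  shows "(\<integral>\<^sup>+x. epowr (maxfun \<nu> g x) p \<partial>\<nu>)
    \<le> ennreal (4 * D * p / (p - 1) * 4 powr (p - 1)) * (\<integral>\<^sup>+x. epowr (g x) p \<partial>\<nu>)"
proof -
  note D = doublingD[OF \<nu>]
  note [measurable_cong] = D(1)
  interpret S: sigma_finite_measure \<nu> by (rule doubling_sigma_finite[OF \<nu>])
  interpret P: pair_sigma_finite \<nu> "lborel :: real measure" ..
  have level: "emeasure \<nu> {x. ennreal (exp (- s)) \<le> maxfun \<nu> g x}
     \<le> ennreal (4 * D * exp s) * (\<integral>\<^sup>+x. g x * indicator {s. ennreal (exp (- s)) \<le> 4 * g x} s \<partial>\<nu>)" for s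
  proof -
    define \<alpha> where "\<alpha> = exp (- s) / 4"
    define g1 where "g1 = (\<lambda>y. g y * indicator {y. ennreal \<alpha> \<le> g y} y)"
    have a: "ennreal \<alpha> \<le> g x \<longleftrightarrow> ennreal (exp (- s)) \<le> 4 * g x" for x
      by (cases "g x") (auto simp: \<alpha>_def ennreal_mult_top simp flip: ennreal_mult ennreal_numeral)
    have [measurable]: "g1 \<in> borel_measurable borel" unfolding g1_def by measurable
    have "emeasure \<nu> {x. ennreal (exp (- s)) \<le> maxfun \<nu> g x} \<le> emeasure \<nu> {x. ennreal \<alpha> < maxfun \<nu> g1 x}"
    proof (rule emeasure_mono, safe)
      fix x assume x: "ennreal (exp (- s)) \<le> maxfun \<nu> g x"
      have "ennreal \<alpha> + ennreal \<alpha> < ennreal (exp (- s))"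
        by (simp add: \<alpha>_def flip: ennreal_plus) (simp add: ennreal_less_iff)
      also have "\<dots> \<le> maxfun \<nu> g1 x + ennreal \<alpha>"
        using x maxfun_le_truncated[OF \<nu>, of g x "ennreal \<alpha>"] unfolding g1_def by auto
      finally show "ennreal \<alpha> < maxfun \<nu> g1 x"
        by (meson add_right_mono leD leI)
    qed (simp add: D(1))
    also have "\<dots> = ennreal (4 * exp s * \<alpha>) * emeasure \<nu> {x. ennreal \<alpha> < maxfun \<nu> g1 x}"
      by (simp add: \<alpha>_def exp_minus)
    also have "\<dots> = ennreal (4 * exp s) * (ennreal \<alpha> * emeasure \<nu> {x. ennreal \<alpha> < maxfun \<nu> g1 x})"
      by (subst ennreal_mult) (auto simp: \<alpha>_def mult.assoc)
    also have "\<dots> \<le> ennreal (4 * exp s) * (ennreal D * (\<integral>\<^sup>+x. g1 x \<partial>\<nu>))"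
      by (intro mult_left_mono maxfun_weak_type[OF \<nu>]) auto
    also have "\<dots> = ennreal (4 * D * exp s) * (\<integral>\<^sup>+x. g1 x \<partial>\<nu>)"
      using D(2) by (simp add: ennreal_mult mult_ac)
    also have "(\<integral>\<^sup>+x. g1 x \<partial>\<nu>) = (\<integral>\<^sup>+x. g x * indicator {s. ennreal (exp (- s)) \<le> 4 * g x} s \<partial>\<nu>)"
      by (intro nn_integral_cong) (auto simp: g1_def a split: split_indicator)
    finally show ?thesis .
  qed
  have "(\<integral>\<^sup>+x. epowr (maxfun \<nu> g x) p \<partial>\<nu>)
     = (\<integral>\<^sup>+x. (\<integral>\<^sup>+s. ennreal (p * exp (- p * s)) * indicator {s. ennreal (exp (- s)) \<le> maxfun \<nu> g x} s \<partial>lborel) \<partial>\<nu>)"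
    using p by (intro nn_integral_cong, subst epowr_layer_cake) auto
  also have "\<dots> = (\<integral>\<^sup>+s. (\<integral>\<^sup>+x. ennreal (p * exp (- p * s)) * indicator {s. ennreal (exp (- s)) \<le> maxfun \<nu> g x} s \<partial>\<nu>) \<partial>lborel)"
    by (rule P.Fubini'[symmetric]) (simp add: indicator_def[abs_def] split_beta')
  also have "\<dots> = (\<integral>\<^sup>+s. ennreal (p * exp (- p * s)) * emeasure \<nu> {x. ennreal (exp (- s)) \<le> maxfun \<nu> g x} \<partial>lborel)"
  proof (intro nn_integral_cong)
    fix s :: real
    have "(\<integral>\<^sup>+x. ennreal (p * exp (- p * s)) * indicator {s. ennreal (exp (- s)) \<le> maxfun \<nu> g x} s \<partial>\<nu>)
       = (\<integral>\<^sup>+x. ennreal (p * exp (- p * s)) * indicator {x. ennreal (exp (- s)) \<le> maxfun \<nu> g x} x \<partial>\<nu>)"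
      by (intro nn_integral_cong) (auto split: split_indicator)
    also have "\<dots> = ennreal (p * exp (- p * s)) * emeasure \<nu> {x. ennreal (exp (- s)) \<le> maxfun \<nu> g x}"
      by (rule nn_integral_cmult_indicator) (simp add: D(1))
    finally show "(\<integral>\<^sup>+x. ennreal (p * exp (- p * s)) * indicator {s. ennreal (exp (- s)) \<le> maxfun \<nu> g x} s \<partial>\<nu>)
       = ennreal (p * exp (- p * s)) * emeasure \<nu> {x. ennreal (exp (- s)) \<le> maxfun \<nu> g x}" .
  qed
  also have "\<dots> \<le> (\<integral>\<^sup>+s. (\<integral>\<^sup>+x. ennreal (4 * D * p / (p - 1)) * g x * (ennreal ((p - 1) * exp (- (p - 1) * s)) *
       indicator {s. ennreal (exp (- s)) \<le> 4 * g x} s) \<partial>\<nu>) \<partial>lborel)"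
  proof (intro nn_integral_mono)
    fix s :: real
    have e: "p * exp (- p * s) * (4 * D * exp s) = 4 * D * p / (p - 1) * ((p - 1) * exp (- (p - 1) * s))"
    proof -
      have "exp (- p * s) * exp s = exp (- (p - 1) * s)"
        by (simp add: exp_add[symmetric] algebra_simps)
      then show ?thesis using p by (simp add: mult_ac)
    qed
    have "ennreal (p * exp (- p * s)) * emeasure \<nu> {x. ennreal (exp (- s)) \<le> maxfun \<nu> g x}
      \<le> ennreal (p * exp (- p * s)) * (ennreal (4 * D * exp s) * (\<integral>\<^sup>+x. g x * indicator {s. ennreal (exp (- s)) \<le> 4 * g x} s \<partial>\<nu>))"
      by (intro mult_left_mono level) auto
    also have "\<dots> = ennreal (4 * D * p / (p - 1) * ((p - 1) * exp (- (p - 1) * s))) * (\<integral>\<^sup>+x. g x * indicator {s. ennreal (exp (- s)) \<le> 4 * g x} s \<partial>\<nu>)"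
      unfolding e[symmetric] using p D(2) by (subst ennreal_mult[of "p * exp (- p * s)"]) (auto simp: mult.assoc)
    also have "\<dots> = (\<integral>\<^sup>+x. ennreal (4 * D * p / (p - 1) * ((p - 1) * exp (- (p - 1) * s))) * (g x * indicator {s. ennreal (exp (- s)) \<le> 4 * g x} s) \<partial>\<nu>)"
      by (rule nn_integral_cmult[symmetric]) (simp add: indicator_def[abs_def])
    also have "\<dots> = (\<integral>\<^sup>+x. ennreal (4 * D * p / (p - 1)) * g x * (ennreal ((p - 1) * exp (- (p - 1) * s)) *
       indicator {s. ennreal (exp (- s)) \<le> 4 * g x} s) \<partial>\<nu>)"
      using p D(2) by (intro nn_integral_cong, subst ennreal_mult) (auto simp: mult_ac)
    finally show "ennreal (p * exp (- p * s)) * emeasure \<nu> {x. ennreal (exp (- s)) \<le> maxfun \<nu> g x} \<le> \<dots>" .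
  qed
  also have "\<dots> = (\<integral>\<^sup>+x. (\<integral>\<^sup>+s. ennreal (4 * D * p / (p - 1)) * g x * (ennreal ((p - 1) * exp (- (p - 1) * s)) *
       indicator {s. ennreal (exp (- s)) \<le> 4 * g x} s) \<partial>lborel) \<partial>\<nu>)"
    by (rule P.Fubini') (simp add: indicator_def[abs_def] split_beta')
  also have "\<dots> = (\<integral>\<^sup>+x. ennreal (4 * D * p / (p - 1)) * g x * epowr (4 * g x) (p - 1) \<partial>\<nu>)"
    using p by (intro nn_integral_cong, subst nn_integral_cmult, simp add: indicator_def[abs_def], subst epowr_layer_cake) auto
  also have "\<dots> = (\<integral>\<^sup>+x. ennreal (4 * D * p / (p - 1) * 4 powr (p - 1)) * epowr (g x) p \<partial>\<nu>)"
  proof (intro nn_integral_cong)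
    fix x
    have "epowr 4 (p - 1) = ennreal (4 powr (p - 1))"
      by (simp add: epowr_ennreal flip: ennreal_numeral)
    moreover have "ennreal (4 * D * p / (p - 1) * 4 powr (p - 1))
        = ennreal (4 * D * p / (p - 1)) * ennreal (4 powr (p - 1))"
      using p D(2) by (intro ennreal_mult) auto
    ultimately show "ennreal (4 * D * p / (p - 1)) * g x * epowr (4 * g x) (p - 1)
       = ennreal (4 * D * p / (p - 1) * 4 powr (p - 1)) * epowr (g x) p"
      using epowr_add[of "g x" 1 "p - 1"] by (simp only: epowr_mult) (simp add: mult_ac)
  qed
  also have "\<dots> = ennreal (4 * D * p / (p - 1) * 4 powr (p - 1)) * (\<integral>\<^sup>+x. epowr (g x) p \<partial>\<nu>)"
    by (rule nn_integral_cmult) simp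
  finally show ?thesis .
qed

end

section \<open>Muckenhoupt weights\<close>

locale doubling_space = quasi_metric d \<kappa>
  for d :: "'a::second_countable_topology \<Rightarrow> 'a \<Rightarrow> real" and \<kappa> +
  fixes M :: "'a measure" and D :: real
  assumes doubling_M: "doubling M D"
begin

lemmas M_sets [measurable_cong, simp] = doublingD(1)[OF doubling_M]
lemmas D_pos = doublingD(2)[OF doubling_M]

lemma space_M [simp]: "space M = UNIV"
  using sets_eq_imp_space_eq[OF M_sets] by simp

sublocale sigma_finite_measure M
  by (rule doubling_sigma_finite[OF doubling_M])

text \<open>Weights are positive everywhere, so that the dual weight \<open>w powr (- 1 / (p - 1))\<close> is again
  one. The bound \<open>K\<close> is a parameter, because extrapolation needs estimates that are uniform over
  all weights with the same bound.\<close>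

definition Ap :: "real \<Rightarrow> real \<Rightarrow> ('a \<Rightarrow> real) \<Rightarrow> bool" where
  "Ap p K w \<longleftrightarrow> w \<in> borel_measurable borel \<and> (\<forall>x. w x > 0) \<and> K > 0 \<and>
     (\<forall>x. \<forall>t>0. (\<integral>\<^sup>+y\<in>qball x t. ennreal (w y) \<partial>M) *
        epowr (\<integral>\<^sup>+y\<in>qball x t. ennreal (w y powr (- 1 / (p - 1))) \<partial>M) (p - 1)
      \<le> ennreal K * epowr (emeasure M (qball x t)) p)"

lemma ApD:
  assumes "Ap p K w"
  shows "w \<in> borel_measurable borel" "w x > 0" "K > 0"
    "t > 0 \<Longrightarrow> (\<integral>\<^sup>+y\<in>qball x t. ennreal (w y) \<partial>M) *
        epowr (\<integral>\<^sup>+y\<in>qball x t. ennreal (w y powr (- 1 / (p - 1))) \<partial>M) (p - 1)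
      \<le> ennreal K * epowr (emeasure M (qball x t)) p"
  using assms by (auto simp: Ap_def)

lemma integral_qball_pos:
  assumes [measurable]: "u \<in> borel_measurable borel" and "\<And>x. u x > (0::real)" and "t > 0"
  shows "0 < (\<integral>\<^sup>+y\<in>qball x t. ennreal (u y) \<partial>M)"
proof (rule ccontr)
  assume "\<not> 0 < (\<integral>\<^sup>+y\<in>qball x t. ennreal (u y) \<partial>M)"
  then have "(\<integral>\<^sup>+y\<in>qball x t. ennreal (u y) \<partial>M) = 0" by (simp add: zero_less_iff_neq_zero)
  then have "AE y in M. ennreal (u y) * indicator (qball x t) y = 0"
    by (subst (asm) nn_integral_0_iff_AE) auto
  then have "AE y in M. y \<notin> qball x t"
    by eventually_elim (use assms(2) in \<open>auto split: split_indicator_asm simp: ennreal_eq_0_iff not_le[symmetric]\<close>)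
  then have "emeasure M (qball x t) = 0"
    by (subst (asm) AE_iff_measurable[OF _ refl]) auto
  then show False using doublingD(3)[OF doubling_M assms(3), of x] by simp
qed

text \<open>Both integrals are positive, so the bound on their product makes both of them finite.\<close>

lemma Ap_integrals:
  assumes w: "Ap p K w" and p: "p > 1" and t: "t > 0"
  obtains W S m where "W > 0" "S > 0" "m > 0"
    "(\<integral>\<^sup>+y\<in>qball x t. ennreal (w y) \<partial>M) = ennreal W"
    "(\<integral>\<^sup>+y\<in>qball x t. ennreal (w y powr (- 1 / (p - 1))) \<partial>M) = ennreal S"
    "emeasure M (qball x t) = ennreal m" "W * S powr (p - 1) \<le> K * m powr p"
proof -
  note [measurable] = ApD(1)[OF w]
  define I where "I = (\<integral>\<^sup>+y\<in>qball x t. ennreal (w y) \<partial>M)"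
  define J where "J = (\<integral>\<^sup>+y\<in>qball x t. ennreal (w y powr (- 1 / (p - 1))) \<partial>M)"
  have I: "I > 0" unfolding I_def using ApD(2)[OF w] t by (intro integral_qball_pos) auto
  have J: "J > 0" unfolding J_def using ApD(2)[OF w] t
    by (intro integral_qball_pos) (auto simp: less_imp_neq[symmetric])
  obtain m where m: "emeasure M (qball x t) = ennreal m" "m > 0"
    using doublingD(3,4)[OF doubling_M t, of x] by (cases "emeasure M (qball x t)") auto
  have A: "I * epowr J (p - 1) \<le> ennreal (K * m powr p)"
    using ApD(4)[OF w t, of x] ApD(3)[OF w] m by (simp add: I_def J_def epowr_ennreal ennreal_mult)
  then have "I * epowr J (p - 1) < top" by (rule le_less_trans) simp
  then have "I \<noteq> top" "J \<noteq> top"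
    using I J by (auto simp: ennreal_mult_less_top epowr_pos_iff zero_less_iff_neq_zero)
  then obtain W S where W: "I = ennreal W" "W \<ge> 0" and S: "J = ennreal S" "S \<ge> 0"
    by (cases I; cases J) auto
  have "W > 0" "S > 0" using I J W S by auto
  moreover have "W * S powr (p - 1) \<le> K * m powr p"
    using A W S ApD(3)[OF w] m by (simp add: epowr_ennreal flip: ennreal_mult)
  ultimately show ?thesis using W S m by (intro that) (auto simp: I_def J_def)
qed

text \<open>For a ball inside a larger one, Hoelder's inequality bounds the \<open>p\<close>-th power of the measure of
  the small ball by its weight times a power of the dual weight of the large ball; the
  \<open>A\<^sub>p\<close> condition on the large ball bounds the weight of the large ball in the same terms.\<close>

lemma Ap_doubling:
  assumes w: "Ap p K w" and p: "p > 1"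
  shows "doubling (density M (\<lambda>x. ennreal (w x))) (K * D powr p)"
  unfolding doubling_def
proof (intro conjI allI impI)
  note [measurable] = ApD(1)[OF w]
  have em: "emeasure (density M (\<lambda>x. ennreal (w x))) (qball x t) = (\<integral>\<^sup>+y\<in>qball x t. ennreal (w y) \<partial>M)" for x t
    by (subst emeasure_density) auto
  show "sets (density M (\<lambda>x. ennreal (w x))) = sets borel" by simp
  show "K * D powr p > 0" using ApD(3)[OF w] D_pos by simp
  fix x :: 'a and t :: real assume t: "0 < t"
  obtain W S m where 1: "W > 0" "S > 0" "m > 0"
    "(\<integral>\<^sup>+y\<in>qball x t. ennreal (w y) \<partial>M) = ennreal W"
    "(\<integral>\<^sup>+y\<in>qball x t. ennreal (w y powr (- 1 / (p - 1))) \<partial>M) = ennreal S"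
    "emeasure M (qball x t) = ennreal m" "W * S powr (p - 1) \<le> K * m powr p"
    by (rule Ap_integrals[OF w p t])
  then show "0 < emeasure (density M (\<lambda>x. ennreal (w x))) (qball x t)"
    "emeasure (density M (\<lambda>x. ennreal (w x))) (qball x t) < top" by (auto simp: em)
  have et: "enl * t > 0" using enl_ge_1 t by simp
  obtain W' S' m' where 2: "W' > 0" "S' > 0" "m' > 0"
    "(\<integral>\<^sup>+y\<in>qball x (enl * t). ennreal (w y) \<partial>M) = ennreal W'"
    "(\<integral>\<^sup>+y\<in>qball x (enl * t). ennreal (w y powr (- 1 / (p - 1))) \<partial>M) = ennreal S'"
    "emeasure M (qball x (enl * t)) = ennreal m'" "W' * S' powr (p - 1) \<le> K * m' powr p"
    by (rule Ap_integrals[OF w p et])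
  have mm: "m' \<le> D * m"
    using doublingD(5)[OF doubling_M t, of x] 1 2 D_pos by (simp flip: ennreal_mult)
  \<comment> \<open>Hoelder's inequality on the small ball bounds its measure by the weight of that ball
    and by the dual weight of the large one.\<close>
  have "ennreal m = (\<integral>\<^sup>+y. epowr (ennreal (w y) * indicator (qball x t) y) (1 / p) *
      epowr (ennreal (w y powr (- 1 / (p - 1))) * indicator (qball x t) y) (1 - 1 / p) \<partial>M)"
  proof -
    have "w y powr (1 / p) * (w y powr (- 1 / (p - 1))) powr (1 - 1 / p) = 1" for y
    proof -
      have "(- 1 / (p - 1)) * (1 - 1 / p) = - (1 / p)" using p by (simp add: field_simps)
      then show ?thesis using ApD(2)[OF w, of y]
        by (simp only: powr_powr powr_add[symmetric]) (simp add: less_imp_neq[symmetric])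
    qed
    then have "epowr (ennreal (w y)) (1 / p) * epowr (ennreal (w y powr (- 1 / (p - 1)))) (1 - 1 / p) = 1" for y
      using ApD(2)[OF w, of y] by (simp add: epowr_ennreal flip: ennreal_mult)
    then have "(\<integral>\<^sup>+y. epowr (ennreal (w y) * indicator (qball x t) y) (1 / p) *
      epowr (ennreal (w y powr (- 1 / (p - 1))) * indicator (qball x t) y) (1 - 1 / p) \<partial>M)
      = (\<integral>\<^sup>+y. indicator (qball x t) y \<partial>M)"
      by (intro nn_integral_cong) (auto split: split_indicator)
    then show ?thesis using 1 by simp
  qed
  also have "\<dots> \<le> epowr (ennreal W) (1 / p) * epowr (ennreal S) (1 - 1 / p)"
    unfolding 1(4,5)[symmetric] by (rule nn_integral_Hoelder) (use p in auto)
  finally have mWS: "m \<le> W powr (1 / p) * S powr (1 - 1 / p)"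
    using 1 by (simp add: epowr_ennreal flip: ennreal_mult)
  have "m powr p \<le> (W powr (1 / p) * S powr (1 - 1 / p)) powr p"
    using 1(1-3) p mWS by (intro powr_mono2) auto
  also have "\<dots> = W * S powr (p - 1)"
  proof -
    have "(1 - 1 / p) * p = p - 1" "1 / p * p = 1" using p by (auto simp: left_diff_distrib)
    then show ?thesis using 1(1,2) by (simp only: powr_mult powr_powr) simp
  qed
  finally have a: "m powr p \<le> W * S powr (p - 1)" .
  have "ennreal S \<le> ennreal S'"
    unfolding 1(5)[symmetric] 2(5)[symmetric] using enl_ge_1 t qball_mono[of t "enl * t" x]
    by (intro nn_integral_mono) (auto split: split_indicator)
  then have b: "S powr (p - 1) \<le> S' powr (p - 1)" using 1(2) 2(2) p by (intro powr_mono2) auto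
  have "W' * S' powr (p - 1) \<le> K * m' powr p" by (rule 2)
  also have "\<dots> \<le> K * (D * m) powr p"
    using mm 2(3) p ApD(3)[OF w] by (intro mult_left_mono powr_mono2) auto
  also have "\<dots> = K * D powr p * m powr p" using D_pos 1(3) by (simp add: powr_mult)
  also have "\<dots> \<le> K * D powr p * (W * S' powr (p - 1))"
  proof (intro mult_left_mono)
    show "m powr p \<le> W * S' powr (p - 1)" using a mult_left_mono[OF b, of W] 1(1) by linarith
  qed (use ApD(3)[OF w] in auto)
  finally have "W' \<le> K * D powr p * W" using 2(2) by (simp add: mult.assoc[symmetric])
  then show "emeasure (density M (\<lambda>x. ennreal (w x))) (qball x (enl * t))
      \<le> ennreal (K * D powr p) * emeasure (density M (\<lambda>x. ennreal (w x))) (qball x t)"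
    using 1 2 ApD(3)[OF w] by (simp add: em flip: ennreal_mult)
qed

text \<open>Raise the \<open>A\<^sub>p\<close> condition to the power \<open>1 / (p - 1)\<close>.\<close>

lemma Ap_dual:
  assumes w: "Ap p K w" and p: "p > 1"
  shows "Ap (p / (p - 1)) (K powr (1 / (p - 1))) (\<lambda>x. w x powr (- 1 / (p - 1)))"
  unfolding Ap_def
proof (intro conjI allI impI)
  note [measurable] = ApD(1)[OF w]
  show "(\<lambda>x. w x powr (- 1 / (p - 1))) \<in> borel_measurable borel" by measurable
  show "w x powr (- 1 / (p - 1)) > 0" for x using ApD(2)[OF w, of x] by simp
  show "K powr (1 / (p - 1)) > 0" using ApD(3)[OF w] by simp
  fix x :: 'a and t :: real assume t: "0 < t"
  obtain W S m where 1: "W > 0" "S > 0" "m > 0"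
    "(\<integral>\<^sup>+y\<in>qball x t. ennreal (w y) \<partial>M) = ennreal W"
    "(\<integral>\<^sup>+y\<in>qball x t. ennreal (w y powr (- 1 / (p - 1))) \<partial>M) = ennreal S"
    "emeasure M (qball x t) = ennreal m" "W * S powr (p - 1) \<le> K * m powr p"
    by (rule Ap_integrals[OF w p t])
  have q: "p / (p - 1) - 1 = 1 / (p - 1)" using p by (simp add: field_simps)
  have ww: "(w y powr (- 1 / (p - 1))) powr (- 1 / (p / (p - 1) - 1)) = w y" for y
  proof -
    have "(- 1 / (p - 1)) * (- 1 / (p / (p - 1) - 1)) = 1" unfolding q using p by (simp add: field_simps)
    then show ?thesis using ApD(2)[OF w, of y] by (simp only: powr_powr) simp
  qed
  have "(W * S powr (p - 1)) powr (1 / (p - 1)) \<le> (K * m powr p) powr (1 / (p - 1))"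
    using 1(1-3,7) p by (intro powr_mono2) auto
  then have "S * W powr (1 / (p - 1)) \<le> K powr (1 / (p - 1)) * m powr (p / (p - 1))"
    using 1(1-3) p ApD(3)[OF w] by (simp add: powr_mult powr_powr mult.commute)
  then show "(\<integral>\<^sup>+y\<in>qball x t. ennreal (w y powr (- 1 / (p - 1))) \<partial>M) *
      epowr (\<integral>\<^sup>+y\<in>qball x t. ennreal ((w y powr (- 1 / (p - 1))) powr (- 1 / (p / (p - 1) - 1))) \<partial>M) (p / (p - 1) - 1)
      \<le> ennreal (K powr (1 / (p - 1))) * epowr (emeasure M (qball x t)) (p / (p - 1))"
    unfolding ww unfolding 1(4-6) q using 1(1-3) by (simp add: epowr_ennreal flip: ennreal_mult)
qed

text \<open>With \<open>W\<close>, \<open>S\<close>, \<open>m\<close> the weight, the dual weight and the measure of a ball, the average of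
  \<open>g\<close> to the power \<open>p - 1\<close> is \<open>W S\<^sup>p\<^sup>-\<^sup>1 / m\<^sup>p\<close>, which \<open>A\<^sub>p\<close> bounds by \<open>K\<close>, times
  \<open>m / W\<close> times the \<open>(p - 1)\<close>-st power of the average of \<open>g / \<sigma>\<close> with respect to \<open>\<sigma>\<close>. The last
  average is below the \<open>\<sigma>\<close>-maximal function throughout the ball, so the product is an
  average with respect to \<open>w\<close>. This argument is due to Lerner.\<close>

lemma maxfun_weighted_pointwise:
  assumes w: "Ap p K w" and p: "p > 1" and [measurable]: "g \<in> borel_measurable borel"
  defines "\<sigma> \<equiv> \<lambda>x. w x powr (- 1 / (p - 1))"
  defines "h \<equiv> \<lambda>x. epowr (maxfun (density M (\<lambda>x. ennreal (\<sigma> x))) (\<lambda>y. g y * ennreal (1 / \<sigma> y)) x) (p - 1) * ennreal (1 / w x)"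
  shows "epowr (maxfun M g x) (p - 1) \<le> ennreal K * maxfun (density M (\<lambda>x. ennreal (w x))) h x"
proof -
  note [measurable] = ApD(1)[OF w]
  have [measurable]: "\<sigma> \<in> borel_measurable borel" unfolding \<sigma>_def by measurable
  have \<sigma>_pos: "\<sigma> x > 0" for x using ApD(2)[OF w, of x] by (simp add: \<sigma>_def)
  define \<mu> where "\<mu> = maxfun (density M (\<lambda>x. ennreal (\<sigma> x))) (\<lambda>y. g y * ennreal (1 / \<sigma> y))"
  have [measurable]: "\<mu> \<in> borel_measurable borel" unfolding \<mu>_def by measurable
  have h_eq: "h = (\<lambda>x. epowr (\<mu> x) (p - 1) * ennreal (1 / w x))" by (simp add: h_def \<mu>_def)
  have [measurable]: "h \<in> borel_measurable borel" unfolding h_eq by measurable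
  have "maxfun M g x \<le> epowr (ennreal K * maxfun (density M (\<lambda>x. ennreal (w x))) h x) (1 / (p - 1))"
    unfolding maxfun_def[of M g]
  proof (rule SUP_least, clarify, subst epowr_le_iff[symmetric])
    fix c t assume t: "0 < t" and x: "x \<in> qball c t"
    obtain W S m where 1: "W > 0" "S > 0" "m > 0"
      "(\<integral>\<^sup>+y\<in>qball c t. ennreal (w y) \<partial>M) = ennreal W"
      "(\<integral>\<^sup>+y\<in>qball c t. ennreal (w y powr (- 1 / (p - 1))) \<partial>M) = ennreal S"
      "emeasure M (qball c t) = ennreal m" "W * S powr (p - 1) \<le> K * m powr p"
      by (rule Ap_integrals[OF w p t])
    define I where "I = (\<integral>\<^sup>+y\<in>qball c t. g y \<partial>M)"
    have e\<sigma>: "emeasure (density M (\<lambda>x. ennreal (\<sigma> x))) (qball c t) = ennreal S"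
      using 1(5) by (subst emeasure_density) (auto simp: \<sigma>_def)
    have ew: "emeasure (density M (\<lambda>x. ennreal (w x))) (qball c t) = ennreal W"
      using 1(4) by (subst emeasure_density) auto
    have IS: "I / ennreal S \<le> \<mu> y" if "y \<in> qball c t" for y
    proof -
      have "I = (\<integral>\<^sup>+y\<in>qball c t. (g y * ennreal (1 / \<sigma> y)) \<partial>density M (\<lambda>x. ennreal (\<sigma> x)))"
        unfolding I_def
      proof (subst nn_integral_density, measurable, intro nn_integral_cong)
        fix y
        have "ennreal (\<sigma> y) * ennreal (1 / \<sigma> y) = 1"
          using \<sigma>_pos[of y] by (simp flip: ennreal_mult)
        then show "g y * indicator (qball c t) y = ennreal (\<sigma> y) * (g y * ennreal (1 / \<sigma> y) * indicator (qball c t) y)"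
          by (metis (no_types, opaque_lifting) mult.commute mult.left_commute mult.right_neutral)
      qed
      then show ?thesis
        unfolding \<mu>_def e\<sigma>[symmetric] using average_le_maxfun[OF t that] by metis
    qed
    have "epowr (I / ennreal S) (p - 1) * ennreal m = (\<integral>\<^sup>+y\<in>qball c t. epowr (I / ennreal S) (p - 1) \<partial>M)"
      using 1 by (simp add: nn_integral_cmult_indicator)
    also have "\<dots> \<le> (\<integral>\<^sup>+y\<in>qball c t. epowr (\<mu> y) (p - 1) \<partial>M)"
      using p by (intro nn_integral_mono) (auto intro!: epowr_mono IS split: split_indicator)
    also have "\<dots> = (\<integral>\<^sup>+y\<in>qball c t. h y \<partial>density M (\<lambda>x. ennreal (w x)))"
    proof (subst nn_integral_density, measurable, intro nn_integral_cong)
      fix y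
      have "ennreal (w y) * ennreal (1 / w y) = 1"
        using ApD(2)[OF w, of y] by (simp flip: ennreal_mult)
      then show "epowr (\<mu> y) (p - 1) * indicator (qball c t) y = ennreal (w y) * (h y * indicator (qball c t) y)"
        unfolding h_eq by (metis (no_types, opaque_lifting) mult.commute mult.left_commute mult.right_neutral)
    qed
    also have "\<dots> = (\<integral>\<^sup>+y\<in>qball c t. h y \<partial>density M (\<lambda>x. ennreal (w x))) / ennreal W * ennreal W"
      using 1(1) by (subst ennreal_divide_times) (auto simp: ennreal_divide_self)
    also have "\<dots> \<le> maxfun (density M (\<lambda>x. ennreal (w x))) h x * ennreal W"
      unfolding ew[symmetric] by (intro mult_right_mono average_le_maxfun t x) auto
    finally have A: "epowr (I / ennreal S) (p - 1) * ennreal m \<le> maxfun (density M (\<lambda>x. ennreal (w x))) h x * ennreal W" .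
    have "I / ennreal m = (I / ennreal S) * ennreal (S / m)"
      using 1 by (simp add: divide_ennreal_def inverse_ennreal mult.assoc field_simps flip: ennreal_mult)
    then have "epowr (I / ennreal m) (p - 1) = epowr (I / ennreal S) (p - 1) * ennreal ((S / m) powr (p - 1))"
      using 1 by (simp add: epowr_mult epowr_ennreal)
    also have "ennreal ((S / m) powr (p - 1)) = ennreal m * ennreal (S powr (p - 1) / m powr p)"
      using 1 by (simp add: powr_divide powr_diff mult_ac flip: ennreal_mult)
    also have "epowr (I / ennreal S) (p - 1) * (ennreal m * ennreal (S powr (p - 1) / m powr p))
       \<le> maxfun (density M (\<lambda>x. ennreal (w x))) h x * ennreal W * ennreal (S powr (p - 1) / m powr p)"
      unfolding mult.assoc[symmetric] by (intro mult_right_mono A) auto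
    also have "\<dots> = maxfun (density M (\<lambda>x. ennreal (w x))) h x * ennreal (W * S powr (p - 1) / m powr p)"
      using 1 by (simp add: mult.assoc flip: ennreal_mult)
    also have "\<dots> \<le> maxfun (density M (\<lambda>x. ennreal (w x))) h x * ennreal K"
      using 1 by (intro mult_left_mono ennreal_leI) (auto simp: field_simps)
    finally show "epowr ((\<integral>\<^sup>+y\<in>qball c t. g y \<partial>M) / emeasure M (qball c t)) (p - 1)
        \<le> ennreal K * maxfun (density M (\<lambda>x. ennreal (w x))) h x"
      by (simp add: I_def 1(6) mult.commute)
  qed (use p in auto)
  then show ?thesis using p by (simp add: epowr_le_iff)
qed

text \<open>Both maximal functions in \<open>maxfun_weighted_pointwise\<close> belong to doubling measures and are
  therefore bounded: for \<open>w\<close> on the Lebesgue space of exponent \<open>p / (p - 1)\<close>, for \<open>\<sigma>\<close> on that of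
  exponent \<open>p\<close>.
  The powers of \<open>w\<close> and \<open>\<sigma>\<close> are such that each norm turns into the next one.\<close>

theorem Muckenhoupt:
  assumes p: "p > 1"
  shows "\<exists>C>0. \<forall>w g. Ap p K w \<longrightarrow> g \<in> borel_measurable borel \<longrightarrow>
    (\<integral>\<^sup>+x. epowr (maxfun M g x) p * ennreal (w x) \<partial>M) \<le> ennreal C * (\<integral>\<^sup>+x. epowr (g x) p * ennreal (w x) \<partial>M)"
proof (cases "K > 0")
  case K: True
  define q where "q = p / (p - 1)"
  have q: "q > 1" using p by (simp add: q_def field_simps)
  define D1 where "D1 = K * D powr p"
  define D2 where "D2 = K powr (1 / (p - 1)) * D powr q"
  define C1 where "C1 = 4 * D1 * q / (q - 1) * 4 powr (q - 1)"
  define C2 where "C2 = 4 * D2 * p / (p - 1) * 4 powr (p - 1)"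
  have pos: "C1 > 0" "C2 > 0" using p q K D_pos by (auto simp: C1_def C2_def D1_def D2_def)
  show ?thesis
  proof (intro exI[of _ "K powr q * C1 * C2"] conjI allI impI)
    show "K powr q * C1 * C2 > 0" using pos K by simp
    fix w :: "'a \<Rightarrow> real" and g :: "'a \<Rightarrow> ennreal" assume w: "Ap p K w" and [measurable]: "g \<in> borel_measurable borel"
    note [measurable] = ApD(1)[OF w]
    define \<sigma> where "\<sigma> = (\<lambda>x. w x powr (- 1 / (p - 1)))"
    have [measurable]: "\<sigma> \<in> borel_measurable borel" unfolding \<sigma>_def by measurable
    have \<sigma>_pos: "\<sigma> x > 0" for x using ApD(2)[OF w, of x] by (simp add: \<sigma>_def)
    have d1: "doubling (density M (\<lambda>x. ennreal (w x))) D1" unfolding D1_def by (rule Ap_doubling[OF w p])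
    have d2: "doubling (density M (\<lambda>x. ennreal (\<sigma> x))) D2"
      unfolding D2_def \<sigma>_def q_def by (rule Ap_doubling[OF Ap_dual[OF w p]]) (use q in \<open>simp add: q_def\<close>)
    define \<mu> where "\<mu> = maxfun (density M (\<lambda>x. ennreal (\<sigma> x))) (\<lambda>y. g y * ennreal (1 / \<sigma> y))"
    define h where "h = (\<lambda>x. epowr (\<mu> x) (p - 1) * ennreal (1 / w x))"
    have [measurable]: "\<mu> \<in> borel_measurable borel" unfolding \<mu>_def by measurable
    have [measurable]: "h \<in> borel_measurable borel" unfolding h_def by measurable
    have pt: "epowr (maxfun M g x) p \<le> ennreal (K powr q) * epowr (maxfun (density M (\<lambda>x. ennreal (w x))) h x) q" for x
    proof -
      have "epowr (maxfun M g x) p = epowr (epowr (maxfun M g x) (p - 1)) q"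
        using p by (simp add: epowr_epowr q_def)
      also have "\<dots> \<le> epowr (ennreal K * maxfun (density M (\<lambda>x. ennreal (w x))) h x) q"
        unfolding h_def \<mu>_def \<sigma>_def using q by (intro epowr_mono maxfun_weighted_pointwise[OF w p]) auto
      finally show ?thesis using K by (simp add: epowr_mult epowr_ennreal)
    qed
    have hq: "ennreal (w x) * epowr (h x) q = ennreal (\<sigma> x) * epowr (\<mu> x) p" for x
    proof -
      have "w x * (1 / w x) powr q = \<sigma> x"
      proof -
        have "1 + - q = - 1 / (p - 1)" using p by (simp add: q_def field_simps)
        moreover have "w x * (1 / w x) powr q = w x powr (1 + - q)"
          using ApD(2)[OF w, of x] by (subst powr_add) (simp add: powr_minus powr_divide field_simps)
        ultimately show ?thesis by (simp add: \<sigma>_def)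
      qed
      then have "ennreal (w x) * ennreal ((1 / w x) powr q) = ennreal (\<sigma> x)"
        using ApD(2)[OF w, of x] by (simp flip: ennreal_mult)
      moreover have "epowr (h x) q = epowr (\<mu> x) p * ennreal ((1 / w x) powr q)"
        using p ApD(2)[OF w, of x] by (simp add: h_def epowr_mult epowr_epowr epowr_ennreal less_imp_le q_def)
      ultimately show ?thesis by (metis mult.assoc mult.commute)
    qed
    have gp: "ennreal (\<sigma> x) * epowr (g x * ennreal (1 / \<sigma> x)) p = epowr (g x) p * ennreal (w x)" for x
    proof -
      have "\<sigma> x * (1 / \<sigma> x) powr p = w x"
      proof -
        have "\<sigma> x * (1 / \<sigma> x) powr p = \<sigma> x powr (1 + - p)"
          using \<sigma>_pos[of x] by (subst powr_add) (simp add: powr_minus powr_divide field_simps)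
        also have "\<dots> = w x powr ((- 1 / (p - 1)) * (1 + - p))" by (simp add: \<sigma>_def powr_powr)
        also have "(- 1 / (p - 1)) * (1 + - p) = 1" using p by (simp add: field_simps)
        finally show ?thesis using ApD(2)[OF w, of x] by simp
      qed
      then have "ennreal (\<sigma> x) * ennreal ((1 / \<sigma> x) powr p) = ennreal (w x)"
        using \<sigma>_pos[of x] by (simp flip: ennreal_mult)
      moreover have "epowr (g x * ennreal (1 / \<sigma> x)) p = epowr (g x) p * ennreal ((1 / \<sigma> x) powr p)"
        using \<sigma>_pos[of x] by (simp add: epowr_mult epowr_ennreal less_imp_le)
      ultimately show ?thesis by (metis mult.assoc mult.commute)
    qed
    have "(\<integral>\<^sup>+x. epowr (maxfun M g x) p * ennreal (w x) \<partial>M)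
       \<le> (\<integral>\<^sup>+x. ennreal (K powr q) * (ennreal (w x) * epowr (maxfun (density M (\<lambda>x. ennreal (w x))) h x) q) \<partial>M)"
    proof (intro nn_integral_mono)
      fix x show "epowr (maxfun M g x) p * ennreal (w x)
        \<le> ennreal (K powr q) * (ennreal (w x) * epowr (maxfun (density M (\<lambda>x. ennreal (w x))) h x) q)"
        using mult_right_mono[OF pt[of x], of "ennreal (w x)"] by (simp add: mult_ac)
    qed
    also have "\<dots> = ennreal (K powr q) * (\<integral>\<^sup>+x. epowr (maxfun (density M (\<lambda>x. ennreal (w x))) h x) q \<partial>density M (\<lambda>x. ennreal (w x)))"
      by (subst nn_integral_density) (auto simp: nn_integral_cmult)
    also have "\<dots> \<le> ennreal (K powr q) * (ennreal C1 * (\<integral>\<^sup>+x. epowr (h x) q \<partial>density M (\<lambda>x. ennreal (w x))))"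
      unfolding C1_def by (intro mult_left_mono maxfun_strong_type[OF d1 _ q]) auto
    also have "(\<integral>\<^sup>+x. epowr (h x) q \<partial>density M (\<lambda>x. ennreal (w x))) = (\<integral>\<^sup>+x. epowr (\<mu> x) p \<partial>density M (\<lambda>x. ennreal (\<sigma> x)))"
      by (subst (1 2) nn_integral_density) (auto simp: hq)
    also have "ennreal (K powr q) * (ennreal C1 * (\<integral>\<^sup>+x. epowr (\<mu> x) p \<partial>density M (\<lambda>x. ennreal (\<sigma> x))))
      \<le> ennreal (K powr q) * (ennreal C1 * (ennreal C2 * (\<integral>\<^sup>+x. epowr (g x * ennreal (1 / \<sigma> x)) p \<partial>density M (\<lambda>x. ennreal (\<sigma> x)))))"
      unfolding C2_def \<mu>_def by (intro mult_left_mono maxfun_strong_type[OF d2 _ p]) auto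
    also have "(\<integral>\<^sup>+x. epowr (g x * ennreal (1 / \<sigma> x)) p \<partial>density M (\<lambda>x. ennreal (\<sigma> x))) = (\<integral>\<^sup>+x. epowr (g x) p * ennreal (w x) \<partial>M)"
      by (subst nn_integral_density) (auto simp: gp)
    finally show "(\<integral>\<^sup>+x. epowr (maxfun M g x) p * ennreal (w x) \<partial>M)
      \<le> ennreal (K powr q * C1 * C2) * (\<integral>\<^sup>+x. epowr (g x) p * ennreal (w x) \<partial>M)"
      using pos by (simp add: ennreal_mult mult.assoc)
  qed
qed (auto intro: exI[of _ 1] simp: Ap_def)

section \<open>Majorants with controlled maximal function\<close>

definition A1 :: "real \<Rightarrow> ('a \<Rightarrow> real) \<Rightarrow> bool" where
  "A1 C U \<longleftrightarrow> U \<in> borel_measurable borel \<and> (\<forall>x. U x > 0) \<and> C > 0 \<and>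
     (AE x in M. maxfun M (\<lambda>y. ennreal (U y)) x \<le> ennreal (C * U x))"

lemma A1D:
  assumes "A1 C U"
  shows "U \<in> borel_measurable borel" "U x > 0" "C > 0"
    "AE x in M. maxfun M (\<lambda>y. ennreal (U y)) x \<le> ennreal (C * U x)"
  using assms by (auto simp: A1_def)

lemma A1_ball:
  assumes U: "A1 C U" and t: "t > 0" and m: "emeasure M (qball c t) = ennreal m" "m > 0"
  obtains V where "V > 0" "(\<integral>\<^sup>+y\<in>qball c t. ennreal (U y) \<partial>M) = ennreal V"
    "AE y in M. y \<in> qball c t \<longrightarrow> V / (m * C) \<le> U y"
proof -
  note [measurable] = A1D(1)[OF U]
  define I where "I = (\<integral>\<^sup>+y\<in>qball c t. ennreal (U y) \<partial>M)"
  have I: "I > 0" unfolding I_def using A1D(2)[OF U] t by (intro integral_qball_pos) auto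
  have AE: "AE y in M. y \<in> qball c t \<longrightarrow> I / ennreal m \<le> ennreal (C * U y)"
    using A1D(4)[OF U]
  proof eventually_elim
    case (elim y)
    then show ?case
      using average_le_maxfun[OF t, of y c, where g = "\<lambda>y. ennreal (U y)" and \<nu> = M] by (auto simp: I_def m intro: order_trans)
  qed
  have "I \<noteq> top"
  proof
    assume top: "I = top"
    have "AE y in M. y \<notin> qball c t"
      using AE by eventually_elim (auto simp: top ennreal_top_divide top_unique)
    then have "emeasure M (qball c t) = 0"
      by (subst (asm) AE_iff_measurable[OF _ refl]) auto
    then show False using m by simp
  qed
  then obtain V where V: "I = ennreal V" "V > 0" using I by (cases I) auto
  show ?thesis
  proof (rule that[of V])
    show "AE y in M. y \<in> qball c t \<longrightarrow> V / (m * C) \<le> U y"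
      using AE
    proof eventually_elim
      case (elim y)
      show ?case
      proof
        assume "y \<in> qball c t"
        with elim have "V / m \<le> C * U y"
          using V m A1D(2)[OF U, of y] A1D(3)[OF U] by (simp add: divide_ennreal less_imp_le)
        then show "V / (m * C) \<le> U y" using m A1D(3)[OF U] by (simp add: field_simps)
      qed
    qed
  qed (use V in \<open>auto simp: I_def\<close>)
qed

lemma maxfun_pos:
  assumes [measurable]: "h \<in> borel_measurable borel" and "\<not> (AE x in M. h x = 0)"
  shows "maxfun M h x > 0"
proof (rule ccontr)
  assume "\<not> maxfun M h x > 0"
  then have z: "maxfun M h x = 0" by (simp add: zero_less_iff_neq_zero)
  have "AE y in M. y \<in> qball x (real (Suc n)) \<longrightarrow> h y = 0" for n
  proof -
    have n: "real (Suc n) > 0" by simp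
    have "(\<integral>\<^sup>+y\<in>qball x (real (Suc n)). h y \<partial>M) / emeasure M (qball x (real (Suc n))) = 0"
      using average_le_maxfun[OF n center_in_qball[OF n, of x], where g = h and \<nu> = M] z by (simp del: of_nat_Suc)
    then have "(\<integral>\<^sup>+y\<in>qball x (real (Suc n)). h y \<partial>M) = 0"
      using doublingD(4)[OF doubling_M n, of x]
      by (auto simp: ennreal_divide_eq_0_iff simp del: of_nat_Suc)
    then have "AE y in M. h y * indicator (qball x (real (Suc n))) y = 0"
      by (subst (asm) nn_integral_0_iff_AE) auto
    then show ?thesis by eventually_elim (auto split: split_indicator_asm)
  qed
  then have "AE y in M. \<forall>n. y \<in> qball x (real (Suc n)) \<longrightarrow> h y = 0"
    by (subst AE_all_countable) auto
  then have "AE y in M. h y = 0"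
    by eventually_elim (use UN_qball[of x] in blast)
  then show False using assms(2) by simp
qed

text \<open>The iteration of Rubio de Francia. The normalized iterates of the maximal operator all have
  weighted norm at most that of \<open>h\<close>; adding them with geometrically decreasing coefficients gives
  a function that the maximal operator maps below a multiple of itself, since it shifts the series
  by one step.\<close>

lemma A1_majorant:
  assumes p: "p > 1"
  shows "\<exists>C>0. \<forall>w h. Ap p K w \<longrightarrow> h \<in> borel_measurable borel \<longrightarrow>
    0 < (\<integral>\<^sup>+x. epowr (h x) p * ennreal (w x) \<partial>M) \<longrightarrow> (\<integral>\<^sup>+x. epowr (h x) p * ennreal (w x) \<partial>M) < top \<longrightarrow>
    (\<exists>U. A1 C U \<and> (AE x in M. h x \<le> ennreal (U x)) \<and>
       (\<integral>\<^sup>+x. ennreal (U x powr p * w x) \<partial>M) \<le> ennreal C * (\<integral>\<^sup>+x. epowr (h x) p * ennreal (w x) \<partial>M))"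
proof -
  obtain C0 where C0: "C0 > 0" and bound: "\<And>w g. Ap p K w \<Longrightarrow> g \<in> borel_measurable borel \<Longrightarrow>
      (\<integral>\<^sup>+x. epowr (maxfun M g x) p * ennreal (w x) \<partial>M) \<le> ennreal C0 * (\<integral>\<^sup>+x. epowr (g x) p * ennreal (w x) \<partial>M)"
    using Muckenhoupt[OF p, of K] by blast
  define A where "A = C0 powr (1 / p)"
  have A: "A > 0" "(1 / A) powr p = 1 / C0" using C0 p by (auto simp: A_def powr_divide powr_powr)
  define \<beta> where "\<beta> = (\<lambda>i::nat. ennreal ((1 / 2) ^ i))"
  define s where "s = (2::real) powr (- p)"
  have s: "0 < s" "s < 1" using p by (auto simp: s_def powr_less_one)
  have sum\<beta>: "(\<Sum>i. \<beta> i) = ennreal 2"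
  proof -
    have "(\<lambda>i. (1 / 2 :: real) ^ i) sums 2" using geometric_sums[of "1/2 :: real"] by simp
    then show ?thesis unfolding \<beta>_def by (intro sums_unique[symmetric] sums_ennreal[THEN iffD2]) auto
  qed
  have sums: "(\<Sum>i. ennreal (s ^ i)) = ennreal (1 / (1 - s))"
  proof -
    have "(\<lambda>i. s ^ i) sums (1 / (1 - s))" using geometric_sums[of s] s by simp
    then show ?thesis using s by (intro sums_unique[symmetric] sums_ennreal[THEN iffD2]) auto
  qed
  have \<beta>p: "epowr (\<beta> i) p = ennreal (s ^ i)" for i
  proof -
    have "(1 / 2 :: real) ^ i = 2 powr (- real i)"
      by (simp add: powr_minus powr_realpow power_one_over inverse_eq_divide)
    then have "((1 / 2 :: real) ^ i) powr p = s ^ i"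
      by (simp only: powr_powr s_def) (simp add: powr_power mult.commute)
    then show ?thesis by (simp add: \<beta>_def epowr_ennreal)
  qed
  define C where "C = max (4 * A) (2 powr p / (1 - s))"
  show ?thesis
  proof (intro exI[of _ C] conjI allI impI)
    show C: "C > 0" using A by (auto simp: C_def)
    fix w :: "'a \<Rightarrow> real" and h :: "'a \<Rightarrow> ennreal"
    assume w: "Ap p K w" and [measurable]: "h \<in> borel_measurable borel"
      and pos: "0 < (\<integral>\<^sup>+x. epowr (h x) p * ennreal (w x) \<partial>M)"
      and fin: "(\<integral>\<^sup>+x. epowr (h x) p * ennreal (w x) \<partial>M) < top"
    note [measurable] = ApD(1)[OF w]
    define H where "H = (\<integral>\<^sup>+x. epowr (h x) p * ennreal (w x) \<partial>M)"
    define v where "v = rec_nat h (\<lambda>_ u x. maxfun M u x * ennreal (1 / A))"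
    have v0: "v 0 = h" and vS: "v (Suc i) = (\<lambda>x. maxfun M (v i) x * ennreal (1 / A))" for i
      by (simp_all add: v_def)
    have [measurable]: "v i \<in> borel_measurable borel" for i
      by (cases i) (auto simp: v0 vS)
    have vH: "(\<integral>\<^sup>+x. epowr (v i x) p * ennreal (w x) \<partial>M) \<le> H" for i
    proof (induction i)
      case (Suc i)
      have "(\<integral>\<^sup>+x. epowr (v (Suc i) x) p * ennreal (w x) \<partial>M)
         = (\<integral>\<^sup>+x. ennreal (1 / C0) * (epowr (maxfun M (v i) x) p * ennreal (w x)) \<partial>M)"
        using A by (intro nn_integral_cong) (simp add: vS epowr_mult epowr_ennreal less_imp_le mult_ac)
      also have "\<dots> = ennreal (1 / C0) * (\<integral>\<^sup>+x. epowr (maxfun M (v i) x) p * ennreal (w x) \<partial>M)"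
        by (rule nn_integral_cmult) auto
      also have "\<dots> \<le> ennreal (1 / C0) * (ennreal C0 * (\<integral>\<^sup>+x. epowr (v i x) p * ennreal (w x) \<partial>M))"
        by (intro mult_left_mono bound w) auto
      also have "\<dots> = (\<integral>\<^sup>+x. epowr (v i x) p * ennreal (w x) \<partial>M)"
        using C0 by (simp add: mult.assoc[symmetric] flip: ennreal_mult)
      finally show ?case using Suc by simp
    qed (simp add: v0 H_def)
    define U0 where "U0 = (\<lambda>x. \<Sum>i. \<beta> i * (\<beta> i * v i x))"
    have [measurable]: "U0 \<in> borel_measurable borel" unfolding U0_def by measurable
    have hU0: "h x \<le> U0 x" for x
      using sum_le_suminf[of "\<lambda>i. \<beta> i * (\<beta> i * v i x)" "{0}"] by (auto simp: U0_def v0 \<beta>_def)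
    have U0_pos: "U0 x > 0" for x
    proof -
      have "\<not> (AE x in M. h x = 0)"
      proof
        assume "AE x in M. h x = 0"
        then have "AE x in M. epowr (h x) p * ennreal (w x) = 0" by eventually_elim simp
        then have "(\<integral>\<^sup>+x. epowr (h x) p * ennreal (w x) \<partial>M) = 0"
          by (subst nn_integral_0_iff_AE) auto
        then show False using pos by simp
      qed
      then have "maxfun M h x > 0" by (intro maxfun_pos) auto
      moreover have "\<beta> 1 > 0" unfolding \<beta>_def by (simp only: ennreal_less_zero_iff) simp
      ultimately have "\<beta> 1 * (\<beta> 1 * v 1 x) > 0"
        using A vS[of 0] by (simp add: v0 ennreal_zero_less_mult_iff)
      also have "\<beta> 1 * (\<beta> 1 * v 1 x) \<le> U0 x"
        using sum_le_suminf[of "\<lambda>i. \<beta> i * (\<beta> i * v i x)" "{1}"] by (auto simp: U0_def)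
      finally show ?thesis .
    qed
    have U0_max: "maxfun M U0 x \<le> ennreal (4 * A) * U0 x" for x
    proof -
      have "maxfun M U0 x \<le> (\<Sum>i. maxfun M (\<lambda>x. \<beta> i * (\<beta> i * v i x)) x)"
        unfolding U0_def by (rule maxfun_suminf_le) auto
      also have "\<dots> \<le> (\<Sum>i. ennreal (4 * A) * (\<beta> (Suc i) * (\<beta> (Suc i) * v (Suc i) x)))"
      proof (intro suminf_le)
        fix i
        have e: "ennreal (4 * A) * (\<beta> (Suc i) * (\<beta> (Suc i) * ennreal (1 / A))) = \<beta> i * \<beta> i"
          using A by (simp add: \<beta>_def mult_ac flip: ennreal_mult)
        have "maxfun M (\<lambda>x. (\<beta> i * \<beta> i) * v i x) x \<le> (\<beta> i * \<beta> i) * maxfun M (v i) x"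
          by (rule maxfun_cmult) auto
        also have "\<dots> = ennreal (4 * A) * (\<beta> (Suc i) * (\<beta> (Suc i) * v (Suc i) x))"
          unfolding e[symmetric] vS by (simp add: mult_ac)
        finally show "maxfun M (\<lambda>x. \<beta> i * (\<beta> i * v i x)) x \<le> ennreal (4 * A) * (\<beta> (Suc i) * (\<beta> (Suc i) * v (Suc i) x))"
          by (simp add: mult.assoc)
      qed auto
      also have "\<dots> = ennreal (4 * A) * (\<Sum>i. \<beta> (Suc i) * (\<beta> (Suc i) * v (Suc i) x))" by simp
      also have "(\<Sum>i. \<beta> (Suc i) * (\<beta> (Suc i) * v (Suc i) x)) \<le> U0 x"
        unfolding U0_def
      proof (rule suminf_le_const)
        fix n
        have "(\<Sum>i<n. \<beta> (Suc i) * (\<beta> (Suc i) * v (Suc i) x)) \<le> (\<Sum>i<Suc n. \<beta> i * (\<beta> i * v i x))"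
          by (subst sum.lessThan_Suc_shift) simp
        also have "\<dots> \<le> (\<Sum>i. \<beta> i * (\<beta> i * v i x))" by (intro sum_le_suminf) auto
        finally show "(\<Sum>i<n. \<beta> (Suc i) * (\<beta> (Suc i) * v (Suc i) x)) \<le> (\<Sum>i. \<beta> i * (\<beta> i * v i x))" .
      qed simp
      finally show ?thesis by (simp add: mult_left_mono)
    qed
    have U0_int: "(\<integral>\<^sup>+x. epowr (U0 x) p * ennreal (w x) \<partial>M) \<le> ennreal (2 powr p / (1 - s)) * H"
    proof -
      have "(\<integral>\<^sup>+x. epowr (U0 x) p * ennreal (w x) \<partial>M)
        \<le> (\<integral>\<^sup>+x. (\<Sum>i. ennreal (2 powr p) * (ennreal (s ^ i) * (epowr (v i x) p * ennreal (w x)))) \<partial>M)"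
      proof (intro nn_integral_mono)
        fix x
        have "epowr (U0 x) p \<le> epowr (\<Sum>i. \<beta> i) p * (\<Sum>i. epowr (\<beta> i * v i x) p)"
          unfolding U0_def using p by (intro epowr_weighted_suminf_le) auto
        also have "\<dots> = (\<Sum>i. ennreal (2 powr p) * (ennreal (s ^ i) * epowr (v i x) p))"
          by (simp add: sum\<beta> epowr_mult \<beta>p epowr_ennreal del: ennreal_numeral)
        finally have "epowr (U0 x) p * ennreal (w x) \<le> (\<Sum>i. ennreal (2 powr p) * (ennreal (s ^ i) * epowr (v i x) p)) * ennreal (w x)"
          by (intro mult_right_mono) auto
        then show "epowr (U0 x) p * ennreal (w x) \<le> (\<Sum>i. ennreal (2 powr p) * (ennreal (s ^ i) * (epowr (v i x) p * ennreal (w x))))"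
          by (simp only: ennreal_suminf_multc[symmetric] mult.assoc)
      qed
      also have "\<dots> = (\<Sum>i. ennreal (2 powr p) * (ennreal (s ^ i) * (\<integral>\<^sup>+x. epowr (v i x) p * ennreal (w x) \<partial>M)))"
        by (subst nn_integral_suminf) (auto simp: nn_integral_cmult)
      also have "\<dots> \<le> (\<Sum>i. ennreal (2 powr p) * (ennreal (s ^ i) * H))"
        by (intro suminf_le mult_left_mono vH) auto
      also have "\<dots> = ennreal (2 powr p) * ((\<Sum>i. ennreal (s ^ i)) * H)" by simp
      also have "\<dots> = ennreal (2 powr p / (1 - s)) * H"
        using s by (simp add: sums mult.assoc[symmetric] flip: ennreal_mult)
      finally show ?thesis .
    qed
    have "ennreal (2 powr p / (1 - s)) * H < top"
      using fin by (simp add: H_def ennreal_mult_less_top)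
    with U0_int have "(\<integral>\<^sup>+x. epowr (U0 x) p * ennreal (w x) \<partial>M) \<noteq> \<infinity>" by auto
    then have "AE x in M. epowr (U0 x) p * ennreal (w x) \<noteq> \<infinity>"
      by (intro nn_integral_PInf_AE) auto
    then have U0_fin: "AE x in M. U0 x \<noteq> top"
    proof eventually_elim
      case (elim x)
      then show ?case using ApD(2)[OF w, of x] by (auto simp: ennreal_mult_eq_top_iff)
    qed
    define U where "U = (\<lambda>x. if U0 x = top then 1 else enn2real (U0 x))"
    have [measurable]: "U \<in> borel_measurable borel" unfolding U_def by (intro measurable_If) auto
    have UU0: "U0 x \<noteq> top \<Longrightarrow> ennreal (U x) = U0 x" for x
      by (simp add: U_def less_top)
    have U_pos: "U x > 0" for x
      using U0_pos[of x] by (auto simp: U_def enn2real_positive_iff less_top)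
    have "AE x in M. maxfun M (\<lambda>y. ennreal (U y)) x \<le> ennreal (C * U x)"
      using U0_fin
    proof eventually_elim
      case (elim x)
      have "maxfun M (\<lambda>y. ennreal (U y)) x \<le> maxfun M U0 x"
        using U0_fin by (intro maxfun_mono_AE) (auto simp: UU0)
      also have "\<dots> \<le> ennreal (4 * A) * ennreal (U x)" using U0_max[of x] elim by (simp add: UU0)
      also have "\<dots> = ennreal (4 * A * U x)" using A U_pos[of x] by (simp add: ennreal_mult)
      also have "\<dots> \<le> ennreal (C * U x)"
        using U_pos[of x] by (intro ennreal_leI mult_right_mono) (auto simp: C_def)
      finally show ?case .
    qed
    then have "A1 C U" using U_pos C by (auto simp: A1_def)
    moreover have "AE x in M. h x \<le> ennreal (U x)"
      using U0_fin by eventually_elim (use hU0 in \<open>auto simp: UU0\<close>)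
    moreover have "(\<integral>\<^sup>+x. ennreal (U x powr p * w x) \<partial>M) \<le> ennreal C * H"
    proof -
      have "(\<integral>\<^sup>+x. ennreal (U x powr p * w x) \<partial>M) = (\<integral>\<^sup>+x. epowr (U0 x) p * ennreal (w x) \<partial>M)"
      proof (intro nn_integral_cong_AE, use U0_fin in eventually_elim)
        case (elim x)
        then show ?case using U_pos[of x] ApD(2)[OF w, of x]
          by (simp add: UU0[symmetric] epowr_ennreal ennreal_mult less_imp_le)
      qed
      also have "\<dots> \<le> ennreal (2 powr p / (1 - s)) * H" by (rule U0_int)
      also have "\<dots> \<le> ennreal C * H" by (intro mult_right_mono ennreal_leI) (auto simp: C_def)
      finally show ?thesis .
    qed
    ultimately show "\<exists>U. A1 C U \<and> (AE x in M. h x \<le> ennreal (U x)) \<and>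
       (\<integral>\<^sup>+x. ennreal (U x powr p * w x) \<partial>M) \<le> ennreal C * (\<integral>\<^sup>+x. epowr (h x) p * ennreal (w x) \<partial>M)"
      unfolding H_def by blast
  qed
qed

section \<open>Extrapolation of weights\<close>

text \<open>On a ball the negative power of \<open>U\<close> is at most the same power of the average of \<open>U\<close>
  (\<open>A1_ball\<close>), and in the dual integral Hoelder's inequality produces the inverse power of that
  average.\<close>

lemma Ap_factor_up:
  assumes w: "Ap p K w" and U: "A1 C U" and p: "1 < p" "p < q"
  shows "Ap q (K * C powr (q - p)) (\<lambda>x. U x powr (p - q) * w x)"
  unfolding Ap_def
proof (intro conjI allI impI)
  note [measurable] = ApD(1)[OF w] A1D(1)[OF U]
  note Upos = A1D(2)[OF U] and Cpos = A1D(3)[OF U] and wpos = ApD(2)[OF w]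
  show "(\<lambda>x. U x powr (p - q) * w x) \<in> borel_measurable borel" by measurable
  show "U x powr (p - q) * w x > 0" for x using Upos[of x] wpos[of x] by simp
  show "K * C powr (q - p) > 0" using Cpos ApD(3)[OF w] by simp
  fix x :: 'a and t :: real assume t: "0 < t"
  obtain W S m where 1: "W > 0" "S > 0" "m > 0"
    "(\<integral>\<^sup>+y\<in>qball x t. ennreal (w y) \<partial>M) = ennreal W"
    "(\<integral>\<^sup>+y\<in>qball x t. ennreal (w y powr (- 1 / (p - 1))) \<partial>M) = ennreal S"
    "emeasure M (qball x t) = ennreal m" "W * S powr (p - 1) \<le> K * m powr p"
    by (rule Ap_integrals[OF w p(1) t])
  obtain V where V: "V > 0" "(\<integral>\<^sup>+y\<in>qball x t. ennreal (U y) \<partial>M) = ennreal V"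
    "AE y in M. y \<in> qball x t \<longrightarrow> V / (m * C) \<le> U y"
    by (rule A1_ball[OF U t 1(6,3)])
  define \<theta> where "\<theta> = (q - p) / (q - 1)"
  have \<theta>: "0 < \<theta>" "\<theta> < 1" "1 - \<theta> = (p - 1) / (q - 1)" using p by (auto simp: \<theta>_def field_simps)
  have I1: "(\<integral>\<^sup>+y\<in>qball x t. ennreal (U y powr (p - q) * w y) \<partial>M) \<le> ennreal ((V / (m * C)) powr (p - q) * W)"
  proof -
    have "(\<integral>\<^sup>+y\<in>qball x t. ennreal (U y powr (p - q) * w y) \<partial>M)
       \<le> (\<integral>\<^sup>+y. ennreal ((V / (m * C)) powr (p - q)) * (ennreal (w y) * indicator (qball x t) y) \<partial>M)"
    proof (intro nn_integral_mono_AE, use V(3) in eventually_elim)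
      case (elim y)
      show ?case
      proof (cases "y \<in> qball x t")
        case True
        then have "U y powr (p - q) \<le> (V / (m * C)) powr (p - q)"
          using elim p V 1 Cpos by (intro powr_mono2') auto
        then have "U y powr (p - q) * w y \<le> (V / (m * C)) powr (p - q) * w y"
          using wpos[of y] by (intro mult_right_mono) auto
        then show ?thesis using True wpos[of y] by (simp flip: ennreal_mult)
      qed auto
    qed
    also have "\<dots> = ennreal ((V / (m * C)) powr (p - q)) * ennreal W"
      by (subst nn_integral_cmult) (auto simp: 1)
    finally show ?thesis using 1 by (simp add: ennreal_mult)
  qed
  have I2: "(\<integral>\<^sup>+y\<in>qball x t. ennreal ((U y powr (p - q) * w y) powr (- 1 / (q - 1))) \<partial>M) \<le> ennreal (V powr \<theta> * S powr (1 - \<theta>))"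
  proof -
    have e: "(U y powr (p - q) * w y) powr (- 1 / (q - 1)) = U y powr \<theta> * (w y powr (- 1 / (p - 1))) powr (1 - \<theta>)" for y
    proof -
      have "(p - q) * (- 1 / (q - 1)) = \<theta>" "(- 1 / (p - 1)) * (1 - \<theta>) = - 1 / (q - 1)"
        unfolding \<theta>(3) using p by (auto simp: \<theta>_def field_simps)
      then show ?thesis using Upos[of y] wpos[of y] by (simp only: powr_mult powr_powr)
    qed
    have "(\<integral>\<^sup>+y\<in>qball x t. ennreal ((U y powr (p - q) * w y) powr (- 1 / (q - 1))) \<partial>M)
      = (\<integral>\<^sup>+y. epowr (ennreal (U y) * indicator (qball x t) y) \<theta> *
          epowr (ennreal (w y powr (- 1 / (p - 1))) * indicator (qball x t) y) (1 - \<theta>) \<partial>M)"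
      unfolding e using Upos
      by (intro nn_integral_cong) (auto simp: epowr_ennreal less_imp_le ennreal_mult split: split_indicator)
    also have "\<dots> \<le> epowr (ennreal V) \<theta> * epowr (ennreal S) (1 - \<theta>)"
      unfolding 1(5)[symmetric] V(2)[symmetric] by (rule nn_integral_Hoelder) (use \<theta> in auto)
    also have "\<dots> = ennreal (V powr \<theta> * S powr (1 - \<theta>))"
      using V 1 by (simp add: epowr_ennreal flip: ennreal_mult)
    finally show ?thesis .
  qed
  have "(\<integral>\<^sup>+y\<in>qball x t. ennreal (U y powr (p - q) * w y) \<partial>M) *
      epowr (\<integral>\<^sup>+y\<in>qball x t. ennreal ((U y powr (p - q) * w y) powr (- 1 / (q - 1))) \<partial>M) (q - 1)
    \<le> ennreal ((V / (m * C)) powr (p - q) * W) * epowr (ennreal (V powr \<theta> * S powr (1 - \<theta>))) (q - 1)"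
    using p by (intro mult_mono I1 I2 epowr_mono) auto
  also have "\<dots> = ennreal ((V / (m * C)) powr (p - q) * W * (V powr \<theta> * S powr (1 - \<theta>)) powr (q - 1))"
    using 1(1,2) by (subst epowr_ennreal) (auto simp flip: ennreal_mult)
  also have "(V / (m * C)) powr (p - q) * W * (V powr \<theta> * S powr (1 - \<theta>)) powr (q - 1)
      = (m * C) powr (q - p) * (W * S powr (p - 1))"
  proof -
    have a: "\<theta> * (q - 1) = q - p" "(1 - \<theta>) * (q - 1) = p - 1" unfolding \<theta>(3) using p by (auto simp: \<theta>_def)
    have b: "(V / (m * C)) powr (p - q) = (m * C) powr (q - p) * V powr (p - q)"
      using V 1 Cpos powr_minus_divide[of "m * C" "q - p"]
      by (simp add: powr_divide field_simps)
    have c: "V powr (p - q) * V powr (q - p) = 1" using V by (simp flip: powr_add)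
    have "(V powr \<theta> * S powr (1 - \<theta>)) powr (q - 1) = V powr (q - p) * S powr (p - 1)"
      using V 1 a by (simp only: powr_mult powr_powr)
    then show ?thesis unfolding b using c by (metis (no_types, opaque_lifting) mult.commute mult.left_commute mult.right_neutral)
  qed
  also have "\<dots> \<le> (m * C) powr (q - p) * (K * m powr p)"
    by (intro mult_left_mono 1) auto
  also have "\<dots> = K * C powr (q - p) * m powr q"
    using 1 Cpos powr_add[of m "q - p" p] by (simp add: powr_mult mult_ac)
  finally show "(\<integral>\<^sup>+y\<in>qball x t. ennreal (U y powr (p - q) * w y) \<partial>M) *
      epowr (\<integral>\<^sup>+y\<in>qball x t. ennreal ((U y powr (p - q) * w y) powr (- 1 / (q - 1))) \<partial>M) (q - 1)
    \<le> ennreal (K * C powr (q - p)) * epowr (emeasure M (qball x t)) q"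
    using 1 Cpos ApD(3)[OF w] by (simp add: ennreal_leI epowr_ennreal flip: ennreal_mult)
qed

text \<open>The reverse of the preceding situation: Hoelder's inequality treats the weight itself, and
  \<open>A1_ball\<close> the negative power of \<open>U\<close> in the dual weight.\<close>

lemma Ap_factor_down:
  assumes w: "Ap p K w" and U: "A1 C U" and p: "1 < q" "q < p"
  defines "\<theta> \<equiv> (p - q) / (p - 1)"
  shows "Ap q (C powr \<theta> * K powr (1 - \<theta>)) (\<lambda>x. U x powr \<theta> * w x powr (1 - \<theta>))"
  unfolding Ap_def
proof (intro conjI allI impI)
  note [measurable] = ApD(1)[OF w] A1D(1)[OF U]
  note Upos = A1D(2)[OF U] and Cpos = A1D(3)[OF U] and wpos = ApD(2)[OF w]
  show "(\<lambda>x. U x powr \<theta> * w x powr (1 - \<theta>)) \<in> borel_measurable borel" by measurable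
  show "U x powr \<theta> * w x powr (1 - \<theta>) > 0" for x using Upos[of x] wpos[of x] by simp
  show "C powr \<theta> * K powr (1 - \<theta>) > 0" using Cpos ApD(3)[OF w] by simp
  fix x :: 'a and t :: real assume t: "0 < t"
  have p1: "1 < p" using p by simp
  obtain W S m where 1: "W > 0" "S > 0" "m > 0"
    "(\<integral>\<^sup>+y\<in>qball x t. ennreal (w y) \<partial>M) = ennreal W"
    "(\<integral>\<^sup>+y\<in>qball x t. ennreal (w y powr (- 1 / (p - 1))) \<partial>M) = ennreal S"
    "emeasure M (qball x t) = ennreal m" "W * S powr (p - 1) \<le> K * m powr p"
    by (rule Ap_integrals[OF w p1 t])
  obtain V where V: "V > 0" "(\<integral>\<^sup>+y\<in>qball x t. ennreal (U y) \<partial>M) = ennreal V"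
    "AE y in M. y \<in> qball x t \<longrightarrow> V / (m * C) \<le> U y"
    by (rule A1_ball[OF U t 1(6,3)])
  have \<theta>: "0 < \<theta>" "\<theta> < 1" "1 - \<theta> = (q - 1) / (p - 1)" using p by (auto simp: \<theta>_def field_simps)
  define r where "r = - \<theta> / (q - 1)"
  have r: "r \<le> 0" "r * (q - 1) = - \<theta>" using p \<theta> by (auto simp: r_def field_simps)
  have I1: "(\<integral>\<^sup>+y\<in>qball x t. ennreal (U y powr \<theta> * w y powr (1 - \<theta>)) \<partial>M) \<le> ennreal (V powr \<theta> * W powr (1 - \<theta>))"
  proof -
    have "(\<integral>\<^sup>+y\<in>qball x t. ennreal (U y powr \<theta> * w y powr (1 - \<theta>)) \<partial>M)
      = (\<integral>\<^sup>+y. epowr (ennreal (U y) * indicator (qball x t) y) \<theta> *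
          epowr (ennreal (w y) * indicator (qball x t) y) (1 - \<theta>) \<partial>M)"
      using Upos wpos
      by (intro nn_integral_cong) (auto simp: epowr_ennreal less_imp_le ennreal_mult split: split_indicator)
    also have "\<dots> \<le> epowr (ennreal V) \<theta> * epowr (ennreal W) (1 - \<theta>)"
      unfolding 1(4)[symmetric] V(2)[symmetric] by (rule nn_integral_Hoelder) (use \<theta> in auto)
    also have "\<dots> = ennreal (V powr \<theta> * W powr (1 - \<theta>))"
      using V 1 by (simp add: epowr_ennreal flip: ennreal_mult)
    finally show ?thesis .
  qed
  have I2: "(\<integral>\<^sup>+y\<in>qball x t. ennreal ((U y powr \<theta> * w y powr (1 - \<theta>)) powr (- 1 / (q - 1))) \<partial>M)
      \<le> ennreal ((V / (m * C)) powr r * S)"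
  proof -
    have e: "(U y powr \<theta> * w y powr (1 - \<theta>)) powr (- 1 / (q - 1)) = U y powr r * w y powr (- 1 / (p - 1))" for y
    proof -
      have "\<theta> * (- 1 / (q - 1)) = r" "(1 - \<theta>) * (- 1 / (q - 1)) = - 1 / (p - 1)"
        unfolding \<theta>(3) using p by (auto simp: r_def field_simps)
      then show ?thesis using Upos[of y] wpos[of y] by (simp only: powr_mult powr_powr)
    qed
    have "(\<integral>\<^sup>+y\<in>qball x t. ennreal ((U y powr \<theta> * w y powr (1 - \<theta>)) powr (- 1 / (q - 1))) \<partial>M)
       \<le> (\<integral>\<^sup>+y. ennreal ((V / (m * C)) powr r) * (ennreal (w y powr (- 1 / (p - 1))) * indicator (qball x t) y) \<partial>M)"
    proof (intro nn_integral_mono_AE, use V(3) in eventually_elim)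
      case (elim y)
      show ?case
      proof (cases "y \<in> qball x t")
        case True
        then have "U y powr r \<le> (V / (m * C)) powr r"
          using elim r V 1 Cpos by (intro powr_mono2') auto
        then have "U y powr r * w y powr (- 1 / (p - 1)) \<le> (V / (m * C)) powr r * w y powr (- 1 / (p - 1))"
          by (intro mult_right_mono) auto
        then show ?thesis unfolding e using True by (simp flip: ennreal_mult)
      qed auto
    qed
    also have "\<dots> = ennreal ((V / (m * C)) powr r) * ennreal S"
      by (subst nn_integral_cmult) (auto simp: 1(5)[simplified])
    finally show ?thesis using 1 by (simp add: ennreal_mult)
  qed
  have "(\<integral>\<^sup>+y\<in>qball x t. ennreal (U y powr \<theta> * w y powr (1 - \<theta>)) \<partial>M) *
      epowr (\<integral>\<^sup>+y\<in>qball x t. ennreal ((U y powr \<theta> * w y powr (1 - \<theta>)) powr (- 1 / (q - 1))) \<partial>M) (q - 1)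
    \<le> ennreal (V powr \<theta> * W powr (1 - \<theta>)) * epowr (ennreal ((V / (m * C)) powr r * S)) (q - 1)"
    using p by (intro mult_mono I1 I2 epowr_mono) auto
  also have "\<dots> = ennreal (V powr \<theta> * W powr (1 - \<theta>) * ((V / (m * C)) powr r * S) powr (q - 1))"
    using 1(2) by (subst epowr_ennreal) (auto simp flip: ennreal_mult)
  also have "V powr \<theta> * W powr (1 - \<theta>) * ((V / (m * C)) powr r * S) powr (q - 1)
      = (m * C) powr \<theta> * (W * S powr (p - 1)) powr (1 - \<theta>)"
  proof -
    have a: "(p - 1) * (1 - \<theta>) = q - 1" unfolding \<theta>(3) using p by auto
    have b: "(V / (m * C)) powr (- \<theta>) = (m * C) powr \<theta> * V powr (- \<theta>)"
      using V 1 Cpos powr_minus_divide[of "m * C" "\<theta>"]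
      by (simp add: powr_divide field_simps)
    have c: "V powr \<theta> * V powr (- \<theta>) = 1" using V by (simp flip: powr_add)
    have "((V / (m * C)) powr r * S) powr (q - 1) = (m * C) powr \<theta> * V powr (- \<theta>) * S powr (q - 1)"
      using V 1 Cpos by (simp only: powr_mult powr_powr r(2) b)
    moreover have "(W * S powr (p - 1)) powr (1 - \<theta>) = W powr (1 - \<theta>) * S powr (q - 1)"
      using 1 a by (simp only: powr_mult powr_powr)
    ultimately show ?thesis using c by (metis (no_types, opaque_lifting) mult.commute mult.left_commute mult.right_neutral)
  qed
  also have "\<dots> \<le> (m * C) powr \<theta> * (K * m powr p) powr (1 - \<theta>)"
    using 1(1,2,7) \<theta> by (intro mult_left_mono powr_mono2) auto
  also have "\<dots> = C powr \<theta> * K powr (1 - \<theta>) * m powr q"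
  proof -
    have "\<theta> + p * (1 - \<theta>) = q"
    proof -
      have "(p - 1) * (1 - \<theta>) = q - 1" unfolding \<theta>(3) using p by simp
      then show ?thesis by (simp add: algebra_simps)
    qed
    then have "m powr \<theta> * m powr (p * (1 - \<theta>)) = m powr q" by (simp flip: powr_add)
    then show ?thesis using 1(3) Cpos ApD(3)[OF w] by (simp add: powr_mult powr_powr mult_ac)
  qed
  finally show "(\<integral>\<^sup>+y\<in>qball x t. ennreal (U y powr \<theta> * w y powr (1 - \<theta>)) \<partial>M) *
      epowr (\<integral>\<^sup>+y\<in>qball x t. ennreal ((U y powr \<theta> * w y powr (1 - \<theta>)) powr (- 1 / (q - 1))) \<partial>M) (q - 1)
    \<le> ennreal (C powr \<theta> * K powr (1 - \<theta>)) * epowr (emeasure M (qball x t)) q"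
    using 1(3,6) Cpos ApD(3)[OF w] by (simp add: ennreal_leI epowr_ennreal flip: ennreal_mult)
qed

section \<open>The weighted vector-valued maximal inequality\<close>

text \<open>For \<open>p < q\<close>, let \<open>U\<close> be a majorant of the \<open>\<ell>\<^sup>q\<close> norm of the \<open>g\<^sub>k\<close>; the inequality for equal
  exponents \<open>q\<close> and the weight \<open>U\<^sup>p\<^sup>-\<^sup>q w\<close> gives the claim by Hoelder's inequality. For
  \<open>p > q\<close>, let \<open>U\<close> be a majorant of \<open>G\<^sup>p\<^sup>-\<^sup>1 w\<close> with respect to the dual weight, where \<open>G\<close> is
  the left-hand \<open>\<ell>\<^sup>q\<close> norm; then \<open>G\<^sup>p w\<close> is at most \<open>G\<^sup>q W\<close> for an \<open>A\<^sub>q\<close> weight \<open>W\<close>, and a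
  smaller power of the left-hand side remains on the right.\<close>

theorem vector_maximal_inequality:
  assumes p: "p > 1" and q: "q > 1" and w: "Ap p K w"
  shows "\<exists>C>0. \<forall>g. (\<forall>k::nat. g k \<in> borel_measurable borel) \<longrightarrow>
    (\<integral>\<^sup>+x. epowr (\<Sum>k. epowr (maxfun M (g k) x) q) (p / q) * ennreal (w x) \<partial>M)
      \<le> ennreal C * (\<integral>\<^sup>+x. epowr (\<Sum>k. epowr (g k x) q) (p / q) * ennreal (w x) \<partial>M)"
proof -
  note [measurable] = ApD(1)[OF w]
  note wpos = ApD(2)[OF w]
  \<comment> \<open>For equal exponents the inequality is the scalar one, summed over the index.\<close>
  have same: "(\<integral>\<^sup>+x. (\<Sum>k. epowr (maxfun M (g k) x) q) * ennreal (W x) \<partial>M)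
        \<le> ennreal C * (\<integral>\<^sup>+x. (\<Sum>k. epowr (g k x) q) * ennreal (W x) \<partial>M)"
    if C: "\<forall>w g. Ap q K' w \<longrightarrow> g \<in> borel_measurable borel \<longrightarrow>
        (\<integral>\<^sup>+x. epowr (maxfun M g x) q * ennreal (w x) \<partial>M) \<le> ennreal C * (\<integral>\<^sup>+x. epowr (g x) q * ennreal (w x) \<partial>M)"
      and W: "Ap q K' W" and [measurable]: "\<And>k. g k \<in> borel_measurable borel"
    for K' C W and g :: "nat \<Rightarrow> 'a \<Rightarrow> ennreal"
  proof -
    note [measurable] = ApD(1)[OF W]
    have "(\<integral>\<^sup>+x. (\<Sum>k. epowr (maxfun M (g k) x) q) * ennreal (W x) \<partial>M)
        = (\<Sum>k. \<integral>\<^sup>+x. epowr (maxfun M (g k) x) q * ennreal (W x) \<partial>M)"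
      by (subst nn_integral_suminf[symmetric]) auto
    also have "\<dots> \<le> (\<Sum>k. ennreal C * (\<integral>\<^sup>+x. epowr (g k x) q * ennreal (W x) \<partial>M))"
      using C W by (intro suminf_le) auto
    also have "\<dots> = ennreal C * (\<Sum>k. \<integral>\<^sup>+x. epowr (g k x) q * ennreal (W x) \<partial>M)" by simp
    also have "(\<Sum>k. \<integral>\<^sup>+x. epowr (g k x) q * ennreal (W x) \<partial>M) = (\<integral>\<^sup>+x. (\<Sum>k. epowr (g k x) q) * ennreal (W x) \<partial>M)"
      by (subst nn_integral_suminf[symmetric]) auto
    finally show ?thesis .
  qed
  \<comment> \<open>In the case \<open>q < p\<close> the sums are truncated so that the left-hand side is finite.\<close>
  consider (eq) "p = q" | (lt) "p < q" | (gt) "q < p" by linarith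
  then show ?thesis
  proof cases
    case eq
    obtain C where "C > 0" and C: "\<forall>w g. Ap q K w \<longrightarrow> g \<in> borel_measurable borel \<longrightarrow>
        (\<integral>\<^sup>+x. epowr (maxfun M g x) q * ennreal (w x) \<partial>M) \<le> ennreal C * (\<integral>\<^sup>+x. epowr (g x) q * ennreal (w x) \<partial>M)"
      using Muckenhoupt[OF q, of K] by blast
    show ?thesis
    proof (intro exI[of _ C] conjI allI impI)
      fix g :: "nat \<Rightarrow> 'a \<Rightarrow> ennreal" assume "\<forall>k. g k \<in> borel_measurable borel"
      then show "(\<integral>\<^sup>+x. epowr (\<Sum>k. epowr (maxfun M (g k) x) q) (p / q) * ennreal (w x) \<partial>M)
      \<le> ennreal C * (\<integral>\<^sup>+x. epowr (\<Sum>k. epowr (g k x) q) (p / q) * ennreal (w x) \<partial>M)"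
        using same[OF C, of w g] w eq q by simp
    qed (use \<open>C > 0\<close> in auto)
  next
    case lt
    obtain CU where CU: "CU > 0" "\<And>w h. Ap p K w \<Longrightarrow> h \<in> borel_measurable borel \<Longrightarrow>
        0 < (\<integral>\<^sup>+x. epowr (h x) p * ennreal (w x) \<partial>M) \<Longrightarrow> (\<integral>\<^sup>+x. epowr (h x) p * ennreal (w x) \<partial>M) < top \<Longrightarrow>
        (\<exists>U. A1 CU U \<and> (AE x in M. h x \<le> ennreal (U x)) \<and>
         (\<integral>\<^sup>+x. ennreal (U x powr p * w x) \<partial>M) \<le> ennreal CU * (\<integral>\<^sup>+x. epowr (h x) p * ennreal (w x) \<partial>M))"
      using A1_majorant[OF p, of K] by blast
    define K' where "K' = K * CU powr (q - p)"
    obtain C where "C > 0" and C: "\<forall>w g. Ap q K' w \<longrightarrow> g \<in> borel_measurable borel \<longrightarrow>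
        (\<integral>\<^sup>+x. epowr (maxfun M g x) q * ennreal (w x) \<partial>M) \<le> ennreal C * (\<integral>\<^sup>+x. epowr (g x) q * ennreal (w x) \<partial>M)"
      using Muckenhoupt[OF q, of K'] by blast
    define \<theta> where "\<theta> = p / q"
    have \<theta>: "0 < \<theta>" "\<theta> < 1" using p q lt by (auto simp: \<theta>_def)
    show ?thesis
    proof (intro exI[of _ "C powr \<theta> * CU powr (1 - \<theta>)"] conjI allI impI)
      show "C powr \<theta> * CU powr (1 - \<theta>) > 0" using \<open>C > 0\<close> CU by simp
      fix g :: "nat \<Rightarrow> 'a \<Rightarrow> ennreal" assume "\<forall>k. g k \<in> borel_measurable borel"
      then have [measurable]: "g k \<in> borel_measurable borel" for k by blast
      define A where "A = (\<lambda>x. \<Sum>k. epowr (maxfun M (g k) x) q)"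
      define B where "B = (\<lambda>x. \<Sum>k. epowr (g k x) q)"
      have [measurable]: "A \<in> borel_measurable borel" "B \<in> borel_measurable borel"
        unfolding A_def B_def by measurable
      define I where "I = (\<integral>\<^sup>+x. epowr (B x) \<theta> * ennreal (w x) \<partial>M)"
      have hI: "(\<integral>\<^sup>+x. epowr (epowr (B x) (1 / q)) p * ennreal (w x) \<partial>M) = I"
        by (simp add: I_def epowr_epowr \<theta>_def)
      have "(\<integral>\<^sup>+x. epowr (A x) \<theta> * ennreal (w x) \<partial>M) \<le> ennreal (C powr \<theta> * CU powr (1 - \<theta>)) * I"
      proof -
        consider (top) "I = top" | (zero) "I = 0" | (fin) "I \<noteq> 0" "I \<noteq> top"
          by auto
        then show ?thesis
        proof cases
          case top
          then show ?thesis using \<open>C > 0\<close> CU by (simp add: ennreal_mult_top)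
        next
          case zero
          have "AE x in M. epowr (B x) \<theta> * ennreal (w x) = 0"
            using zero unfolding I_def by (subst (asm) nn_integral_0_iff_AE) auto
          then have "AE x in M. \<forall>k. g k x \<le> 0"
          proof eventually_elim
            case (elim x)
            then have "B x = 0" using wpos[of x] by simp
            then show ?case by (simp add: B_def suminf_eq_zero_iff)
          qed
          then have "AE x in M. g k x \<le> 0" for k by eventually_elim simp
          then have "maxfun M (g k) x \<le> maxfun M (\<lambda>_. 0) x" for k x by (intro maxfun_mono_AE) auto
          moreover have "maxfun M (\<lambda>_. 0) x \<le> 0" for x unfolding maxfun_def by (intro SUP_least) auto
          ultimately have "maxfun M (g k) x = 0" for k x by (meson le_zero_eq order_trans)
          then show ?thesis by (simp add: A_def)
        next
          case fin
          then have fin: "0 < I" "I < top" by (auto simp: less_top zero_less_iff_neq_zero)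
          obtain U where U: "A1 CU U" and BU: "AE x in M. epowr (B x) (1 / q) \<le> ennreal (U x)"
            and UI: "(\<integral>\<^sup>+x. ennreal (U x powr p * w x) \<partial>M) \<le> ennreal CU * I"
            using CU(2)[OF w, of "\<lambda>x. epowr (B x) (1 / q)"] fin unfolding hI by auto
          note [measurable] = A1D(1)[OF U]
          note Upos = A1D(2)[OF U]
          define W where "W = (\<lambda>x. U x powr (p - q) * w x)"
          have W: "Ap q K' W" unfolding W_def K'_def by (rule Ap_factor_up[OF w U p lt])
          have [measurable]: "W \<in> borel_measurable borel" by (rule ApD(1)[OF W])
          have Wpos: "W x > 0" for x by (rule ApD(2)[OF W])
          have split: "w x = W x powr \<theta> * (U x powr p * w x) powr (1 - \<theta>)" for x
          proof -
            have "(p - q) * \<theta> + p * (1 - \<theta>) = 0" using q by (simp add: \<theta>_def field_simps)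
            then have "U x powr ((p - q) * \<theta>) * U x powr (p * (1 - \<theta>)) = 1"
              using Upos[of x] by (simp flip: powr_add)
            moreover have "w x powr \<theta> * w x powr (1 - \<theta>) = w x"
              using wpos[of x] by (simp flip: powr_add)
            moreover have "W x powr \<theta> * (U x powr p * w x) powr (1 - \<theta>)
              = (U x powr ((p - q) * \<theta>) * U x powr (p * (1 - \<theta>))) * (w x powr \<theta> * w x powr (1 - \<theta>))"
              using Upos[of x] wpos[of x] by (simp add: W_def powr_mult powr_powr mult_ac)
            ultimately show ?thesis by simp
          qed
          have "(\<integral>\<^sup>+x. epowr (A x) \<theta> * ennreal (w x) \<partial>M)
             = (\<integral>\<^sup>+x. epowr (A x * ennreal (W x)) \<theta> * epowr (ennreal (U x powr p * w x)) (1 - \<theta>) \<partial>M)"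
          proof (intro nn_integral_cong)
            fix x
            have "ennreal (w x) = epowr (ennreal (W x)) \<theta> * epowr (ennreal (U x powr p * w x)) (1 - \<theta>)"
            proof -
              have "epowr (ennreal (W x)) \<theta> = ennreal (W x powr \<theta>)"
                using Wpos[of x] by (intro epowr_ennreal) auto
              moreover have "epowr (ennreal (U x powr p * w x)) (1 - \<theta>) = ennreal ((U x powr p * w x) powr (1 - \<theta>))"
                using wpos[of x] by (intro epowr_ennreal) auto
              ultimately show ?thesis by (subst split) (simp only: ennreal_mult powr_ge_zero)
            qed
            then show "epowr (A x) \<theta> * ennreal (w x) = epowr (A x * ennreal (W x)) \<theta> * epowr (ennreal (U x powr p * w x)) (1 - \<theta>)"
              by (simp add: epowr_mult mult.assoc)
          qed
          also have "\<dots> \<le> epowr (\<integral>\<^sup>+x. A x * ennreal (W x) \<partial>M) \<theta> * epowr (\<integral>\<^sup>+x. ennreal (U x powr p * w x) \<partial>M) (1 - \<theta>)"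
            by (rule nn_integral_Hoelder) (use \<theta> in auto)
          also have "\<dots> \<le> epowr (ennreal C * I) \<theta> * epowr (ennreal CU * I) (1 - \<theta>)"
          proof (intro mult_mono epowr_mono UI)
            have "(\<integral>\<^sup>+x. A x * ennreal (W x) \<partial>M) \<le> ennreal C * (\<integral>\<^sup>+x. B x * ennreal (W x) \<partial>M)"
              unfolding A_def B_def by (rule same[OF C W]) auto
            also have "(\<integral>\<^sup>+x. B x * ennreal (W x) \<partial>M) \<le> I"
              unfolding I_def
            proof (intro nn_integral_mono_AE, use BU in eventually_elim)
              case (elim x)
              have "epowr (B x) (1 - \<theta>) = epowr (epowr (B x) (1 / q)) (q - p)"
                using q by (simp add: epowr_epowr \<theta>_def diff_divide_distrib)
              also have "\<dots> \<le> epowr (ennreal (U x)) (q - p)" using elim lt by (intro epowr_mono) auto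
              finally have "epowr (B x) (1 - \<theta>) * ennreal (U x powr (p - q)) \<le> ennreal (U x powr (q - p)) * ennreal (U x powr (p - q))"
                using Upos[of x] by (intro mult_right_mono) (auto simp: epowr_ennreal less_imp_le)
              also have "\<dots> = 1" using Upos[of x] by (simp flip: ennreal_mult powr_add)
              finally have 1: "epowr (B x) (1 - \<theta>) * ennreal (U x powr (p - q)) \<le> 1" .
              have "epowr (B x) \<theta> * epowr (B x) (1 - \<theta>) = B x"
                by (simp flip: epowr_add)
              then have "B x * ennreal (W x) = (epowr (B x) \<theta> * epowr (B x) (1 - \<theta>)) * ennreal (W x)" by simp
              also have "\<dots> = epowr (B x) \<theta> * ennreal (w x) * (epowr (B x) (1 - \<theta>) * ennreal (U x powr (p - q)))"
                using wpos[of x] by (simp add: W_def ennreal_mult mult_ac)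
              also have "\<dots> \<le> epowr (B x) \<theta> * ennreal (w x) * 1" by (intro mult_left_mono 1) auto
              finally show ?case by simp
            qed
            finally show "(\<integral>\<^sup>+x. A x * ennreal (W x) \<partial>M) \<le> ennreal C * I" by (simp add: mult_left_mono)
          qed (use \<theta> in auto)
          also have "\<dots> = ennreal (C powr \<theta> * CU powr (1 - \<theta>)) * (epowr I \<theta> * epowr I (1 - \<theta>))"
            using \<open>C > 0\<close> CU(1) by (simp add: epowr_mult epowr_ennreal ennreal_mult mult_ac)
          also have "epowr I \<theta> * epowr I (1 - \<theta>) = I" by (simp flip: epowr_add)
          finally show ?thesis .
        qed
      qed
      then show "(\<integral>\<^sup>+x. epowr (\<Sum>k. epowr (maxfun M (g k) x) q) (p / q) * ennreal (w x) \<partial>M)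
         \<le> ennreal (C powr \<theta> * CU powr (1 - \<theta>)) * (\<integral>\<^sup>+x. epowr (\<Sum>k. epowr (g k x) q) (p / q) * ennreal (w x) \<partial>M)"
        by (simp add: A_def B_def I_def \<theta>_def)
    qed
  next
    case gt
    define p' where "p' = p / (p - 1)"
    define \<sigma> where "\<sigma> = (\<lambda>x. w x powr (- 1 / (p - 1)))"
    have p': "p' > 1" using p by (simp add: p'_def field_simps)
    have \<sigma>: "Ap p' (K powr (1 / (p - 1))) \<sigma>" unfolding p'_def \<sigma>_def by (rule Ap_dual[OF w p])
    note [measurable] = ApD(1)[OF \<sigma>]
    obtain CU where CU: "CU > 0" "\<And>w h. Ap p' (K powr (1 / (p - 1))) w \<Longrightarrow> h \<in> borel_measurable borel \<Longrightarrow>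
        0 < (\<integral>\<^sup>+x. epowr (h x) p' * ennreal (w x) \<partial>M) \<Longrightarrow> (\<integral>\<^sup>+x. epowr (h x) p' * ennreal (w x) \<partial>M) < top \<Longrightarrow>
        (\<exists>U. A1 CU U \<and> (AE x in M. h x \<le> ennreal (U x)) \<and>
         (\<integral>\<^sup>+x. ennreal (U x powr p' * w x) \<partial>M) \<le> ennreal CU * (\<integral>\<^sup>+x. epowr (h x) p' * ennreal (w x) \<partial>M))"
      using A1_majorant[OF p', of "K powr (1 / (p - 1))"] by blast
    define \<theta> where "\<theta> = (p - q) / (p - 1)"
    have \<theta>: "0 < \<theta>" "\<theta> < 1" "1 - \<theta> = (q - 1) / (p - 1)" using p q gt by (auto simp: \<theta>_def field_simps)
    define K' where "K' = CU powr \<theta> * K powr (1 - \<theta>)"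
    obtain C where "C > 0" and C: "\<forall>w g. Ap q K' w \<longrightarrow> g \<in> borel_measurable borel \<longrightarrow>
        (\<integral>\<^sup>+x. epowr (maxfun M g x) q * ennreal (w x) \<partial>M) \<le> ennreal C * (\<integral>\<^sup>+x. epowr (g x) q * ennreal (w x) \<partial>M)"
      using Muckenhoupt[OF q, of K'] by blast
    obtain Cp where "Cp > 0" and Cp: "\<forall>w g. Ap p K w \<longrightarrow> g \<in> borel_measurable borel \<longrightarrow>
        (\<integral>\<^sup>+x. epowr (maxfun M g x) p * ennreal (w x) \<partial>M) \<le> ennreal Cp * (\<integral>\<^sup>+x. epowr (g x) p * ennreal (w x) \<partial>M)"
      using Muckenhoupt[OF p, of K] by blast
    define \<tau> where "\<tau> = q / p"
    have \<tau>: "0 < \<tau>" "\<tau> < 1" "1 - \<tau> = (p - q) / p" using p q gt by (auto simp: \<tau>_def field_simps)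
    define C' where "C' = (C * CU powr (1 - \<tau>)) powr (1 / \<tau>)"
    show ?thesis
    proof (intro exI[of _ C'] conjI allI impI)
      show "C' > 0" using \<open>C > 0\<close> CU by (simp add: C'_def)
      fix g :: "nat \<Rightarrow> 'a \<Rightarrow> ennreal" assume "\<forall>k. g k \<in> borel_measurable borel"
      then have [measurable]: "g k \<in> borel_measurable borel" for k by blast
      define A where "A = (\<lambda>n x. \<Sum>k<n. epowr (maxfun M (g k) x) q)"
      define B where "B = (\<lambda>x. \<Sum>k. epowr (g k x) q)"
      have [measurable]: "A n \<in> borel_measurable borel" "B \<in> borel_measurable borel" for n
        unfolding A_def B_def by measurable
      define I where "I = (\<integral>\<^sup>+x. epowr (B x) (p / q) * ennreal (w x) \<partial>M)"
      have A_le: "(\<integral>\<^sup>+x. epowr (A n x) (p / q) * ennreal (w x) \<partial>M) \<le> ennreal C' * I" for n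
      proof (cases "I = top")
        case True then show ?thesis using \<open>C' > 0\<close> by (simp add: ennreal_mult_top)
      next
        case I_fin: False
        define J where "J = (\<integral>\<^sup>+x. epowr (A n x) (p / q) * ennreal (w x) \<partial>M)"
        have "J < top"
        proof -
          have "J \<le> (\<integral>\<^sup>+x. (\<Sum>k<n. ennreal (real n powr (p / q)) * (epowr (maxfun M (g k) x) p * ennreal (w x))) \<partial>M)"
            unfolding J_def
          proof (intro nn_integral_mono)
            fix x
            have "epowr (A n x) (p / q) \<le> ennreal (real (card {..<n}) powr (p / q)) * (\<Sum>k<n. epowr (epowr (maxfun M (g k) x) q) (p / q))"
              unfolding A_def by (rule epowr_sum_le) (use p q in auto)
            then have "epowr (A n x) (p / q) * ennreal (w x) \<le> ennreal (real (card {..<n}) powr (p / q)) * (\<Sum>k<n. epowr (epowr (maxfun M (g k) x) q) (p / q)) * ennreal (w x)"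
              by (intro mult_right_mono) auto
            then show "epowr (A n x) (p / q) * ennreal (w x) \<le> (\<Sum>k<n. ennreal (real n powr (p / q)) * (epowr (maxfun M (g k) x) p * ennreal (w x)))"
              using q by (simp add: epowr_epowr sum_distrib_left sum_distrib_right mult.assoc)
          qed
          also have "\<dots> = (\<Sum>k<n. ennreal (real n powr (p / q)) * (\<integral>\<^sup>+x. epowr (maxfun M (g k) x) p * ennreal (w x) \<partial>M))"
            by (subst nn_integral_sum) (auto simp: nn_integral_cmult)
          also have "\<dots> \<le> (\<Sum>k<n. ennreal (real n powr (p / q)) * (ennreal Cp * I))"
          proof (intro sum_mono mult_left_mono)
            fix k
            have "(\<integral>\<^sup>+x. epowr (maxfun M (g k) x) p * ennreal (w x) \<partial>M) \<le> ennreal Cp * (\<integral>\<^sup>+x. epowr (g k x) p * ennreal (w x) \<partial>M)"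
              using Cp w by auto
            also have "(\<integral>\<^sup>+x. epowr (g k x) p * ennreal (w x) \<partial>M) \<le> I"
              unfolding I_def
            proof (intro nn_integral_mono mult_right_mono)
              fix x
              have "epowr (g k x) q \<le> B x"
                using sum_le_suminf[of "\<lambda>k. epowr (g k x) q" "{k}"] by (auto simp: B_def)
              then have "epowr (epowr (g k x) q) (p / q) \<le> epowr (B x) (p / q)" using p q by (intro epowr_mono) auto
              then show "epowr (g k x) p \<le> epowr (B x) (p / q)" using q by (simp add: epowr_epowr)
            qed simp
            finally show "(\<integral>\<^sup>+x. epowr (maxfun M (g k) x) p * ennreal (w x) \<partial>M) \<le> ennreal Cp * I"
              by (simp add: mult_left_mono)
          qed simp
          also have "\<dots> < top" using I_fin by (simp add: ennreal_mult_less_top less_top of_nat_less_top)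
          finally show ?thesis .
        qed
        show ?thesis
        proof (cases "J = 0")
          case False
          then have "J > 0" by (simp add: zero_less_iff_neq_zero)
          define h where "h = (\<lambda>x. epowr (A n x) ((p - 1) / q) * ennreal (w x))"
          have [measurable]: "h \<in> borel_measurable borel" unfolding h_def by measurable
          have hJ: "(\<integral>\<^sup>+x. epowr (h x) p' * ennreal (\<sigma> x) \<partial>M) = J"
            unfolding J_def
          proof (intro nn_integral_cong)
            fix x
            have "p' = 1 + 1 / (p - 1)" using p by (simp add: p'_def divide_simps)
            then have "p' + - 1 / (p - 1) = 1" by simp
            have "(p - 1) / q * p' = p / q" using p q by (simp add: p'_def divide_simps)
            then have "w x powr p' * \<sigma> x = w x"
              using wpos[of x] \<open>p' + - 1 / (p - 1) = 1\<close> by (simp only: \<sigma>_def powr_add[symmetric]) simp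
            then have "ennreal (w x powr p') * ennreal (\<sigma> x) = ennreal (w x)"
              by (simp flip: ennreal_mult add: \<sigma>_def)
            then show "epowr (h x) p' * ennreal (\<sigma> x) = epowr (A n x) (p / q) * ennreal (w x)"
              using wpos[of x] \<open>(p - 1) / q * p' = p / q\<close>
              by (simp only: h_def epowr_mult epowr_epowr epowr_ennreal less_imp_le mult.assoc)
          qed
          obtain U where U: "A1 CU U" and hU: "AE x in M. h x \<le> ennreal (U x)"
            and UJ: "(\<integral>\<^sup>+x. ennreal (U x powr p' * \<sigma> x) \<partial>M) \<le> ennreal CU * J"
            using CU(2)[OF \<sigma>, of h] \<open>J > 0\<close> \<open>J < top\<close> unfolding hJ by auto
          note [measurable] = A1D(1)[OF U]
          note Upos = A1D(2)[OF U]
          define W where "W = (\<lambda>x. U x powr \<theta> * w x powr (1 - \<theta>))"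
          have W: "Ap q K' W" unfolding W_def K'_def \<theta>_def by (rule Ap_factor_down[OF w U q gt])
          have [measurable]: "W \<in> borel_measurable borel" by (rule ApD(1)[OF W])
          have split: "W x = w x powr \<tau> * (U x powr p' * \<sigma> x) powr (1 - \<tau>)" for x
          proof -
            have e: "p' * (1 - \<tau>) = \<theta>" "\<tau> + (- 1 / (p - 1)) * (1 - \<tau>) = 1 - \<theta>"
              unfolding \<theta>(3) \<tau>(3) using p q gt by (auto simp: p'_def \<theta>_def \<tau>_def field_simps)
            have "w x powr \<tau> * (U x powr p' * \<sigma> x) powr (1 - \<tau>)
               = U x powr (p' * (1 - \<tau>)) * (w x powr \<tau> * w x powr ((- 1 / (p - 1)) * (1 - \<tau>)))"
              using Upos[of x] wpos[of x] by (simp only: \<sigma>_def powr_mult powr_powr mult_ac)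
            then show ?thesis unfolding W_def by (simp only: e powr_add[symmetric])
          qed
          have "J \<le> (\<integral>\<^sup>+x. A n x * ennreal (W x) \<partial>M)"
            unfolding J_def
          proof (intro nn_integral_mono_AE, use hU in eventually_elim)
            case (elim x)
            have e: "p / q = 1 + (p - 1) / q * \<theta>" using p q by (simp add: \<theta>_def field_simps)
            have "epowr (A n x) (p / q) * ennreal (w x)
               = A n x * (epowr (A n x) ((p - 1) / q * \<theta>) * ennreal (w x powr \<theta>) * ennreal (w x powr (1 - \<theta>)))"
              unfolding e epowr_add using wpos[of x] by (simp add: mult.assoc flip: ennreal_mult powr_add)
            also have "epowr (A n x) ((p - 1) / q * \<theta>) * ennreal (w x powr \<theta>) = epowr (h x) \<theta>"
              using wpos[of x] by (simp add: h_def epowr_mult epowr_epowr epowr_ennreal less_imp_le)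
            also have "A n x * (epowr (h x) \<theta> * ennreal (w x powr (1 - \<theta>)))
               \<le> A n x * (epowr (ennreal (U x)) \<theta> * ennreal (w x powr (1 - \<theta>)))"
              using elim \<theta> by (intro mult_left_mono mult_right_mono epowr_mono) auto
            also have "\<dots> = A n x * ennreal (W x)"
              using Upos[of x] by (simp add: W_def epowr_ennreal less_imp_le ennreal_mult)
            finally show ?case .
          qed
          also have "\<dots> = (\<Sum>k<n. \<integral>\<^sup>+x. epowr (maxfun M (g k) x) q * ennreal (W x) \<partial>M)"
            unfolding A_def by (subst nn_integral_sum[symmetric]) (auto simp: sum_distrib_right)
          also have "\<dots> \<le> (\<Sum>k<n. ennreal C * (\<integral>\<^sup>+x. epowr (g k x) q * ennreal (W x) \<partial>M))"
            using C W by (intro sum_mono) auto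
          also have "\<dots> = ennreal C * (\<integral>\<^sup>+x. (\<Sum>k<n. epowr (g k x) q) * ennreal (W x) \<partial>M)"
            by (simp add: sum_distrib_left sum_distrib_right nn_integral_sum)
          also have "\<dots> \<le> ennreal C * (\<integral>\<^sup>+x. B x * ennreal (W x) \<partial>M)"
            unfolding B_def by (intro mult_left_mono nn_integral_mono mult_right_mono sum_le_suminf) auto
          also have "(\<integral>\<^sup>+x. B x * ennreal (W x) \<partial>M)
             = (\<integral>\<^sup>+x. epowr (epowr (B x) (p / q) * ennreal (w x)) \<tau> * epowr (ennreal (U x powr p' * \<sigma> x)) (1 - \<tau>) \<partial>M)"
          proof (intro nn_integral_cong)
            fix x
            have "epowr (epowr (B x) (p / q)) \<tau> = B x" using p q by (simp add: epowr_epowr \<tau>_def)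
            moreover have "ennreal (W x) = ennreal (w x powr \<tau>) * ennreal ((U x powr p' * \<sigma> x) powr (1 - \<tau>))"
              by (subst split, subst ennreal_mult) auto
            show "B x * ennreal (W x) = epowr (epowr (B x) (p / q) * ennreal (w x)) \<tau> * epowr (ennreal (U x powr p' * \<sigma> x)) (1 - \<tau>)"
            proof -
              have "epowr (ennreal (U x powr p' * \<sigma> x)) (1 - \<tau>) = ennreal ((U x powr p' * \<sigma> x) powr (1 - \<tau>))"
                using ApD(2)[OF \<sigma>, of x] by (intro epowr_ennreal) auto
              moreover have "epowr (ennreal (w x)) \<tau> = ennreal (w x powr \<tau>)"
                using wpos[of x] by (intro epowr_ennreal) auto
              moreover note \<open>epowr (epowr (B x) (p / q)) \<tau> = B x\<close>
                \<open>ennreal (W x) = ennreal (w x powr \<tau>) * ennreal ((U x powr p' * \<sigma> x) powr (1 - \<tau>))\<close>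
              ultimately show ?thesis by (simp only: epowr_mult mult.assoc)
            qed
          qed
          also have "\<dots> \<le> epowr I \<tau> * epowr (\<integral>\<^sup>+x. ennreal (U x powr p' * \<sigma> x) \<partial>M) (1 - \<tau>)"
            unfolding I_def by (rule nn_integral_Hoelder) (use \<tau> in auto)
          also have "\<dots> \<le> epowr I \<tau> * epowr (ennreal CU * J) (1 - \<tau>)"
            using \<tau> by (intro mult_left_mono epowr_mono UJ) auto
          finally have JJ: "J \<le> ennreal C * (epowr I \<tau> * epowr (ennreal CU * J) (1 - \<tau>))"
            by (simp add: mult_left_mono)
          \<comment> \<open>The truncated left-hand side is finite and can be absorbed.\<close>
          obtain j where j: "J = ennreal j" "j > 0" using \<open>J > 0\<close> \<open>J < top\<close> by (cases J) auto
          obtain i where i: "I = ennreal i" "i \<ge> 0" using I_fin by (cases I) auto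
          have "j \<le> C * (i powr \<tau> * (CU * j) powr (1 - \<tau>))"
            using JJ i j CU(1) \<open>C > 0\<close> by (simp add: epowr_mult epowr_ennreal flip: ennreal_mult)
          also have "\<dots> = C * CU powr (1 - \<tau>) * i powr \<tau> * j powr (1 - \<tau>)"
            using j CU(1) by (simp add: powr_mult)
          finally have "j powr \<tau> * j powr (1 - \<tau>) \<le> C * CU powr (1 - \<tau>) * i powr \<tau> * j powr (1 - \<tau>)"
            using j by (simp flip: powr_add)
          then have "j powr \<tau> \<le> C * CU powr (1 - \<tau>) * i powr \<tau>" using j by simp
          then have "(j powr \<tau>) powr (1 / \<tau>) \<le> (C * CU powr (1 - \<tau>) * i powr \<tau>) powr (1 / \<tau>)"
            using \<tau> by (intro powr_mono2) auto
          then have "j \<le> C' * i" using \<tau> j i \<open>C > 0\<close> by (simp add: powr_mult powr_powr C'_def)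
          then show ?thesis unfolding J_def[symmetric] i(1) j(1) using i \<open>C' > 0\<close>
            by (simp add: ennreal_leI flip: ennreal_mult)
        qed (simp flip: J_def)
      qed
      have "(\<integral>\<^sup>+x. epowr (\<Sum>k. epowr (maxfun M (g k) x) q) (p / q) * ennreal (w x) \<partial>M)
        = (\<integral>\<^sup>+x. (SUP n. epowr (A n x) (p / q) * ennreal (w x)) \<partial>M)"
        using p q by (intro nn_integral_cong) (simp add: suminf_eq_SUP epowr_SUP A_def SUP_mult_right_ennreal)
      also have "\<dots> = (SUP n. \<integral>\<^sup>+x. epowr (A n x) (p / q) * ennreal (w x) \<partial>M)"
      proof (rule nn_integral_monotone_convergence_SUP)
        show "incseq (\<lambda>n x. epowr (A n x) (p / q) * ennreal (w x))"
          using p q by (intro monoI le_funI mult_right_mono epowr_mono) (auto simp: A_def intro!: sum_mono2)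
      qed simp
      also have "\<dots> \<le> ennreal C' * I" by (intro SUP_least A_le)
      finally show "(\<integral>\<^sup>+x. epowr (\<Sum>k. epowr (maxfun M (g k) x) q) (p / q) * ennreal (w x) \<partial>M)
         \<le> ennreal C' * (\<integral>\<^sup>+x. epowr (\<Sum>k. epowr (g k x) q) (p / q) * ennreal (w x) \<partial>M)"
        by (simp add: B_def I_def)
    qed
  qed
qed

end

section \<open>Homogeneous groups\<close>

lemma polynomial_function_vec:
  fixes f :: "'b::real_normed_vector \<Rightarrow> real ^ 'n"
  assumes "\<And>k. real_polynomial_function (\<lambda>x. f x $ k)"
  shows "polynomial_function f"
  unfolding polynomial_function_iff_Basis_inner
  using assms by (auto simp: Basis_vec_def inner_axis)

lemma polynomial_function_nth:
  assumes "polynomial_function f"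
  shows "real_polynomial_function (\<lambda>x. f x $ k)"
  using assms unfolding polynomial_function_def
  by (auto simp: o_def dest: spec[of _ "\<lambda>v. v $ k"] intro: bounded_linear_vec_nth)

lemma polynomial_growth:
  assumes "real_polynomial_function p"
  shows "\<exists>C>0. \<exists>m::nat. \<forall>x. \<bar>p x\<bar> \<le> C * (1 + norm x) ^ m"
  using assms
proof (induction rule: real_polynomial_function.induct)
  case (linear f)
  then obtain K where K: "\<And>x. norm (f x) \<le> norm x * K" and "K > 0" using bounded_linear.pos_bounded by blast
  have "\<bar>f x\<bar> \<le> K * (1 + norm x) ^ 1" for x
    using K[of x] \<open>K > 0\<close> by (simp add: distrib_left mult.commute)
  then show ?case using \<open>K > 0\<close> by blast
next
  case (const c)
  show ?case by (intro exI[of _ "\<bar>c\<bar> + 1"] conjI exI[of _ "0::nat"]) auto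
next
  case (add f g)
  from \<open>\<exists>C>0. \<exists>m. \<forall>x. \<bar>f x\<bar> \<le> C * (1 + norm x) ^ m\<close> obtain C m
    where "C > 0" "\<And>x. \<bar>f x\<bar> \<le> C * (1 + norm x) ^ m" by blast
  moreover from \<open>\<exists>C>0. \<exists>m. \<forall>x. \<bar>g x\<bar> \<le> C * (1 + norm x) ^ m\<close> obtain D n
    where "D > 0" "\<And>x. \<bar>g x\<bar> \<le> D * (1 + norm x) ^ n" by blast
  ultimately have *: "C > 0" "D > 0" "\<And>x. \<bar>f x\<bar> \<le> C * (1 + norm x) ^ m" "\<And>x. \<bar>g x\<bar> \<le> D * (1 + norm x) ^ n"
    by auto
  have "\<bar>f x + g x\<bar> \<le> (C + D) * (1 + norm x) ^ (m + n)" for x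
  proof -
    have "(1 + norm x) ^ m \<le> (1 + norm x) ^ (m + n)" "(1 + norm x) ^ n \<le> (1 + norm x) ^ (m + n)"
      by (auto intro!: power_increasing)
    then have "C * (1 + norm x) ^ m + D * (1 + norm x) ^ n \<le> C * (1 + norm x) ^ (m + n) + D * (1 + norm x) ^ (m + n)"
      using *(1,2) by (intro add_mono mult_left_mono) auto
    then show ?thesis using *(3,4)[of x] by (simp add: distrib_right)
  qed
  moreover have "C + D > 0" using *(1,2) by simp
  ultimately show ?case by blast
next
  case (mult f g)
  from \<open>\<exists>C>0. \<exists>m. \<forall>x. \<bar>f x\<bar> \<le> C * (1 + norm x) ^ m\<close> obtain C m
    where "C > 0" "\<And>x. \<bar>f x\<bar> \<le> C * (1 + norm x) ^ m" by blast
  moreover from \<open>\<exists>C>0. \<exists>m. \<forall>x. \<bar>g x\<bar> \<le> C * (1 + norm x) ^ m\<close> obtain D n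
    where "D > 0" "\<And>x. \<bar>g x\<bar> \<le> D * (1 + norm x) ^ n" by blast
  ultimately have *: "C > 0" "D > 0" "\<And>x. \<bar>f x\<bar> \<le> C * (1 + norm x) ^ m" "\<And>x. \<bar>g x\<bar> \<le> D * (1 + norm x) ^ n"
    by auto
  have "\<bar>f x * g x\<bar> \<le> (C * D) * (1 + norm x) ^ (m + n)" for x
  proof -
    have "\<bar>f x\<bar> * \<bar>g x\<bar> \<le> (C * (1 + norm x) ^ m) * (D * (1 + norm x) ^ n)"
      using *(1,2) by (intro mult_mono *(3,4)) auto
    then show ?thesis by (simp add: abs_mult power_add mult_ac)
  qed
  moreover have "C * D > 0" using *(1,2) by simp
  ultimately show ?case by blast
qed

lemma polynomial_growth_vec:
  fixes f :: "'b::real_normed_vector \<Rightarrow> real ^ 'n"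
  assumes "polynomial_function f"
  shows "\<exists>C>0. \<exists>m::nat. \<forall>x. norm (f x) \<le> C * (1 + norm x) ^ m"
proof -
  have "\<exists>C m. C > 0 \<and> (\<forall>x. \<bar>f x $ k\<bar> \<le> C * (1 + norm x) ^ m)" for k
    using polynomial_growth[OF polynomial_function_nth[OF assms, of k]] by blast
  then obtain C m where Cm: "\<And>k. C k > 0" "\<And>k x. \<bar>f x $ k\<bar> \<le> C k * (1 + norm x) ^ m k" by metis
  define n where "n = (\<Sum>k\<in>UNIV. m k)"
  have "norm (f x) \<le> ((\<Sum>k\<in>UNIV. C k) + 1) * (1 + norm x) ^ n" for x
  proof -
    have "norm (f x) \<le> (\<Sum>k\<in>UNIV. \<bar>f x $ k\<bar>)" by (rule norm_le_l1_cart)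
    also have "\<dots> \<le> (\<Sum>k\<in>UNIV. C k * (1 + norm x) ^ n)"
    proof (intro sum_mono)
      fix k :: 'n
      have "m k \<le> n" unfolding n_def by (intro member_le_sum) auto
      then have "C k * (1 + norm x) ^ m k \<le> C k * (1 + norm x) ^ n"
        using Cm(1)[of k] by (intro mult_left_mono power_increasing) auto
      then show "\<bar>f x $ k\<bar> \<le> C k * (1 + norm x) ^ n" using Cm(2)[of x k] by linarith
    qed
    also have "\<dots> \<le> ((\<Sum>k\<in>UNIV. C k) + 1) * (1 + norm x) ^ n"
      by (simp add: sum_distrib_right distrib_right)
    finally show ?thesis .
  qed
  moreover have "(\<Sum>k\<in>UNIV. C k) + 1 > 0" using Cm(1) by (intro add_nonneg_pos sum_nonneg) (auto simp: less_imp_le)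
  ultimately show ?thesis by blast
qed

lemma polynomial_directional_derivative:
  fixes v :: "'b::real_normed_vector"
  assumes "real_polynomial_function p"
  shows "\<exists>p'. real_polynomial_function p' \<and> (\<forall>x. ((\<lambda>t. p (x + t *\<^sub>R v)) has_vector_derivative p' x) (at 0))"
  using assms
proof (induction rule: real_polynomial_function.induct)
  case (linear f)
  interpret bounded_linear f by (rule linear)
  have "((\<lambda>t. f (x + t *\<^sub>R v)) has_vector_derivative f v) (at 0)" for x
    by (simp add: add scaleR) (auto intro!: derivative_eq_intros)
  then show ?case by blast
next
  case (const c)
  then show ?case by (auto intro!: exI[of _ "\<lambda>_. 0"] real_polynomial_function.intros(2))
next
  case (add f g)
  from add(3) obtain f' where "real_polynomial_function f'" "\<And>x. ((\<lambda>t. f (x + t *\<^sub>R v)) has_vector_derivative f' x) (at 0)" by blast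
  moreover from add(4) obtain g' where "real_polynomial_function g'" "\<And>x. ((\<lambda>t. g (x + t *\<^sub>R v)) has_vector_derivative g' x) (at 0)" by blast
  ultimately show ?case
    by (intro exI[of _ "\<lambda>x. f' x + g' x"]) (auto intro!: has_vector_derivative_add)
next
  case (mult f g)
  from mult(3) obtain f' where 1: "real_polynomial_function f'" "\<And>x. ((\<lambda>t. f (x + t *\<^sub>R v)) has_vector_derivative f' x) (at 0)" by blast
  from mult(4) obtain g' where 2: "real_polynomial_function g'" "\<And>x. ((\<lambda>t. g (x + t *\<^sub>R v)) has_vector_derivative g' x) (at 0)" by blast
  note * = 1 2
  show ?case
  proof (intro exI[of _ "\<lambda>x. f x * g' x + f' x * g x"] conjI allI)
    show "real_polynomial_function (\<lambda>x. f x * g' x + f' x * g x)" using mult * by auto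
    fix x show "((\<lambda>t. f (x + t *\<^sub>R v) * g (x + t *\<^sub>R v)) has_vector_derivative f x * g' x + f' x * g x) (at 0)"
      using has_vector_derivative_mult[OF *(2)[of x] *(4)[of x]] by simp
  qed
qed

context homogeneous_group begin

lemma grp: "group (group_of mul)"
  using nilpotent by (simp add: nilpotent_group_def)

lemma mul_assoc: "mul (mul x y) z = mul x (mul y z)"
  using monoid.m_assoc[OF group.is_monoid[OF grp], of x y z] by (simp add: group_of_def)

lemma mul_0_left [simp]: "mul 0 x = x"
  using monoid.l_one[OF group.is_monoid[OF grp], of x] by (simp add: group_of_def)

lemma mul_0_right [simp]: "mul x 0 = x"
  using monoid.r_one[OF group.is_monoid[OF grp], of x] by (simp add: group_of_def)

lemma mul_minus_left [simp]: "mul (- x) x = 0"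
  using group.l_inv[OF grp, of x] unfolding inv_eq by (simp add: group_of_def)

lemma mul_minus_right [simp]: "mul x (- x) = 0"
  using group.r_inv[OF grp, of x] unfolding inv_eq by (simp add: group_of_def)

lemma mul_minus_cancel [simp]: "mul (- x) (mul x y) = y" "mul x (mul (- x) y) = y"
  by (simp_all only: mul_assoc[symmetric] mul_minus_left mul_minus_right mul_0_left)

lemma minus_mul: "- mul x y = mul (- y) (- x)"
  using group.inv_mult_group[OF grp, of x y] unfolding inv_eq by (simp add: group_of_def)

lemma a_ge_1: "a i \<ge> 1"
proof -
  have "a (Min UNIV) \<le> a i" by (rule monoD[OF a_mono]) simp
  then show ?thesis by (simp add: a_first)
qed

lemma hom_dim_ge_1: "hom_dim a \<ge> 1"
proof -
  have "0 \<le> a i" for i using a_ge_1[of i] by linarith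
  then have "a undefined \<le> (\<Sum>i\<in>UNIV. a i)" by (intro member_le_sum) auto
  then show ?thesis using a_ge_1[of undefined] by (simp add: hom_dim_def)
qed

lemma mul_polynomial:
  assumes f: "polynomial_function f" and g: "polynomial_function g"
  shows "polynomial_function (\<lambda>u. mul (f u) (g u))"
proof (rule polynomial_function_vec)
  fix k
  obtain c where c: "\<And>k x y. k \<noteq> Min UNIV \<Longrightarrow> mul x y $ k =
      x $ k + y $ k + (\<Sum>(I, J)\<in>admissible a k. c k I J * monomial I x * monomial J y)"
    using mul_poly by blast
  note [intro] = polynomial_function_nth[OF f] polynomial_function_nth[OF g]
  show "real_polynomial_function (\<lambda>u. mul (f u) (g u) $ k)"
  proof (cases "k = Min UNIV")
    case True
    then show ?thesis by (auto simp: mul_first)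
  next
    case False
    have mon: "real_polynomial_function (\<lambda>u. monomial I (h u))" if "polynomial_function h" for I h
      unfolding monomial_def using polynomial_function_nth[OF that]
      by (intro real_polynomial_function_prod real_polynomial_function_power) auto
    show ?thesis
    proof (cases "finite (admissible a k)")
      case True
      then have "real_polynomial_function (\<lambda>u. \<Sum>p\<in>admissible a k. c k (fst p) (snd p) * monomial (fst p) (f u) * monomial (snd p) (g u))"
        by (intro real_polynomial_function_sum real_polynomial_function.intros(2,4) mon f g)
      then show ?thesis
        unfolding c[OF False] split_beta
        by (intro real_polynomial_function.intros(3) polynomial_function_nth f g)
    next
      case F: False
      then show ?thesis by (auto simp: c[OF False])
    qed
  qed
qed

lemma continuous_mul: "continuous_on UNIV (\<lambda>z. mul (fst z) (snd z))"
  by (intro continuous_on_polymonial_function mul_polynomial polynomial_function_bounded_linear)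
     (auto intro: bounded_linear_fst bounded_linear_snd)

lemma continuous_on_mul [continuous_intros]:
  assumes "continuous_on S f" "continuous_on S g"
  shows "continuous_on S (\<lambda>x. mul (f x) (g x))"
  using continuous_on_compose2[OF continuous_mul continuous_on_Pair[OF assms]] by auto

lemma borel_measurable_mul [measurable (raw)]:
  assumes "f \<in> borel_measurable M" "g \<in> borel_measurable M"
  shows "(\<lambda>x. mul (f x) (g x)) \<in> borel_measurable M"
  using borel_measurable_continuous_on[OF continuous_mul borel_measurable_Pair[OF assms]] by simp

lemma nn_integral_mul_left:
  assumes [measurable]: "f \<in> borel_measurable borel"
  shows "(\<integral>\<^sup>+y. f (mul x y) \<partial>lborel) = (\<integral>\<^sup>+y. f y \<partial>lborel)"
  using nn_integral_distr[of "\<lambda>y. mul x y" lborel lborel f] by (simp add: haar_left)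

lemma nn_integral_mul_right:
  assumes [measurable]: "f \<in> borel_measurable borel"
  shows "(\<integral>\<^sup>+y. f (mul y x) \<partial>lborel) = (\<integral>\<^sup>+y. f y \<partial>lborel)"
  using nn_integral_distr[of "\<lambda>y. mul y x" lborel lborel f] by (simp add: haar_right)

lemma distr_lborel_minus: "distr lborel lborel (\<lambda>x. - x :: real ^ ('n::{finite, linorder})) = lborel"
proof -
  have "lborel = density (distr lborel borel (\<lambda>x. 0 + (-1) *\<^sub>R x :: real ^ ('n::{finite, linorder}))) (\<lambda>_. ennreal (\<bar>-1\<bar> ^ DIM(real ^ ('n::{finite, linorder}))))"
    by (rule lborel_affine) simp
  then show ?thesis by (simp add: density_1 cong: distr_cong)
qed

lemma integral_mul_right:
  fixes f :: "real ^ ('n::{finite, linorder}) \<Rightarrow> 'b::{banach, second_countable_topology}"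
  assumes [measurable]: "f \<in> borel_measurable borel"
  shows "(\<integral>y. f (mul y x) \<partial>lborel) = (\<integral>y. f y \<partial>lborel)"
  using integral_distr[of "\<lambda>y. mul y x" lborel lborel f] by (simp add: haar_right)

lemma integral_minus_arg:
  fixes f :: "real ^ ('n::{finite, linorder}) \<Rightarrow> 'b::{banach, second_countable_topology}"
  assumes [measurable]: "f \<in> borel_measurable borel"
  shows "(\<integral>y. f (- y) \<partial>lborel) = (\<integral>y. f y \<partial>lborel)"
  using integral_distr[of "\<lambda>y. - y :: real ^ ('n::{finite, linorder})" lborel lborel f] by (simp add: distr_lborel_minus)

lemma integrable_mul_right:
  fixes f :: "real ^ ('n::{finite, linorder}) \<Rightarrow> 'b::{banach, second_countable_topology}"
  assumes "integrable lborel f"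
  shows "integrable lborel (\<lambda>y. f (mul y x))"
  using integrable_distr[of "\<lambda>y. mul y x" lborel lborel f] assms by (simp add: haar_right)

lemma integrable_minus_arg:
  fixes f :: "real ^ ('n::{finite, linorder}) \<Rightarrow> 'b::{banach, second_countable_topology}"
  assumes "integrable lborel f"
  shows "integrable lborel (\<lambda>y. f (- y))"
  using integrable_distr[of "\<lambda>y. - y :: real ^ ('n::{finite, linorder})" lborel lborel f] assms by (simp add: distr_lborel_minus)

end

lemma dil_nth [simp]: "dil a t x $ i = t powr a i * x $ i"
  by (simp add: dil_def)

lemma dil_dil: "s > 0 \<Longrightarrow> t > 0 \<Longrightarrow> dil a s (dil a t x) = dil a (s * t) x"
  by (simp add: vec_eq_iff powr_mult)

lemma dil_1 [simp]: "dil a 1 x = x"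
  by (simp add: vec_eq_iff)

lemma dil_0 [simp]: "dil a t 0 = 0"
  by (simp add: vec_eq_iff)

lemma dil_minus: "dil a t (- x) = - dil a t x"
  by (simp add: vec_eq_iff)

lemma dil_scaleR: "dil a t (s *\<^sub>R x) = s *\<^sub>R dil a t x"
  by (simp add: vec_eq_iff)

lemma continuous_on_dil [continuous_intros]:
  assumes "continuous_on S f" shows "continuous_on S (\<lambda>x. dil a t (f x))"
  unfolding dil_def using assms by (intro continuous_intros)

lemma borel_measurable_dil [measurable (raw)]:
  assumes "f \<in> borel_measurable M"
  shows "(\<lambda>x. dil (a :: 'n::finite \<Rightarrow> real) t (f x)) \<in> borel_measurable M"
proof -
  have "continuous_on UNIV (dil a t)" by (intro continuous_on_dil continuous_on_id)
  from borel_measurable_continuous_on[OF this assms] show ?thesis .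
qed

lemma lborel_dil:
  fixes a :: "'n::finite \<Rightarrow> real"
  assumes t: "t > 0"
  shows "lborel = density (distr lborel borel (dil a t)) (\<lambda>_. ennreal (t powr hom_dim a))"
proof -
  have Basis: "Basis = range (\<lambda>i::'n. axis i (1::real))" by (auto simp: Basis_vec_def)
  define c where "c = (\<lambda>v :: real ^ 'n. \<Sum>i\<in>UNIV. t powr a i * v $ i)"
  have c: "c (axis i 1) = t powr a i" for i by (simp add: c_def axis_def if_distrib cong: if_cong)
  have "inj (\<lambda>i::'n. axis i (1::real))" by (auto simp: inj_def axis_eq_axis)
  then have prod: "(\<Prod>j\<in>Basis. \<bar>c j\<bar>) = t powr hom_dim a"
    unfolding Basis using t by (subst prod.reindex) (auto simp: c hom_dim_def powr_sum)
  have T: "0 + (\<Sum>j\<in>Basis. (c j * (x \<bullet> j)) *\<^sub>R j) = dil a t x" for x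
  proof (rule euclidean_eqI)
    fix b :: "real ^ 'n" assume "b \<in> Basis"
    then obtain i where "b = axis i 1" by (auto simp: Basis)
    then show "(0 + (\<Sum>j\<in>Basis. (c j * (x \<bullet> j)) *\<^sub>R j)) \<bullet> b = dil a t x \<bullet> b"
      unfolding add_0_left inner_sum_left_Basis[OF \<open>b \<in> Basis\<close>] by (simp add: c inner_axis)
  qed
  have "lborel = density (distr lborel borel (\<lambda>x. 0 + (\<Sum>j\<in>Basis. (c j * (x \<bullet> j)) *\<^sub>R j))) (\<lambda>_. ennreal (\<Prod>j\<in>Basis. \<bar>c j\<bar>))"
    by (rule lborel_affine_euclidean) (use t in \<open>auto simp: Basis c\<close>)
  then show ?thesis unfolding T prod .
qed

lemma nn_integral_dil:
  fixes a :: "'n::finite \<Rightarrow> real"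
  assumes t: "t > 0" and [measurable]: "f \<in> borel_measurable borel"
  shows "(\<integral>\<^sup>+x. f x \<partial>lborel) = ennreal (t powr hom_dim a) * (\<integral>\<^sup>+x. f (dil a t x) \<partial>lborel)"
  by (subst lborel_dil[OF t, of a]) (simp add: nn_integral_density nn_integral_distr nn_integral_cmult)

lemma integral_dil:
  fixes a :: "'n::finite \<Rightarrow> real" and f :: "real ^ 'n \<Rightarrow> 'b::{banach, second_countable_topology}"
  assumes t: "t > 0" and [measurable]: "f \<in> borel_measurable borel"
  shows "(\<integral>x. f x \<partial>lborel) = t powr hom_dim a *\<^sub>R (\<integral>x. f (dil a t x) \<partial>lborel)"
  by (subst lborel_dil[OF t, of a]) (simp add: integral_density integral_distr)

lemma integrable_dil:
  fixes a :: "'n::finite \<Rightarrow> real" and f :: "real ^ 'n \<Rightarrow> 'b::{banach, second_countable_topology}"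
  assumes t: "t > 0" and f: "integrable lborel f"
  shows "integrable lborel (\<lambda>x. f (dil a t x))"
proof -
  have [measurable]: "f \<in> borel_measurable borel" using f by auto
  from f have "integrable (density (distr lborel borel (dil a t)) (\<lambda>_. ennreal (t powr hom_dim a))) f"
    by (subst (asm) lborel_dil[OF t, of a])
  then have "integrable lborel (\<lambda>x. t powr hom_dim a *\<^sub>R f (dil a t x))"
    by (subst (asm) integrable_density) (auto simp: integrable_distr_eq)
  then have "integrable lborel (\<lambda>x. t powr (- hom_dim a) *\<^sub>R t powr hom_dim a *\<^sub>R f (dil a t x))"
    by (rule integrable_scaleR_right)
  then show ?thesis using t by (simp flip: powr_add)
qed

context homogeneous_group_norm begin

lemma rho_0 [simp]: "\<rho> 0 = 0"
  using rho_dil[of 2 0] by simp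

lemma rho_minus [simp]: "\<rho> (- x) = \<rho> x"
  using rho_inv[of x] by (simp add: inv_eq)

lemma rho_nonneg [simp]: "0 \<le> \<rho> x"
  using rho_add[of x "- x"] by simp

lemma borel_measurable_rho [measurable (raw)]:
  "f \<in> borel_measurable M \<Longrightarrow> (\<lambda>x. \<rho> (f x)) \<in> borel_measurable M"
  by (rule borel_measurable_continuous_on[OF rho_cont])

lemma rho_eq_0_iff [simp]: "\<rho> x = 0 \<longleftrightarrow> x = 0"
proof
  assume x: "\<rho> x = 0"
  show "x = 0"
  proof (rule ccontr)
    assume "x \<noteq> 0"
    then obtain i where i: "x $ i \<noteq> 0" by (auto simp: vec_eq_iff)
    define t where "t = 1 + 1 / \<bar>x $ i\<bar>"
    have t: "t \<ge> 1" by (simp add: t_def)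
    have "\<rho> (dil a t x) \<le> 1" using x t by (simp add: rho_dil)
    then have "norm (dil a t x) \<le> 1" by (simp add: rho_le_1_iff)
    then have "\<bar>t powr a i * x $ i\<bar> \<le> 1"
      using component_le_norm_cart[of "dil a t x" i] by simp
    moreover have "t powr 1 \<le> t powr a i" using t a_ge_1 by (intro powr_mono) auto
    then have "t * \<bar>x $ i\<bar> \<le> \<bar>t powr a i * x $ i\<bar>"
      using t by (simp add: abs_mult mult_right_mono)
    moreover have "t * \<bar>x $ i\<bar> > 1" using i by (simp add: t_def distrib_right)
    ultimately show False by linarith
  qed
qed simp

lemma rho_pos: "x \<noteq> 0 \<Longrightarrow> 0 < \<rho> x"
  using rho_nonneg[of x] by (simp add: less_le)

lemma polar:
  assumes "x \<noteq> 0"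
  obtains y where "x = dil a (\<rho> x) y" "norm y = 1"
proof (rule that)
  have r: "\<rho> x > 0" using assms by (rule rho_pos)
  show "x = dil a (\<rho> x) (dil a (1 / \<rho> x) x)" using r by (simp add: dil_dil)
  have "\<rho> (dil a (1 / \<rho> x) x) = 1" using r assms by (simp add: rho_dil)
  then show "norm (dil a (1 / \<rho> x) x) = 1" by (simp add: rho_eq_1_iff)
qed

text \<open>Dilate \<open>x\<close> to the unit sphere, where all coordinates are at most 1.\<close>

lemma coord_le_rho: "\<bar>x $ i\<bar> \<le> \<rho> x powr a i"
proof (cases "x = 0")
  case False
  from polar[OF this] obtain y where y: "x = dil a (\<rho> x) y" "norm y = 1" .
  have "\<bar>x $ i\<bar> = \<rho> x powr a i * \<bar>y $ i\<bar>" by (subst y(1)) (simp add: abs_mult)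
  also have "\<dots> \<le> \<rho> x powr a i * 1"
    using component_le_norm_cart[of y i] y(2) by (intro mult_left_mono) auto
  finally show ?thesis by simp
qed simp

lemma rho_le_max_norm: "\<rho> x \<le> max 1 (norm x)"
proof (cases "\<rho> x \<le> 1")
  case False
  then have "x \<noteq> 0" by auto
  from polar[OF this] obtain y where y: "x = dil a (\<rho> x) y" "norm y = 1" .
  have "\<rho> x * norm y \<le> norm (dil a (\<rho> x) y)"
  proof -
    have "norm (\<rho> x *\<^sub>R y) \<le> norm (dil a (\<rho> x) y)"
    proof (rule norm_le_componentwise_cart)
      fix i
      have "\<rho> x powr 1 \<le> \<rho> x powr a i" using False a_ge_1 by (intro powr_mono) auto
      then show "norm ((\<rho> x *\<^sub>R y) $ i) \<le> norm (dil a (\<rho> x) y $ i)"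
        by (simp add: abs_mult mult_right_mono)
    qed
    then show ?thesis by simp
  qed
  then show ?thesis using y by simp
qed auto

text \<open>Straight segments from the identity stay in the ball of their end point; they serve as paths in
  the mean value estimates.\<close>

lemma rho_scaleR_le:
  assumes "0 \<le> s" "s \<le> 1" shows "\<rho> (s *\<^sub>R x) \<le> \<rho> x"
proof (cases "x = 0")
  case False
  from polar[OF this] obtain y where y: "x = dil a (\<rho> x) y" "norm y = 1" .
  have "\<rho> (s *\<^sub>R y) \<le> 1" using y assms by (simp add: rho_le_1_iff)
  moreover have "\<rho> (s *\<^sub>R x) = \<rho> x * \<rho> (s *\<^sub>R y)"
  proof -
    have "dil a (\<rho> x) (s *\<^sub>R y) = s *\<^sub>R x" by (simp only: dil_scaleR y(1)[symmetric])
    then show ?thesis using rho_dil[OF rho_pos[OF False], of "s *\<^sub>R y"] by simp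
  qed
  ultimately show ?thesis using mult_left_mono[of "\<rho> (s *\<^sub>R y)" 1 "\<rho> x"] by simp
qed simp

definition c0 :: real where
  "c0 = (SOME c. c \<ge> 1 \<and> (\<forall>x y. \<rho> (mul x y) \<le> c * (\<rho> x + \<rho> y)))"

lemma c0: "c0 \<ge> 1" "\<rho> (mul x y) \<le> c0 * (\<rho> x + \<rho> y)"
  using someI_ex[OF rho_mul] unfolding c0_def by blast+

lemma one_plus_rho_mul: "1 + \<rho> (mul x y) \<le> c0 * ((1 + \<rho> x) * (1 + \<rho> y))"
proof -
  have "1 + c0 * (\<rho> x + \<rho> y) \<le> c0 * (1 + (\<rho> x + \<rho> y))" using c0(1) by (simp add: algebra_simps)
  also have "\<dots> \<le> c0 * ((1 + \<rho> x) * (1 + \<rho> y))"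
    using c0(1) by (intro mult_left_mono) (auto simp: algebra_simps)
  finally show ?thesis using c0(2)[of x y] by linarith
qed

text \<open>The left-invariant quasi-distance. Since \<open>\<rho>\<close> is invariant under inversion, its balls are those
  in the definition of the Muckenhoupt classes.\<close>

definition gdist :: "real ^ ('n::{finite, linorder}) \<Rightarrow> real ^ ('n::{finite, linorder}) \<Rightarrow> real" where
  "gdist x y = \<rho> (mul (- x) y)"

sublocale quasi_metric gdist c0
proof
  show "c0 \<ge> 1" by (rule c0)
  show "gdist x x = 0" for x by (simp add: gdist_def)
  show sym: "gdist x y = gdist y x" for x y
    using rho_minus[of "mul (- x) y"] by (simp add: gdist_def minus_mul)
  show "gdist x z \<le> c0 * (gdist x y + gdist y z)" for x y z
    using c0(2)[of "mul (- x) y" "mul (- y) z"] by (simp add: gdist_def mul_assoc)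
  show "open {y. gdist x y < t}" for x t
    unfolding gdist_def
    by (intro open_Collect_less continuous_intros continuous_on_compose2[OF rho_cont]) auto
qed

lemma gball_eq_qball: "gball mul \<rho> x t = qball x t"
  using d_sym by (auto simp: gball_def qball_def gdist_def)

text \<open>The unit balls of \<open>\<rho>\<close> and of the Euclidean norm agree.\<close>

definition ball_volume :: real where
  "ball_volume = measure lborel (ball (0 :: real ^ ('n::{finite, linorder})) 1)"

lemma ball_volume_pos: "ball_volume > 0"
  unfolding ball_volume_def by (rule content_ball_pos) simp

lemma qball_0_1: "qball 0 1 = ball 0 1"
  using rho_le_1_iff rho_eq_1_iff by (auto simp: qball_def gdist_def less_le)

lemma emeasure_qball:
  assumes t: "t > 0"
  shows "emeasure lborel (qball x t) = ennreal (ball_volume * t powr hom_dim a)"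
proof -
  have "emeasure lborel (qball x t) = (\<integral>\<^sup>+y. indicator (qball 0 1) (dil a (1 / t) (mul (- x) y)) \<partial>lborel)"
  proof (subst nn_integral_indicator[symmetric], simp, intro nn_integral_cong)
    fix y
    have "\<rho> (dil a (1 / t) (mul (- x) y)) < 1 \<longleftrightarrow> \<rho> (mul (- x) y) < t"
      using t by (subst rho_dil) (auto simp: field_simps)
    then show "(indicator (qball x t) y :: ennreal) = indicator (qball 0 1) (dil a (1 / t) (mul (- x) y))"
      by (auto simp: qball_def gdist_def split: split_indicator)
  qed
  also have "\<dots> = (\<integral>\<^sup>+y. indicator (qball 0 1) (dil a (1 / t) y) \<partial>lborel)"
    by (rule nn_integral_mul_left) measurable
  also have "\<dots> = ennreal (t powr hom_dim a) * (\<integral>\<^sup>+y. indicator (qball 0 1) (dil a (1 / t) (dil a t y)) \<partial>lborel)"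
    by (rule nn_integral_dil[OF t]) measurable
  also have "(\<integral>\<^sup>+y. indicator (qball 0 1) (dil a (1 / t) (dil a t y)) \<partial>lborel) = emeasure lborel (qball 0 1)"
    using t by (simp add: dil_dil)
  also have "\<dots> = ennreal ball_volume"
    unfolding qball_0_1 ball_volume_def 
    using emeasure_bounded_finite[OF bounded_ball, of "0 :: real ^ ('n::{finite, linorder})" 1]
    by (intro emeasure_eq_ennreal_measure) auto
  finally show ?thesis using ball_volume_pos by (simp add: mult.commute flip: ennreal_mult)
qed

sublocale doubling_space gdist c0 lborel "enl powr hom_dim a"
proof
  show "doubling lborel (enl powr hom_dim a)"
    unfolding doubling_def
  proof (intro conjI allI impI)
    fix x :: "real ^ ('n::{finite, linorder})" and t :: real assume t: "0 < t"
    show "0 < emeasure lborel (qball x t)" "emeasure lborel (qball x t) < top"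
      using t ball_volume_pos by (auto simp: emeasure_qball)
    show "emeasure lborel (qball x (enl * t)) \<le> ennreal (enl powr hom_dim a) * emeasure lborel (qball x t)"
      using t enl_ge_1 ball_volume_pos by (simp add: emeasure_qball powr_mult mult_ac flip: ennreal_mult)
  qed (use enl_ge_1 in auto)
qed

lemma integrable_rho_decay:
  assumes L: "L > hom_dim a"
  shows "integrable lborel (\<lambda>x. (1 + \<rho> x) powr (- L))"
proof (rule integrableI_nonneg)
  show "(\<lambda>x. (1 + \<rho> x) powr (- L)) \<in> borel_measurable lborel" by measurable
  define b where "b = ball_volume * 2 powr L"
  define s where "s = (2::real) powr (hom_dim a - L)"
  have s: "0 < s" "s < 1" using L by (auto simp: s_def powr_less_one)
  \<comment> \<open>On the shell where \<open>1 + \<rho>\<close> is comparable to \<open>2 ^ k\<close> the integrand is comparable to a power of two.\<close>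
  have "(\<integral>\<^sup>+x. ennreal ((1 + \<rho> x) powr (- L)) \<partial>lborel)
     \<le> (\<integral>\<^sup>+x. (\<Sum>k. ennreal (2 powr L * (2 ^ k) powr (- L)) * indicator (qball 0 (2 ^ k)) x) \<partial>lborel)"
  proof (intro nn_integral_mono)
    fix x
    obtain n where "\<rho> x < 2 ^ n" using real_arch_pow[of 2 "\<rho> x"] by auto
    define k where "k = (LEAST n. \<rho> x < 2 ^ n)"
    have k: "\<rho> x < 2 ^ k" unfolding k_def by (rule LeastI, fact)
    have "2 ^ k \<le> 2 * (1 + \<rho> x)"
    proof (cases k)
      case (Suc j)
      then have "\<not> \<rho> x < 2 ^ j" using not_less_Least[of j "\<lambda>n. \<rho> x < 2 ^ n"] by (simp add: k_def)
      then show ?thesis using Suc by simp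
    qed (use rho_nonneg[of x] in \<open>auto simp: add_increasing2\<close>)
    then have "(2 * (1 + \<rho> x)) powr (- L) \<le> (2 ^ k) powr (- L)"
      using L hom_dim_ge_1 by (intro powr_mono2') auto
    then have "(1 + \<rho> x) powr (- L) \<le> 2 powr L * (2 ^ k) powr (- L)"
    proof -
      assume le: "(2 * (1 + \<rho> x)) powr (- L) \<le> (2 ^ k) powr (- L)"
      have "2 powr L * (2 * (1 + \<rho> x)) powr (- L) = (1 + \<rho> x) powr (- L)"
        using rho_nonneg[of x] by (subst powr_mult) (auto simp: powr_minus)
      then show ?thesis using mult_left_mono[OF le, of "2 powr L"] by simp
    qed
    then have "ennreal ((1 + \<rho> x) powr (- L)) \<le> ennreal (2 powr L * (2 ^ k) powr (- L)) * indicator (qball 0 (2 ^ k)) x"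
      using k by (auto simp: qball_def gdist_def intro!: ennreal_leI)
    also have "\<dots> \<le> (\<Sum>k. ennreal (2 powr L * (2 ^ k) powr (- L)) * indicator (qball 0 (2 ^ k)) x)"
      by (rule term_le_suminf)
    finally show "ennreal ((1 + \<rho> x) powr (- L)) \<le> (\<Sum>k. ennreal (2 powr L * (2 ^ k) powr (- L)) * indicator (qball 0 (2 ^ k)) x)" .
  qed
  also have "\<dots> = (\<Sum>k. ennreal (2 powr L * (2 ^ k) powr (- L)) * emeasure lborel (qball 0 (2 ^ k)))"
    by (subst nn_integral_suminf) (auto simp: nn_integral_cmult)
  also have "\<dots> = (\<Sum>k. ennreal (b * s ^ k))"
  proof (intro suminf_cong)
    fix k :: nat
    have "(2 ^ k) powr (- L) * (2 ^ k) powr hom_dim a = s ^ k"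
    proof -
      have e: "((2::real) ^ k) powr u = (2 powr u) ^ k" for u by (rule power_powr_swap) simp
      have "(2::real) powr (- L) * 2 powr hom_dim a = s" by (simp add: s_def flip: powr_add)
      then show ?thesis by (simp only: e power_mult_distrib[symmetric])
    qed
    then have "2 powr L * (2 ^ k) powr (- L) * (ball_volume * (2 ^ k) powr hom_dim a) = b * s ^ k"
      by (simp add: b_def mult_ac)
    then show "ennreal (2 powr L * (2 ^ k) powr (- L)) * emeasure lborel (qball 0 (2 ^ k)) = ennreal (b * s ^ k)"
      using ball_volume_pos by (simp add: emeasure_qball flip: ennreal_mult)
  qed
  also have "\<dots> = ennreal (b * (1 / (1 - s)))"
  proof -
    have "(\<lambda>k. b * s ^ k) sums (b * (1 / (1 - s)))" using geometric_sums[of s] s by (intro sums_mult) auto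
    then show ?thesis using s ball_volume_pos
      by (intro sums_unique[symmetric] sums_ennreal[THEN iffD2]) (auto simp: b_def)
  qed
  also have "\<dots> < \<infinity>" by simp
  finally show "(\<integral>\<^sup>+x. ennreal ((1 + \<rho> x) powr (- L)) \<partial>lborel) < \<infinity>" .
qed simp

end

section \<open>Schwartz functions\<close>

lemma schwartzD:
  assumes "f \<in> schwartz"
  shows "iter_partial l f differentiable (at x)"
    and "bounded (range (\<lambda>x. (1 + norm x) ^ m *\<^sub>R iter_partial l f x))"
  using assms by (auto simp: schwartz_def smooth_on_def)

lemma schwartz_differentiable: "f \<in> schwartz \<Longrightarrow> f differentiable (at x)"
  using schwartzD(1)[of f "[]"] by simp

lemma schwartz_continuous: "f \<in> schwartz \<Longrightarrow> continuous_on UNIV f"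
  by (meson continuous_at_imp_continuous_on differentiable_imp_continuous_within schwartz_differentiable)

lemma schwartz_measurable [measurable_dest]: "f \<in> schwartz \<Longrightarrow> f \<in> borel_measurable borel"
  by (intro borel_measurable_continuous_onI schwartz_continuous)

lemma schwartz_partial_deriv: "f \<in> schwartz \<Longrightarrow> partial_deriv i f \<in> schwartz"
proof -
  assume f: "f \<in> schwartz"
  have "iter_partial l (partial_deriv i f) = iter_partial (l @ [i]) f" for l by simp
  then show ?thesis using f unfolding schwartz_def smooth_on_def by (simp del: foldr_append)
qed

lemma schwartz_bound:
  assumes "f \<in> schwartz"
  obtains C where "C > 0" "\<And>x. (1 + norm x) ^ m * cmod (f x) \<le> C"
proof -
  from schwartzD(2)[OF assms, of m "[]"] obtain B where "\<And>x. norm ((1 + norm x) ^ m *\<^sub>R f x) \<le> B"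
    by (auto simp: bounded_iff)
  then have "(1 + norm x) ^ m * cmod (f x) \<le> \<bar>B\<bar> + 1" for x
    by (smt (verit, best) abs_of_nonneg norm_ge_zero norm_scaleR zero_le_power)
  then show ?thesis by (intro that[of "\<bar>B\<bar> + 1"]) auto
qed

lemma vec_eq_sum_axis: "v = (\<Sum>i\<in>UNIV. v $ i *\<^sub>R axis i (1::real))"
  by (simp add: vec_eq_iff axis_def if_distrib cong: if_cong)

lemma differentiable_has_derivative_partial:
  fixes f :: "real ^ 'n \<Rightarrow> 'b::real_normed_vector"
  assumes "f differentiable (at x)"
  shows "(f has_derivative (\<lambda>v. \<Sum>i\<in>UNIV. v $ i *\<^sub>R partial_deriv i f x)) (at x)"
proof -
  obtain f' where f': "(f has_derivative f') (at x)" using assms by (auto simp: differentiable_def)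
  interpret bounded_linear f' by (rule has_derivative_bounded_linear[OF f'])
  have "partial_deriv i f x = f' (axis i 1)" for i
  proof -
    have "((\<lambda>t. x + t *\<^sub>R axis i 1) has_derivative (\<lambda>t. t *\<^sub>R axis i 1)) (at 0)"
      by (auto intro!: derivative_eq_intros)
    from has_derivative_compose[OF this, of f f'] f'
    have "((\<lambda>t. f (x + t *\<^sub>R axis i 1)) has_vector_derivative f' (axis i 1)) (at 0)"
      by (simp add: has_vector_derivative_def scaleR)
    then show ?thesis unfolding partial_deriv_def by (rule vector_derivative_at)
  qed
  then have "f' = (\<lambda>v. \<Sum>i\<in>UNIV. v $ i *\<^sub>R partial_deriv i f x)"
    by (intro ext, subst vec_eq_sum_axis) (simp add: sum scaleR)
  then show ?thesis using f' by simp
qed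

text \<open>The derivatives of a composition of a Schwartz function with a polynomial map \<open>T\<close> are
  sums of products of a polynomial and a Schwartz function evaluated at \<open>T\<close>.
  This class is closed under differentiation, and if \<open>T\<close> grows at least like a power of the
  norm, then its members decay rapidly.\<close>

inductive_set poly_comp :: "(real ^ 'n::finite \<Rightarrow> real ^ 'n) \<Rightarrow> (real ^ 'n \<Rightarrow> complex) set"
  for T :: "real ^ 'n \<Rightarrow> real ^ 'n" where
  base: "real_polynomial_function p \<Longrightarrow> f \<in> schwartz \<Longrightarrow> (\<lambda>x. p x *\<^sub>R f (T x)) \<in> poly_comp T"
| add: "g \<in> poly_comp T \<Longrightarrow> h \<in> poly_comp T \<Longrightarrow> (\<lambda>x. g x + h x) \<in> poly_comp T"

lemma poly_comp_sum:
  assumes "finite I" "I \<noteq> {}" "\<And>i. i \<in> I \<Longrightarrow> g i \<in> poly_comp T"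
  shows "(\<lambda>x. \<Sum>i\<in>I. g i x) \<in> poly_comp T"
  using assms
proof (induction I rule: finite_ne_induct)
  case (insert i I)
  then have "(\<lambda>x. g i x + (\<Sum>i\<in>I. g i x)) \<in> poly_comp T" by (intro poly_comp.add) auto
  then show ?case using insert by simp
qed auto

lemma poly_comp_derivative:
  fixes T :: "real ^ 'n::finite \<Rightarrow> real ^ 'n"
  assumes T: "polynomial_function T" and "h \<in> poly_comp T"
  shows "(\<forall>x. h differentiable (at x)) \<and> partial_deriv i h \<in> poly_comp T"
  using assms(2)
proof induction
  case (base p f)
  have dT: "T differentiable (at x)" for x by (rule differentiable_at_polynomial_function[OF T])
  have dp: "p differentiable (at x)" for x by (rule differentiable_at_real_polynomial_function[OF base(1)])
  have df: "f differentiable (at x)" for x by (rule schwartz_differentiable[OF base(2)])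
  have dfT: "(\<lambda>x. f (T x)) differentiable (at x)" for x
    using differentiable_compose[of f T x UNIV] df dT by (simp add: differentiable_at_withinI)
  have d: "(\<lambda>x. p x *\<^sub>R f (T x)) differentiable (at x)" for x
    by (intro differentiable_scaleR dp dfT)
  obtain p' where p': "real_polynomial_function p'" "\<And>x. ((\<lambda>t. p (x + t *\<^sub>R axis i 1)) has_vector_derivative p' x) (at 0)"
    using polynomial_directional_derivative[OF base(1)] by blast
  have "\<exists>q. real_polynomial_function q \<and> (\<forall>x. ((\<lambda>t. T (x + t *\<^sub>R axis i 1) $ k) has_vector_derivative q x) (at 0))" for k
    using polynomial_directional_derivative[OF polynomial_function_nth[OF T, of k]] by blast
  then obtain q where q: "\<And>k. real_polynomial_function (q k)"
     "\<And>k x. ((\<lambda>t. T (x + t *\<^sub>R axis i 1) $ k) has_vector_derivative q k x) (at 0)" by metis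
  have "partial_deriv i (\<lambda>x. p x *\<^sub>R f (T x)) x
      = (\<Sum>k\<in>UNIV. (p x * q k x) *\<^sub>R partial_deriv k f (T x)) + p' x *\<^sub>R f (T x)" for x
  proof -
    have "((\<lambda>t. T (x + t *\<^sub>R axis i 1)) has_vector_derivative (\<chi> k. q k x)) (at 0)"
      unfolding has_vector_derivative_def
      by (subst has_derivative_componentwise_within)
         (use q(2) in \<open>auto simp: Basis_vec_def inner_axis has_vector_derivative_def\<close>)
    then have "((\<lambda>t. f (T (x + t *\<^sub>R axis i 1))) has_derivative
       (\<lambda>t. \<Sum>k\<in>UNIV. (t *\<^sub>R (\<chi> k. q k x)) $ k *\<^sub>R partial_deriv k f (T x))) (at 0)"
      using has_derivative_compose[of "\<lambda>t. T (x + t *\<^sub>R axis i 1)" "\<lambda>t. t *\<^sub>R (\<chi> k. q k x)" 0 UNIV f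
          "\<lambda>w. \<Sum>k\<in>UNIV. w $ k *\<^sub>R partial_deriv k f (T x)"]
        differentiable_has_derivative_partial[OF df, of "T x"]
      by (simp add: has_vector_derivative_def)
    then have "((\<lambda>t. f (T (x + t *\<^sub>R axis i 1))) has_vector_derivative
       (\<Sum>k\<in>UNIV. q k x *\<^sub>R partial_deriv k f (T x))) (at 0)"
      by (simp add: has_vector_derivative_def scaleR_sum_right)
    from has_vector_derivative_scaleR[OF p'(2)[of x, folded has_real_derivative_iff_has_vector_derivative] this]
    have "((\<lambda>t. p (x + t *\<^sub>R axis i 1) *\<^sub>R f (T (x + t *\<^sub>R axis i 1))) has_vector_derivative
       (\<Sum>k\<in>UNIV. (p x * q k x) *\<^sub>R partial_deriv k f (T x)) + p' x *\<^sub>R f (T x)) (at 0)"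
      by (simp add: scaleR_sum_right)
    then show ?thesis unfolding partial_deriv_def[of i] by (rule vector_derivative_at)
  qed
  then have "partial_deriv i (\<lambda>x. p x *\<^sub>R f (T x))
      = (\<lambda>x. (\<Sum>k\<in>UNIV. (p x * q k x) *\<^sub>R partial_deriv k f (T x)) + p' x *\<^sub>R f (T x))" by auto
  also have "\<dots> \<in> poly_comp T"
    using base q(1) p'(1)
    by (intro poly_comp.add poly_comp_sum poly_comp.base schwartz_partial_deriv real_polynomial_function.intros(4)) auto
  finally show ?case using d by simp
next
  case (add g h)
  then have dg: "g differentiable (at x)" and dh: "h differentiable (at x)" for x by auto
  have "partial_deriv i (\<lambda>x. g x + h x) x = partial_deriv i g x + partial_deriv i h x" for x
  proof -
    have "((\<lambda>v. x + v *\<^sub>R axis i 1) has_derivative (\<lambda>t. t *\<^sub>R axis i 1)) (at 0)"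
      by (auto intro!: derivative_eq_intros)
    then have "(\<lambda>t. x + t *\<^sub>R axis i 1) differentiable (at 0)" by (auto simp: differentiable_def)
    then have "(\<lambda>t. g (x + t *\<^sub>R axis i 1)) differentiable (at 0)" "(\<lambda>t. h (x + t *\<^sub>R axis i 1)) differentiable (at 0)"
      using differentiable_chain_at[of "\<lambda>t. x + t *\<^sub>R axis i 1" 0 g] differentiable_chain_at[of "\<lambda>t. x + t *\<^sub>R axis i 1" 0 h] dg dh
      by (auto simp: o_def)
    then show ?thesis unfolding partial_deriv_def
      by (simp add: vector_derivative_add_at)
  qed
  then have "partial_deriv i (\<lambda>x. g x + h x) = (\<lambda>x. partial_deriv i g x + partial_deriv i h x)" by auto
  then show ?case using add dg dh by (auto intro: poly_comp.add)
qed

lemma poly_comp_schwartz: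
  fixes T :: "real ^ 'n::finite \<Rightarrow> real ^ 'n"
  assumes T: "polynomial_function T" and C: "C > 0" "\<And>x. norm x \<le> C * (1 + norm (T x)) ^ m"
    and h: "h \<in> poly_comp T"
  shows "h \<in> schwartz"
proof -
  have iter: "iter_partial l h \<in> poly_comp T" for l
    by (induction l) (auto simp: h poly_comp_derivative[OF T])
  have bnd: "bounded (range (\<lambda>x. (1 + norm x) ^ n *\<^sub>R g x))" if "g \<in> poly_comp T" for g n
    using that
  proof induction
    case (base p f)
    obtain P k where P: "P > 0" "\<And>x. \<bar>p x\<bar> \<le> P * (1 + norm x) ^ k"
      using polynomial_growth[OF base(1)] by blast
    obtain B where B: "B > 0" "\<And>x. (1 + norm x) ^ (m * (n + k)) * cmod (f x) \<le> B"
      using schwartz_bound[OF base(2)] by blast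
    have "norm ((1 + norm x) ^ n *\<^sub>R (p x *\<^sub>R f (T x))) \<le> P * (1 + C) ^ (n + k) * B" for x
    proof -
      have one: "1 \<le> (1 + norm (T x)) ^ m" by simp
      have "1 + norm x \<le> 1 * (1 + norm (T x)) ^ m + C * (1 + norm (T x)) ^ m"
        using C(2)[of x] one by linarith
      then have "1 + norm x \<le> (1 + C) * (1 + norm (T x)) ^ m" by (simp add: distrib_right)
      then have "(1 + norm x) ^ (n + k) \<le> ((1 + C) * (1 + norm (T x)) ^ m) ^ (n + k)"
        by (intro power_mono) auto
      also have "\<dots> = (1 + C) ^ (n + k) * (1 + norm (T x)) ^ (m * (n + k))"
        by (simp add: power_mult_distrib power_mult)
      finally have 1: "(1 + norm x) ^ (n + k) \<le> (1 + C) ^ (n + k) * (1 + norm (T x)) ^ (m * (n + k))" .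
      have "norm ((1 + norm x) ^ n *\<^sub>R (p x *\<^sub>R f (T x))) = (1 + norm x) ^ n * (\<bar>p x\<bar> * cmod (f (T x)))"
        by (simp add: abs_mult)
      also have "\<dots> \<le> (1 + norm x) ^ n * ((P * (1 + norm x) ^ k) * cmod (f (T x)))"
        by (intro mult_left_mono mult_right_mono P(2)) auto
      also have "\<dots> = P * ((1 + norm x) ^ (n + k) * cmod (f (T x)))" by (simp add: power_add mult_ac)
      also have "\<dots> \<le> P * (((1 + C) ^ (n + k) * (1 + norm (T x)) ^ (m * (n + k))) * cmod (f (T x)))"
        using P(1) by (intro mult_left_mono mult_right_mono 1) auto
      also have "\<dots> = P * (1 + C) ^ (n + k) * ((1 + norm (T x)) ^ (m * (n + k)) * cmod (f (T x)))" by simp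
      also have "\<dots> \<le> P * (1 + C) ^ (n + k) * B"
        using P(1) C(1) by (intro mult_left_mono B(2)) auto
      finally show ?thesis .
    qed
    then show ?case unfolding bounded_iff by blast
  next
    case (add g h)
    then show ?case using bounded_plus_comp[OF add(3,4)] by (simp add: scaleR_add_right)
  qed
  show ?thesis
    unfolding schwartz_def smooth_on_def
    using bnd[OF iter] poly_comp_derivative[OF T iter] by blast
qed

context homogeneous_group begin

text \<open>These functions are the test functions to which the reproducing formula is applied: paired with
  \<open>D\<close>, they give \<open>f * D\<close> at \<open>x\<close>. The map \<open>z \<mapsto> x z\<^sup>-\<^sup>1\<close> and its inverse are polynomial.\<close>

lemma schwartz_translate_minus:
  assumes f: "f \<in> schwartz" shows "(\<lambda>z. f (mul x (- z))) \<in> schwartz"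
proof -
  have T: "polynomial_function (\<lambda>z. mul x (- z))"
    by (intro mul_polynomial polynomial_function_minus) auto
  have "polynomial_function (\<lambda>z. mul (- x) z)" by (intro mul_polynomial) auto
  from polynomial_growth_vec[OF this] obtain C m where C: "C > 0" "\<And>z. norm (mul (- x) z) \<le> C * (1 + norm z) ^ m" by blast
  have "norm z \<le> C * (1 + norm (mul x (- z))) ^ m" for z
    using C(2)[of "mul x (- z)"] by simp
  moreover have "(\<lambda>z. 1 *\<^sub>R f (mul x (- z))) \<in> poly_comp (\<lambda>z. mul x (- z))"
    by (rule poly_comp.base) (use f in \<open>auto intro: real_polynomial_function.intros(2)\<close>)
  ultimately show ?thesis using poly_comp_schwartz[OF T C(1)] by auto
qed

lemma left_deriv_vector:
  assumes "\<phi> differentiable (at v)"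
  shows "((\<lambda>h. \<phi> (mul v (h *\<^sub>R z))) has_vector_derivative (\<Sum>i\<in>UNIV. z $ i *\<^sub>R left_deriv mul i \<phi> v)) (at 0)"
proof -
  have "polynomial_function (\<lambda>y. mul v y)" by (intro mul_polynomial) auto
  then have "(\<lambda>y. mul v y) differentiable (at 0)" by (rule differentiable_at_polynomial_function)
  then have G: "(\<lambda>y. \<phi> (mul v y)) differentiable (at 0)"
    using differentiable_chain_at[of "\<lambda>y. mul v y" 0 \<phi>] assms by (simp add: o_def)
  have e: "partial_deriv i (\<lambda>y. \<phi> (mul v y)) 0 = left_deriv mul i \<phi> v" for i
    by (simp add: partial_deriv_def left_deriv_def)
  have "((\<lambda>h. h *\<^sub>R z) has_derivative (\<lambda>h. h *\<^sub>R z)) (at 0)" by (auto intro!: derivative_eq_intros)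
  from has_derivative_compose[OF this, of "\<lambda>y. \<phi> (mul v y)" "\<lambda>v'. \<Sum>i\<in>UNIV. v' $ i *\<^sub>R left_deriv mul i \<phi> v"]
    differentiable_has_derivative_partial[OF G]
  show ?thesis by (simp add: e has_vector_derivative_def scaleR_sum_right)
qed

text \<open>The path \<open>s \<mapsto> v (s z)\<close> is a translate of a one-parameter subgroup, so its velocity is given by
  the left-invariant vector fields.\<close>

lemma left_deriv_along_line:
  assumes "\<And>x. \<phi> differentiable (at x)"
  shows "((\<lambda>s. \<phi> (mul v (s *\<^sub>R z))) has_vector_derivative
    (\<Sum>i\<in>UNIV. z $ i *\<^sub>R left_deriv mul i \<phi> (mul v (s *\<^sub>R z)))) (at s)"
proof -
  have "mul v ((s + h) *\<^sub>R z) = mul (mul v (s *\<^sub>R z)) (h *\<^sub>R z)" for h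
    by (simp add: mul_assoc mul_line scaleR_add_left)
  then have "((\<lambda>h. \<phi> (mul v ((s + h) *\<^sub>R z))) has_vector_derivative
    (\<Sum>i\<in>UNIV. z $ i *\<^sub>R left_deriv mul i \<phi> (mul v (s *\<^sub>R z)))) (at 0)"
    using left_deriv_vector[OF assms, of "mul v (s *\<^sub>R z)" z] by simp
  then have "((\<lambda>h. \<phi> (mul v ((s + h) *\<^sub>R z))) has_vector_derivative
    (\<Sum>i\<in>UNIV. z $ i *\<^sub>R left_deriv mul i \<phi> (mul v (s *\<^sub>R z)))) (at (s - s))" by simp
  moreover have "((\<lambda>r. r - s) has_vector_derivative 1) (at s)" by (auto intro!: derivative_eq_intros)
  ultimately have "((\<lambda>h. \<phi> (mul v ((s + h) *\<^sub>R z))) \<circ> (\<lambda>r. r - s) has_vector_derivative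
    1 *\<^sub>R (\<Sum>i\<in>UNIV. z $ i *\<^sub>R left_deriv mul i \<phi> (mul v (s *\<^sub>R z)))) (at s)"
    by (intro vector_diff_chain_at)
  then show ?thesis by (simp add: o_def)
qed

text \<open>The coefficients of a left-invariant vector field are polynomials.\<close>

lemma schwartz_left_deriv:
  assumes f: "f \<in> schwartz" shows "left_deriv mul i f \<in> schwartz"
proof -
  have "\<exists>q. real_polynomial_function q \<and> (\<forall>v. ((\<lambda>t. mul v (t *\<^sub>R axis i 1) $ k) has_vector_derivative q v) (at 0))" for k
  proof -
    have "polynomial_function (\<lambda>z :: (real ^ ('n::{finite, linorder})) \<times> (real ^ ('n::{finite, linorder})). mul (fst z) (snd z))"
      by (intro mul_polynomial polynomial_function_bounded_linear bounded_linear_fst bounded_linear_snd)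
    then have pk: "real_polynomial_function (\<lambda>z :: (real ^ ('n::{finite, linorder})) \<times> (real ^ ('n::{finite, linorder})). mul (fst z) (snd z) $ k)"
      by (rule polynomial_function_nth)
    obtain p' where p': "real_polynomial_function p'"
      "\<And>x. ((\<lambda>t. mul (fst (x + t *\<^sub>R (0, axis i 1))) (snd (x + t *\<^sub>R (0, axis i 1))) $ k) has_vector_derivative p' x) (at 0)"
      using polynomial_directional_derivative[OF pk, of "(0, axis i 1)"] by blast
    have "bounded_linear (\<lambda>v :: real ^ ('n::{finite, linorder}). (v, 0 :: real ^ ('n::{finite, linorder})))"
      by (intro bounded_linear_Pair bounded_linear_ident bounded_linear_zero)
    then have "real_polynomial_function (p' \<circ> (\<lambda>v. (v, 0)))"
      using p'(1) by (intro real_polynomial_function_compose polynomial_function_bounded_linear)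
    moreover have "((\<lambda>t. mul v (t *\<^sub>R axis i 1) $ k) has_vector_derivative (p' \<circ> (\<lambda>v. (v, 0))) v) (at 0)" for v
      using p'(2)[of "(v, 0)"] by simp
    ultimately show ?thesis by blast
  qed
  then obtain q where q: "\<And>k. real_polynomial_function (q k)"
     "\<And>k v. ((\<lambda>t. mul v (t *\<^sub>R axis i 1) $ k) has_vector_derivative q k v) (at 0)" by metis
  have "left_deriv mul i f v = (\<Sum>k\<in>UNIV. q k v *\<^sub>R partial_deriv k f v)" for v
  proof -
    have "((\<lambda>t. mul v (t *\<^sub>R axis i 1)) has_vector_derivative (\<chi> k. q k v)) (at 0)"
      unfolding has_vector_derivative_def
      by (subst has_derivative_componentwise_within)
         (use q(2) in \<open>auto simp: Basis_vec_def inner_axis has_vector_derivative_def\<close>)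
    then have "((\<lambda>t. f (mul v (t *\<^sub>R axis i 1))) has_derivative
       (\<lambda>t. \<Sum>k\<in>UNIV. (t *\<^sub>R (\<chi> k. q k v)) $ k *\<^sub>R partial_deriv k f v)) (at 0)"
      using has_derivative_compose[of "\<lambda>t. mul v (t *\<^sub>R axis i 1)" "\<lambda>t. t *\<^sub>R (\<chi> k. q k v)" 0 UNIV f
          "\<lambda>w. \<Sum>k\<in>UNIV. w $ k *\<^sub>R partial_deriv k f v"]
        differentiable_has_derivative_partial[OF schwartz_differentiable[OF f], of v]
      by (simp add: has_vector_derivative_def)
    then have "((\<lambda>t. f (mul v (t *\<^sub>R axis i 1))) has_vector_derivative
       (\<Sum>k\<in>UNIV. q k v *\<^sub>R partial_deriv k f v)) (at 0)"
      by (simp add: has_vector_derivative_def scaleR_sum_right)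
    then show ?thesis unfolding left_deriv_def by (rule vector_derivative_at)
  qed
  then have "left_deriv mul i f = (\<lambda>v. \<Sum>k\<in>UNIV. q k v *\<^sub>R partial_deriv k f v)" by auto
  also have "\<dots> \<in> poly_comp (\<lambda>x. x)"
    by (intro poly_comp_sum poly_comp.base schwartz_partial_deriv f q) auto
  finally show ?thesis
    by (rule poly_comp_schwartz[of "\<lambda>x. x" 1 1, rotated 3]) auto
qed

end

context homogeneous_group_norm begin

lemma one_plus_rho [simp]: "0 < 1 + \<rho> x" "1 \<le> 1 + \<rho> x" "1 + \<rho> x \<noteq> 0"
  using rho_nonneg[of x] by linarith+

lemma schwartz_rho_decay:
  assumes f: "f \<in> schwartz"
  obtains C where "C > 0" "\<And>x. cmod (f x) \<le> C * (1 + \<rho> x) powr (- L)"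
proof -
  obtain m :: nat where m: "L \<le> real m" using real_arch_simple by blast
  obtain B where B: "B > 0" "\<And>x. (1 + norm x) ^ m * cmod (f x) \<le> B"
    using schwartz_bound[OF f] by blast
  have "cmod (f x) \<le> (2 ^ m * B) * (1 + \<rho> x) powr (- L)" for x
  proof -
    have "1 + \<rho> x \<le> 2 * (1 + norm x)"
    proof -
      have "max 1 (norm x) \<le> 1 + norm x" by simp
      from order_trans[OF rho_le_max_norm this] have "\<rho> x \<le> 1 + norm x" .
      then show ?thesis using norm_ge_zero[of x] unfolding distrib_left by linarith
    qed
    then have "(1 + \<rho> x) ^ m \<le> (2 * (1 + norm x)) ^ m" by (intro power_mono) auto
    then have "(1 + \<rho> x) ^ m * cmod (f x) \<le> (2 * (1 + norm x)) ^ m * cmod (f x)"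
      by (intro mult_right_mono) auto
    also have "\<dots> = 2 ^ m * ((1 + norm x) ^ m * cmod (f x))" by (simp only: power_mult_distrib mult.assoc)
    also have "\<dots> \<le> 2 ^ m * B" by (intro mult_left_mono B(2)) auto
    finally have 1: "(1 + \<rho> x) ^ m * cmod (f x) \<le> 2 ^ m * B" .
    have r: "1 + \<rho> x \<ge> 1" by simp
    have "(1 + \<rho> x) powr L * cmod (f x) \<le> (1 + \<rho> x) powr real m * cmod (f x)"
      using m r by (intro mult_right_mono powr_mono) auto
    also have "\<dots> = (1 + \<rho> x) ^ m * cmod (f x)" using r by (subst powr_realpow) auto
    finally have "(1 + \<rho> x) powr L * cmod (f x) \<le> 2 ^ m * B" using 1 by simp
    moreover have "(1 + \<rho> x) powr L > 0" by (simp add: add_pos_nonneg)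
    ultimately show ?thesis by (simp add: powr_minus field_simps)
  qed
  moreover have "2 ^ m * B > 0" using B by simp
  ultimately show ?thesis using that by blast
qed

lemma integrable_of_rho_decay:
  fixes f :: "real ^ ('n::{finite, linorder}) \<Rightarrow> complex"
  assumes [measurable]: "f \<in> borel_measurable borel"
    and "L > hom_dim a" "\<And>x. cmod (f x) \<le> C * (1 + \<rho> x) powr (- L)"
  shows "integrable lborel f"
proof (rule Bochner_Integration.integrable_bound)
  show "integrable lborel (\<lambda>x. C * (1 + \<rho> x) powr (- L))"
    by (intro integrable_mult_right integrable_rho_decay assms)
  show "AE x in lborel. norm (f x) \<le> norm (C * (1 + \<rho> x) powr (- L))"
  proof (rule AE_I2)
    fix x show "norm (f x) \<le> norm (C * (1 + \<rho> x) powr (- L))" using assms(3)[of x] by simp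
  qed
qed simp

lemma schwartz_integrable:
  fixes f :: "real ^ ('n::{finite, linorder}) \<Rightarrow> complex"
  assumes f: "f \<in> schwartz" shows "integrable lborel f"
proof -
  obtain C where "\<And>x. cmod (f x) \<le> C * (1 + \<rho> x) powr (- (hom_dim a + 1))"
    using schwartz_rho_decay[OF f, of "hom_dim a + 1"] by blast
  then show ?thesis
    by (rule integrable_of_rho_decay[OF schwartz_measurable[OF f], rotated]) simp
qed

lemma schwartz_bounded:
  assumes "f \<in> schwartz" obtains C where "C > 0" "\<And>x. cmod (f x) \<le> C"
  using schwartz_bound[OF assms, of 0] by auto

end

section \<open>Convolution\<close>

lemma dilate_measurable [measurable (raw)]:
  assumes [measurable]: "f \<in> borel_measurable borel" "g \<in> borel_measurable M"
  shows "(\<lambda>x. dilate (a :: 'n::finite \<Rightarrow> real) t f (g x)) \<in> borel_measurable M"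
  unfolding dilate_def by measurable

lemma dilate_integral:
  fixes a :: "'n::finite \<Rightarrow> real"
  assumes t: "t > 0" and [measurable]: "f \<in> borel_measurable borel" "g \<in> borel_measurable borel"
  shows "(\<integral>x. g x * dilate a t f x \<partial>lborel) = (\<integral>x. g (dil a t x) * f x \<partial>lborel)"
proof -
  have "(\<integral>x. g x * dilate a t f x \<partial>lborel)
     = t powr hom_dim a *\<^sub>R (\<integral>x. g (dil a t x) * dilate a t f (dil a t x) \<partial>lborel)"
    by (rule integral_dil[OF t]) measurable
  also have "(\<integral>x. g (dil a t x) * dilate a t f (dil a t x) \<partial>lborel)
     = (\<integral>x. t powr (- hom_dim a) *\<^sub>R (g (dil a t x) * f x) \<partial>lborel)"
    using t by (simp add: dilate_def dil_dil)
  also have "\<dots> = t powr (- hom_dim a) *\<^sub>R (\<integral>x. g (dil a t x) * f x \<partial>lborel)"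
    by (rule integral_scaleR_right)
  finally show ?thesis using t by (simp flip: powr_add)
qed

lemma dilate_integrable:
  fixes a :: "'n::finite \<Rightarrow> real"
  assumes t: "t > 0" and f: "integrable lborel f"
  shows "integrable lborel (dilate a t f)"
  unfolding dilate_def[abs_def] using integrable_dil[OF _ f, of "inverse t" a] t
  by (intro integrable_scaleR_right) auto

lemma integral_lebesgue_lborel:
  fixes f :: "real ^ 'n \<Rightarrow> complex"
  assumes "f \<in> borel_measurable borel"
  shows "(LINT x|lebesgue. f x) = (\<integral>x. f x \<partial>lborel)"
  using assms by (intro integral_completion) simp

text \<open>The form of Fubini's condition that occurs for integrals along a path of unit length.\<close>

lemma integrable_strip:
  fixes k :: "real \<times> 'b::euclidean_space \<Rightarrow> complex"
  assumes [measurable]: "k \<in> borel_measurable (lborel \<Otimes>\<^sub>M lborel)"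
    and k: "\<And>s. (\<integral>\<^sup>+v. ennreal (norm (k (s, v))) \<partial>lborel) \<le> ennreal B * indicator {0..1} s"
  shows "integrable (lborel \<Otimes>\<^sub>M lborel) k"
proof (rule integrableI_bounded)
  have "(\<integral>\<^sup>+x. ennreal (norm (k x)) \<partial>(lborel \<Otimes>\<^sub>M lborel)) = (\<integral>\<^sup>+s. \<integral>\<^sup>+v. ennreal (norm (k (s, v))) \<partial>lborel \<partial>lborel)"
    by (rule lborel.nn_integral_fst[symmetric]) measurable
  also have "\<dots> \<le> (\<integral>\<^sup>+s. ennreal B * indicator {0..1} (s::real) \<partial>lborel)" by (intro nn_integral_mono k)
  also have "\<dots> < \<infinity>" by (simp add: nn_integral_cmult_indicator ennreal_mult_less_top)
  finally show "(\<integral>\<^sup>+x. ennreal (norm (k x)) \<partial>(lborel \<Otimes>\<^sub>M lborel)) < \<infinity>" .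
qed measurable

context homogeneous_group begin

lemma conv_lborel:
  assumes [measurable]: "F \<in> borel_measurable borel" "G \<in> borel_measurable borel"
  shows "conv mul F G x = (\<integral>y. F (mul x (- y)) * G y \<partial>lborel)"
  unfolding conv_def by (rule integral_lebesgue_lborel) measurable

lemma conv_measurable [measurable]:
  assumes [measurable]: "F \<in> borel_measurable borel" "G \<in> borel_measurable borel"
  shows "conv mul F G \<in> borel_measurable borel"
proof -
  have "(\<lambda>x. \<integral>y. F (mul x (- y)) * G y \<partial>lborel) \<in> borel_measurable borel" by measurable
  then show ?thesis by (simp add: conv_lborel cong: measurable_cong)
qed

lemma conv_bounded:
  assumes [measurable]: "F \<in> borel_measurable borel" and G: "integrable lborel G"
    and B: "\<And>x. cmod (F x) \<le> B"
  shows "cmod (conv mul F G x) \<le> B * (\<integral>y. cmod (G y) \<partial>lborel)"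
proof -
  have [measurable]: "G \<in> borel_measurable borel" using G by auto
  have i: "integrable lborel (\<lambda>y. F (mul x (- y)) * G y)"
    by (rule Bochner_Integration.integrable_bound[OF integrable_mult_right[OF integrable_norm[OF G], of B]])
       (use B order_trans[OF norm_ge_zero B] in \<open>auto simp: norm_mult abs_mult intro!: mult_right_mono\<close>)
  have "cmod (conv mul F G x) \<le> (\<integral>y. cmod (F (mul x (- y)) * G y) \<partial>lborel)"
    by (simp add: conv_lborel)
  also have "\<dots> \<le> (\<integral>y. B * cmod (G y) \<partial>lborel)"
  proof (rule integral_mono[OF integrable_norm[OF i]])
    show "cmod (F (mul x (- y)) * G y) \<le> B * cmod (G y)" for y
      using B by (simp add: norm_mult mult_right_mono)
  qed (use G in simp)
  finally show ?thesis by simp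
qed

lemma integrable_conv_kernel:
  fixes F G :: "real ^ ('n::{finite, linorder}) \<Rightarrow> complex"
  assumes F: "integrable lborel F" and G: "integrable lborel G"
  shows "integrable (lborel \<Otimes>\<^sub>M lborel) (\<lambda>(y, x). F (mul x (- y)) * G y)"
proof (rule lborel_pair.Fubini_integrable)
  have [measurable]: "F \<in> borel_measurable borel" "G \<in> borel_measurable borel" using F G by auto
  show "(\<lambda>(y, x). F (mul x (- y)) * G y) \<in> borel_measurable (lborel \<Otimes>\<^sub>M lborel)" by measurable
  have "(\<integral>x. norm (case (y, x) of (y, x) \<Rightarrow> F (mul x (- y)) * G y) \<partial>lborel) = (\<integral>x. cmod (F x) \<partial>lborel) * cmod (G y)" for y
    using integral_mul_right[of "\<lambda>x. cmod (F x)" "- y"] by (simp add: norm_mult)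
  then show "integrable lborel (\<lambda>y. \<integral>x. norm (case (y, x) of (y, x) \<Rightarrow> F (mul x (- y)) * G y) \<partial>lborel)"
    using G by simp
  show "AE y in lborel. integrable lborel (\<lambda>x. case (y, x) of (y, x) \<Rightarrow> F (mul x (- y)) * G y)"
    using integrable_mul_right[OF F] by auto
qed

lemma conv_integrable:
  assumes F: "integrable lborel F" and G: "integrable lborel G"
  shows "integrable lborel (conv mul F G)"
proof -
  have [measurable]: "F \<in> borel_measurable borel" "G \<in> borel_measurable borel" using F G by auto
  have "integrable lborel (\<lambda>x. \<integral>y. F (mul x (- y)) * G y \<partial>lborel)"
    using lborel_pair.integrable_snd[OF integrable_conv_kernel[OF F G]] by simp
  moreover have "conv mul F G = (\<lambda>x. \<integral>y. F (mul x (- y)) * G y \<partial>lborel)"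
    by (rule ext, rule conv_lborel) measurable
  ultimately show ?thesis by simp
qed

lemma conv_assoc:
  assumes [measurable]: "F \<in> borel_measurable borel" and B: "\<And>x. cmod (F x) \<le> B"
    and G: "integrable lborel G" and H: "integrable lborel H"
  shows "conv mul F (conv mul G H) = conv mul (conv mul F G) H"
proof
  fix x
  have [measurable]: "G \<in> borel_measurable borel" "H \<in> borel_measurable borel" using G H by auto
  have k: "integrable (lborel \<Otimes>\<^sub>M lborel) (\<lambda>(y, z). F (mul x (- z)) * (G (mul z (- y)) * H y))"
  proof (rule Bochner_Integration.integrable_bound[OF integrable_mult_right[OF integrable_norm[OF integrable_conv_kernel[OF G H]], of B]])
    have "0 \<le> B" by (rule order_trans[OF norm_ge_zero B])
    show "AE p in lborel \<Otimes>\<^sub>M lborel. norm (case p of (y, z) \<Rightarrow> F (mul x (- z)) * (G (mul z (- y)) * H y))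
      \<le> norm (B * norm (case p of (y, z) \<Rightarrow> G (mul z (- y)) * H y))"
    proof (rule AE_I2)
      fix p :: "(real ^ ('n::{finite, linorder})) \<times> (real ^ ('n::{finite, linorder}))"
      show "norm (case p of (y, z) \<Rightarrow> F (mul x (- z)) * (G (mul z (- y)) * H y))
        \<le> norm (B * norm (case p of (y, z) \<Rightarrow> G (mul z (- y)) * H y))"
        using B[of "mul x (- snd p)"] \<open>0 \<le> B\<close>
        by (cases p) (auto simp: norm_mult abs_mult intro!: mult_right_mono)
    qed
  qed measurable
  have "conv mul F (conv mul G H) x = (\<integral>z. (\<integral>y. F (mul x (- z)) * (G (mul z (- y)) * H y) \<partial>lborel) \<partial>lborel)"
    by (simp add: conv_lborel)
  also have "\<dots> = (\<integral>y. (\<integral>z. F (mul x (- z)) * (G (mul z (- y)) * H y) \<partial>lborel) \<partial>lborel)"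
    by (rule lborel_pair.Fubini_integral[OF k])
  also have "\<dots> = (\<integral>y. conv mul F G (mul x (- y)) * H y \<partial>lborel)"
  proof (intro Bochner_Integration.integral_cong refl)
    fix y
    have "(\<integral>z. F (mul x (- z)) * (G (mul z (- y)) * H y) \<partial>lborel)
       = (\<integral>g. F (mul x (- mul g y)) * (G (mul (mul g y) (- y)) * H y) \<partial>lborel)"
      by (rule integral_mul_right[symmetric]) measurable
    also have "\<dots> = (\<integral>g. F (mul (mul x (- y)) (- g)) * G g * H y \<partial>lborel)"
      by (simp add: minus_mul mul_assoc mult.assoc)
    also have "\<dots> = conv mul F G (mul x (- y)) * H y" by (simp add: conv_lborel)
    finally show "(\<integral>z. F (mul x (- z)) * (G (mul z (- y)) * H y) \<partial>lborel) = conv mul F G (mul x (- y)) * H y" .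
  qed
  also have "\<dots> = conv mul (conv mul F G) H x" by (subst conv_lborel) auto
  finally show "conv mul F (conv mul G H) x = conv mul (conv mul F G) H x" .
qed

lemma conv_dilate_right:
  assumes t: "t > 0" and [measurable]: "F \<in> borel_measurable borel" "G \<in> borel_measurable borel"
  shows "conv mul F (dilate a t G) x = (\<integral>y. F (mul x (- dil a t y)) * G y \<partial>lborel)"
  using dilate_integral[OF t, of G "\<lambda>y. F (mul x (- y))"] by (simp add: conv_lborel)

lemma conv_dilate_dilate:
  assumes t: "t > 0" "s > 0" and [measurable]: "F \<in> borel_measurable borel" "G \<in> borel_measurable borel"
  shows "conv mul (dilate a s F) (dilate a t G) = dilate a s (conv mul F (dilate a (t / s) G))"
proof
  fix x
  have "conv mul (dilate a s F) (dilate a t G) x = (\<integral>y. dilate a s F (mul x (- dil a t y)) * G y \<partial>lborel)"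
    by (rule conv_dilate_right[OF t(1)]) measurable
  also have "\<dots> = (\<integral>y. s powr (- hom_dim a) *\<^sub>R (F (mul (dil a (inverse s) x) (- dil a (t / s) y)) * G y) \<partial>lborel)"
    using t by (simp add: dilate_def dil_mul dil_minus dil_dil divide_inverse mult.commute)
  also have "\<dots> = dilate a s (conv mul F (dilate a (t / s) G)) x"
    using t by (simp add: dilate_def[of a s] conv_dilate_right)
  finally show "conv mul (dilate a s F) (dilate a t G) x = dilate a s (conv mul F (dilate a (t / s) G)) x" .
qed

lemma conv_right_translate:
  assumes [measurable]: "F \<in> borel_measurable borel" "G \<in> borel_measurable borel"
  shows "conv mul F G x = (\<integral>v. F (- v) * G (mul v x) \<partial>lborel)"
proof -
  have "conv mul F G x = (\<integral>y. F (mul x (- y)) * G y \<partial>lborel)" by (rule conv_lborel) measurable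
  also have "\<dots> = (\<integral>v. F (mul x (- mul v x)) * G (mul v x) \<partial>lborel)"
    by (rule integral_mul_right[symmetric]) measurable
  finally show ?thesis by (simp add: minus_mul)
qed

end

context homogeneous_group_norm begin

lemma schwartz_path:
  fixes \<phi> :: "real ^ ('n::{finite, linorder}) \<Rightarrow> complex"
  assumes f: "\<phi> \<in> schwartz"
  shows "\<phi> (mul v z) - \<phi> v
    = (\<integral>s. indicator {0..1} s *\<^sub>R (\<Sum>i\<in>UNIV. z $ i *\<^sub>R left_deriv mul i \<phi> (mul v (s *\<^sub>R z))) \<partial>lborel)"
proof -
  have c: "continuous_on {0..1} (\<lambda>s. \<Sum>i\<in>UNIV. z $ i *\<^sub>R left_deriv mul i \<phi> (mul v (s *\<^sub>R z)))"
  proof (intro continuous_on_sum continuous_on_scaleR continuous_on_const)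
    fix i
    show "continuous_on {0..1} (\<lambda>s. left_deriv mul i \<phi> (mul v (s *\<^sub>R z)))"
      by (rule continuous_on_compose2[OF schwartz_continuous[OF schwartz_left_deriv[OF f]]])
         (auto intro!: continuous_intros)
  qed
  have "(\<integral>s. indicator {0..1} s *\<^sub>R (\<Sum>i\<in>UNIV. z $ i *\<^sub>R left_deriv mul i \<phi> (mul v (s *\<^sub>R z))) \<partial>lborel)
     = \<phi> (mul v (1 *\<^sub>R z)) - \<phi> (mul v (0 *\<^sub>R z))"
    by (rule integral_FTC_Icc[OF _ _ c])
       (auto intro!: has_vector_derivative_at_within left_deriv_along_line schwartz_differentiable f)
  then show ?thesis by simp
qed

text \<open>Right translations preserve Haar measure, so the integral of \<open>\<phi> (v e) - \<phi> v\<close> vanishes; as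
  an integral along the path it is the integral of the derivative.\<close>

lemma integral_left_deriv:
  fixes \<phi> :: "real ^ ('n::{finite, linorder}) \<Rightarrow> complex"
  assumes f: "\<phi> \<in> schwartz"
  shows "(\<integral>x. left_deriv mul k \<phi> x \<partial>lborel) = 0"
proof -
  define X where "X = left_deriv mul k \<phi>"
  have X: "X \<in> schwartz" unfolding X_def by (rule schwartz_left_deriv[OF f])
  have [measurable]: "X \<in> borel_measurable borel" "\<phi> \<in> borel_measurable borel"
    using X f by (auto intro: schwartz_measurable)
  define e where "e = (axis k 1 :: real ^ ('n::{finite, linorder}))"
  have Xi: "integrable lborel X" by (rule schwartz_integrable[OF X])
  have path: "\<phi> (mul v e) - \<phi> v = (\<integral>s. indicator {0..1} s *\<^sub>R X (mul v (s *\<^sub>R e)) \<partial>lborel)" for v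
  proof -
    have "(\<Sum>i\<in>UNIV. e $ i *\<^sub>R left_deriv mul i \<phi> u) = X u" for u
      by (simp add: e_def X_def axis_def if_distrib[of "\<lambda>c. c *\<^sub>R _"] cong: if_cong)
    then show ?thesis using schwartz_path[OF f, of v e] by simp
  qed
  have k: "integrable (lborel \<Otimes>\<^sub>M lborel) (\<lambda>(s, v). indicator {0..1} (s::real) *\<^sub>R X (mul v (s *\<^sub>R e)))"
  proof (rule integrable_strip[where B = "\<integral>x. cmod (X x) \<partial>lborel"])
    fix s :: real
    have "(\<integral>\<^sup>+v. ennreal (norm (case (s, v) of (s, v) \<Rightarrow> indicator {0..1} s *\<^sub>R X (mul v (s *\<^sub>R e)))) \<partial>lborel)
       = indicator {0..1} s * (\<integral>\<^sup>+v. ennreal (cmod (X (mul v (s *\<^sub>R e)))) \<partial>lborel)"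
      by (auto split: split_indicator)
    also have "(\<integral>\<^sup>+v. ennreal (cmod (X (mul v (s *\<^sub>R e)))) \<partial>lborel) = (\<integral>\<^sup>+v. ennreal (cmod (X v)) \<partial>lborel)"
      by (rule nn_integral_mul_right) measurable
    also have "\<dots> = ennreal (\<integral>x. cmod (X x) \<partial>lborel)"
      using Xi by (intro nn_integral_eq_integral) auto
    finally show "(\<integral>\<^sup>+v. ennreal (norm (case (s, v) of (s, v) \<Rightarrow> indicator {0..1} s *\<^sub>R X (mul v (s *\<^sub>R e)))) \<partial>lborel)
      \<le> ennreal (\<integral>x. cmod (X x) \<partial>lborel) * indicator {0..1} s" by (simp add: mult.commute)
  qed measurable
  have "0 = (\<integral>v. \<phi> (mul v e) - \<phi> v \<partial>lborel)"
    using schwartz_integrable[OF f] integrable_mul_right[OF schwartz_integrable[OF f]]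
    by (subst Bochner_Integration.integral_diff) (auto simp: integral_mul_right)
  also have "\<dots> = (\<integral>v. (\<integral>s. indicator {0..1} s *\<^sub>R X (mul v (s *\<^sub>R e)) \<partial>lborel) \<partial>lborel)"
    by (simp add: path)
  also have "\<dots> = (\<integral>s. (\<integral>v. indicator {0..1} s *\<^sub>R X (mul v (s *\<^sub>R e)) \<partial>lborel) \<partial>lborel)"
    by (rule lborel_pair.Fubini_integral[OF k])
  also have "\<dots> = (\<integral>s. indicator {0..1} s *\<^sub>R (\<integral>v. X v \<partial>lborel) \<partial>(lborel :: real measure))"
    by (simp add: integral_mul_right)
  also have "\<dots> = (\<integral>v. X v \<partial>lborel)" by simp
  finally show ?thesis by (simp add: X_def)
qed

text \<open>The mean value theorem along the path \<open>s \<mapsto> x (s y)\<close>. The decay in \<open>x\<close> is recovered from the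
  decay at the intermediate point at the expense of a power of \<open>1 + \<rho> y\<close>.\<close>

lemma schwartz_difference:
  fixes \<eta> :: "real ^ ('n::{finite, linorder}) \<Rightarrow> complex"
  assumes f: "\<eta> \<in> schwartz" and L: "L \<ge> 0"
  shows "\<exists>C>0. \<forall>x y. cmod (\<eta> (mul x y) - \<eta> x) \<le> C * (\<rho> y * (1 + \<rho> y) powr (hom_dim a + L)) * (1 + \<rho> x) powr (- L)"
proof -
  have "\<exists>C>0. \<forall>x. cmod (left_deriv mul i \<eta> x) \<le> C * (1 + \<rho> x) powr (- L)" for i
    using schwartz_rho_decay[OF schwartz_left_deriv[OF f], of i L] by blast
  then obtain C where C: "\<And>i. C i > 0" "\<And>i x. cmod (left_deriv mul i \<eta> x) \<le> C i * (1 + \<rho> x) powr (- L)" by metis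
  define K where "K = (\<Sum>i\<in>UNIV. C i) * c0 powr L"
  have K: "K > 0" unfolding K_def using C(1) c0(1) by (intro mult_pos_pos sum_pos) auto
  have "cmod (\<eta> (mul x y) - \<eta> x) \<le> K * (\<rho> y * (1 + \<rho> y) powr (hom_dim a + L)) * (1 + \<rho> x) powr (- L)" for x y
  proof -
    define G where "G = (\<lambda>s. \<Sum>i\<in>UNIV. y $ i *\<^sub>R left_deriv mul i \<eta> (mul x (s *\<^sub>R y)))"
    have der: "((\<lambda>s. \<eta> (mul x (s *\<^sub>R y))) has_vector_derivative G s) (at s)" for s
      unfolding G_def by (rule left_deriv_along_line[OF schwartz_differentiable[OF f]])
    have "\<exists>s\<in>{0<..<1}. norm (\<eta> (mul x (1 *\<^sub>R y)) - \<eta> (mul x (0 *\<^sub>R y))) \<le> norm ((1 - 0) *\<^sub>R G s)"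
    proof (rule mvt_general[of 0 1 "\<lambda>s. \<eta> (mul x (s *\<^sub>R y))" "\<lambda>s h. h *\<^sub>R G s"])
      show "continuous_on {0..1} (\<lambda>s. \<eta> (mul x (s *\<^sub>R y)))"
        using der by (meson continuous_at_imp_continuous_on has_vector_derivative_continuous)
    qed (use der in \<open>auto simp: has_vector_derivative_def\<close>)
    then obtain s where s: "0 < s" "s < 1" "cmod (\<eta> (mul x y) - \<eta> x) \<le> cmod (G s)" by auto
    define w where "w = mul x (s *\<^sub>R y)"
    have "x = mul w (- (s *\<^sub>R y))" by (simp add: w_def mul_assoc)
    then have "1 + \<rho> x \<le> c0 * ((1 + \<rho> w) * (1 + \<rho> (s *\<^sub>R y)))"
      using one_plus_rho_mul[of w "- (s *\<^sub>R y)"] by simp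
    also have "\<dots> \<le> c0 * ((1 + \<rho> w) * (1 + \<rho> y))"
      using rho_scaleR_le[of s y] s c0(1) by (intro mult_left_mono) auto
    finally have "(1 + \<rho> x) powr L \<le> (c0 * ((1 + \<rho> w) * (1 + \<rho> y))) powr L"
      using L by (intro powr_mono2) auto
    also have "\<dots> = c0 powr L * ((1 + \<rho> w) powr L * (1 + \<rho> y) powr L)"
      using c0(1) by (simp add: powr_mult less_imp_le)
    finally have w: "(1 + \<rho> w) powr (- L) \<le> c0 powr L * (1 + \<rho> y) powr L * (1 + \<rho> x) powr (- L)"
      by (simp add: powr_minus field_simps)
    have yi: "\<bar>y $ i\<bar> \<le> \<rho> y * (1 + \<rho> y) powr hom_dim a" for i
    proof -
      have "\<bar>y $ i\<bar> \<le> \<rho> y powr a i" by (rule coord_le_rho)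
      also have "\<dots> = \<rho> y * \<rho> y powr (a i - 1)" 
        using powr_mult_base[of "\<rho> y" "a i - 1"] by simp
      also have "\<rho> y powr (a i - 1) \<le> (1 + \<rho> y) powr (a i - 1)"
        using a_ge_1[of i] by (intro powr_mono2) auto
      also have "(1 + \<rho> y) powr (a i - 1) \<le> (1 + \<rho> y) powr hom_dim a"
      proof (rule powr_mono)
        have "a i \<le> hom_dim a" unfolding hom_dim_def
          using order_trans[OF zero_le_one a_ge_1] by (intro member_le_sum) auto
        then show "a i - 1 \<le> hom_dim a" by simp
      qed simp
      finally show ?thesis by (simp add: mult_left_mono)
    qed
    have "cmod (G s) \<le> (\<Sum>i\<in>UNIV. \<bar>y $ i\<bar> * cmod (left_deriv mul i \<eta> w))"
      unfolding G_def w_def by (rule order_trans[OF norm_sum]) simp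
    also have "\<dots> \<le> (\<Sum>i\<in>UNIV. (\<rho> y * (1 + \<rho> y) powr hom_dim a) * (C i * (c0 powr L * (1 + \<rho> y) powr L * (1 + \<rho> x) powr (- L))))"
    proof (intro sum_mono mult_mono yi)
      fix i
      have "cmod (left_deriv mul i \<eta> w) \<le> C i * (1 + \<rho> w) powr (- L)" by (rule C)
      also have "\<dots> \<le> C i * (c0 powr L * (1 + \<rho> y) powr L * (1 + \<rho> x) powr (- L))"
        using C(1)[of i] by (intro mult_left_mono w) auto
      finally show "cmod (left_deriv mul i \<eta> w) \<le> C i * (c0 powr L * (1 + \<rho> y) powr L * (1 + \<rho> x) powr (- L))" .
    qed auto
    also have "\<dots> = K * (\<rho> y * (1 + \<rho> y) powr (hom_dim a + L)) * (1 + \<rho> x) powr (- L)"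
      by (simp add: K_def powr_add sum_distrib_left[symmetric] sum_distrib_right[symmetric] mult_ac)
    finally show ?thesis using s(3) by linarith
  qed
  then show ?thesis using K by blast
qed

text \<open>As the integral of \<open>\<psi>\<close> vanishes, \<open>\<eta> x\<close> may be subtracted under the integral; the increments
  of \<open>\<eta>\<close> supply the factor \<open>t\<close>.\<close>

lemma conv_cancellation:
  fixes \<eta> :: "real ^ ('n::{finite, linorder}) \<Rightarrow> complex"
  assumes \<eta>: "\<eta> \<in> schwartz" and \<psi>: "\<psi> \<in> schwartz" and z: "(\<integral>x. \<psi> x \<partial>lborel) = 0" and L: "L \<ge> 0"
  shows "\<exists>C>0. \<forall>t x. 0 < t \<longrightarrow> t \<le> 1 \<longrightarrow> cmod (conv mul \<eta> (dilate a t \<psi>) x) \<le> C * t * (1 + \<rho> x) powr (- L)"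
proof -
  note [measurable] = schwartz_measurable[OF \<eta>] schwartz_measurable[OF \<psi>]
  obtain C where C: "C > 0" "\<And>x y. cmod (\<eta> (mul x y) - \<eta> x) \<le> C * (\<rho> y * (1 + \<rho> y) powr (hom_dim a + L)) * (1 + \<rho> x) powr (- L)"
    using schwartz_difference[OF \<eta> L] by blast
  define g where "g = (\<lambda>y. \<rho> y * (1 + \<rho> y) powr (hom_dim a + L) * cmod (\<psi> y))"
  have [measurable]: "g \<in> borel_measurable borel" unfolding g_def by measurable
  have g_nonneg: "g y \<ge> 0" for y by (simp add: g_def)
  have gi: "integrable lborel g"
  proof -
    obtain P where P: "P > 0" "\<And>x. cmod (\<psi> x) \<le> P * (1 + \<rho> x) powr (- (hom_dim a + L + 1 + (hom_dim a + 1)))"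
      using schwartz_rho_decay[OF \<psi>] by blast
    have "g y \<le> P * (1 + \<rho> y) powr (- (hom_dim a + 1))" for y
    proof -
      have "g y \<le> (1 + \<rho> y) * (1 + \<rho> y) powr (hom_dim a + L) * (P * (1 + \<rho> y) powr (- (hom_dim a + L + 1 + (hom_dim a + 1))))"
        unfolding g_def by (intro mult_mono P(2)) auto
      also have "\<dots> = P * (1 + \<rho> y) powr (1 + (hom_dim a + L) + (- (hom_dim a + L + 1 + (hom_dim a + 1))))"
        by (simp only: powr_add powr_one[OF one_plus_rho(2)[THEN order_trans[OF zero_le_one]]] mult_ac)
      finally show ?thesis by (simp add: algebra_simps)
    qed
    then show ?thesis
      using integrable_of_rho_decay[of "\<lambda>y. complex_of_real (g y)" "hom_dim a + 1" P] g_nonneg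
      by (simp add: abs_of_nonneg complex_of_real_integrable_eq)
  qed
  define K where "K = C * ((\<integral>y. g y \<partial>lborel) + 1)"
  have "cmod (conv mul \<eta> (dilate a t \<psi>) x) \<le> K * t * (1 + \<rho> x) powr (- L)" if t: "0 < t" "t \<le> 1" for t x
  proof -
    define h where "h = (\<lambda>y. (\<eta> (mul x (- dil a t y)) - \<eta> x) * \<psi> y)"
    have hg: "cmod (h y) \<le> C * t * (1 + \<rho> x) powr (- L) * g y" for y
    proof -
      have "cmod (\<eta> (mul x (- dil a t y)) - \<eta> x) \<le> C * ((t * \<rho> y) * (1 + t * \<rho> y) powr (hom_dim a + L)) * (1 + \<rho> x) powr (- L)"
        using C(2)[of x "- dil a t y"] t by (simp add: rho_dil)
      also have "\<dots> \<le> C * ((t * \<rho> y) * (1 + \<rho> y) powr (hom_dim a + L)) * (1 + \<rho> x) powr (- L)"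
      proof (intro mult_right_mono mult_left_mono powr_mono2)
        show "0 \<le> hom_dim a + L" using hom_dim_ge_1 L by simp
        show "1 + t * \<rho> y \<le> 1 + \<rho> y" using t mult_right_mono[of t 1 "\<rho> y"] by simp
      qed (use t C(1) in auto)
      finally have "cmod (h y) \<le> C * ((t * \<rho> y) * (1 + \<rho> y) powr (hom_dim a + L)) * (1 + \<rho> x) powr (- L) * cmod (\<psi> y)"
        unfolding h_def norm_mult by (intro mult_right_mono) auto
      then show ?thesis by (simp add: g_def mult_ac)
    qed
    have i1: "integrable lborel (\<lambda>y. C * t * (1 + \<rho> x) powr (- L) * g y)" using gi by simp
    have hi: "integrable lborel h"
      by (rule Bochner_Integration.integrable_bound[OF i1])
         (use hg g_nonneg C(1) t in \<open>auto simp: h_def abs_mult intro: order_trans[OF hg]\<close>)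
    have "conv mul \<eta> (dilate a t \<psi>) x = (\<integral>y. h y + \<eta> x * \<psi> y \<partial>lborel)"
      by (subst conv_dilate_right[OF t(1)]) (auto simp: h_def algebra_simps)
    also have "\<dots> = (\<integral>y. h y \<partial>lborel)"
      using hi schwartz_integrable[OF \<psi>] z by simp
    finally have "cmod (conv mul \<eta> (dilate a t \<psi>) x) \<le> (\<integral>y. cmod (h y) \<partial>lborel)" by simp
    also have "\<dots> \<le> (\<integral>y. C * t * (1 + \<rho> x) powr (- L) * g y \<partial>lborel)"
      using hi i1 by (intro integral_mono hg) auto
    also have "\<dots> = C * t * (1 + \<rho> x) powr (- L) * (\<integral>y. g y \<partial>lborel)" by simp
    also have "\<dots> \<le> C * t * (1 + \<rho> x) powr (- L) * ((\<integral>y. g y \<partial>lborel) + 1)"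
      using C(1) t by (intro mult_left_mono) auto
    finally show ?thesis by (simp add: K_def mult_ac)
  qed
  moreover have "K > 0"
    unfolding K_def using C(1) g_nonneg by (intro mult_pos_pos add_nonneg_pos integral_nonneg) auto
  ultimately show ?thesis by blast
qed

text \<open>The increment is moved onto the dilated \<open>\<phi>\<close> and written as an integral along the path from
  \<open>u\<close> to \<open>u z\<close>; interchanging the integrals produces the convolutions with \<open>X\<^sub>i \<phi>\<close>. The powers
  of \<open>\<tau>\<close> come from the homogeneity of the vector fields.\<close>

lemma conv_difference_bound:
  fixes f \<phi> :: "real ^ ('n::{finite, linorder}) \<Rightarrow> complex"
  assumes f: "f \<in> schwartz" and \<phi>: "\<phi> \<in> schwartz" and \<tau>: "\<tau> > 0"
    and b: "\<And>i s. 0 \<le> s \<Longrightarrow> s \<le> 1 \<Longrightarrow> cmod (conv mul f (dilate a \<tau> (left_deriv mul i \<phi>)) (mul u (s *\<^sub>R z))) \<le> b i"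
  shows "cmod (conv mul f (dilate a \<tau> \<phi>) (mul u z) - conv mul f (dilate a \<tau> \<phi>) u) \<le> (\<Sum>i\<in>UNIV. \<bar>z $ i\<bar> * \<tau> powr (- a i) * b i)"
proof -
  define X where "X = (\<lambda>i. dilate a \<tau> (left_deriv mul i \<phi>))"
  define \<phi>t where "\<phi>t = dilate a \<tau> \<phi>"
  note [measurable] = schwartz_measurable[OF f] schwartz_measurable[OF \<phi>] schwartz_measurable[OF schwartz_left_deriv[OF \<phi>]]
  have [measurable]: "X i \<in> borel_measurable borel" "\<phi>t \<in> borel_measurable borel" for i
    unfolding X_def \<phi>t_def by measurable
  define d where "d = (\<lambda>i. z $ i * \<tau> powr (- a i))"
  have path: "\<phi>t (mul w z) - \<phi>t w = (\<integral>s. indicator {0..1} s *\<^sub>R (\<Sum>i\<in>UNIV. d i *\<^sub>R X i (mul w (s *\<^sub>R z))) \<partial>lborel)" for w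
  proof -
    define \<delta> where "\<delta> = dil a (inverse \<tau>)"
    have \<delta>: "\<delta> (mul x y) = mul (\<delta> x) (\<delta> y)" for x y unfolding \<delta>_def using \<tau> by (intro dil_mul) auto
    have \<delta>i: "\<delta> z $ i = d i" for i
      using \<tau> by (simp add: \<delta>_def d_def powr_minus inverse_powr)
    have "\<phi>t (mul w z) - \<phi>t w = \<tau> powr (- hom_dim a) *\<^sub>R (\<phi> (mul (\<delta> w) (\<delta> z)) - \<phi> (\<delta> w))"
      unfolding \<phi>t_def dilate_def \<delta>_def[symmetric] \<delta> by (simp add: scaleR_diff_right)
    also have "\<dots> = (\<integral>s. \<tau> powr (- hom_dim a) *\<^sub>R indicator {0..1} s *\<^sub>R (\<Sum>i\<in>UNIV. \<delta> z $ i *\<^sub>R left_deriv mul i \<phi> (mul (\<delta> w) (s *\<^sub>R \<delta> z))) \<partial>lborel)"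
      unfolding schwartz_path[OF \<phi>] by (rule integral_scaleR_right[symmetric])
    also have "\<dots> = (\<integral>s. indicator {0..1} s *\<^sub>R (\<Sum>i\<in>UNIV. d i *\<^sub>R X i (mul w (s *\<^sub>R z))) \<partial>lborel)"
    proof (intro Bochner_Integration.integral_cong refl)
      fix s :: real
      have "X i (mul w (s *\<^sub>R z)) = \<tau> powr (- hom_dim a) *\<^sub>R left_deriv mul i \<phi> (mul (\<delta> w) (s *\<^sub>R \<delta> z))" for i
        unfolding X_def dilate_def \<delta>_def[symmetric] \<delta> by (simp add: \<delta>_def dil_scaleR)
      then show "\<tau> powr (- hom_dim a) *\<^sub>R indicator {0..1} s *\<^sub>R (\<Sum>i\<in>UNIV. \<delta> z $ i *\<^sub>R left_deriv mul i \<phi> (mul (\<delta> w) (s *\<^sub>R \<delta> z)))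
        = indicator {0..1} s *\<^sub>R (\<Sum>i\<in>UNIV. d i *\<^sub>R X i (mul w (s *\<^sub>R z)))"
        by (simp add: \<delta>i scaleR_sum_right mult_ac)
    qed
    finally show ?thesis .
  qed
  have "\<exists>C>0. \<forall>x. cmod (X i x) \<le> C" for i
  proof -
    obtain C where "C > 0" "\<And>x. cmod (left_deriv mul i \<phi> x) \<le> C" using schwartz_bounded[OF schwartz_left_deriv[OF \<phi>]] by blast
    then show ?thesis using \<tau>
      by (intro exI[of _ "\<tau> powr (- hom_dim a) * C"]) (auto simp: X_def dilate_def)
  qed
  then obtain C where C: "\<And>i. C i > 0" "\<And>i x. cmod (X i x) \<le> C i" by metis
  obtain P where P: "P > 0" "\<And>x. cmod (\<phi> x) \<le> P" using schwartz_bounded[OF \<phi>] by blast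
  have fi: "integrable lborel (\<lambda>v. f (- v))" by (rule integrable_minus_arg[OF schwartz_integrable[OF f]])
  have bi: "integrable lborel (\<lambda>v. f (- v) * h v)" if [measurable]: "h \<in> borel_measurable borel" and "\<And>v. cmod (h v) \<le> B" for h B
    by (rule Bochner_Integration.integrable_bound[OF integrable_mult_left[OF integrable_norm[OF fi], of B]])
       (use that(2) order_trans[OF norm_ge_zero that(2)] in \<open>auto simp: norm_mult abs_mult intro!: mult_left_mono\<close>)
  have \<phi>tb: "cmod (\<phi>t v) \<le> \<tau> powr (- hom_dim a) * P" for v using P(2) \<tau> by (simp add: \<phi>t_def dilate_def)
  define B where "B = (\<Sum>i\<in>UNIV. \<bar>d i\<bar> * C i)"
  have B0: "B \<ge> 0"
    unfolding B_def using C(1) by (intro sum_nonneg mult_nonneg_nonneg) (auto simp: less_imp_le)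
  define k where "k = (\<lambda>s v. f (- v) * (indicator {0..1} s *\<^sub>R (\<Sum>i\<in>UNIV. d i *\<^sub>R X i (mul (mul v u) (s *\<^sub>R z)))))"
  have ki: "integrable (lborel \<Otimes>\<^sub>M lborel) (\<lambda>(s, v). k s v)"
  proof (rule integrable_strip[where B = "(\<integral>v. cmod (f (- v)) \<partial>lborel) * B"])
    show "(\<lambda>(s, v). k s v) \<in> borel_measurable (lborel \<Otimes>\<^sub>M lborel)" unfolding k_def by measurable
    fix s :: real
    have "norm (k s v) \<le> cmod (f (- v)) * B * indicator {0..1} s" for v
    proof -
      have "cmod (\<Sum>i\<in>UNIV. d i *\<^sub>R X i (mul (mul v u) (s *\<^sub>R z))) \<le> B"
        unfolding B_def by (rule sum_norm_le) (use C(2) in \<open>auto intro!: mult_left_mono\<close>)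
      then show ?thesis by (auto simp: k_def norm_mult split: split_indicator intro!: mult_left_mono)
    qed
    then have "(\<integral>\<^sup>+v. ennreal (norm (k s v)) \<partial>lborel) \<le> (\<integral>\<^sup>+v. ennreal (cmod (f (- v)) * B * indicator {0..1} s) \<partial>lborel)"
      by (intro nn_integral_mono ennreal_leI)
    also have "\<dots> = ennreal (\<integral>v. cmod (f (- v)) * B * indicator {0..1} s \<partial>lborel)"
      using fi B0 by (intro nn_integral_eq_integral) auto
    finally show "(\<integral>\<^sup>+v. ennreal (norm (case (s, v) of (s, v) \<Rightarrow> k s v)) \<partial>lborel)
      \<le> ennreal ((\<integral>v. cmod (f (- v)) \<partial>lborel) * B) * indicator {0..1} s"
      by (auto split: split_indicator)
  qed
  have "conv mul f \<phi>t (mul u z) - conv mul f \<phi>t u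
     = (\<integral>v. f (- v) * \<phi>t (mul (mul v u) z) \<partial>lborel) - (\<integral>v. f (- v) * \<phi>t (mul v u) \<partial>lborel)"
    by (simp add: conv_right_translate mul_assoc)
  also have "\<dots> = (\<integral>v. f (- v) * (\<phi>t (mul (mul v u) z) - \<phi>t (mul v u)) \<partial>lborel)"
    by (subst Bochner_Integration.integral_diff[symmetric]) (auto intro!: bi \<phi>tb simp: right_diff_distrib)
  also have "\<dots> = (\<integral>v. (\<integral>s. k s v \<partial>lborel) \<partial>lborel)"
    unfolding path k_def by (simp flip: integral_mult_right_zero)
  also have "\<dots> = (\<integral>s. (\<integral>v. k s v \<partial>lborel) \<partial>lborel)"
    by (rule lborel_pair.Fubini_integral[OF ki])
  finally have eq: "conv mul f \<phi>t (mul u z) - conv mul f \<phi>t u = (\<integral>s. (\<integral>v. k s v \<partial>lborel) \<partial>lborel)" .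
  have inner: "(\<integral>v. k s v \<partial>lborel) = indicator {0..1} s *\<^sub>R (\<Sum>i\<in>UNIV. d i *\<^sub>R conv mul f (X i) (mul u (s *\<^sub>R z)))" for s
  proof -
    have "(\<integral>v. k s v \<partial>lborel) = (\<integral>v. indicator {0..1} s *\<^sub>R (\<Sum>i\<in>UNIV. d i *\<^sub>R (f (- v) * X i (mul v (mul u (s *\<^sub>R z))))) \<partial>lborel)"
      by (simp add: k_def sum_distrib_left mul_assoc)
    also have "\<dots> = indicator {0..1} s *\<^sub>R (\<Sum>i\<in>UNIV. d i *\<^sub>R (\<integral>v. f (- v) * X i (mul v (mul u (s *\<^sub>R z))) \<partial>lborel))"
    proof -
      have "integrable lborel (\<lambda>v. f (- v) * X i (mul v w))" for i w
        by (rule bi[where B = "C i"]) (use C(2) in auto)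
      then show ?thesis
        by (subst integral_scaleR_right, subst Bochner_Integration.integral_sum) auto
    qed
    finally show ?thesis by (simp add: conv_right_translate)
  qed
  define R where "R = (\<Sum>i\<in>UNIV. \<bar>z $ i\<bar> * \<tau> powr (- a i) * b i)"
  have inner_b: "norm (\<integral>v. k s v \<partial>lborel) \<le> R * indicator {0..1} s" for s
  proof (cases "s \<in> {0..1}")
    case True
    have "norm (\<Sum>i\<in>UNIV. d i *\<^sub>R conv mul f (X i) (mul u (s *\<^sub>R z))) \<le> R"
      unfolding R_def using True b[of s]
      by (intro sum_norm_le) (auto simp: d_def X_def abs_mult intro!: mult_left_mono)
    then show ?thesis using True by (simp add: inner)
  qed (simp add: inner)
  have "cmod (conv mul f \<phi>t (mul u z) - conv mul f \<phi>t u) \<le> (\<integral>s. norm (\<integral>v. k s v \<partial>lborel) \<partial>lborel)"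
    unfolding eq by (rule integral_norm_bound)
  also have "\<dots> \<le> (\<integral>s. R * indicator {0..1} s \<partial>(lborel :: real measure))"
  proof (rule integral_mono')
    show "0 \<le> R * indicator {0..1} s" for s :: real by (rule order_trans[OF norm_ge_zero inner_b])
  qed (use inner_b in auto)
  also have "\<dots> = R" by simp
  finally show ?thesis by (simp add: R_def \<phi>t_def)
qed

end

section \<open>Sums over the integers\<close>

lemma sum_le_nn_integral_count_space:
  fixes g :: "'i \<Rightarrow> ennreal"
  assumes "finite I"
  shows "sum g I \<le> (\<integral>\<^sup>+i. g i \<partial>count_space UNIV)"
proof -
  have "sum g I = (\<integral>\<^sup>+i. g i * indicator I i \<partial>count_space UNIV)"
    using assms by (subst nn_integral_indicator_finite) auto
  also have "\<dots> \<le> (\<integral>\<^sup>+i. g i \<partial>count_space UNIV)"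
    by (intro nn_integral_mono) (auto split: split_indicator)
  finally show ?thesis .
qed

lemma geometric_int_finite:
  assumes "0 \<le> e" "e < 1"
  shows "(\<integral>\<^sup>+i. ennreal (e ^ nat \<bar>i\<bar>) \<partial>count_space (UNIV :: int set)) < top"
proof -
  have "(\<integral>\<^sup>+i. ennreal (e ^ nat \<bar>i\<bar>) \<partial>count_space (UNIV :: int set))
     \<le> (\<integral>\<^sup>+i. (\<integral>\<^sup>+n. ennreal (e ^ n) * indicator {int n, - int n} i \<partial>count_space UNIV) \<partial>count_space UNIV)"
  proof (intro nn_integral_mono)
    fix i :: int
    have "ennreal (e ^ nat \<bar>i\<bar>) = ennreal (e ^ nat \<bar>i\<bar>) * indicator {int (nat \<bar>i\<bar>), - int (nat \<bar>i\<bar>)} i"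
      by (auto split: split_indicator)
    also have "\<dots> \<le> (\<integral>\<^sup>+n. ennreal (e ^ n) * indicator {int n, - int n} i \<partial>count_space UNIV)"
      by (rule nn_integral_ge_point) simp
    finally show "ennreal (e ^ nat \<bar>i\<bar>) \<le> (\<integral>\<^sup>+n. ennreal (e ^ n) * indicator {int n, - int n} i \<partial>count_space UNIV)" .
  qed
  also have "\<dots> = (\<integral>\<^sup>+n. (\<integral>\<^sup>+i. ennreal (e ^ n) * indicator {int n, - int n} i \<partial>count_space UNIV) \<partial>count_space UNIV)"
    by (intro nn_integral_count_space_nn_integral) auto
  also have "\<dots> \<le> (\<integral>\<^sup>+n. ennreal (2 * e ^ n) \<partial>count_space UNIV)"
  proof (intro nn_integral_mono)
    fix n :: nat
    have "(\<integral>\<^sup>+i. ennreal (e ^ n) * indicator {int n, - int n} i \<partial>count_space UNIV)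
       = ennreal (e ^ n) * of_nat (card {int n, - int n})"
      by (subst nn_integral_cmult_indicator) auto
    also have "\<dots> \<le> ennreal (e ^ n) * of_nat 2"
      by (intro mult_left_mono of_nat_mono card_insert_le_m1) auto
    also have "\<dots> = ennreal (2 * e ^ n)" using assms by (simp add: ennreal_mult mult.commute)
    finally show "(\<integral>\<^sup>+i. ennreal (e ^ n) * indicator {int n, - int n} i \<partial>count_space UNIV) \<le> ennreal (2 * e ^ n)" .
  qed
  also have "\<dots> = (\<Sum>n. ennreal (2 * e ^ n))" by (rule nn_integral_count_space_nat)
  also have "\<dots> = ennreal (2 * (1 / (1 - e)))"
  proof -
    have "(\<lambda>n. 2 * e ^ n) sums (2 * (1 / (1 - e)))" using geometric_sums[of e] assms by (intro sums_mult) auto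
    then show ?thesis using assms by (intro sums_unique[symmetric] sums_ennreal[THEN iffD2]) auto
  qed
  also have "\<dots> < top" by simp
  finally show ?thesis .
qed

lemma geometric_int_translate:
  fixes e :: real and k :: int
  shows "(\<integral>\<^sup>+j. ennreal (e ^ nat \<bar>k - j\<bar>) \<partial>count_space UNIV) = (\<integral>\<^sup>+i. ennreal (e ^ nat \<bar>i\<bar>) \<partial>count_space UNIV)"
    and "(\<integral>\<^sup>+j. ennreal (e ^ nat \<bar>j - k\<bar>) \<partial>count_space UNIV) = (\<integral>\<^sup>+i. ennreal (e ^ nat \<bar>i\<bar>) \<partial>count_space UNIV)"
proof -
  have "bij (\<lambda>j. k - j)" by (rule o_bij[of "\<lambda>j. k - j"]) auto
  then show "(\<integral>\<^sup>+j. ennreal (e ^ nat \<bar>k - j\<bar>) \<partial>count_space UNIV) = (\<integral>\<^sup>+i. ennreal (e ^ nat \<bar>i\<bar>) \<partial>count_space UNIV)"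
    by (rule nn_integral_bij_count_space)
  then show "(\<integral>\<^sup>+j. ennreal (e ^ nat \<bar>j - k\<bar>) \<partial>count_space UNIV) = (\<integral>\<^sup>+i. ennreal (e ^ nat \<bar>i\<bar>) \<partial>count_space UNIV)"
    by (simp add: abs_minus_commute)
qed

text \<open>Half of the geometric weight is spent on \<open>epowr_weighted_count_space\<close>, and the other half is
  summed after the sums are interchanged.\<close>

lemma discrete_convolution_lq:
  assumes c: "0 < c" "c < 1" and q: "q > 0"
  shows "\<exists>C>0. \<forall>u :: int \<Rightarrow> ennreal.
    (\<integral>\<^sup>+k. epowr (\<integral>\<^sup>+j. ennreal (c ^ nat \<bar>k - j\<bar>) * u j \<partial>count_space UNIV) q \<partial>count_space UNIV)
      \<le> ennreal C * (\<integral>\<^sup>+j. epowr (u j) q \<partial>count_space UNIV)"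
proof -
  define e where "e = sqrt c"
  have e: "0 < e" "e < 1" using c by (auto simp: e_def)
  define d where "d = e powr q"
  have d: "0 < d" "d < 1" using e q powr_less_mono2[of q e 1] by (auto simp: d_def)
  have e1: "\<bar>e\<bar> < 1" using e by simp
  obtain E where E: "(\<integral>\<^sup>+i. ennreal (e ^ nat \<bar>i\<bar>) \<partial>count_space (UNIV :: int set)) = ennreal E" "E \<ge> 0"
    using geometric_int_finite[of e] e by (cases "\<integral>\<^sup>+i. ennreal (e ^ nat \<bar>i\<bar>) \<partial>count_space (UNIV :: int set)") auto
  obtain E' where E': "(\<integral>\<^sup>+i. ennreal (d ^ nat \<bar>i\<bar>) \<partial>count_space (UNIV :: int set)) = ennreal E'" "E' \<ge> 0"
    using geometric_int_finite[of d] d by (cases "\<integral>\<^sup>+i. ennreal (d ^ nat \<bar>i\<bar>) \<partial>count_space (UNIV :: int set)") auto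
  show ?thesis
  proof (intro exI[of _ "E powr q * E' + 1"] conjI allI)
    show "E powr q * E' + 1 > 0" using E' by (intro add_nonneg_pos mult_nonneg_nonneg) auto
    fix u :: "int \<Rightarrow> ennreal"
    have pt: "epowr (\<integral>\<^sup>+j. ennreal (c ^ nat \<bar>k - j\<bar>) * u j \<partial>count_space UNIV) q
      \<le> ennreal (E powr q) * (\<integral>\<^sup>+j. ennreal (d ^ nat \<bar>k - j\<bar>) * epowr (u j) q \<partial>count_space UNIV)" for k
    proof -
      have "ennreal (c ^ m) = ennreal (e ^ m) * ennreal (e ^ m)" for m
        using c by (simp add: e_def power_mult_distrib[symmetric] flip: ennreal_mult)
      then have "epowr (\<integral>\<^sup>+j. ennreal (c ^ nat \<bar>k - j\<bar>) * u j \<partial>count_space UNIV) q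
         = epowr (\<integral>\<^sup>+j. ennreal (e ^ nat \<bar>k - j\<bar>) * (ennreal (e ^ nat \<bar>k - j\<bar>) * u j) \<partial>count_space UNIV) q"
        by (simp only: mult.assoc)
      also have "\<dots> \<le> epowr (\<integral>\<^sup>+j. ennreal (e ^ nat \<bar>k - j\<bar>) \<partial>count_space UNIV) q *
          (\<integral>\<^sup>+j. epowr (ennreal (e ^ nat \<bar>k - j\<bar>) * u j) q \<partial>count_space UNIV)"
        by (rule epowr_weighted_count_space[OF q])
      also have "epowr (\<integral>\<^sup>+j. ennreal (e ^ nat \<bar>k - j\<bar>) \<partial>count_space UNIV) q = ennreal (E powr q)"
        using E by (simp add: geometric_int_translate epowr_ennreal)
      also have "(\<lambda>j. epowr (ennreal (e ^ nat \<bar>k - j\<bar>) * u j) q) = (\<lambda>j. ennreal (d ^ nat \<bar>k - j\<bar>) * epowr (u j) q)"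
        using e by (simp add: epowr_mult epowr_ennreal power_powr_swap d_def)
      finally show ?thesis .
    qed
    have "(\<integral>\<^sup>+k. epowr (\<integral>\<^sup>+j. ennreal (c ^ nat \<bar>k - j\<bar>) * u j \<partial>count_space UNIV) q \<partial>count_space UNIV)
      \<le> (\<integral>\<^sup>+k. ennreal (E powr q) * (\<integral>\<^sup>+j. ennreal (d ^ nat \<bar>k - j\<bar>) * epowr (u j) q \<partial>count_space UNIV) \<partial>count_space UNIV)"
      by (intro nn_integral_mono pt)
    also have "\<dots> = ennreal (E powr q) * (\<integral>\<^sup>+k. (\<integral>\<^sup>+j. ennreal (d ^ nat \<bar>k - j\<bar>) * epowr (u j) q \<partial>count_space UNIV) \<partial>count_space UNIV)"
      by (rule nn_integral_cmult) auto
    also have "(\<integral>\<^sup>+k. (\<integral>\<^sup>+j. ennreal (d ^ nat \<bar>k - j\<bar>) * epowr (u j) q \<partial>count_space UNIV) \<partial>count_space UNIV)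
      = (\<integral>\<^sup>+j. (\<integral>\<^sup>+k. ennreal (d ^ nat \<bar>k - j\<bar>) * epowr (u j) q \<partial>count_space UNIV) \<partial>count_space UNIV)"
      by (intro nn_integral_count_space_nn_integral) auto
    also have "\<dots> = (\<integral>\<^sup>+j. ennreal E' * epowr (u j) q \<partial>count_space UNIV)"
      by (subst nn_integral_multc) (auto simp: geometric_int_translate E')
    also have "\<dots> = ennreal E' * (\<integral>\<^sup>+j. epowr (u j) q \<partial>count_space UNIV)"
      by (rule nn_integral_cmult) auto
    also have "ennreal (E powr q) * (ennreal E' * (\<integral>\<^sup>+j. epowr (u j) q \<partial>count_space UNIV))
      = ennreal (E powr q * E') * (\<integral>\<^sup>+j. epowr (u j) q \<partial>count_space UNIV)"
      using E' by (simp add: ennreal_mult mult.assoc)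
    also have "\<dots> \<le> ennreal (E powr q * E' + 1) * (\<integral>\<^sup>+j. epowr (u j) q \<partial>count_space UNIV)"
      by (intro mult_right_mono ennreal_leI) auto
    finally show "(\<integral>\<^sup>+k. epowr (\<integral>\<^sup>+j. ennreal (c ^ nat \<bar>k - j\<bar>) * u j \<partial>count_space UNIV) q \<partial>count_space UNIV)
      \<le> ennreal (E powr q * E' + 1) * (\<integral>\<^sup>+j. epowr (u j) q \<partial>count_space UNIV)" .
  qed
qed

section \<open>The Peetre maximal function\<close>

context homogeneous_group_norm begin

lemma le_peetre:
  assumes "R \<ge> 0"
  shows "ennreal (cmod (F (mul x (- y)))) \<le> ennreal ((1 + R * \<rho> y) powr N) * peetre mul \<rho> N R F x"
proof -
  have "0 < 1 + R * \<rho> y" using mult_nonneg_nonneg[OF assms rho_nonneg, of y] by linarith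
  then have p: "(1 + R * \<rho> y) powr N > 0" by simp
  have "ennreal (cmod (F (mul x (- y)))) = ennreal ((1 + R * \<rho> y) powr N) * ennreal (cmod (F (mul x (- y))) / (1 + R * \<rho> y) powr N)"
    using p by (simp flip: ennreal_mult)
  also have "\<dots> \<le> ennreal ((1 + R * \<rho> y) powr N) * peetre mul \<rho> N R F x"
    unfolding peetre_def by (intro mult_left_mono SUP_upper) auto
  finally show ?thesis .
qed

lemma peetre_le:
  assumes "R \<ge> 0" "\<And>y. ennreal (cmod (F (mul x (- y)))) \<le> ennreal ((1 + R * \<rho> y) powr N) * B"
  shows "peetre mul \<rho> N R F x \<le> B"
  unfolding peetre_def
proof (rule SUP_least)
  fix y
  have "0 < 1 + R * \<rho> y" using mult_nonneg_nonneg[OF assms(1) rho_nonneg, of y] by linarith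
  then have p: "(1 + R * \<rho> y) powr N > 0" by simp
  have "ennreal (cmod (F (mul x (- y))) / (1 + R * \<rho> y) powr N) = ennreal (1 / (1 + R * \<rho> y) powr N) * ennreal (cmod (F (mul x (- y))))"
    using p by (simp flip: ennreal_mult)
  also have "\<dots> \<le> ennreal (1 / (1 + R * \<rho> y) powr N) * (ennreal ((1 + R * \<rho> y) powr N) * B)"
    by (intro mult_left_mono assms(2)) auto
  also have "\<dots> = B" using p by (simp add: mult.assoc[symmetric] flip: ennreal_mult)
  finally show "ennreal (cmod (F (mul x (- y))) / (1 + R * \<rho> y) powr N) \<le> B" .
qed

lemma peetre_bounded:
  assumes "R \<ge> 0" "N \<ge> 0" "\<And>x. cmod (F x) \<le> B"
  shows "peetre mul \<rho> N R F x \<le> ennreal B"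
proof (rule peetre_le[OF assms(1)])
  fix y
  have B: "B \<ge> 0" using order_trans[OF norm_ge_zero assms(3)] .
  have "1 \<le> (1 + R * \<rho> y) powr N" using assms(1,2) by (intro ge_one_powr_ge_zero) auto
  then have "cmod (F (mul x (- y))) \<le> (1 + R * \<rho> y) powr N * B"
    using assms(3)[of "mul x (- y)"] mult_right_mono[of 1 "(1 + R * \<rho> y) powr N" B] B by simp
  then show "ennreal (cmod (F (mul x (- y)))) \<le> ennreal ((1 + R * \<rho> y) powr N) * ennreal B"
    using B by (simp add: ennreal_leI flip: ennreal_mult)
qed

lemma one_plus_scaled_rho_mul:
  assumes "R \<ge> 0"
  shows "1 + R * \<rho> (mul x y) \<le> c0 * ((1 + R * \<rho> x) * (1 + R * \<rho> y))"
proof -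
  have "R * \<rho> (mul x y) \<le> R * (c0 * (\<rho> x + \<rho> y))" using assms c0 by (intro mult_left_mono) auto
  then have "1 + R * \<rho> (mul x y) \<le> c0 * (1 + R * \<rho> x + R * \<rho> y)" using c0(1) by (simp add: algebra_simps)
  also have "\<dots> \<le> c0 * ((1 + R * \<rho> x) * (1 + R * \<rho> y))"
    using assms c0(1) by (intro mult_left_mono) (auto simp: algebra_simps)
  finally show ?thesis .
qed

text \<open>In \<open>G (x y\<^sup>-\<^sup>1 z\<^sup>-\<^sup>1)\<close> the argument is \<open>x (z y)\<^sup>-\<^sup>1\<close>, and the weight at \<open>z y\<close> is at most
  the product of the weights at \<open>z\<close> and \<open>y\<close>.\<close>

lemma conv_le_peetre:
  fixes G H :: "real ^ ('n::{finite, linorder}) \<Rightarrow> complex"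
  assumes [measurable]: "G \<in> borel_measurable borel" "H \<in> borel_measurable borel" and R: "R \<ge> 0" and N: "N \<ge> 0"
  shows "ennreal (cmod (conv mul G H (mul x (- y))))
    \<le> ennreal ((1 + R * \<rho> y) powr N) * (ennreal (c0 powr N) *
      (\<integral>\<^sup>+z. ennreal ((1 + R * \<rho> z) powr N * cmod (H z)) \<partial>lborel) * peetre mul \<rho> N R G x)"
proof -
  have "ennreal (cmod (conv mul G H (mul x (- y))))
     \<le> (\<integral>\<^sup>+z. ennreal (cmod (G (mul (mul x (- y)) (- z)) * H z)) \<partial>lborel)"
  proof (cases "integrable lborel (\<lambda>z. G (mul (mul x (- y)) (- z)) * H z)")
    case True
    then show ?thesis by (simp add: conv_lborel integral_norm_bound_ennreal)
  next
    case False
    then show ?thesis by (simp add: conv_lborel not_integrable_integral_eq)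
  qed
  also have "\<dots> \<le> (\<integral>\<^sup>+z. (ennreal (c0 powr N * (1 + R * \<rho> y) powr N) * peetre mul \<rho> N R G x) *
        ennreal ((1 + R * \<rho> z) powr N * cmod (H z)) \<partial>lborel)"
  proof (intro nn_integral_mono)
    fix z
    have "(1 + R * \<rho> (mul z y)) powr N \<le> (c0 * ((1 + R * \<rho> z) * (1 + R * \<rho> y))) powr N"
      using R N by (intro powr_mono2 one_plus_scaled_rho_mul) auto
    also have "\<dots> = c0 powr N * (1 + R * \<rho> y) powr N * (1 + R * \<rho> z) powr N"
      using c0(1) R by (simp add: powr_mult mult_ac)
    finally have 1: "(1 + R * \<rho> (mul z y)) powr N \<le> c0 powr N * (1 + R * \<rho> y) powr N * (1 + R * \<rho> z) powr N" .
    have "mul (mul x (- y)) (- z) = mul x (- mul z y)" by (simp add: minus_mul mul_assoc)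
    then have "ennreal (cmod (G (mul (mul x (- y)) (- z)) * H z)) = ennreal (cmod (G (mul x (- mul z y)))) * ennreal (cmod (H z))"
      by (simp add: norm_mult ennreal_mult)
    also have "\<dots> \<le> (ennreal ((1 + R * \<rho> (mul z y)) powr N) * peetre mul \<rho> N R G x) * ennreal (cmod (H z))"
      by (intro mult_right_mono le_peetre R) auto
    also have "\<dots> \<le> (ennreal (c0 powr N * (1 + R * \<rho> y) powr N * (1 + R * \<rho> z) powr N) * peetre mul \<rho> N R G x) * ennreal (cmod (H z))"
      by (intro mult_right_mono ennreal_leI 1) auto
    also have "\<dots> = (ennreal (c0 powr N * (1 + R * \<rho> y) powr N) * peetre mul \<rho> N R G x) * ennreal ((1 + R * \<rho> z) powr N * cmod (H z))"
      by (simp add: ennreal_mult mult_ac)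
    finally show "ennreal (cmod (G (mul (mul x (- y)) (- z)) * H z)) \<le> \<dots>" .
  qed
  also have "\<dots> = (ennreal (c0 powr N * (1 + R * \<rho> y) powr N) * peetre mul \<rho> N R G x) *
        (\<integral>\<^sup>+z. ennreal ((1 + R * \<rho> z) powr N * cmod (H z)) \<partial>lborel)"
    by (rule nn_integral_cmult) measurable
  finally show ?thesis by (simp add: ennreal_mult mult_ac)
qed

text \<open>The left-hand integrand is the dilate by \<open>s\<close> of the integrand that defines \<open>C_int\<close>.\<close>

lemma C_int_scaled:
  fixes \<eta> \<psi> :: "real ^ ('n::{finite, linorder}) \<Rightarrow> complex"
  assumes [measurable]: "\<eta> \<in> borel_measurable borel" "\<psi> \<in> borel_measurable borel" and st: "s > 0" "t > 0"
  shows "(\<integral>\<^sup>+z. ennreal ((1 + 1 / s * \<rho> z) powr N * cmod (conv mul (dilate a s \<eta>) (dilate a t \<psi>) z)) \<partial>lborel)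
     = C_int a mul \<rho> \<eta> \<psi> (t / s) N"
proof -
  define h where "h = conv mul \<eta> (dilate a (t / s) \<psi>)"
  have [measurable]: "h \<in> borel_measurable borel" unfolding h_def by measurable
  have "(\<integral>\<^sup>+z. ennreal ((1 + 1 / s * \<rho> z) powr N * cmod (dilate a s h z)) \<partial>lborel)
    = ennreal (s powr hom_dim a) * (\<integral>\<^sup>+z. ennreal ((1 + 1 / s * \<rho> (dil a s z)) powr N * cmod (dilate a s h (dil a s z))) \<partial>lborel)"
    by (rule nn_integral_dil[OF st(1)]) measurable
  also have "\<dots> = (\<integral>\<^sup>+z. ennreal (s powr hom_dim a) * ennreal ((1 + 1 / s * \<rho> (dil a s z)) powr N * cmod (dilate a s h (dil a s z))) \<partial>lborel)"
    by (rule nn_integral_cmult[symmetric]) measurable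
  also have "\<dots> = (\<integral>\<^sup>+z. ennreal ((1 + \<rho> z) powr N * cmod (h z)) \<partial>lborel)"
  proof (intro nn_integral_cong)
    fix z
    have "cmod (dilate a s h (dil a s z)) = s powr (- hom_dim a) * cmod (h z)"
      using st by (simp add: dilate_def dil_dil)
    moreover have "s powr hom_dim a * s powr (- hom_dim a) = 1" using st by (simp flip: powr_add)
    ultimately have "s powr hom_dim a * ((1 + 1 / s * \<rho> (dil a s z)) powr N * cmod (dilate a s h (dil a s z))) = (1 + \<rho> z) powr N * cmod (h z)"
      using st by (simp add: rho_dil)
    then show "ennreal (s powr hom_dim a) * ennreal ((1 + 1 / s * \<rho> (dil a s z)) powr N * cmod (dilate a s h (dil a s z))) = ennreal ((1 + \<rho> z) powr N * cmod (h z))"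
      by (simp flip: ennreal_mult)
  qed
  finally show ?thesis
    using st by (simp add: conv_dilate_dilate C_int_def h_def nn_integral_completion)
qed

text \<open>For \<open>u \<ge> 1\<close> this is the defining bound of the class, and for \<open>u \<le> 1\<close> it is
  \<open>conv_cancellation\<close>. The factor \<open>max 1 u\<close> is the price for changing the scale of a Peetre
  maximal function.\<close>

lemma C_int_decay:
  assumes C1: "(\<eta>, \<psi>) \<in> C1_class a mul \<rho> (N + \<epsilon>) N" and z: "(\<integral>x. \<psi> x \<partial>lborel) = 0"
    and N: "N \<ge> 0" and \<epsilon>: "\<epsilon> > 0"
  shows "\<exists>K>0. \<forall>u>0. C_int a mul \<rho> \<eta> \<psi> u N * ennreal (max 1 u powr N) \<le> ennreal (K * (if u \<le> 1 then u else 1 / u) powr (min \<epsilon> 1))"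
proof -
  have S: "\<eta> \<in> schwartz" "\<psi> \<in> schwartz" and fin: "(SUP t\<in>{1..}. ennreal (t powr (N + \<epsilon>)) * C_int a mul \<rho> \<eta> \<psi> t N) < \<infinity>"
    using C1 by (auto simp: C1_class_def)
  note [measurable] = schwartz_measurable[OF S(1)] schwartz_measurable[OF S(2)]
  obtain K1 where K1: "(SUP t\<in>{1..}. ennreal (t powr (N + \<epsilon>)) * C_int a mul \<rho> \<eta> \<psi> t N) = ennreal K1" "K1 \<ge> 0"
    using fin by (cases "SUP t\<in>{1..}. ennreal (t powr (N + \<epsilon>)) * C_int a mul \<rho> \<eta> \<psi> t N") auto
  obtain C where C: "C > 0" "\<And>t x. 0 < t \<Longrightarrow> t \<le> 1 \<Longrightarrow> cmod (conv mul \<eta> (dilate a t \<psi>) x) \<le> C * t * (1 + \<rho> x) powr (- (N + (hom_dim a + 1)))"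
    using conv_cancellation[OF S z, of "N + (hom_dim a + 1)"] N hom_dim_ge_1 by auto
  define I where "I = (\<integral>x. (1 + \<rho> x) powr (- (hom_dim a + 1)) \<partial>lborel)"
  have I: "(\<integral>\<^sup>+x. ennreal ((1 + \<rho> x) powr (- (hom_dim a + 1))) \<partial>lborel) = ennreal I" "I \<ge> 0"
    using integrable_rho_decay[of "hom_dim a + 1"]
    unfolding I_def by (auto intro!: nn_integral_eq_integral integral_nonneg)
  show ?thesis
  proof (intro exI[of _ "K1 + C * I + 1"] conjI allI impI)
    have CI: "C * I \<ge> 0" using C I by simp
    show "K1 + C * I + 1 > 0" using K1 CI by linarith
    fix u :: real assume u: "u > 0"
    show "C_int a mul \<rho> \<eta> \<psi> u N * ennreal (max 1 u powr N) \<le> ennreal ((K1 + C * I + 1) * (if u \<le> 1 then u else 1 / u) powr (min \<epsilon> 1))"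
    proof (cases "u \<le> 1")
      case True
      have "C_int a mul \<rho> \<eta> \<psi> u N = (\<integral>\<^sup>+x. ennreal ((1 + \<rho> x) powr N * cmod (conv mul \<eta> (dilate a u \<psi>) x)) \<partial>lborel)"
        by (simp add: C_int_def nn_integral_completion)
      also have "\<dots> \<le> (\<integral>\<^sup>+x. ennreal (C * u) * ennreal ((1 + \<rho> x) powr (- (hom_dim a + 1))) \<partial>lborel)"
      proof (intro nn_integral_mono)
        fix x
        have "(1 + \<rho> x) powr N * cmod (conv mul \<eta> (dilate a u \<psi>) x) \<le> (1 + \<rho> x) powr N * (C * u * (1 + \<rho> x) powr (- (N + (hom_dim a + 1))))"
          by (intro mult_left_mono C u True) auto
        also have "\<dots> = C * u * (1 + \<rho> x) powr (N + (- (N + (hom_dim a + 1))))" by (simp only: powr_add mult_ac)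
        finally have "(1 + \<rho> x) powr N * cmod (conv mul \<eta> (dilate a u \<psi>) x) \<le> C * u * (1 + \<rho> x) powr (- (hom_dim a + 1))" by simp
        then show "ennreal ((1 + \<rho> x) powr N * cmod (conv mul \<eta> (dilate a u \<psi>) x)) \<le> ennreal (C * u) * ennreal ((1 + \<rho> x) powr (- (hom_dim a + 1)))"
          using C(1) u by (simp add: ennreal_leI flip: ennreal_mult)
      qed
      also have "\<dots> = ennreal (C * u) * ennreal I" unfolding I(1)[symmetric] by (rule nn_integral_cmult) measurable
      also have "\<dots> = ennreal (C * I * u)" using C(1) u I(2) by (simp add: mult_ac flip: ennreal_mult)
      also have "\<dots> \<le> ennreal ((K1 + C * I + 1) * u powr (min \<epsilon> 1))"
      proof (intro ennreal_leI mult_mono)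
        show "u \<le> u powr (min \<epsilon> 1)" using powr_mono'[of "min \<epsilon> 1" 1 u] u True by simp
      qed (use K1 CI u in auto)
      finally show ?thesis using True u by simp
    next
      case False
      have "C_int a mul \<rho> \<eta> \<psi> u N * ennreal (max 1 u powr N) = ennreal (u powr (- \<epsilon>)) * (ennreal (u powr (N + \<epsilon>)) * C_int a mul \<rho> \<eta> \<psi> u N)"
      proof -
        have "u powr N = u powr (- \<epsilon>) * u powr (N + \<epsilon>)" by (simp flip: powr_add)
        then have "ennreal (u powr N) = ennreal (u powr (- \<epsilon>)) * ennreal (u powr (N + \<epsilon>))" by (simp add: ennreal_mult)
        then show ?thesis using False by (simp add: max_def mult_ac)
      qed
      also have "\<dots> \<le> ennreal (u powr (- \<epsilon>)) * ennreal K1"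
        unfolding K1(1)[symmetric] using False by (intro mult_left_mono SUP_upper) auto
      also have "\<dots> = ennreal (K1 * u powr (- \<epsilon>))" using K1(2) by (simp add: mult.commute flip: ennreal_mult)
      also have "\<dots> \<le> ennreal ((K1 + C * I + 1) * (1 / u) powr (min \<epsilon> 1))"
      proof (intro ennreal_leI mult_mono)
        have "u powr (- \<epsilon>) \<le> u powr (- min \<epsilon> 1)" using False by (intro powr_mono) auto
        then show "u powr (- \<epsilon>) \<le> (1 / u) powr (min \<epsilon> 1)" using u by (simp add: powr_divide powr_minus_divide)
      qed (use K1 CI in auto)
      finally show ?thesis using False by simp
    qed
  qed
qed

section \<open>The reproducing formula\<close>

lemma schwartz_conv_bounded:
  fixes f \<phi> :: "real ^ ('n::{finite, linorder}) \<Rightarrow> complex"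
  assumes f: "f \<in> schwartz" and \<phi>: "\<phi> \<in> schwartz" and t: "t > 0"
  shows "\<exists>B\<ge>0. \<forall>x. cmod (conv mul f (dilate a t \<phi>) x) \<le> B"
proof -
  note [measurable] = schwartz_measurable[OF f]
  obtain C where "C > 0" "\<And>x. cmod (f x) \<le> C" using schwartz_bounded[OF f] by blast
  then show ?thesis
    using conv_bounded[OF _ dilate_integrable[OF t schwartz_integrable[OF \<phi>]], of f C]
    by (intro exI[of _ "C * (\<integral>y. cmod (dilate a t \<phi> y) \<partial>lborel)"]) (auto intro!: mult_nonneg_nonneg integral_nonneg)
qed

text \<open>For small scales this is \<open>conv_cancellation\<close>; for large scales it is the decay of the
  supremum of the dilates, as the homogeneous dimension is at least 1.\<close>

lemma conv_uniform_decay: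
  fixes f \<phi> :: "real ^ ('n::{finite, linorder}) \<Rightarrow> complex"
  assumes f: "f \<in> schwartz" and \<phi>: "\<phi> \<in> schwartz" and z: "(\<integral>x. \<phi> x \<partial>lborel) = 0"
    and b: "0 < b" "b < 1"
  shows "\<exists>C>0. \<forall>k x. cmod (conv mul f (dilate a (b powi k) \<phi>) x) \<le> C * b ^ nat \<bar>k\<bar>"
proof -
  note [measurable] = schwartz_measurable[OF f] schwartz_measurable[OF \<phi>]
  obtain C1 where C1: "C1 > 0" "\<And>t x. 0 < t \<Longrightarrow> t \<le> 1 \<Longrightarrow> cmod (conv mul f (dilate a t \<phi>) x) \<le> C1 * t * (1 + \<rho> x) powr (- 0)"
    using conv_cancellation[OF f \<phi> z order_refl] by auto
  obtain P where P: "P > 0" "\<And>x. cmod (\<phi> x) \<le> P" using schwartz_bounded[OF \<phi>] by blast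
  define C2 where "C2 = P * (\<integral>v. cmod (f v) \<partial>lborel)"
  have C2: "C2 \<ge> 0" using P by (simp add: C2_def)
  have "cmod (conv mul f (dilate a (b powi k) \<phi>) x) \<le> (C1 + C2) * b ^ nat \<bar>k\<bar>" for k x
  proof (cases "k \<ge> 0")
    case True
    then have bk: "b powi k = b ^ nat \<bar>k\<bar>" by (simp add: power_int_def)
    have "cmod (conv mul f (dilate a (b powi k) \<phi>) x) \<le> C1 * b ^ nat \<bar>k\<bar>"
      using C1(2)[of "b powi k" x] b by (simp add: bk power_le_one)
    also have "\<dots> \<le> (C1 + C2) * b ^ nat \<bar>k\<bar>" using C2 b by (intro mult_right_mono) auto
    finally show ?thesis .
  next
    case False
    define m where "m = nat \<bar>k\<bar>"
    have bk: "b powi k = 1 / b ^ m" using False by (simp add: power_int_def m_def power_one_over inverse_eq_divide)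
    define t where "t = b powi k"
    have t: "t > 0" using b by (simp add: t_def)
    have d: "cmod (dilate a t \<phi> v) \<le> b ^ m * P" for v
    proof -
      have "t powr (- hom_dim a) = (b ^ m) powr hom_dim a" using b by (simp add: t_def bk powr_divide powr_minus)
      also have "\<dots> \<le> (b ^ m) powr 1" using b hom_dim_ge_1 by (intro powr_mono') (auto simp: power_le_one)
      finally have "t powr (- hom_dim a) \<le> b ^ m" using b by simp
      then show ?thesis using P(2)[of "dil a (inverse t) v"] b by (simp add: dilate_def mult_mono)
    qed
    have "cmod (conv mul f (dilate a t \<phi>) x) = cmod (\<integral>v. f (- v) * dilate a t \<phi> (mul v x) \<partial>lborel)"
      by (simp add: conv_right_translate)
    also have "\<dots> \<le> (\<integral>v. cmod (f (- v)) * (b ^ m * P) \<partial>lborel)"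
    proof (rule order_trans[OF integral_norm_bound integral_mono'])
      show "integrable lborel (\<lambda>v. cmod (f (- v)) * (b ^ m * P))"
        using integrable_minus_arg[OF schwartz_integrable[OF f]] by simp
      show "norm (f (- v) * dilate a t \<phi> (mul v x)) \<le> cmod (f (- v)) * (b ^ m * P)" for v
        using d by (simp add: norm_mult mult_left_mono)
    qed (use b P in auto)
    also have "\<dots> = C2 * b ^ m" using integral_minus_arg[of "\<lambda>v. cmod (f v)"] by (simp add: C2_def)
    also have "\<dots> \<le> (C1 + C2) * b ^ m" using C1 b by (intro mult_right_mono) auto
    finally show ?thesis by (simp add: t_def m_def)
  qed
  moreover have "C1 + C2 > 0" using C1 C2 by simp
  ultimately show ?thesis by blast
qed

lemma conv_sum_right:
  assumes [measurable]: "F \<in> borel_measurable borel" and B: "\<And>x. cmod (F x) \<le> B"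
    and "finite I" "\<And>i. i \<in> I \<Longrightarrow> integrable lborel (G i)"
  shows "conv mul F (\<lambda>x. \<Sum>i\<in>I. G i x) x = (\<Sum>i\<in>I. conv mul F (G i) x)"
proof -
  have [measurable]: "G i \<in> borel_measurable borel" if "i \<in> I" for i using assms(4)[OF that] by auto
  have i: "integrable lborel (\<lambda>y. F (mul x (- y)) * G i y)" if "i \<in> I" for i
  proof (rule Bochner_Integration.integrable_bound[OF integrable_mult_right[OF integrable_norm[OF assms(4)[OF that]], of B]])
    have "0 \<le> B" by (rule order_trans[OF norm_ge_zero B])
    then show "AE y in lborel. norm (F (mul x (- y)) * G i y) \<le> norm (B * norm (G i y))"
      using B by (auto simp: norm_mult abs_mult intro!: mult_right_mono)
  qed (use that in measurable)
  have "conv mul F (\<lambda>x. \<Sum>i\<in>I. G i x) x = (\<integral>y. (\<Sum>i\<in>I. F (mul x (- y)) * G i y) \<partial>lborel)"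
    by (subst conv_lborel) (auto simp: sum_distrib_left)
  also have "\<dots> = (\<Sum>i\<in>I. \<integral>y. F (mul x (- y)) * G i y \<partial>lborel)"
    using i by (rule Bochner_Integration.integral_sum)
  finally show ?thesis by (simp add: conv_lborel cong: sum.cong)
qed

lemma conv_sum_left:
  assumes "finite I" "\<And>i. i \<in> I \<Longrightarrow> F i \<in> borel_measurable borel" "\<And>i x. i \<in> I \<Longrightarrow> cmod (F i x) \<le> B i"
    and H: "integrable lborel H"
  shows "conv mul (\<lambda>x. \<Sum>i\<in>I. F i x) H x = (\<Sum>i\<in>I. conv mul (F i) H x)"
proof -
  have [measurable]: "F i \<in> borel_measurable borel" if "i \<in> I" for i using assms(2)[OF that] .
  have [measurable]: "H \<in> borel_measurable borel" using H by auto
  have i: "integrable lborel (\<lambda>y. F i (mul x (- y)) * H y)" if "i \<in> I" for i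
  proof (rule Bochner_Integration.integrable_bound[OF integrable_mult_right[OF integrable_norm[OF H], of "B i"]])
    have "0 \<le> B i" by (rule order_trans[OF norm_ge_zero assms(3)[OF that]])
    then show "AE y in lborel. norm (F i (mul x (- y)) * H y) \<le> norm (B i * norm (H y))"
      using assms(3)[OF that] by (auto simp: norm_mult abs_mult intro!: mult_right_mono)
  qed (use that in measurable)
  have "conv mul (\<lambda>x. \<Sum>i\<in>I. F i x) H x = (\<integral>y. (\<Sum>i\<in>I. F i (mul x (- y)) * H y) \<partial>lborel)"
    by (subst conv_lborel) (auto simp: sum_distrib_right)
  also have "\<dots> = (\<Sum>i\<in>I. \<integral>y. F i (mul x (- y)) * H y \<partial>lborel)"
    using i by (rule Bochner_Integration.integral_sum)
  finally show ?thesis by (simp add: conv_lborel cong: sum.cong)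
qed

definition reproducing :: "real \<Rightarrow> nat \<Rightarrow> (nat \<Rightarrow> real ^ ('n::{finite, linorder}) \<Rightarrow> complex) \<Rightarrow> (nat \<Rightarrow> real ^ ('n::{finite, linorder}) \<Rightarrow> complex) \<Rightarrow> bool" where
  "reproducing b M \<phi> \<eta> \<longleftrightarrow> 0 < b \<and> b < 1 \<and>
     (\<forall>l\<in>{1..M}. \<phi> l \<in> schwartz \<and> \<eta> l \<in> schwartz \<and> (\<integral>x. \<phi> l x \<partial>lborel) = 0) \<and>
     tendsto_tempered
           (\<lambda>(k, m). fun_distribution (\<lambda>x. \<Sum>j = - int k..int m. \<Sum>l = 1..M.
              conv mul (dilate a (b powi j) (\<phi> l)) (dilate a (b powi j) (\<eta> l)) x))
           dirac (sequentially \<times>\<^sub>F sequentially)"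

text \<open>Convergence of the partial sums \<open>D\<^sub>n\<close> in \<open>\<S>'\<close> means that \<open>f * D\<^sub>n\<close> converges to \<open>f\<close> at every
  point. By \<open>conv_uniform_decay\<close> the functions \<open>f * D\<^sub>n\<close> are uniformly bounded, so dominated
  convergence passes to the convolution with the dilate of \<open>\<psi>\<close>.\<close>

lemma reproducing_bound:
  fixes f \<psi> :: "real ^ ('n::{finite, linorder}) \<Rightarrow> complex"
  assumes R: "reproducing b M \<phi> \<eta>" and f: "f \<in> schwartz" and \<psi>: "\<psi> \<in> schwartz" and t: "t > 0"
  shows "ennreal (cmod (conv mul f (dilate a t \<psi>) u)) \<le>
    (\<integral>\<^sup>+k. (\<Sum>l=1..M. ennreal (cmod (conv mul (conv mul f (dilate a (b powi k) (\<phi> l)))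
        (conv mul (dilate a (b powi k) (\<eta> l)) (dilate a t \<psi>)) u))) \<partial>count_space UNIV)"
proof -
  have b: "0 < b" "b < 1" and S: "\<And>l. l \<in> {1..M} \<Longrightarrow> \<phi> l \<in> schwartz" "\<And>l. l \<in> {1..M} \<Longrightarrow> \<eta> l \<in> schwartz"
    and z: "\<And>l. l \<in> {1..M} \<Longrightarrow> (\<integral>x. \<phi> l x \<partial>lborel) = 0"
    and T: "tendsto_tempered (\<lambda>(k, m). fun_distribution (\<lambda>x. \<Sum>j = - int k..int m. \<Sum>l = 1..M.
              conv mul (dilate a (b powi j) (\<phi> l)) (dilate a (b powi j) (\<eta> l)) x))
           dirac (sequentially \<times>\<^sub>F sequentially)"
    using R unfolding reproducing_def by blast+
  have bj: "b powi j > 0" for j using b by simp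
  note [measurable] = schwartz_measurable[OF f] schwartz_measurable[OF \<psi>]
  obtain Bf where Bf: "Bf > 0" "\<And>x. cmod (f x) \<le> Bf" using schwartz_bounded[OF f] by blast
  define \<phi>j where "\<phi>j = (\<lambda>j l. dilate a (b powi j) (\<phi> l))"
  define \<eta>j where "\<eta>j = (\<lambda>j l. dilate a (b powi j) (\<eta> l))"
  define H where "H = dilate a t \<psi>"
  have int: "integrable lborel (\<phi>j j l)" "integrable lborel (\<eta>j j l)" if "l \<in> {1..M}" for j l
    unfolding \<phi>j_def \<eta>j_def by (intro dilate_integrable bj schwartz_integrable S that)+
  have H: "integrable lborel H" unfolding H_def by (intro dilate_integrable t schwartz_integrable \<psi>)
  have [measurable]: "H \<in> borel_measurable borel" using H by auto
  have meas[measurable]: "\<phi>j j l \<in> borel_measurable borel" "\<eta>j j l \<in> borel_measurable borel" if "l \<in> {1..M}" for j l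
    using int[OF that] by auto
  define E where "E = (\<lambda>j l. conv mul (conv mul f (\<phi>j j l)) (\<eta>j j l))"
  have Em[measurable]: "E j l \<in> borel_measurable borel" if "l \<in> {1..M}" for j l
    unfolding E_def using that by measurable
  define Tn where "Tn = (\<lambda>n x. \<Sum>j = - int n..int n. \<Sum>l = 1..M. E j l x)"
  have Tm[measurable]: "Tn n \<in> borel_measurable borel" for n
    unfolding Tn_def by (intro borel_measurable_sum Em)
  have lim: "(\<lambda>n. Tn n x) \<longlonglongrightarrow> f x" for x
  proof -
    have "((\<lambda>i. (case i of (k, m) \<Rightarrow> fun_distribution (\<lambda>x. \<Sum>j = - int k..int m. \<Sum>l = 1..M. conv mul (\<phi>j j l) (\<eta>j j l) x))
           (\<lambda>z. f (mul x (- z)))) \<longlongrightarrow> dirac (\<lambda>z. f (mul x (- z)))) (sequentially \<times>\<^sub>F sequentially)"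
      using T[unfolded tendsto_tempered_def, THEN bspec, OF schwartz_translate_minus[OF f, of x]]
      unfolding \<phi>j_def \<eta>j_def .
    from filterlim_compose[OF this filterlim_Pair[OF filterlim_ident filterlim_ident]]
    have "(\<lambda>n. fun_distribution (\<lambda>x. \<Sum>j = - int n..int n. \<Sum>l = 1..M. conv mul (\<phi>j j l) (\<eta>j j l) x)
           (\<lambda>z. f (mul x (- z)))) \<longlonglongrightarrow> f x"
      by (simp add: dirac_def)
    moreover have "fun_distribution (\<lambda>x. \<Sum>j = - int n..int n. \<Sum>l = 1..M. conv mul (\<phi>j j l) (\<eta>j j l) x)
           (\<lambda>z. f (mul x (- z))) = Tn n x" for n
    proof -
      have ci: "integrable lborel (conv mul (\<phi>j j l) (\<eta>j j l))" if "l \<in> {1..M}" for j l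
        by (intro conv_integrable int that)
      have "fun_distribution (\<lambda>x. \<Sum>j = - int n..int n. \<Sum>l = 1..M. conv mul (\<phi>j j l) (\<eta>j j l) x) (\<lambda>z. f (mul x (- z)))
         = conv mul f (\<lambda>x. \<Sum>j = - int n..int n. \<Sum>l = 1..M. conv mul (\<phi>j j l) (\<eta>j j l) x) x"
        unfolding fun_distribution_def conv_def[of _ f] by (simp add: mult.commute)
      also have "\<dots> = (\<Sum>j = - int n..int n. conv mul f (\<lambda>x. \<Sum>l = 1..M. conv mul (\<phi>j j l) (\<eta>j j l) x) x)"
        by (rule conv_sum_right[OF _ Bf(2)]) (auto intro!: ci)
      also have "\<dots> = (\<Sum>j = - int n..int n. \<Sum>l = 1..M. conv mul f (conv mul (\<phi>j j l) (\<eta>j j l)) x)"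
        by (intro sum.cong refl conv_sum_right[OF _ Bf(2)]) (auto intro!: ci)
      also have "\<dots> = Tn n x"
        unfolding Tn_def E_def
        by (intro sum.cong refl fun_cong[OF conv_assoc[OF schwartz_measurable[OF f] Bf(2) int]])
      finally show ?thesis .
    qed
    ultimately show ?thesis by simp
  qed
  have "\<exists>C>0. \<forall>k x. cmod (conv mul f (\<phi>j k l) x) \<le> C * b ^ nat \<bar>k\<bar>" if "l \<in> {1..M}" for l
    unfolding \<phi>j_def by (rule conv_uniform_decay[OF f S(1)[OF that] z[OF that] b])
  then obtain C where C: "\<And>l. l \<in> {1..M} \<Longrightarrow> C l > 0"
    "\<And>l k x. l \<in> {1..M} \<Longrightarrow> cmod (conv mul f (\<phi>j k l) x) \<le> C l * b ^ nat \<bar>k\<bar>" by metis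
  define e where "e = (\<lambda>l. \<integral>y. cmod (\<eta> l y) \<partial>lborel)"
  have ej: "(\<integral>y. cmod (\<eta>j j l y) \<partial>lborel) = e l" if "l \<in> {1..M}" for j l
  proof -
    have [measurable]: "\<eta> l \<in> borel_measurable borel" using S(2)[OF that] by (rule schwartz_measurable)
    have "(\<integral>y. cmod (\<eta>j j l y) \<partial>lborel) = (b powi j) powr hom_dim a *\<^sub>R (\<integral>y. cmod (\<eta>j j l (dil a (b powi j) y)) \<partial>lborel)"
      unfolding \<eta>j_def by (rule integral_dil[OF bj]) measurable
    also have "\<dots> = (b powi j) powr hom_dim a * ((b powi j) powr (- hom_dim a) * e l)"
      using bj[of j] b by (simp add: \<eta>j_def dilate_def dil_dil e_def)
    also have "\<dots> = ((b powi j) powr hom_dim a * (b powi j) powr (- hom_dim a)) * e l" by simp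
    also have "(b powi j) powr hom_dim a * (b powi j) powr (- hom_dim a) = 1"
      using bj[of j] b by (simp flip: powr_add)
    finally show ?thesis by simp
  qed
  have Eb: "cmod (E j l x) \<le> C l * b ^ nat \<bar>j\<bar> * e l" if "l \<in> {1..M}" for j l x
  proof -
    have "conv mul f (\<phi>j j l) \<in> borel_measurable borel" using that by measurable
    from conv_bounded[OF this int(2)[OF that, of j] C(2)[OF that, of j]]
    show ?thesis unfolding E_def ej[OF that] .
  qed
  define c where "c = (\<Sum>l = 1..M. C l * e l)"
  have e0: "e l \<ge> 0" for l by (simp add: e_def)
  have c0': "c \<ge> 0" unfolding c_def using C(1) e0 by (intro sum_nonneg mult_nonneg_nonneg) (auto simp: less_imp_le)
  obtain g where g: "(\<integral>\<^sup>+i. ennreal (b ^ nat \<bar>i\<bar>) \<partial>count_space (UNIV :: int set)) = ennreal g" "g \<ge> 0"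
    using geometric_int_finite[of b] b by (cases "\<integral>\<^sup>+i. ennreal (b ^ nat \<bar>i\<bar>) \<partial>count_space (UNIV :: int set)") auto
  have Tb: "cmod (Tn n x) \<le> g * c" for n x
  proof -
    have "cmod (Tn n x) \<le> (\<Sum>j = - int n..int n. \<Sum>l = 1..M. cmod (E j l x))"
      unfolding Tn_def by (intro order_trans[OF norm_sum] sum_mono norm_sum)
    also have "\<dots> \<le> (\<Sum>j = - int n..int n. \<Sum>l = 1..M. C l * b ^ nat \<bar>j\<bar> * e l)"
      by (intro sum_mono Eb) auto
    also have "\<dots> = (\<Sum>j = - int n..int n. b ^ nat \<bar>j\<bar>) * c"
      by (simp add: c_def sum_distrib_left sum_distrib_right mult_ac)
    also have "\<dots> \<le> g * c"
    proof (rule mult_right_mono[OF _ c0'])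
      have "ennreal (\<Sum>j = - int n..int n. b ^ nat \<bar>j\<bar>) = (\<Sum>j = - int n..int n. ennreal (b ^ nat \<bar>j\<bar>))"
        using b by (intro sum_ennreal[symmetric]) auto
      also have "\<dots> \<le> ennreal g" unfolding g(1)[symmetric] by (rule sum_le_nn_integral_count_space) simp
      finally show "(\<Sum>j = - int n..int n. b ^ nat \<bar>j\<bar>) \<le> g" using g(2) by (simp add: ennreal_le_iff)
    qed
    finally show ?thesis .
  qed
  have conv_lim: "(\<lambda>n. conv mul (Tn n) H u) \<longlonglongrightarrow> conv mul f H u"
  proof -
    have "(\<lambda>n. \<integral>y. Tn n (mul u (- y)) * H y \<partial>lborel) \<longlonglongrightarrow> (\<integral>y. f (mul u (- y)) * H y \<partial>lborel)"
    proof (rule integral_dominated_convergence[where w = "\<lambda>y. g * c * cmod (H y)"])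
      show "integrable lborel (\<lambda>y. g * c * cmod (H y))" using H by simp
      show "AE y in lborel. (\<lambda>n. Tn n (mul u (- y)) * H y) \<longlonglongrightarrow> f (mul u (- y)) * H y"
        by (intro AE_I2 tendsto_mult lim tendsto_const)
      show "AE y in lborel. norm (Tn n (mul u (- y)) * H y) \<le> g * c * cmod (H y)" for n
        using Tb by (intro AE_I2) (simp add: norm_mult mult_right_mono)
    qed measurable
    then show ?thesis by (simp add: conv_lborel)
  qed
  have Tconv: "conv mul (Tn n) H u = (\<Sum>j = - int n..int n. \<Sum>l = 1..M. conv mul (conv mul f (\<phi>j j l)) (conv mul (\<eta>j j l) H) u)" for n
  proof -
    have "conv mul (Tn n) H u = (\<Sum>j = - int n..int n. conv mul (\<lambda>x. \<Sum>l = 1..M. E j l x) H u)"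
      unfolding Tn_def
    proof (rule conv_sum_left[OF _ _ _ H])
      show "(\<lambda>x. \<Sum>l = 1..M. E j l x) \<in> borel_measurable borel" for j by (intro borel_measurable_sum Em)
      show "cmod (\<Sum>l = 1..M. E j l x) \<le> (\<Sum>l = 1..M. C l * b ^ nat \<bar>j\<bar> * e l)" for j x
        by (intro sum_norm_le Eb) auto
    qed simp
    also have "\<dots> = (\<Sum>j = - int n..int n. \<Sum>l = 1..M. conv mul (E j l) H u)"
      by (intro sum.cong refl conv_sum_left[OF _ _ Eb H]) (auto intro!: Em)
    also have "\<dots> = (\<Sum>j = - int n..int n. \<Sum>l = 1..M. conv mul (conv mul f (\<phi>j j l)) (conv mul (\<eta>j j l) H) u)"
      unfolding E_def
    proof (intro sum.cong refl)
      fix j l assume l: "l \<in> {1..M}"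
      have "conv mul f (\<phi>j j l) \<in> borel_measurable borel" using l by measurable
      from conv_assoc[OF this C(2)[OF l] int(2)[OF l] H, of j]
      show "conv mul (conv mul (conv mul f (\<phi>j j l)) (\<eta>j j l)) H u = conv mul (conv mul f (\<phi>j j l)) (conv mul (\<eta>j j l) H) u"
        by simp
    qed
    finally show ?thesis .
  qed
  have "(\<lambda>n. ennreal (cmod (conv mul (Tn n) H u))) \<longlonglongrightarrow> ennreal (cmod (conv mul f H u))"
    by (intro tendsto_ennrealI tendsto_norm conv_lim)
  then have "ennreal (cmod (conv mul f H u)) \<le> (\<integral>\<^sup>+k. (\<Sum>l=1..M. ennreal (cmod (conv mul (conv mul f (\<phi>j k l)) (conv mul (\<eta>j k l) H) u))) \<partial>count_space UNIV)"
  proof (rule LIMSEQ_le_const2, intro exI allI impI)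
    fix n
    have "cmod (conv mul (Tn n) H u) \<le> (\<Sum>j = - int n..int n. \<Sum>l = 1..M. cmod (conv mul (conv mul f (\<phi>j j l)) (conv mul (\<eta>j j l) H) u))"
      unfolding Tconv by (intro order_trans[OF norm_sum] sum_mono norm_sum)
    then have "ennreal (cmod (conv mul (Tn n) H u)) \<le> ennreal (\<Sum>j = - int n..int n. \<Sum>l = 1..M. cmod (conv mul (conv mul f (\<phi>j j l)) (conv mul (\<eta>j j l) H) u))"
      by (rule ennreal_leI)
    also have "\<dots> = (\<Sum>j = - int n..int n. ennreal (\<Sum>l=1..M. cmod (conv mul (conv mul f (\<phi>j j l)) (conv mul (\<eta>j j l) H) u)))"
      by (intro sum_ennreal[symmetric] sum_nonneg) simp
    also have "\<dots> = (\<Sum>j = - int n..int n. \<Sum>l=1..M. ennreal (cmod (conv mul (conv mul f (\<phi>j j l)) (conv mul (\<eta>j j l) H) u)))"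
      by (intro sum.cong refl sum_ennreal[symmetric]) simp
    also have "\<dots> \<le> (\<integral>\<^sup>+k. (\<Sum>l=1..M. ennreal (cmod (conv mul (conv mul f (\<phi>j k l)) (conv mul (\<eta>j k l) H) u))) \<partial>count_space UNIV)"
      by (rule sum_le_nn_integral_count_space) simp
    finally show "ennreal (cmod (conv mul (Tn n) H u)) \<le> \<dots>" .
  qed
  then show ?thesis by (simp add: \<phi>j_def \<eta>j_def H_def)
qed

section \<open>Comparison of Peetre maximal functions\<close>

text \<open>Estimate each term of the reproducing formula by \<open>conv_le_peetre\<close> at scale \<open>b\<^sup>k\<close> and pass to the
  scale \<open>b\<^sup>j\<close>, which costs the factor \<open>max 1 (b\<^sup>j / b\<^sup>k)\<close> to the power \<open>N\<close> that is admitted in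
  \<open>C_int_decay\<close>.\<close>

lemma peetre_comparison:
  fixes \<psi> :: "real ^ ('n::{finite, linorder}) \<Rightarrow> complex"
  assumes R: "reproducing b M \<phi> \<eta>" and \<psi>: "\<psi> \<in> schwartz" "(\<integral>x. \<psi> x \<partial>lborel) = 0"
    and N: "N \<ge> 0" and \<epsilon>: "\<epsilon> > 0" and C1: "\<And>l. l \<in> {1..M} \<Longrightarrow> (\<eta> l, \<psi>) \<in> C1_class a mul \<rho> (N + \<epsilon>) N"
  shows "\<exists>K>0. \<forall>f\<in>schwartz. \<forall>j x. peetre mul \<rho> N (b powi (- j)) (conv mul f (dilate a (b powi j) \<psi>)) x
    \<le> ennreal K * (\<integral>\<^sup>+k. ennreal ((b powr min \<epsilon> 1) ^ nat \<bar>j - k\<bar>) *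
       (\<Sum>l=1..M. peetre mul \<rho> N (b powi (- k)) (conv mul f (dilate a (b powi k) (\<phi> l))) x) \<partial>count_space UNIV)"
proof -
  have b: "0 < b" "b < 1" and S: "\<And>l. l \<in> {1..M} \<Longrightarrow> \<phi> l \<in> schwartz" "\<And>l. l \<in> {1..M} \<Longrightarrow> \<eta> l \<in> schwartz"
    using R by (auto simp: reproducing_def)
  have bj: "b powi j > 0" for j using b by simp
  define c where "c = b powr min \<epsilon> 1"
  have "\<exists>K>0. \<forall>u>0. C_int a mul \<rho> (\<eta> l) \<psi> u N * ennreal (max 1 u powr N) \<le> ennreal (K * (if u \<le> 1 then u else 1 / u) powr (min \<epsilon> 1))"
    if "l \<in> {1..M}" for l
    by (rule C_int_decay[OF C1[OF that] \<psi>(2) N \<epsilon>])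
  then obtain K where K: "\<And>l. l \<in> {1..M} \<Longrightarrow> K l > 0"
    "\<And>l u. l \<in> {1..M} \<Longrightarrow> u > 0 \<Longrightarrow> C_int a mul \<rho> (\<eta> l) \<psi> u N * ennreal (max 1 u powr N) \<le> ennreal (K l * (if u \<le> 1 then u else 1 / u) powr (min \<epsilon> 1))"
    by metis
  define K' where "K' = (\<Sum>l=1..M. K l) + 1"
  have KK': "K l \<le> K'" if "l \<in> {1..M}" for l
  proof -
    have "K l \<le> (\<Sum>l=1..M. K l)" using that K(1) by (intro member_le_sum) (auto simp: less_imp_le)
    then show ?thesis by (simp add: K'_def)
  qed
  have K'pos: "K' > 0" unfolding K'_def using K(1) by (intro add_nonneg_pos sum_nonneg) (auto simp: less_imp_le)
  have cc: "C_int a mul \<rho> (\<eta> l) \<psi> (b powi j / b powi k) N * ennreal (max 1 (b powi j / b powi k) powr N) \<le> ennreal (K' * c ^ nat \<bar>j - k\<bar>)"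
    if l: "l \<in> {1..M}" for l j k
  proof -
    define u where "u = b powi j / b powi k"
    have u: "u > 0" "u = b powi (j - k)" using b bj by (auto simp: u_def power_int_diff)
    have e: "(if u \<le> 1 then u else 1 / u) = b ^ nat \<bar>j - k\<bar>"
    proof (cases "j \<ge> k")
      case True
      then have "u = b ^ nat \<bar>j - k\<bar>" by (simp add: u power_int_def)
      then show ?thesis using b by (simp add: power_le_one)
    next
      case False
      then have i: "u = 1 / b ^ nat \<bar>j - k\<bar>" by (simp add: u power_int_def power_one_over inverse_eq_divide)
      have "b ^ nat \<bar>j - k\<bar> < 1" using power_strict_decreasing[of 0 "nat \<bar>j - k\<bar>" b] b False by simp
      then have "u > 1" unfolding i using b by (simp add: field_simps)
      then show ?thesis using i by simp
    qed
    have "C_int a mul \<rho> (\<eta> l) \<psi> u N * ennreal (max 1 u powr N) \<le> ennreal (K l * c ^ nat \<bar>j - k\<bar>)"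
      using K(2)[OF l u(1)] unfolding e c_def using b by (simp add: power_powr_swap)
    also have "\<dots> \<le> ennreal (K' * c ^ nat \<bar>j - k\<bar>)"
      using KK'[OF l] by (intro ennreal_leI mult_right_mono) (auto simp: c_def)
    finally show ?thesis by (simp add: u_def)
  qed
  show ?thesis
  proof (intro exI[of _ "c0 powr N * K'"] conjI ballI allI)
    show "c0 powr N * K' > 0" using c0(1) K'pos by simp
    fix f :: "real ^ ('n::{finite, linorder}) \<Rightarrow> complex" and j :: int and x
    assume f: "f \<in> schwartz"
    note [measurable] = schwartz_measurable[OF f] schwartz_measurable[OF \<psi>(1)]
    have [measurable]: "\<phi> l \<in> borel_measurable borel" "\<eta> l \<in> borel_measurable borel" if "l \<in> {1..M}" for l
      using S[OF that] by (auto intro: schwartz_measurable)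
    define F where "F = (\<lambda>k l. conv mul f (dilate a (b powi k) (\<phi> l)))"
    have [measurable]: "F k l \<in> borel_measurable borel" if "l \<in> {1..M}" for k l
      unfolding F_def using that by measurable
    have F_eq: "F k l = conv mul f (dilate a (b powi k) (\<phi> l))" for k l by (simp add: F_def)
    have neg: "b powi (- k) = 1 / b powi k" for k by (simp add: power_int_minus inverse_eq_divide)
    show "peetre mul \<rho> N (b powi (- j)) (conv mul f (dilate a (b powi j) \<psi>)) x
      \<le> ennreal (c0 powr N * K') * (\<integral>\<^sup>+k. ennreal ((b powr min \<epsilon> 1) ^ nat \<bar>j - k\<bar>) *
       (\<Sum>l=1..M. peetre mul \<rho> N (b powi (- k)) (conv mul f (dilate a (b powi k) (\<phi> l))) x) \<partial>count_space UNIV)"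
      unfolding F_eq[symmetric] c_def[symmetric]
    proof (rule peetre_le)
      fix y
      define w where "w = (1 + b powi (- j) * \<rho> y) powr N"
      have "ennreal (cmod (conv mul f (dilate a (b powi j) \<psi>) (mul x (- y))))
        \<le> (\<integral>\<^sup>+k. (\<Sum>l=1..M. ennreal (cmod (conv mul (F k l) (conv mul (dilate a (b powi k) (\<eta> l)) (dilate a (b powi j) \<psi>)) (mul x (- y))))) \<partial>count_space UNIV)"
        unfolding F_def by (rule reproducing_bound[OF R f \<psi>(1) bj])
      also have "\<dots> \<le> (\<integral>\<^sup>+k. (ennreal w * ennreal (c0 powr N * K')) * (ennreal (c ^ nat \<bar>j - k\<bar>) * (\<Sum>l=1..M. peetre mul \<rho> N (b powi (- k)) (F k l) x)) \<partial>count_space UNIV)"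
      proof (intro nn_integral_mono)
        fix k
        have "ennreal (cmod (conv mul (F k l) (conv mul (dilate a (b powi k) (\<eta> l)) (dilate a (b powi j) \<psi>)) (mul x (- y))))
          \<le> (ennreal w * ennreal (c0 powr N * K')) * (ennreal (c ^ nat \<bar>j - k\<bar>) * peetre mul \<rho> N (b powi (- k)) (F k l) x)"
          if l: "l \<in> {1..M}" for l
        proof -
          define u where "u = b powi j / b powi k"
          have u: "u > 0" using bj by (simp add: u_def)
          have "b powi (- k) = u * b powi (- j)" using bj[of j] b by (simp add: u_def neg)
          have ww: "(1 + b powi (- k) * \<rho> y) powr N \<le> max 1 u powr N * w"
          proof -
            have r: "0 \<le> b powi (- j) * \<rho> y" using bj[of "- j"] by simp
            have "1 + b powi (- k) * \<rho> y = 1 + u * (b powi (- j) * \<rho> y)"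
              by (simp add: \<open>b powi (- k) = u * b powi (- j)\<close>)
            also have "\<dots> \<le> max 1 u + max 1 u * (b powi (- j) * \<rho> y)"
              using r by (intro add_mono mult_right_mono) auto
            finally have "1 + b powi (- k) * \<rho> y \<le> max 1 u * (1 + b powi (- j) * \<rho> y)" by (simp add: distrib_left)
            moreover have "0 \<le> b powi (- k) * \<rho> y" using bj[of "- k"] by simp
            ultimately have "(1 + b powi (- k) * \<rho> y) powr N \<le> (max 1 u * (1 + b powi (- j) * \<rho> y)) powr N"
              using N by (intro powr_mono2) auto
            then show ?thesis using r by (simp add: powr_mult w_def)
          qed
          have "ennreal (cmod (conv mul (F k l) (conv mul (dilate a (b powi k) (\<eta> l)) (dilate a (b powi j) \<psi>)) (mul x (- y))))
            \<le> ennreal ((1 + b powi (- k) * \<rho> y) powr N) * (ennreal (c0 powr N) *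
               (\<integral>\<^sup>+z. ennreal ((1 + b powi (- k) * \<rho> z) powr N * cmod (conv mul (dilate a (b powi k) (\<eta> l)) (dilate a (b powi j) \<psi>) z)) \<partial>lborel) *
               peetre mul \<rho> N (b powi (- k)) (F k l) x)"
            by (rule conv_le_peetre) (use l N bj[of "- k"] in \<open>auto simp: less_imp_le\<close>)
          also have "(\<integral>\<^sup>+z. ennreal ((1 + b powi (- k) * \<rho> z) powr N * cmod (conv mul (dilate a (b powi k) (\<eta> l)) (dilate a (b powi j) \<psi>) z)) \<partial>lborel)
             = C_int a mul \<rho> (\<eta> l) \<psi> u N"
            unfolding neg u_def by (rule C_int_scaled) (use l bj in auto)
          also have "ennreal ((1 + b powi (- k) * \<rho> y) powr N) * (ennreal (c0 powr N) * C_int a mul \<rho> (\<eta> l) \<psi> u N * peetre mul \<rho> N (b powi (- k)) (F k l) x)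
            \<le> ennreal (max 1 u powr N * w) * (ennreal (c0 powr N) * C_int a mul \<rho> (\<eta> l) \<psi> u N * peetre mul \<rho> N (b powi (- k)) (F k l) x)"
            by (intro mult_right_mono ennreal_leI ww) auto
          also have "\<dots> = ennreal w * ennreal (c0 powr N) * ((C_int a mul \<rho> (\<eta> l) \<psi> u N * ennreal (max 1 u powr N)) * peetre mul \<rho> N (b powi (- k)) (F k l) x)"
            by (simp add: w_def ennreal_mult mult_ac)
          also have "\<dots> \<le> ennreal w * ennreal (c0 powr N) * (ennreal (K' * c ^ nat \<bar>j - k\<bar>) * peetre mul \<rho> N (b powi (- k)) (F k l) x)"
            unfolding u_def by (intro mult_left_mono mult_right_mono cc l) auto
          also have "\<dots> = (ennreal w * ennreal (c0 powr N * K')) * (ennreal (c ^ nat \<bar>j - k\<bar>) * peetre mul \<rho> N (b powi (- k)) (F k l) x)"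
            using K'pos by (simp add: ennreal_mult mult_ac c_def)
          finally show ?thesis .
        qed
        then show "(\<Sum>l=1..M. ennreal (cmod (conv mul (F k l) (conv mul (dilate a (b powi k) (\<eta> l)) (dilate a (b powi j) \<psi>)) (mul x (- y)))))
          \<le> (ennreal w * ennreal (c0 powr N * K')) * (ennreal (c ^ nat \<bar>j - k\<bar>) * (\<Sum>l=1..M. peetre mul \<rho> N (b powi (- k)) (F k l) x))"
          by (simp only: sum_distrib_left) (intro sum_mono)
      qed
      also have "\<dots> = ennreal w * ennreal (c0 powr N * K') * (\<integral>\<^sup>+k. ennreal (c ^ nat \<bar>j - k\<bar>) * (\<Sum>l=1..M. peetre mul \<rho> N (b powi (- k)) (F k l) x) \<partial>count_space UNIV)"
        by (rule nn_integral_cmult) simp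
      finally show "ennreal (cmod (conv mul f (dilate a (b powi j) \<psi>) (mul x (- y))))
         \<le> ennreal ((1 + b powi (- j) * \<rho> y) powr N) * (ennreal (c0 powr N * K') * (\<integral>\<^sup>+k. ennreal (c ^ nat \<bar>j - k\<bar>) * (\<Sum>l=1..M. peetre mul \<rho> N (b powi (- k)) (F k l) x) \<partial>count_space UNIV))"
        by (simp add: w_def mult.assoc)
    qed (use bj[of "- j"] in simp)
  qed
qed

section \<open>Control by the Hardy--Littlewood maximal function\<close>

text \<open>Compare the value of \<open>F = f * \<phi>\<^sub>\<tau>\<close> at \<open>u = x y\<^sup>-\<^sup>1\<close> with its values on the ball of radius
  \<open>\<delta> \<tau>\<close> about \<open>u\<close>: the difference is controlled by the derivatives, with a factor \<open>\<delta>\<close> because all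
  \<open>a\<^sub>i\<close> are at least 1. The average over this ball is compared with that over a ball about \<open>x\<close>; the
  ratio of the volumes is at most a constant times \<open>\<delta>\<^sup>-\<^sup>\<gamma> (1 + \<rho> y / \<tau>)\<^sup>\<gamma>\<close>, and \<open>r\<close> is chosen so that \<open>N r = \<gamma>\<close>.\<close>

lemma peetre_local:
  fixes \<phi> :: "real ^ ('n::{finite, linorder}) \<Rightarrow> complex"
  assumes \<phi>: "\<phi> \<in> schwartz" and N: "N > 0"
  defines "r \<equiv> hom_dim a / N"
  shows "\<exists>C>0. \<forall>f\<in>schwartz. \<forall>\<tau> \<delta> x. 0 < \<tau> \<longrightarrow> 0 < \<delta> \<longrightarrow> \<delta> \<le> 1 \<longrightarrow>
    epowr (peetre mul \<rho> N (1 / \<tau>) (conv mul f (dilate a \<tau> \<phi>)) x) r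
      \<le> ennreal (C * \<delta> powr (- hom_dim a)) * maxfun lborel (\<lambda>v. ennreal (cmod (conv mul f (dilate a \<tau> \<phi>) v) powr r)) x
        + ennreal (C * \<delta> powr r) * epowr (\<Sum>i\<in>UNIV. peetre mul \<rho> N (1 / \<tau>) (conv mul f (dilate a \<tau> (left_deriv mul i \<phi>))) x) r"
proof -
  define \<gamma> where "\<gamma> = hom_dim a"
  have \<gamma>: "\<gamma> > 0" using hom_dim_ge_1 by (simp add: \<gamma>_def)
  have r: "r > 0" "N * r = \<gamma>" using \<gamma> N by (auto simp: r_def \<gamma>_def)
  define C where "C = 2 powr r * (2 * c0) powr \<gamma>"
  have C: "C > 0" using c0(1) by (simp add: C_def)
  have "epowr (peetre mul \<rho> N (1 / \<tau>) (conv mul f (dilate a \<tau> \<phi>)) x) r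
      \<le> ennreal (C * \<delta> powr (- \<gamma>)) * maxfun lborel (\<lambda>v. ennreal (cmod (conv mul f (dilate a \<tau> \<phi>) v) powr r)) x
        + ennreal (C * \<delta> powr r) * epowr (\<Sum>i\<in>UNIV. peetre mul \<rho> N (1 / \<tau>) (conv mul f (dilate a \<tau> (left_deriv mul i \<phi>))) x) r"
    if f: "f \<in> schwartz" and \<tau>: "0 < \<tau>" and \<delta>: "0 < \<delta>" "\<delta> \<le> 1" for f \<tau> \<delta> x
  proof -
    note [measurable] = schwartz_measurable[OF f] schwartz_measurable[OF \<phi>]
    define F where "F = conv mul f (dilate a \<tau> \<phi>)"
    define Fi where "Fi = (\<lambda>i. conv mul f (dilate a \<tau> (left_deriv mul i \<phi>)))"
    have [measurable]: "F \<in> borel_measurable borel" unfolding F_def by measurable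
    define R where "R = 1 / \<tau>"
    have R: "R > 0" using \<tau> by (simp add: R_def)
    define P where "P = (\<lambda>i. enn2real (peetre mul \<rho> N R (Fi i) x))"
    have P: "peetre mul \<rho> N R (Fi i) x = ennreal (P i)" for i
    proof -
      obtain B where "\<forall>x. cmod (Fi i x) \<le> B"
        using schwartz_conv_bounded[OF f schwartz_left_deriv[OF \<phi>] \<tau>] unfolding Fi_def by blast
      then have "peetre mul \<rho> N R (Fi i) x \<le> ennreal B" using R N by (intro peetre_bounded) auto
      from le_less_trans[OF this ennreal_less_top] show ?thesis by (simp add: P_def)
    qed
    have P0: "P i \<ge> 0" for i by (simp add: P_def)
    define S where "S = (\<Sum>i\<in>UNIV. P i)"
    have S0: "S \<ge> 0" unfolding S_def using P0 by (intro sum_nonneg) auto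
    define m where "m = maxfun lborel (\<lambda>v. ennreal (cmod (F v) powr r)) x"
    define rhs where "rhs = ennreal (C * \<delta> powr (- \<gamma>)) * m + ennreal (C * \<delta> powr r) * ennreal (S powr r)"
    have main: "ennreal (cmod (F (mul x (- y))) powr r) \<le> ennreal ((1 + R * \<rho> y) powr \<gamma>) * rhs" for y
    proof -
      define u where "u = mul x (- y)"
      define w where "w = 1 + R * \<rho> y"
      have w: "w \<ge> 1" using R by (simp add: w_def)
      define t where "t = \<delta> * \<tau>"
      have t: "t > 0" using \<delta> \<tau> by (simp add: t_def)
      define Y where "Y = (2 * c0) powr N * w powr N * S"
      have Y: "Y \<ge> 0" using S0 by (simp add: Y_def)
      have near: "cmod (F u) \<le> cmod (F v) + \<delta> * Y" if v: "v \<in> qball u t" for v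
      proof -
        define z where "z = mul (- u) v"
        have v_eq: "v = mul u z" by (simp add: z_def)
        have \<rho>z: "\<rho> z < t" using v by (simp add: qball_def gdist_def z_def)
        have "cmod (Fi i (mul u (s *\<^sub>R z))) \<le> P i * ((2 * c0) powr N * w powr N)" if s: "0 \<le> s" "s \<le> 1" for i s
        proof -
          have "R * \<rho> (s *\<^sub>R z) \<le> R * t" using rho_scaleR_le[OF s, of z] \<rho>z R by (intro mult_left_mono) auto
          also have "R * t \<le> 1" using \<tau> \<delta> by (simp add: R_def t_def)
          finally have s1: "R * \<rho> (s *\<^sub>R z) \<le> 1" .
          have "1 + R * \<rho> (mul (- (s *\<^sub>R z)) y) \<le> c0 * ((1 + R * \<rho> (- (s *\<^sub>R z))) * (1 + R * \<rho> y))"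
            using R by (intro one_plus_scaled_rho_mul) auto
          also have "\<dots> \<le> c0 * (2 * w)"
            using s1 w c0(1) by (intro mult_left_mono mult_mono) (auto simp: w_def)
          finally have le: "1 + R * \<rho> (mul (- (s *\<^sub>R z)) y) \<le> 2 * c0 * w" by simp
          have e: "mul u (s *\<^sub>R z) = mul x (- mul (- (s *\<^sub>R z)) y)" by (simp add: u_def minus_mul mul_assoc)
          have "ennreal (cmod (Fi i (mul u (s *\<^sub>R z)))) \<le> ennreal ((1 + R * \<rho> (mul (- (s *\<^sub>R z)) y)) powr N) * peetre mul \<rho> N R (Fi i) x"
            unfolding e using R by (intro le_peetre) auto
          also have "\<dots> \<le> ennreal ((2 * c0 * w) powr N) * ennreal (P i)"
            unfolding P using N R le by (intro mult_right_mono ennreal_leI powr_mono2) auto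
          also have "\<dots> = ennreal (P i * ((2 * c0) powr N * w powr N))"
            using P0[of i] c0(1) w by (simp add: powr_mult mult_ac flip: ennreal_mult)
          finally show ?thesis using P0[of i] by (simp add: ennreal_le_iff)
        qed
        then have "cmod (F (mul u z) - F u) \<le> (\<Sum>i\<in>UNIV. \<bar>z $ i\<bar> * \<tau> powr (- a i) * (P i * ((2 * c0) powr N * w powr N)))"
          unfolding F_def Fi_def by (intro conv_difference_bound[OF f \<phi> \<tau>]) auto
        also have "\<dots> \<le> (\<Sum>i\<in>UNIV. \<delta> * (P i * ((2 * c0) powr N * w powr N)))"
        proof (intro sum_mono mult_right_mono)
          fix i
          have "\<bar>z $ i\<bar> \<le> \<rho> z powr a i" by (rule coord_le_rho)
          also have "\<dots> \<le> t powr a i" using \<rho>z a_ge_1[of i] by (intro powr_mono2) auto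
          also have "\<dots> = \<delta> powr a i * \<tau> powr a i" using \<delta> \<tau> by (simp add: t_def powr_mult)
          finally have "\<bar>z $ i\<bar> * \<tau> powr (- a i) \<le> \<delta> powr a i * \<tau> powr a i * \<tau> powr (- a i)"
            by (intro mult_right_mono) auto
          also have "\<dots> = \<delta> powr a i" using \<tau> by (simp add: mult.assoc flip: powr_add)
          also have "\<dots> \<le> \<delta> powr 1" using \<delta> a_ge_1[of i] by (intro powr_mono') auto
          finally show "\<bar>z $ i\<bar> * \<tau> powr (- a i) \<le> \<delta>" using \<delta> by simp
        qed (use P0 in auto)
        also have "\<dots> = \<delta> * Y"
          by (simp add: Y_def S_def sum_distrib_left[symmetric] sum_distrib_right[symmetric] mult_ac)
        finally have "cmod (F (mul u z) - F u) \<le> \<delta> * Y" .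
        then show ?thesis using norm_triangle_ineq3[of "F (mul u z)" "F u"] by (simp add: v_eq)
      qed
      have pt: "ennreal (cmod (F u) powr r) \<le> ennreal (2 powr r) * (ennreal (cmod (F v) powr r) + ennreal ((\<delta> * Y) powr r))"
        if v: "v \<in> qball u t" for v
      proof -
        have dY: "0 \<le> \<delta> * Y" using \<delta> Y by simp
        have "epowr (ennreal (cmod (F u))) r \<le> epowr (ennreal (cmod (F v)) + ennreal (\<delta> * Y)) r"
        proof (rule epowr_mono)
          show "ennreal (cmod (F u)) \<le> ennreal (cmod (F v)) + ennreal (\<delta> * Y)"
            unfolding ennreal_plus[OF norm_ge_zero dY, symmetric] by (rule ennreal_leI[OF near[OF v]])
        qed (use r in simp)
        also have "\<dots> \<le> ennreal (2 powr r) * (epowr (ennreal (cmod (F v))) r + epowr (ennreal (\<delta> * Y)) r)"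
          by (rule epowr_add_le[OF r(1)])
        finally show ?thesis using dY by (simp only: epowr_ennreal norm_ge_zero)
      qed
      define T where "T = c0 * (\<rho> y + t)"
      have T: "T > 0" using c0(1) t by (simp add: T_def add_nonneg_pos)
      have sub: "qball u t \<subseteq> qball x T"
      proof
        fix v assume v: "v \<in> qball u t"
        define z where "z = mul (- u) v"
        have \<rho>z: "\<rho> z < t" using v by (simp add: qball_def gdist_def z_def)
        have "mul (- x) v = mul (- y) z" by (simp add: z_def u_def minus_mul mul_assoc[symmetric])
        then have "\<rho> (mul (- x) v) \<le> c0 * (\<rho> y + \<rho> z)" using c0(2)[of "- y" z] by simp
        also have "\<dots> < T" unfolding T_def using c0(1) \<rho>z by (intro mult_strict_left_mono) auto
        finally show "v \<in> qball x T" by (simp add: qball_def gdist_def)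
      qed
      define V where "V = ball_volume * t powr \<gamma>"
      define V' where "V' = ball_volume * T powr \<gamma>"
      have V: "emeasure lborel (qball u t) = ennreal V" "V > 0"
        using t ball_volume_pos by (auto simp: V_def emeasure_qball \<gamma>_def)
      have V': "emeasure lborel (qball x T) = ennreal V'" "V' > 0"
        using T ball_volume_pos by (auto simp: V'_def emeasure_qball \<gamma>_def)
      have VV: "V' \<le> V * ((c0 / \<delta>) powr \<gamma> * w powr \<gamma>)"
      proof -
        have "T \<le> t * (c0 / \<delta> * w)"
        proof -
          have "t * (c0 / \<delta> * w) = c0 * (\<rho> y + \<tau>)" using \<delta> \<tau> by (simp add: t_def w_def R_def field_simps)
          moreover have "t \<le> \<tau>" using \<delta> \<tau> by (simp add: t_def)
          ultimately show ?thesis using c0(1) by (simp add: T_def)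
        qed
        then have "T powr \<gamma> \<le> (t * (c0 / \<delta> * w)) powr \<gamma>" using T \<gamma> by (intro powr_mono2) auto
        also have "\<dots> = t powr \<gamma> * ((c0 / \<delta>) powr \<gamma> * w powr \<gamma>)"
          by (simp only: powr_mult)
        finally show ?thesis using ball_volume_pos by (simp add: V_def V'_def mult.assoc)
      qed
      have int: "(\<integral>\<^sup>+v\<in>qball u t. ennreal (cmod (F v) powr r) \<partial>lborel) \<le> ennreal V' * m"
      proof -
        have "(\<integral>\<^sup>+v\<in>qball u t. ennreal (cmod (F v) powr r) \<partial>lborel) \<le> (\<integral>\<^sup>+v\<in>qball x T. ennreal (cmod (F v) powr r) \<partial>lborel)"
          using sub by (intro nn_integral_mono) (auto split: split_indicator)
        also have "\<dots> = ennreal V' * ((\<integral>\<^sup>+v\<in>qball x T. ennreal (cmod (F v) powr r) \<partial>lborel) / ennreal V')"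
          using V'(2) by (subst mult.commute, subst ennreal_divide_times) (auto simp: ennreal_divide_self)
        also have "\<dots> \<le> ennreal V' * m"
          unfolding m_def V'(1)[symmetric] by (intro mult_left_mono average_le_maxfun T center_in_qball) auto
        finally show ?thesis .
      qed
      have "ennreal V * ennreal (cmod (F u) powr r) = (\<integral>\<^sup>+v\<in>qball u t. ennreal (cmod (F u) powr r) \<partial>lborel)"
        by (subst nn_integral_cmult_indicator) (auto simp: V mult.commute)
      also have "\<dots> \<le> (\<integral>\<^sup>+v. ennreal (2 powr r) * (ennreal (cmod (F v) powr r) * indicator (qball u t) v + ennreal ((\<delta> * Y) powr r) * indicator (qball u t) v) \<partial>lborel)"
        using pt by (intro nn_integral_mono) (auto split: split_indicator)
      also have "\<dots> = ennreal (2 powr r) * ((\<integral>\<^sup>+v\<in>qball u t. ennreal (cmod (F v) powr r) \<partial>lborel) + ennreal ((\<delta> * Y) powr r) * ennreal V)"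
        by (subst nn_integral_cmult, simp, subst nn_integral_add) (auto simp: nn_integral_cmult_indicator V)
      also have "\<dots> \<le> ennreal (2 powr r) * (ennreal (V * ((c0 / \<delta>) powr \<gamma> * w powr \<gamma>)) * m + ennreal ((\<delta> * Y) powr r) * ennreal V)"
        by (intro mult_left_mono add_mono order_trans[OF int] mult_right_mono ennreal_leI VV) auto
      also have "\<dots> = ennreal V * (ennreal (2 powr r * ((c0 / \<delta>) powr \<gamma> * w powr \<gamma>)) * m + ennreal (2 powr r * (\<delta> * Y) powr r))"
        using V(2) by (simp add: ennreal_mult distrib_left mult_ac)
      finally have "ennreal (1 / V) * (ennreal V * ennreal (cmod (F u) powr r))
         \<le> ennreal (1 / V) * (ennreal V * (ennreal (2 powr r * ((c0 / \<delta>) powr \<gamma> * w powr \<gamma>)) * m + ennreal (2 powr r * (\<delta> * Y) powr r)))"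
        by (rule mult_left_mono) simp
      then have "ennreal (cmod (F u) powr r) \<le> ennreal (2 powr r * ((c0 / \<delta>) powr \<gamma> * w powr \<gamma>)) * m + ennreal (2 powr r * (\<delta> * Y) powr r)"
        using V(2) by (simp add: mult.assoc[symmetric] ennreal_mult[symmetric])
      also have "\<dots> \<le> ennreal (w powr \<gamma> * (C * \<delta> powr (- \<gamma>))) * m + ennreal (w powr \<gamma> * (C * \<delta> powr r * S powr r))"
      proof (intro add_mono mult_right_mono ennreal_leI)
        have "c0 powr \<gamma> \<le> (2 * c0) powr \<gamma>" using c0(1) \<gamma> by (intro powr_mono2) auto
        then have "(c0 / \<delta>) powr \<gamma> \<le> (2 * c0) powr \<gamma> * \<delta> powr (- \<gamma>)"
          using c0(1) \<delta> by (simp add: powr_divide powr_minus_divide divide_right_mono)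
        then have "2 powr r * ((c0 / \<delta>) powr \<gamma> * w powr \<gamma>) \<le> 2 powr r * (((2 * c0) powr \<gamma> * \<delta> powr (- \<gamma>)) * w powr \<gamma>)"
          by (intro mult_left_mono mult_right_mono) auto
        then show "2 powr r * ((c0 / \<delta>) powr \<gamma> * w powr \<gamma>) \<le> w powr \<gamma> * (C * \<delta> powr (- \<gamma>))" by (simp add: C_def mult_ac)
        have "(\<delta> * Y) powr r = \<delta> powr r * (((2 * c0) powr (N * r)) * w powr (N * r) * S powr r)"
          using \<delta> S0 c0(1) w by (simp add: Y_def powr_mult powr_powr)
        then show "2 powr r * (\<delta> * Y) powr r \<le> w powr \<gamma> * (C * \<delta> powr r * S powr r)" by (simp add: C_def r(2) mult_ac)
      qed simp
      also have "\<dots> = ennreal (w powr \<gamma>) * rhs"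
        using C by (simp add: rhs_def ennreal_mult distrib_left mult_ac)
      finally show ?thesis by (simp add: u_def w_def)
    qed
    have "peetre mul \<rho> N R F x \<le> epowr rhs (1 / r)"
    proof (rule peetre_le)
      fix y
      have w: "1 + R * \<rho> y > 0" using R by (simp add: add_pos_nonneg)
      have "epowr (ennreal (cmod (F (mul x (- y))))) r \<le> ennreal ((1 + R * \<rho> y) powr \<gamma>) * rhs"
        using main[of y] by (simp add: epowr_ennreal)
      then have "ennreal (cmod (F (mul x (- y)))) \<le> epowr (ennreal ((1 + R * \<rho> y) powr \<gamma>) * rhs) (1 / r)"
        using r by (simp add: epowr_le_iff)
      also have "\<dots> = ennreal ((1 + R * \<rho> y) powr N) * epowr rhs (1 / r)"
        using r w by (simp add: epowr_mult epowr_ennreal powr_powr flip: r(2))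
      finally show "ennreal (cmod (F (mul x (- y)))) \<le> ennreal ((1 + R * \<rho> y) powr N) * epowr rhs (1 / r)" .
    qed (use R in simp)
    then have "epowr (peetre mul \<rho> N R F x) r \<le> rhs" using r by (simp add: epowr_le_iff)
    moreover have "ennreal (S powr r) = epowr (\<Sum>i\<in>UNIV. peetre mul \<rho> N R (Fi i) x) r"
      using P0 S0 by (simp add: P S_def sum_ennreal epowr_ennreal)
    ultimately show ?thesis by (simp add: rhs_def m_def F_def Fi_def R_def)
  qed
  then show ?thesis using C unfolding \<gamma>_def by blast
qed

text \<open>By \<open>peetre_comparison\<close> and \<open>discrete_convolution_lq\<close> the derivative terms in
  \<open>peetre_local\<close> contribute at most a multiple of \<open>\<delta>\<^sup>q\<close> times the left-hand side.\<close>

lemma peetre_lq_le_maximal: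
  assumes R: "reproducing b M \<phi> \<eta>" and N: "N > 0" and q: "q > 0" and \<epsilon>: "\<epsilon> > 0"
    and C1: "\<And>k l m. l \<in> {1..M} \<Longrightarrow> m \<in> {1..M} \<Longrightarrow> (\<eta> m, left_deriv mul k (\<phi> l)) \<in> C1_class a mul \<rho> (N + \<epsilon>) N"
  defines "r \<equiv> hom_dim a / N"
  shows "\<exists>C>0. \<forall>f\<in>schwartz. \<forall>x.
    (\<integral>\<^sup>+k. epowr (\<Sum>l=1..M. peetre mul \<rho> N (b powi (- k)) (conv mul f (dilate a (b powi k) (\<phi> l))) x) q \<partial>count_space UNIV)
     \<le> ennreal C * (\<Sum>l=1..M. \<integral>\<^sup>+k. epowr (maxfun lborel (\<lambda>v. ennreal (cmod (conv mul f (dilate a (b powi k) (\<phi> l)) v) powr r)) x) (q / r) \<partial>count_space UNIV)"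
proof -
  have b: "0 < b" "b < 1" and S: "\<And>l. l \<in> {1..M} \<Longrightarrow> \<phi> l \<in> schwartz" "\<And>l. l \<in> {1..M} \<Longrightarrow> \<eta> l \<in> schwartz"
    and z: "\<And>l. l \<in> {1..M} \<Longrightarrow> (\<integral>x. \<phi> l x \<partial>lborel) = 0"
    using R by (auto simp: reproducing_def)
  have bj: "b powi j > 0" for j using b by simp
  have neg: "b powi (- k) = 1 / b powi k" for k by (simp add: power_int_minus inverse_eq_divide)
  have r: "r > 0" using hom_dim_ge_1 N by (auto simp: r_def)
  define c where "c = b powr min \<epsilon> 1"
  have c: "0 < c" "c < 1" using b \<epsilon> powr_less_mono2[of "min \<epsilon> 1" b 1] by (auto simp: c_def)
  obtain C2 where C2: "C2 > 0" "\<And>u :: int \<Rightarrow> ennreal.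
    (\<integral>\<^sup>+k. epowr (\<integral>\<^sup>+j. ennreal (c ^ nat \<bar>k - j\<bar>) * u j \<partial>count_space UNIV) q \<partial>count_space UNIV)
      \<le> ennreal C2 * (\<integral>\<^sup>+j. epowr (u j) q \<partial>count_space UNIV)"
    using discrete_convolution_lq[OF c q] by blast
  define A where "A = (\<lambda>f x k. \<Sum>l=1..M. peetre mul \<rho> N (b powi (- k)) (conv mul f (dilate a (b powi k) (\<phi> l))) x)"
  define s where "s = (\<lambda>f x j. \<integral>\<^sup>+k. ennreal (c ^ nat \<bar>j - k\<bar>) * A f x k \<partial>count_space UNIV)"
  have ex: "\<exists>K>0. \<forall>f\<in>schwartz. \<forall>j x. peetre mul \<rho> N (b powi (- j)) (conv mul f (dilate a (b powi j) (left_deriv mul i (\<phi> l)))) x \<le> ennreal K * s f x j"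
    if "l \<in> {1..M}" for i l
    unfolding s_def A_def c_def
    by (rule peetre_comparison[OF R schwartz_left_deriv[OF S(1)[OF that]] integral_left_deriv[OF S(1)[OF that]] _ \<epsilon> C1[OF that]])
       (use N in auto)
  define Kf where "Kf = (\<lambda>i l. SOME K. K > 0 \<and> (\<forall>f\<in>schwartz. \<forall>j x.
      peetre mul \<rho> N (b powi (- j)) (conv mul f (dilate a (b powi j) (left_deriv mul i (\<phi> l)))) x \<le> ennreal K * s f x j))"
  have "Kf i l > 0 \<and> (\<forall>f\<in>schwartz. \<forall>j x.
      peetre mul \<rho> N (b powi (- j)) (conv mul f (dilate a (b powi j) (left_deriv mul i (\<phi> l)))) x \<le> ennreal (Kf i l) * s f x j)"
    if "l \<in> {1..M}" for i l
    unfolding Kf_def by (rule someI_ex[OF ex[OF that]])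
  then have Kf: "\<And>i l. l \<in> {1..M} \<Longrightarrow> Kf i l > 0" "\<And>i l f j x. l \<in> {1..M} \<Longrightarrow> f \<in> schwartz \<Longrightarrow>
      peetre mul \<rho> N (b powi (- j)) (conv mul f (dilate a (b powi j) (left_deriv mul i (\<phi> l)))) x \<le> ennreal (Kf i l) * s f x j"
    by blast+
  define K where "K = (\<Sum>l=1..M. \<Sum>i\<in>UNIV. Kf i l)"
  have K0: "K \<ge> 0" unfolding K_def using Kf(1) by (intro sum_nonneg) (auto simp: less_imp_le)
  have sumX: "(\<Sum>i\<in>UNIV. peetre mul \<rho> N (b powi (- j)) (conv mul f (dilate a (b powi j) (left_deriv mul i (\<phi> l)))) x) \<le> ennreal K * s f x j"
    if l: "l \<in> {1..M}" and f: "f \<in> schwartz" for l f j x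
  proof -
    have "(\<Sum>i\<in>UNIV. peetre mul \<rho> N (b powi (- j)) (conv mul f (dilate a (b powi j) (left_deriv mul i (\<phi> l)))) x) \<le> (\<Sum>i\<in>UNIV. ennreal (Kf i l) * s f x j)"
      by (intro sum_mono Kf(2) l f)
    also have "\<dots> = ennreal (\<Sum>i\<in>UNIV. Kf i l) * s f x j"
      using Kf(1)[OF l] by (simp add: sum_distrib_right[symmetric] less_imp_le)
    also have "\<dots> \<le> ennreal K * s f x j"
      unfolding K_def using l Kf(1) by (intro mult_right_mono ennreal_leI member_le_sum sum_nonneg) (auto simp: less_imp_le)
    finally show ?thesis .
  qed
  have "\<exists>C>0. \<forall>f\<in>schwartz. \<forall>\<tau> \<delta> x. 0 < \<tau> \<longrightarrow> 0 < \<delta> \<longrightarrow> \<delta> \<le> 1 \<longrightarrow>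
    epowr (peetre mul \<rho> N (1 / \<tau>) (conv mul f (dilate a \<tau> (\<phi> l))) x) r
      \<le> ennreal (C * \<delta> powr (- hom_dim a)) * maxfun lborel (\<lambda>v. ennreal (cmod (conv mul f (dilate a \<tau> (\<phi> l)) v) powr r)) x
        + ennreal (C * \<delta> powr r) * epowr (\<Sum>i\<in>UNIV. peetre mul \<rho> N (1 / \<tau>) (conv mul f (dilate a \<tau> (left_deriv mul i (\<phi> l)))) x) r"
    if "l \<in> {1..M}" for l
    unfolding r_def by (rule peetre_local[OF S(1)[OF that] N])
  then obtain Cf where Cf: "\<And>l. l \<in> {1..M} \<Longrightarrow> Cf l > 0" "\<And>l f \<tau> \<delta> x. l \<in> {1..M} \<Longrightarrow> f \<in> schwartz \<Longrightarrow> 0 < \<tau> \<Longrightarrow> 0 < \<delta> \<Longrightarrow> \<delta> \<le> 1 \<Longrightarrow>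
    epowr (peetre mul \<rho> N (1 / \<tau>) (conv mul f (dilate a \<tau> (\<phi> l))) x) r
      \<le> ennreal (Cf l * \<delta> powr (- hom_dim a)) * maxfun lborel (\<lambda>v. ennreal (cmod (conv mul f (dilate a \<tau> (\<phi> l)) v) powr r)) x
        + ennreal (Cf l * \<delta> powr r) * epowr (\<Sum>i\<in>UNIV. peetre mul \<rho> N (1 / \<tau>) (conv mul f (dilate a \<tau> (left_deriv mul i (\<phi> l)))) x) r"
    by metis
  define C where "C = (\<Sum>l=1..M. Cf l)"
  have C_ge: "Cf l \<le> C" if "l \<in> {1..M}" for l
    unfolding C_def using that Cf(1) by (intro member_le_sum) (auto simp: less_imp_le)
  have C0: "C \<ge> 0" unfolding C_def using Cf(1) by (intro sum_nonneg) (auto simp: less_imp_le)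
  define m where "m = (\<lambda>f x l k. maxfun lborel (\<lambda>v. ennreal (cmod (conv mul f (dilate a (b powi k) (\<phi> l)) v) powr r)) x)"
  define H where "H = real M powr q * 2 powr (q / r)"
  define G where "G = H * real M * (C powr (q / r) * K powr q) * C2"
  have H0: "H \<ge> 0" and G0: "G \<ge> 0" using C2 by (auto simp: G_def H_def)
  \<comment> \<open>\<open>G \<delta>\<^sup>q\<close> is the factor of the term to be absorbed.\<close>
  define \<delta> where "\<delta> = (1 / (2 * (G + 1))) powr (1 / q)"
  have \<delta>: "0 < \<delta>" "\<delta> \<le> 1" "G * \<delta> powr q \<le> 1 / 2"
  proof -
    show "0 < \<delta>" using G0 by (simp add: \<delta>_def)
    have "(1 / (2 * (G + 1))) powr (1 / q) \<le> 1 powr (1 / q)" using G0 q by (intro powr_mono2) auto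
    then show "\<delta> \<le> 1" by (simp add: \<delta>_def)
    have "\<delta> powr q = 1 / (2 * (G + 1))" using G0 q by (simp add: \<delta>_def powr_powr)
    then have "G * \<delta> powr q = G / (2 * (G + 1))" by simp
    also have "\<dots> \<le> 1 / 2" using G0 by (simp add: field_simps)
    finally show "G * \<delta> powr q \<le> 1 / 2" .
  qed
  define L where "L = H * (C * \<delta> powr (- hom_dim a)) powr (q / r)"
  have L0: "L \<ge> 0" using H0 by (simp add: L_def)
  show ?thesis
  proof (intro exI[of _ "2 * L + 1"] conjI ballI allI)
    show "2 * L + 1 > 0" using L0 by simp
    fix f :: "real ^ ('n::{finite, linorder}) \<Rightarrow> complex" and x assume f: "f \<in> schwartz"
    define U where "U = (\<integral>\<^sup>+k. epowr (A f x k) q \<partial>count_space UNIV)"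
    define W where "W = (\<Sum>l=1..M. \<integral>\<^sup>+k. epowr (m f x l k) (q / r) \<partial>count_space UNIV)"
    \<comment> \<open>The Peetre maximal function is bounded by the supremum of the function.\<close>
    have U_fin: "U < top"
    proof -
      have "\<exists>C>0. \<forall>k x. cmod (conv mul f (dilate a (b powi k) (\<phi> l)) x) \<le> C * b ^ nat \<bar>k\<bar>" if "l \<in> {1..M}" for l
        by (rule conv_uniform_decay[OF f S(1)[OF that] z[OF that] b])
      then obtain E where E: "\<And>l. l \<in> {1..M} \<Longrightarrow> E l > 0"
        "\<And>l k x. l \<in> {1..M} \<Longrightarrow> cmod (conv mul f (dilate a (b powi k) (\<phi> l)) x) \<le> E l * b ^ nat \<bar>k\<bar>" by metis
      define E' where "E' = (\<Sum>l=1..M. E l)"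
      have E'0: "E' \<ge> 0" unfolding E'_def using E(1) by (intro sum_nonneg) (auto simp: less_imp_le)
      define d where "d = b powr q"
      have d: "0 < d" "d < 1" using b q powr_less_mono2[of q b 1] by (auto simp: d_def)
      have "epowr (A f x k) q \<le> ennreal (E' powr q) * ennreal (d ^ nat \<bar>k\<bar>)" for k
      proof -
        have "A f x k \<le> (\<Sum>l=1..M. ennreal (E l * b ^ nat \<bar>k\<bar>))"
          unfolding A_def using N bj[of "- k"] by (intro sum_mono peetre_bounded E(2)) (auto simp: less_imp_le)
        also have "\<dots> = ennreal (E' * b ^ nat \<bar>k\<bar>)"
          using E(1) b by (subst sum_ennreal) (auto simp: E'_def sum_distrib_right less_imp_le)
        finally have "epowr (A f x k) q \<le> epowr (ennreal (E' * b ^ nat \<bar>k\<bar>)) q" using q by (intro epowr_mono) auto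
        also have "\<dots> = ennreal ((E' * b ^ nat \<bar>k\<bar>) powr q)" using E'0 b by (intro epowr_ennreal) auto
        also have "(E' * b ^ nat \<bar>k\<bar>) powr q = E' powr q * d ^ nat \<bar>k\<bar>"
          using E'0 b by (simp add: powr_mult power_powr_swap d_def)
        finally show ?thesis using d by (simp add: ennreal_mult)
      qed
      then have "U \<le> (\<integral>\<^sup>+k. ennreal (E' powr q) * ennreal (d ^ nat \<bar>k\<bar>) \<partial>count_space (UNIV :: int set))"
        unfolding U_def by (intro nn_integral_mono)
      also have "\<dots> = ennreal (E' powr q) * (\<integral>\<^sup>+k. ennreal (d ^ nat \<bar>k\<bar>) \<partial>count_space (UNIV :: int set))"
        by (rule nn_integral_cmult) simp
      also have "\<dots> < top" using geometric_int_finite[of d] d by (simp add: ennreal_mult_less_top)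
      finally show ?thesis .
    qed
    have pt: "epowr (A f x k) q \<le> ennreal L * (\<Sum>l=1..M. epowr (m f x l k) (q / r))
        + ennreal (H * real M * ((C * \<delta> powr r) powr (q / r) * K powr q)) * epowr (s f x k) q" for k
    proof -
      have one: "epowr (peetre mul \<rho> N (b powi (- k)) (conv mul f (dilate a (b powi k) (\<phi> l))) x) q
        \<le> ennreal (2 powr (q / r)) * (ennreal ((C * \<delta> powr (- hom_dim a)) powr (q / r)) * epowr (m f x l k) (q / r)
            + ennreal ((C * \<delta> powr r) powr (q / r) * K powr q) * epowr (s f x k) q)" if l: "l \<in> {1..M}" for l
      proof -
        define p where "p = peetre mul \<rho> N (b powi (- k)) (conv mul f (dilate a (b powi k) (\<phi> l))) x"
        have "epowr p r \<le> ennreal (Cf l * \<delta> powr (- hom_dim a)) * m f x l k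
            + ennreal (Cf l * \<delta> powr r) * epowr (\<Sum>i\<in>UNIV. peetre mul \<rho> N (b powi (- k)) (conv mul f (dilate a (b powi k) (left_deriv mul i (\<phi> l)))) x) r"
          using Cf(2)[OF l f bj \<delta>(1,2), of k x] by (simp add: p_def m_def neg)
        also have "\<dots> \<le> ennreal (C * \<delta> powr (- hom_dim a)) * m f x l k + ennreal (C * \<delta> powr r) * epowr (ennreal K * s f x k) r"
          using r by (intro add_mono mult_mono ennreal_leI mult_right_mono C_ge[OF l] epowr_mono sumX[OF l f]) auto
        finally have "epowr (epowr p r) (q / r) \<le> epowr (ennreal (C * \<delta> powr (- hom_dim a)) * m f x l k + ennreal (C * \<delta> powr r) * epowr (ennreal K * s f x k) r) (q / r)"
          using q r by (intro epowr_mono) auto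
        also have "\<dots> \<le> ennreal (2 powr (q / r)) * (epowr (ennreal (C * \<delta> powr (- hom_dim a)) * m f x l k) (q / r) + epowr (ennreal (C * \<delta> powr r) * epowr (ennreal K * s f x k) r) (q / r))"
          using q r by (intro epowr_add_le) auto
        also have "epowr (ennreal (C * \<delta> powr (- hom_dim a)) * m f x l k) (q / r) = ennreal ((C * \<delta> powr (- hom_dim a)) powr (q / r)) * epowr (m f x l k) (q / r)"
          unfolding epowr_mult using C0 by (subst epowr_ennreal) auto
        also have "epowr (ennreal (C * \<delta> powr r) * epowr (ennreal K * s f x k) r) (q / r) = ennreal ((C * \<delta> powr r) powr (q / r) * K powr q) * epowr (s f x k) q"
        proof -
          have "epowr (ennreal (C * \<delta> powr r)) (q / r) = ennreal ((C * \<delta> powr r) powr (q / r))"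
            using C0 by (intro epowr_ennreal) auto
          moreover have "epowr (epowr (ennreal K * s f x k) r) (q / r) = ennreal (K powr q) * epowr (s f x k) q"
          proof -
            have "r * (q / r) = q" using r by simp
            then have "epowr (epowr (ennreal K * s f x k) r) (q / r) = epowr (ennreal K * s f x k) q"
              by (simp only: epowr_epowr)
            then show ?thesis by (simp only: epowr_mult epowr_ennreal[OF K0])
          qed
          ultimately show ?thesis by (simp only: epowr_mult[of _ _ "q / r"] ennreal_mult powr_ge_zero mult.assoc)
        qed
        finally show ?thesis using r by (simp add: p_def epowr_epowr)
      qed
      have "epowr (A f x k) q \<le> ennreal (real M powr q) * (\<Sum>l=1..M. epowr (peetre mul \<rho> N (b powi (- k)) (conv mul f (dilate a (b powi k) (\<phi> l))) x) q)"
        using epowr_sum_le[of "{1..M}" q] q by (simp add: A_def)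
      also have "\<dots> \<le> ennreal (real M powr q) * (\<Sum>l=1..M. ennreal (2 powr (q / r)) * (ennreal ((C * \<delta> powr (- hom_dim a)) powr (q / r)) * epowr (m f x l k) (q / r)
            + ennreal ((C * \<delta> powr r) powr (q / r) * K powr q) * epowr (s f x k) q))"
        by (intro mult_left_mono sum_mono one) auto
      also have "\<dots> = ennreal (real M powr q) * ennreal (2 powr (q / r)) * (ennreal ((C * \<delta> powr (- hom_dim a)) powr (q / r)) * (\<Sum>l=1..M. epowr (m f x l k) (q / r))
            + ennreal (real M) * (ennreal ((C * \<delta> powr r) powr (q / r) * K powr q) * epowr (s f x k) q))"
        by (simp only: sum_distrib_left[symmetric] sum.distrib sum_constant card_atLeastAtMost diff_Suc_1 mult.assoc ennreal_of_nat_eq_real_of_nat)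
           (simp add: mult_ac)
      also have "\<dots> = ennreal L * (\<Sum>l=1..M. epowr (m f x l k) (q / r))
        + ennreal (H * real M * ((C * \<delta> powr r) powr (q / r) * K powr q)) * epowr (s f x k) q"
      proof -
        have 1: "ennreal L = ennreal (real M powr q) * ennreal (2 powr (q / r)) * ennreal ((C * \<delta> powr (- hom_dim a)) powr (q / r))"
          unfolding L_def H_def by (simp only: ennreal_mult powr_ge_zero mult_nonneg_nonneg)
        have 2: "ennreal (H * real M * ((C * \<delta> powr r) powr (q / r) * K powr q))
           = ennreal (real M powr q) * ennreal (2 powr (q / r)) * (ennreal (real M) * ennreal ((C * \<delta> powr r) powr (q / r) * K powr q))"
          unfolding H_def by (simp only: ennreal_mult powr_ge_zero mult_nonneg_nonneg of_nat_0_le_iff mult.assoc)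
        show ?thesis unfolding 1 2 by (simp only: distrib_left mult.assoc)
      qed
      finally show ?thesis .
    qed
    have "U \<le> (\<integral>\<^sup>+k. ennreal L * (\<Sum>l=1..M. epowr (m f x l k) (q / r))
        + ennreal (H * real M * ((C * \<delta> powr r) powr (q / r) * K powr q)) * epowr (s f x k) q \<partial>count_space UNIV)"
      unfolding U_def by (intro nn_integral_mono pt)
    also have "\<dots> = ennreal L * W + ennreal (H * real M * ((C * \<delta> powr r) powr (q / r) * K powr q)) * (\<integral>\<^sup>+k. epowr (s f x k) q \<partial>count_space UNIV)"
      by (subst nn_integral_add) (auto simp: nn_integral_cmult nn_integral_sum W_def)
    also have "\<dots> \<le> ennreal L * W + ennreal (H * real M * ((C * \<delta> powr r) powr (q / r) * K powr q)) * (ennreal C2 * U)"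
      unfolding s_def U_def by (intro add_left_mono mult_left_mono C2(2)) auto
    also have "\<dots> = ennreal L * W + ennreal (G * \<delta> powr q) * U"
    proof -
      have "(C * \<delta> powr r) powr (q / r) = C powr (q / r) * \<delta> powr q"
        using C0 r by (simp add: powr_mult powr_powr)
      then have "H * real M * ((C * \<delta> powr r) powr (q / r) * K powr q) * C2 = G * \<delta> powr q" by (simp add: G_def)
      moreover have "ennreal (H * real M * ((C * \<delta> powr r) powr (q / r) * K powr q)) * (ennreal C2 * U)
         = ennreal (H * real M * ((C * \<delta> powr r) powr (q / r) * K powr q) * C2) * U"
        using H0 C2(1) by (subst ennreal_mult[of _ C2]) (auto simp: mult.assoc)
      ultimately show ?thesis by simp
    qed
    also have "\<dots> \<le> ennreal L * W + ennreal (1 / 2) * U"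
      by (intro add_left_mono mult_right_mono ennreal_leI \<delta>(3)) auto
    finally have UW: "U \<le> ennreal L * W + ennreal (1 / 2) * U" .
    have "U \<le> ennreal (2 * L + 1) * W"
    proof (cases "W = top")
      case True
      then show ?thesis using L0 by (simp add: ennreal_mult_top)
    next
      case False
      then obtain v where v: "W = ennreal v" "v \<ge> 0" by (cases W) auto
      obtain u where u: "U = ennreal u" "u \<ge> 0" using U_fin by (cases U) auto
      have eqn: "ennreal L * W + ennreal (1 / 2) * U = ennreal (L * v + 1 / 2 * u)"
      proof -
        have "ennreal (L * v + 1 / 2 * u) = ennreal (L * v) + ennreal (1 / 2 * u)"
          using L0 v(2) u(2) by (intro ennreal_plus) auto
        also have "ennreal (L * v) = ennreal L * W" unfolding v(1) using L0 v(2) by (intro ennreal_mult)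
        also have "ennreal (1 / 2 * u) = ennreal (1 / 2) * U" unfolding u(1) using u(2) by (intro ennreal_mult) auto
        finally show ?thesis by simp
      qed
      have "U \<le> ennreal (L * v + 1 / 2 * u)" using UW unfolding eqn .
      moreover have "0 \<le> L * v + 1 / 2 * u" using L0 v(2) u(2) by simp
      ultimately have "u \<le> L * v + 1 / 2 * u" unfolding u(1) by (simp only: ennreal_le_iff)
      then have "u \<le> (2 * L + 1) * v" using v(2) by (simp add: distrib_right)
      then have "ennreal u \<le> ennreal ((2 * L + 1) * v)" by (rule ennreal_leI)
      also have "\<dots> = ennreal (2 * L + 1) * ennreal v" using L0 v(2) by (intro ennreal_mult) auto
      finally show ?thesis unfolding u(1) v(1) .
    qed
    then show "(\<integral>\<^sup>+k. epowr (\<Sum>l=1..M. peetre mul \<rho> N (b powi (- k)) (conv mul f (dilate a (b powi k) (\<phi> l))) x) q \<partial>count_space UNIV)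
     \<le> ennreal (2 * L + 1) * (\<Sum>l=1..M. \<integral>\<^sup>+k. epowr (maxfun lborel (\<lambda>v. ennreal (cmod (conv mul f (dilate a (b powi k) (\<phi> l)) v) powr r)) x) (q / r) \<partial>count_space UNIV)"
      by (simp add: U_def W_def A_def m_def)
  qed
qed

text \<open>A Lebesgue measurable weight agrees almost everywhere with a Borel function that is positive
  everywhere; the averages do not change.\<close>

lemma muckenhoupt_Ap:
  assumes w: "w \<in> muckenhoupt mul \<rho> s"
  obtains w' K where "Ap s K w'" "AE x in lborel. w x = w' x"
proof -
  have wt: "weight w" and fin: "(SUP (x, t)\<in>UNIV \<times> {0<..}.
        average (gball mul \<rho> x t) w *
        epowr (average (gball mul \<rho> x t) (\<lambda>y. w y powr (- 1 / (s - 1)))) (s - 1)) < \<infinity>"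
    using w by (auto simp: muckenhoupt_def)
  define Q where "Q = (SUP (x, t)\<in>UNIV \<times> {0<..}.
        average (gball mul \<rho> x t) w *
        epowr (average (gball mul \<rho> x t) (\<lambda>y. w y powr (- 1 / (s - 1)))) (s - 1))"
  have "Q < \<infinity>" unfolding Q_def by (rule fin)
  then obtain K where K: "K \<ge> 0" "Q = ennreal K" by (cases Q) auto
  obtain w1 where w1: "w1 \<in> borel_measurable lborel" "AE x in lborel. w x = w1 x"
    using completion_ex_borel_measurable_real[of w lborel] wt by (auto simp: weight_def)
  define w' where "w' = (\<lambda>x. if w1 x > 0 then w1 x else 1)"
  have [measurable]: "w1 \<in> borel_measurable borel" using w1 by simp
  have [measurable]: "w' \<in> borel_measurable borel" unfolding w'_def by measurable
  have pos: "w' x > 0" for x by (simp add: w'_def)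
  have "AE x in lborel. w x > 0" using wt by (simp add: weight_def AE_completion_iff)
  then have eq: "AE x in lborel. w x = w' x"
    using w1(2) by eventually_elim (simp add: w'_def)
  have "Ap s (K + 1) w'"
    unfolding Ap_def
  proof (intro conjI allI impI)
    fix x and t :: real assume t: "0 < t"
    define V where "V = ball_volume * t powr hom_dim a"
    have V: "emeasure lborel (qball x t) = ennreal V" "V > 0"
      using t ball_volume_pos by (auto simp: V_def emeasure_qball)
    define I where "I = (\<integral>\<^sup>+y\<in>qball x t. ennreal (w' y) \<partial>lborel)"
    define J where "J = (\<integral>\<^sup>+y\<in>qball x t. ennreal (w' y powr (- 1 / (s - 1))) \<partial>lborel)"
    have eV: "emeasure lebesgue (qball x t) = ennreal V" using V by simp
    have aI: "average (gball mul \<rho> x t) w = I / ennreal V"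
      unfolding average_def gball_eq_qball eV I_def nn_integral_completion
      by (intro arg_cong2[where f = "(/)"] nn_integral_cong_AE refl) (use eq in eventually_elim, simp)
    have aJ: "average (gball mul \<rho> x t) (\<lambda>y. w y powr (- 1 / (s - 1))) = J / ennreal V"
      unfolding average_def gball_eq_qball eV J_def nn_integral_completion
      by (intro arg_cong2[where f = "(/)"] nn_integral_cong_AE refl) (use eq in eventually_elim, simp)
    have "I / ennreal V * epowr (J / ennreal V) (s - 1) \<le> ennreal K"
      unfolding aI[symmetric] aJ[symmetric] K(2)[symmetric] Q_def using t by (intro SUP_upper2[of "(x, t)"]) auto
    then have "(I / ennreal V * epowr (J / ennreal V) (s - 1)) * epowr (ennreal V) s \<le> ennreal K * epowr (ennreal V) s"
      by (rule mult_right_mono) simp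
    also have "(I / ennreal V * epowr (J / ennreal V) (s - 1)) * epowr (ennreal V) s
       = (I / ennreal V * ennreal V) * epowr (J / ennreal V * ennreal V) (s - 1)"
      using epowr_add[of "ennreal V" 1 "s - 1"] by (simp add: epowr_mult mult_ac)
    also have "I / ennreal V * ennreal V = I"
      using V(2) by (subst ennreal_divide_times) (auto simp: ennreal_divide_self)
    also have "J / ennreal V * ennreal V = J"
      using V(2) by (subst ennreal_divide_times) (auto simp: ennreal_divide_self)
    also have "ennreal K * epowr (ennreal V) s \<le> ennreal (K + 1) * epowr (ennreal V) s"
      by (intro mult_right_mono ennreal_leI) auto
    finally show "I * epowr J (s - 1) \<le> ennreal (K + 1) * epowr (emeasure lborel (qball x t)) s"
      by (simp add: V)
  qed (use pos K in auto)
  then show ?thesis using eq that by blast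
qed

end

section \<open>The Littlewood--Paley inequality\<close>

theorem theorem6p4:
  fixes a :: "'n::{finite, linorder} \<Rightarrow> real"
    and mul :: "real ^ ('n::{finite, linorder}) \<Rightarrow> real ^ ('n::{finite, linorder}) \<Rightarrow> real ^ ('n::{finite, linorder})"
    and \<rho> w :: "real ^ ('n::{finite, linorder}) \<Rightarrow> real"
    and N p q b :: real
    and M :: nat
    and \<phi> \<eta> :: "nat \<Rightarrow> real ^ ('n::{finite, linorder}) \<Rightarrow> complex"
    and \<psi> :: "real ^ ('n::{finite, linorder}) \<Rightarrow> complex"
  assumes "homogeneous_group_norm a mul \<rho>"
    and "N > 0" and "hom_dim a / N < p" and "hom_dim a / N < q"
    and "w \<in> muckenhoupt mul \<rho> (p * N / hom_dim a)"
    and "\<And>l. l \<in> {1..M} \<Longrightarrow> \<phi> l \<in> schwartz"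
    and "\<And>l. l \<in> {1..M} \<Longrightarrow> (LINT x|lebesgue. \<phi> l x) = 0"
    and "0 < b" and "b < 1"
    and "\<And>l. l \<in> {1..M} \<Longrightarrow> \<eta> l \<in> schwartz"
    and "tendsto_tempered
           (\<lambda>(k, m). fun_distribution (\<lambda>x. \<Sum>j = - int k..int m. \<Sum>l = 1..M.
              conv mul (dilate a (b powi j) (\<phi> l)) (dilate a (b powi j) (\<eta> l)) x))
           dirac (sequentially \<times>\<^sub>F sequentially)"
    and "\<exists>\<epsilon>>0. \<forall>k. \<forall>l\<in>{1..M}. \<forall>m\<in>{1..M}.
           (\<eta> m, left_deriv mul k (\<phi> l)) \<in> C1_class a mul \<rho> (N + \<epsilon>) N"
    and "\<psi> \<in> schwartz" and "(LINT x|lebesgue. \<psi> x) = 0"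
    and "\<exists>\<epsilon>>0. \<forall>l\<in>{1..M}. (\<eta> l, \<psi>) \<in> C1_class a mul \<rho> (N + \<epsilon>) N"
  shows "\<exists>C>0. \<forall>f\<in>schwartz.
     Lp_norm p w (\<lambda>x. lq_norm q (\<lambda>j.
        peetre mul \<rho> N (b powi (- j)) (conv mul f (dilate a (b powi j) \<psi>)) x))
     \<le> ennreal C * (\<Sum>l = 1..M. Lp_norm p w (square_fun a mul q (\<phi> l) b f))"
proof -
  interpret homogeneous_group_norm a mul \<rho> by fact
  define r where "r = hom_dim a / N"
  have r: "r > 0" using hom_dim_ge_1 \<open>N > 0\<close> by (auto simp: r_def)
  have p: "p > 0" "p / r > 1" and q: "q > 0" "q / r > 1"
    using r \<open>hom_dim a / N < p\<close> \<open>hom_dim a / N < q\<close> unfolding r_def[symmetric] by auto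
  have pr: "p * N / hom_dim a = p / r" by (simp add: r_def)
  have \<phi>z: "(\<integral>x. \<phi> l x \<partial>lborel) = 0" if "l \<in> {1..M}" for l
    using assms(7)[OF that] integral_lebesgue_lborel[OF schwartz_measurable[OF assms(6)[OF that]]] by simp
  have \<psi>z: "(\<integral>x. \<psi> x \<partial>lborel) = 0"
    using assms(14) integral_lebesgue_lborel[OF schwartz_measurable[OF assms(13)]] by simp
  have R: "reproducing b M \<phi> \<eta>"
    unfolding reproducing_def by (intro conjI ballI assms(6,8-11) \<phi>z)
  obtain w' K where Aw: "Ap (p / r) K w'" and ww: "AE x in lborel. w x = w' x"
    using muckenhoupt_Ap[OF assms(5)] unfolding pr by blast
  note [measurable] = ApD(1)[OF Aw]
  obtain \<epsilon>1 where \<epsilon>1: "\<epsilon>1 > 0" "\<And>k l m. l \<in> {1..M} \<Longrightarrow> m \<in> {1..M} \<Longrightarrow> (\<eta> m, left_deriv mul k (\<phi> l)) \<in> C1_class a mul \<rho> (N + \<epsilon>1) N"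
    using assms(12) by blast
  obtain \<epsilon>2 where \<epsilon>2: "\<epsilon>2 > 0" "\<And>l. l \<in> {1..M} \<Longrightarrow> (\<eta> l, \<psi>) \<in> C1_class a mul \<rho> (N + \<epsilon>2) N"
    using assms(15) by blast
  define A where "A = (\<lambda>f x k. \<Sum>l=1..M. peetre mul \<rho> N (b powi (- k)) (conv mul f (dilate a (b powi k) (\<phi> l))) x)"
  define c where "c = b powr min \<epsilon>2 1"
  have c: "0 < c" "c < 1"
    using \<open>0 < b\<close> \<open>b < 1\<close> \<epsilon>2(1) powr_less_mono2[of "min \<epsilon>2 1" b 1] by (auto simp: c_def)
  obtain C1 where C1: "C1 > 0" "\<And>f j x. f \<in> schwartz \<Longrightarrow>
      peetre mul \<rho> N (b powi (- j)) (conv mul f (dilate a (b powi j) \<psi>)) x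
      \<le> ennreal C1 * (\<integral>\<^sup>+k. ennreal (c ^ nat \<bar>j - k\<bar>) * A f x k \<partial>count_space UNIV)"
    using peetre_comparison[OF R assms(13) \<psi>z less_imp_le[OF \<open>N > 0\<close>] \<epsilon>2] unfolding A_def c_def by blast
  obtain C2 where C2: "C2 > 0" "\<And>u :: int \<Rightarrow> ennreal.
    (\<integral>\<^sup>+k. epowr (\<integral>\<^sup>+j. ennreal (c ^ nat \<bar>k - j\<bar>) * u j \<partial>count_space UNIV) q \<partial>count_space UNIV)
      \<le> ennreal C2 * (\<integral>\<^sup>+j. epowr (u j) q \<partial>count_space UNIV)"
    using discrete_convolution_lq[OF c q(1)] by blast
  define F where "F = (\<lambda>f l k v. ennreal (cmod (conv mul f (dilate a (b powi k) (\<phi> l)) v) powr r))"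
  obtain C3 where C3: "C3 > 0" "\<And>f x. f \<in> schwartz \<Longrightarrow>
     (\<integral>\<^sup>+k. epowr (A f x k) q \<partial>count_space UNIV) \<le> ennreal C3 * (\<Sum>l=1..M. \<integral>\<^sup>+k. epowr (maxfun lborel (F f l k) x) (q / r) \<partial>count_space UNIV)"
    using peetre_lq_le_maximal[OF R \<open>N > 0\<close> q(1) \<epsilon>1] unfolding A_def F_def r_def by blast
  obtain C4 where C4: "C4 > 0" "\<And>g. (\<And>k::nat. g k \<in> borel_measurable borel) \<Longrightarrow>
    (\<integral>\<^sup>+x. epowr (\<Sum>k. epowr (maxfun lborel (g k) x) (q / r)) (p / r / (q / r)) * ennreal (w' x) \<partial>lborel)
      \<le> ennreal C4 * (\<integral>\<^sup>+x. epowr (\<Sum>k. epowr (g k x) (q / r)) (p / r / (q / r)) * ennreal (w' x) \<partial>lborel)"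
    using vector_maximal_inequality[OF p(2) q(2) Aw] by blast
  define C5 where "C5 = C1 powr q * C2 * C3"
  have C5: "C5 > 0" using C1 C2 C3 by (simp add: C5_def)
  define C6 where "C6 = C5 powr (p / q) * real M powr (p / q) * C4"
  have C6: "C6 \<ge> 0" using C4 by (simp add: C6_def)
  define C where "C = C6 powr (1 / p) * real M powr (1 / p) + 1"
  have LpN: "Lp_norm p w G = epowr (\<integral>\<^sup>+x. epowr (G x) p * ennreal (w' x) \<partial>lborel) (1 / p)" for G
    unfolding Lp_norm_def nn_integral_completion
    by (intro arg_cong[where f = "\<lambda>I. epowr I (1 / p)"] nn_integral_cong_AE) (use ww in eventually_elim, simp)
  have lqp: "epowr (lq_norm q u) p = epowr (\<integral>\<^sup>+j. epowr (u j) q \<partial>count_space UNIV) (p / q)" for u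
    by (simp add: lq_norm_def infsum_int_eq_nn_integral_count_space epowr_epowr)
  show ?thesis
  proof (intro exI[of _ C] conjI ballI)
    show "C > 0" unfolding C_def by (intro add_nonneg_pos mult_nonneg_nonneg) auto
    fix f :: "real ^ ('n::{finite, linorder}) \<Rightarrow> complex" assume f: "f \<in> schwartz"
    note [measurable] = schwartz_measurable[OF f]
    have [measurable]: "\<phi> l \<in> borel_measurable borel" if "l \<in> {1..M}" for l
      by (rule schwartz_measurable[OF assms(6)[OF that]])
    have Fm[measurable]: "F f l k \<in> borel_measurable borel" if "l \<in> {1..M}" for l k
      unfolding F_def using that by measurable
    define Z where "Z = (\<lambda>l x. \<integral>\<^sup>+k. epowr (maxfun lborel (F f l k) x) (q / r) \<partial>count_space UNIV)"
    define I where "I = (\<lambda>l. \<integral>\<^sup>+x. epowr (square_fun a mul q (\<phi> l) b f x) p * ennreal (w' x) \<partial>lborel)"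
    have Z_nat: "Z l x = (\<Sum>n. epowr (maxfun lborel (F f l (int_decode n)) x) (q / r))" for l x
      unfolding Z_def nn_integral_count_space_nat[symmetric]
      by (rule nn_integral_bij_count_space[OF bij_int_decode, symmetric])
    have Zm: "Z l \<in> borel_measurable borel" for l unfolding Z_nat[abs_def] by measurable
    have ZI: "(\<integral>\<^sup>+x. epowr (Z l x) (p / q) * ennreal (w' x) \<partial>lborel) \<le> ennreal C4 * I l" if l: "l \<in> {1..M}" for l
    proof -
      have e: "epowr (square_fun a mul q (\<phi> l) b f x) p = epowr (\<Sum>n. epowr (F f l (int_decode n) x) (q / r)) (p / q)" for x
      proof -
        have "epowr (square_fun a mul q (\<phi> l) b f x) p = epowr (\<integral>\<^sup>+k. epowr (F f l k x) (q / r) \<partial>count_space UNIV) (p / q)"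
          unfolding square_fun_def lqp using r by (simp add: F_def epowr_ennreal powr_powr)
        also have "(\<integral>\<^sup>+k. epowr (F f l k x) (q / r) \<partial>count_space UNIV) = (\<Sum>n. epowr (F f l (int_decode n) x) (q / r))"
          unfolding nn_integral_count_space_nat[symmetric]
          by (rule nn_integral_bij_count_space[OF bij_int_decode, symmetric])
        finally show ?thesis .
      qed
      have "p / r / (q / r) = p / q" using r by simp
      show ?thesis
        using C4(2)[of "\<lambda>n. F f l (int_decode n)", OF Fm[OF l]]
        unfolding I_def e Z_nat \<open>p / r / (q / r) = p / q\<close> .
    qed
    have pt: "epowr (lq_norm q (\<lambda>j. peetre mul \<rho> N (b powi (- j)) (conv mul f (dilate a (b powi j) \<psi>)) x)) p
       \<le> ennreal (C5 powr (p / q) * real M powr (p / q)) * (\<Sum>l=1..M. epowr (Z l x) (p / q))" for x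
    proof -
      have "(\<integral>\<^sup>+j. epowr (peetre mul \<rho> N (b powi (- j)) (conv mul f (dilate a (b powi j) \<psi>)) x) q \<partial>count_space UNIV)
         \<le> (\<integral>\<^sup>+j. epowr (ennreal C1 * (\<integral>\<^sup>+k. ennreal (c ^ nat \<bar>j - k\<bar>) * A f x k \<partial>count_space UNIV)) q \<partial>count_space UNIV)"
        using q by (intro nn_integral_mono epowr_mono C1(2) f) auto
      also have "\<dots> = ennreal (C1 powr q) * (\<integral>\<^sup>+j. epowr (\<integral>\<^sup>+k. ennreal (c ^ nat \<bar>j - k\<bar>) * A f x k \<partial>count_space UNIV) q \<partial>count_space UNIV)"
        using C1(1) by (simp add: epowr_mult epowr_ennreal nn_integral_cmult)
      also have "\<dots> \<le> ennreal (C1 powr q) * (ennreal C2 * (ennreal C3 * (\<Sum>l=1..M. Z l x)))"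
        unfolding Z_def by (intro mult_left_mono order_trans[OF C2(2)] C3(2) f) auto
      also have "\<dots> = ennreal C5 * (\<Sum>l=1..M. Z l x)"
        using C1 C2 C3 by (simp add: C5_def ennreal_mult mult.assoc)
      finally have "epowr (\<integral>\<^sup>+j. epowr (peetre mul \<rho> N (b powi (- j)) (conv mul f (dilate a (b powi j) \<psi>)) x) q \<partial>count_space UNIV) (p / q)
         \<le> epowr (ennreal C5 * (\<Sum>l=1..M. Z l x)) (p / q)"
        using p q by (intro epowr_mono) auto
      also have "\<dots> = ennreal (C5 powr (p / q)) * epowr (\<Sum>l=1..M. Z l x) (p / q)"
        using C5 by (simp add: epowr_mult epowr_ennreal)
      also have "\<dots> \<le> ennreal (C5 powr (p / q)) * (ennreal (real M powr (p / q)) * (\<Sum>l=1..M. epowr (Z l x) (p / q)))"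
        using epowr_sum_le[of "{1..M}" "p / q" "\<lambda>l. Z l x"] p q by (intro mult_left_mono) auto
      finally show ?thesis unfolding lqp by (simp add: ennreal_mult mult.assoc)
    qed
    have "(\<integral>\<^sup>+x. epowr (lq_norm q (\<lambda>j. peetre mul \<rho> N (b powi (- j)) (conv mul f (dilate a (b powi j) \<psi>)) x)) p * ennreal (w' x) \<partial>lborel)
       \<le> (\<integral>\<^sup>+x. ennreal (C5 powr (p / q) * real M powr (p / q)) * (\<Sum>l=1..M. epowr (Z l x) (p / q)) * ennreal (w' x) \<partial>lborel)"
      by (intro nn_integral_mono mult_right_mono pt) auto
    also have "\<dots> = ennreal (C5 powr (p / q) * real M powr (p / q)) * (\<Sum>l=1..M. \<integral>\<^sup>+x. epowr (Z l x) (p / q) * ennreal (w' x) \<partial>lborel)"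
      using Zm by (simp add: mult.assoc sum_distrib_right nn_integral_cmult nn_integral_sum del: ennreal_mult)
    also have "\<dots> \<le> ennreal (C5 powr (p / q) * real M powr (p / q)) * (\<Sum>l=1..M. ennreal C4 * I l)"
      by (intro mult_left_mono sum_mono ZI) auto
    also have "\<dots> = ennreal C6 * (\<Sum>l=1..M. I l)"
      using C4(1) unfolding C6_def sum_distrib_left[symmetric] by (subst ennreal_mult[of _ C4]) (auto simp: mult.assoc)
    finally have "Lp_norm p w (\<lambda>x. lq_norm q (\<lambda>j. peetre mul \<rho> N (b powi (- j)) (conv mul f (dilate a (b powi j) \<psi>)) x))
      \<le> epowr (ennreal C6 * (\<Sum>l=1..M. I l)) (1 / p)"
      unfolding LpN using p by (intro epowr_mono) auto
    also have "\<dots> = ennreal (C6 powr (1 / p)) * epowr (\<Sum>l=1..M. I l) (1 / p)"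
      using C6 by (simp add: epowr_mult epowr_ennreal)
    also have "\<dots> \<le> ennreal (C6 powr (1 / p)) * (ennreal (real M powr (1 / p)) * (\<Sum>l=1..M. epowr (I l) (1 / p)))"
      using epowr_sum_le[of "{1..M}" "1 / p" I] p by (intro mult_left_mono) auto
    also have "\<dots> = ennreal (C6 powr (1 / p) * real M powr (1 / p)) * (\<Sum>l=1..M. epowr (I l) (1 / p))"
      by (simp add: ennreal_mult mult.assoc)
    also have "\<dots> \<le> ennreal C * (\<Sum>l=1..M. epowr (I l) (1 / p))"
      by (intro mult_right_mono ennreal_leI) (auto simp: C_def)
    finally show "Lp_norm p w (\<lambda>x. lq_norm q (\<lambda>j. peetre mul \<rho> N (b powi (- j)) (conv mul f (dilate a (b powi j) \<psi>)) x))
     \<le> ennreal C * (\<Sum>l = 1..M. Lp_norm p w (square_fun a mul q (\<phi> l) b f))"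
      unfolding LpN I_def .
  qed
qed

end
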